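(* Let $\Omega\subset\mathbb{R}^n$ be an open bounded set with Lipschitz boundary, let $u_a,u_b\in\mathbb{R}$ with $u_a<u_b$, and let $U_{ad}:=\{u\in L^2(\Omega): u_a\le u(x)\le u_b \text{ for a.a. } x\in\Omega\}$. Let $f:L^2(\Omega)\to\mathbb{R}$ be bounded from below, weakly lower semicontinuous and continuously Fréchet differentiable, and such that $f(u_k)\to+\infty$ for every sequence $(u_k)\subset U_{ad}$ with $\|u_k\|_{L^2(\Omega)}\to\infty$. Let $\epsilon_k>0$ with $\epsilon_k\searrow0$ and $\rho_k>0$ with $\rho_k\to\infty$. For each $k$ let $u_k\in H^1(\Omega)$ satisfy $$\int_\Omega\nabla f(u_k)v+\psi_{\epsilon_k}'(\nabla u_k)\nabla v-\lambda^a_{\rho_k}(u_k)v+\lambda^b_{\rho_k}(u_k)v\,dx=0\quad\forall v\in H^1(\Omega).$$ Assume that there is a subsequence with $u_{k_n}\to u^*$, $\lambda^a_{\rho_{k_n}}(u_{k_n})\rightharpoonup\lambda^a$ and $\lambda^b_{\rho_{k_n}}(u_{k_n})\rightharpoonup\lambda^b$ in $L^2(\Omega)$. Then $$u^*\in U_{ad},\quad\lambda^a\ge0,\quad\lambda^b\ge0,\quad(\lambda^a,u_a-u^* )=0,\quad(\lambda^b,u^*-u_b)=0.$$ In addition, there is $\mu^*\in L^\infty(\Omega)^n$ with $\operatorname{div}\mu^*\in L^2(\Omega)$ such that $$-\operatorname{div}\mu^*-\lambda^a+\lambda^b=-\nabla f(u^* )\quad\text{and}\quad-\operatorname{div}\mu^*\in\partial(|\cdot|_{BV(\Omega)})(u^*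 ).$$ Moreover, there is $\lambda^*\in\partial\|\cdot\|_{\mathcal M(\Omega)}(\nabla u^* )\subset(\mathcal M(\Omega)^n)^*$ with $\operatorname{div}\lambda^*\in L^2(\Omega)$ such that $$-\operatorname{div}\lambda^*-\lambda^a+\lambda^b=-\nabla f(u^* ).$$
   Context: For $\epsilon>0$, $\psi_\epsilon:\mathbb{R}^n\to\mathbb{R}$, $\psi_\epsilon(t):=\sqrt{\epsilon+|t|^2}+\epsilon|t|^2$ with $|\cdot|$ the Euclidean norm; $\psi_\epsilon'(t)$ is its derivative, so $\psi'_\epsilon(\nabla u)\nabla v=\frac{\nabla u\cdot\nabla v}{\sqrt{\epsilon+|\nabla u|^2}}+2\epsilon\nabla u\cdot\nabla v$. For $\rho>0$, ${\max}_\rho(x):=\max(0,x)$ if $|x|\ge\frac1{2\rho}$ and ${\max}_\rho(x):=\frac\rho2(x+\frac1{2\rho})^2$ if $|x|\le\frac1{2\rho}$. $\lambda^a_\rho(u):={\max}_\rho(\rho(u_a-u))$, $\lambda^b_\rho(u):={\max}_\rho(\rho(u-u_b))$. $|u|_{BV(\Omega)}:=\sup\{\int_\Omega u\operatorname{div}\varphi\,dx:\varphi\in C_0^\infty(\Omega)^n,\ |\varphi(x)|\le1\ \forall x\in\Omega\}=\|\nabla u\|_{\mathcal M(\Omega)^n}$, where $\mathcal M(\Omega)=C_0(\Omega)^*$ is the space of real Borel measures. The norm $\|\cdot\|_{\mathcal M(\Omega)}$ on $\mathcal M(\Omega)^n$ is the total variation norm with respect to the Euclidean norm (so that this identity holds).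 $\partial$ denotes the convex subdifferential; $\partial(|\cdot|_{BV(\Omega)})(u^* )$ is a subset of $(BV(\Omega)\cap L^2(\Omega))^*$, in which $L^2(\Omega)$ functions act by integration. For $\mu^*\in L^\infty(\Omega)^n$, $\operatorname{div}\mu^*$ is the distributional divergence. On $(\mathcal M(\Omega)^n)^*$, $-\operatorname{div}:(\mathcal M(\Omega)^n)^*\to(BV(\Omega)\cap L^2(\Omega))^*$ is the adjoint of $\nabla:BV(\Omega)\cap L^2(\Omega)\to\mathcal M(\Omega)^n$; "$\operatorname{div}\lambda^*\in L^2(\Omega)$" means this functional is given by integration against an $L^2(\Omega)$ function, with which it is identified. $\nabla f(u)\in L^2(\Omega)$ is the Riesz representative of $f'(u)$. $(\cdot,\cdot)$ is the $L^2(\Omega)$ inner product. *)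

theory Defs
  imports "HOL-Analysis.Analysis"
begin

text \<open>
  Elements of function spaces over \<open>\<Omega>\<close> are represented by functions on the whole space, identified
  when they agree almost everywhere in \<open>\<Omega>\<close>; values outside \<open>\<Omega>\<close> are irrelevant.
\<close>

text \<open>
  Locally, after a rotation, \<open>\<Omega>\<close> is the strict epigraph of a Lipschitz function \<open>\<gamma>\<close>. The unit vector
  \<open>e\<close> is the vertical direction, and \<open>\<gamma>\<close> lives on the hyperplane orthogonal to \<open>e\<close>.
\<close>

definition lipschitz_boundary :: "(real^'n) set \<Rightarrow> bool" where
  "lipschitz_boundary \<Omega> \<longleftrightarrow>
     (\<forall>x\<in>frontier \<Omega>. \<exists>r>0. \<exists>e \<gamma> L. norm e = 1 \<and> L-lipschitz_on {z. z \<bullet> e = 0} \<gamma> \<and>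
        \<Omega> \<inter> ball x r = {y \<in> ball x r. \<gamma> (y - (y \<bullet> e) *\<^sub>R e) < y \<bullet> e})"

definition pd :: "'n \<Rightarrow> (real^'n \<Rightarrow> real) \<Rightarrow> real^'n \<Rightarrow> real" where
  "pd i g x = frechet_derivative g (at x) (axis i 1)"

primrec Ck :: "nat \<Rightarrow> (real^'n \<Rightarrow> real) \<Rightarrow> bool" where
  "Ck 0 g \<longleftrightarrow> continuous_on UNIV g"
| "Ck (Suc k) g \<longleftrightarrow> (\<forall>x. g differentiable (at x)) \<and> (\<forall>i. Ck k (pd i g))"

definition test_funs :: "(real^'n) set \<Rightarrow> (real^'n \<Rightarrow> real) set" where
  "test_funs \<Omega> = {g. (\<forall>k. Ck k g) \<and> compact (closure {x. g x \<noteq> 0}) \<and> closure {x. g x \<noteq> 0} \<subseteq> \<Omega>}"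

definition test_fields :: "(real^'n) set \<Rightarrow> (real^'n \<Rightarrow> real^'n) set" where
  "test_fields \<Omega> = {\<phi>. \<forall>i. (\<lambda>x. \<phi> x $ i) \<in> test_funs \<Omega>}"

definition divg :: "(real^'n \<Rightarrow> real^'n) \<Rightarrow> real^'n \<Rightarrow> real" where
  "divg \<phi> x = (\<Sum>i\<in>UNIV. pd i (\<lambda>y. \<phi> y $ i) x)"

definition L2 :: "(real^'n) set \<Rightarrow> (real^'n \<Rightarrow> real) set" where
  "L2 \<Omega> = {u \<in> borel_measurable (lebesgue_on \<Omega>). integrable (lebesgue_on \<Omega>) (\<lambda>x. (u x)\<^sup>2)}"

definition L2_inner :: "(real^'n) set \<Rightarrow> (real^'n \<Rightarrow> real) \<Rightarrow> (real^'n \<Rightarrow> real) \<Rightarrow> real" where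
  "L2_inner \<Omega> u v = (\<integral>x. u x * v x \<partial>lebesgue_on \<Omega>)"

definition L2_norm :: "(real^'n) set \<Rightarrow> (real^'n \<Rightarrow> real) \<Rightarrow> real" where
  "L2_norm \<Omega> u = sqrt (L2_inner \<Omega> u u)"

definition L2_tendsto ::
  "(real^'n) set \<Rightarrow> (nat \<Rightarrow> real^'n \<Rightarrow> real) \<Rightarrow> (real^'n \<Rightarrow> real) \<Rightarrow> bool" where
  "L2_tendsto \<Omega> u w \<longleftrightarrow> (\<forall>k. u k \<in> L2 \<Omega>) \<and> w \<in> L2 \<Omega> \<and>
     (\<lambda>k. L2_norm \<Omega> (\<lambda>x. u k x - w x)) \<longlonglongrightarrow> 0"

definition L2_weakly_tendsto ::
  "(real^'n) set \<Rightarrow> (nat \<Rightarrow> real^'n \<Rightarrow> real) \<Rightarrow> (real^'n \<Rightarrow> real) \<Rightarrow> bool" where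
  "L2_weakly_tendsto \<Omega> u w \<longleftrightarrow> (\<forall>k. u k \<in> L2 \<Omega>) \<and> w \<in> L2 \<Omega> \<and>
     (\<forall>v\<in>L2 \<Omega>. (\<lambda>k. L2_inner \<Omega> (u k) v) \<longlonglongrightarrow> L2_inner \<Omega> w v)"

definition Linf_fields :: "(real^'n) set \<Rightarrow> (real^'n \<Rightarrow> real^'n) set" where
  "Linf_fields \<Omega> = {\<mu> \<in> borel_measurable (lebesgue_on \<Omega>). \<exists>C. AE x in lebesgue_on \<Omega>. norm (\<mu> x) \<le> C}"

definition has_weak_gradient ::
  "(real^'n) set \<Rightarrow> (real^'n \<Rightarrow> real) \<Rightarrow> (real^'n \<Rightarrow> real^'n) \<Rightarrow> bool" where
  "has_weak_gradient \<Omega> u G \<longleftrightarrow> (\<forall>i. (\<lambda>x. G x $ i) \<in> L2 \<Omega>) \<and>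
     (\<forall>g\<in>test_funs \<Omega>. \<forall>i. L2_inner \<Omega> u (pd i g) = - L2_inner \<Omega> (\<lambda>x. G x $ i) g)"

definition H1 :: "(real^'n) set \<Rightarrow> (real^'n \<Rightarrow> real) set" where
  "H1 \<Omega> = {u \<in> L2 \<Omega>. \<exists>G. has_weak_gradient \<Omega> u G}"

definition weak_gradient :: "(real^'n) set \<Rightarrow> (real^'n \<Rightarrow> real) \<Rightarrow> real^'n \<Rightarrow> real^'n" where
  "weak_gradient \<Omega> u = (SOME G. has_weak_gradient \<Omega> u G)"

definition has_distributional_div ::
  "(real^'n) set \<Rightarrow> (real^'n \<Rightarrow> real^'n) \<Rightarrow> (real^'n \<Rightarrow> real) \<Rightarrow> bool" where
  "has_distributional_div \<Omega> \<mu> w \<longleftrightarrow>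
     (\<forall>g\<in>test_funs \<Omega>. (\<integral>x. (\<Sum>i\<in>UNIV. \<mu> x $ i * pd i g x) \<partial>lebesgue_on \<Omega>) = - L2_inner \<Omega> w g)"

text \<open>
  \<open>V\<close> is a linear space of functions with (semi)norm \<open>N\<close>. Boundedness forces a functional in the dual
  to take equal values on functions at \<open>N\<close>-distance zero, so it acts on the normed quotient.
\<close>

definition dual_space ::
  "('x \<Rightarrow> 'y::real_vector) set \<Rightarrow> (('x \<Rightarrow> 'y) \<Rightarrow> real) \<Rightarrow> (('x \<Rightarrow> 'y) \<Rightarrow> real) set" where
  "dual_space V N = {\<xi>.
     (\<forall>v\<in>V. \<forall>w\<in>V. \<forall>a b. \<xi> (\<lambda>x. a *\<^sub>R v x + b *\<^sub>R w x) = a * \<xi> v + b * \<xi> w) \<and>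
     (\<exists>C. \<forall>v\<in>V. \<bar>\<xi> v\<bar> \<le> C * N v)}"

definition subdifferential ::
  "('x \<Rightarrow> 'y::real_vector) set \<Rightarrow> (('x \<Rightarrow> 'y) \<Rightarrow> real) \<Rightarrow> (('x \<Rightarrow> 'y) \<Rightarrow> real) \<Rightarrow> ('x \<Rightarrow> 'y)
     \<Rightarrow> (('x \<Rightarrow> 'y) \<Rightarrow> real) set" where
  "subdifferential V N J u =
     {\<xi> \<in> dual_space V N. u \<in> V \<and> (\<forall>v\<in>V. J u + \<xi> (\<lambda>x. v x - u x) \<le> J v)}"

definition functional_on_L2 :: "(real^'n) set \<Rightarrow> ((real^'n \<Rightarrow> real) \<Rightarrow> real) \<Rightarrow> bool" where
  "functional_on_L2 \<Omega> f \<longleftrightarrow>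
     (\<forall>u\<in>L2 \<Omega>. \<forall>v\<in>L2 \<Omega>. (AE x in lebesgue_on \<Omega>. u x = v x) \<longrightarrow> f u = f v)"

definition weakly_lsc :: "(real^'n) set \<Rightarrow> ((real^'n \<Rightarrow> real) \<Rightarrow> real) \<Rightarrow> bool" where
  "weakly_lsc \<Omega> f \<longleftrightarrow>
     (\<forall>u w. L2_weakly_tendsto \<Omega> u w \<longrightarrow> ereal (f w) \<le> liminf (\<lambda>k. ereal (f (u k))))"

definition has_frechet_L2 ::
  "(real^'n) set \<Rightarrow> ((real^'n \<Rightarrow> real) \<Rightarrow> real) \<Rightarrow> (real^'n \<Rightarrow> real)
     \<Rightarrow> ((real^'n \<Rightarrow> real) \<Rightarrow> real) \<Rightarrow> bool" where
  "has_frechet_L2 \<Omega> f u D \<longleftrightarrow> D \<in> dual_space (L2 \<Omega>) (L2_norm \<Omega>) \<and>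
     (\<forall>e>0. \<exists>d>0. \<forall>h\<in>L2 \<Omega>. L2_norm \<Omega> h < d \<longrightarrow>
        \<bar>f (\<lambda>x. u x + h x) - f u - D h\<bar> \<le> e * L2_norm \<Omega> h)"

definition continuously_frechet_L2 :: "(real^'n) set \<Rightarrow> ((real^'n \<Rightarrow> real) \<Rightarrow> real) \<Rightarrow> bool" where
  "continuously_frechet_L2 \<Omega> f \<longleftrightarrow>
     (\<exists>D. (\<forall>u\<in>L2 \<Omega>. has_frechet_L2 \<Omega> f u (D u)) \<and>
        (\<forall>u\<in>L2 \<Omega>. \<forall>e>0. \<exists>d>0. \<forall>v\<in>L2 \<Omega>. L2_norm \<Omega> (\<lambda>x. v x - u x) < d \<longrightarrow>
           (\<forall>h\<in>L2 \<Omega>. \<bar>D v h - D u h\<bar> \<le> e * L2_norm \<Omega> h)))"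

text \<open>The Riesz representative of the derivative, determined up to a null set.\<close>

definition L2_gradient ::
  "(real^'n) set \<Rightarrow> ((real^'n \<Rightarrow> real) \<Rightarrow> real) \<Rightarrow> (real^'n \<Rightarrow> real) \<Rightarrow> real^'n \<Rightarrow> real" where
  "L2_gradient \<Omega> f u = (SOME g. g \<in> L2 \<Omega> \<and> has_frechet_L2 \<Omega> f u (L2_inner \<Omega> g))"

definition borel_in :: "(real^'n) set \<Rightarrow> (real^'n) set set" where
  "borel_in \<Omega> = sets (restrict_space borel \<Omega>)"

definition variation_sums :: "(real^'n) set \<Rightarrow> ((real^'n) set \<Rightarrow> real^'n) \<Rightarrow> real set" where
  "variation_sums \<Omega> m =
     {\<Sum>B\<in>P. norm (m B) | P. finite P \<and> P \<subseteq> borel_in \<Omega> \<and> partition_on \<Omega> P}"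

definition total_variation :: "(real^'n) set \<Rightarrow> ((real^'n) set \<Rightarrow> real^'n) \<Rightarrow> real" where
  "total_variation \<Omega> m = Sup (variation_sums \<Omega> m)"

text \<open>
  Set functions are zero off the Borel subsets of \<open>\<Omega>\<close>, so that equality of measures is equality of
  functions. Finiteness of the total variation follows from countable additivity.
\<close>

definition vector_measures :: "(real^'n) set \<Rightarrow> ((real^'n) set \<Rightarrow> real^'n) set" where
  "vector_measures \<Omega> = {m.
     (\<forall>B. B \<notin> borel_in \<Omega> \<longrightarrow> m B = 0) \<and>
     (\<forall>A. range A \<subseteq> borel_in \<Omega> \<longrightarrow> disjoint_family A \<longrightarrow>
        (\<lambda>k::nat. m (A k)) sums m (\<Union>k. A k)) \<and>
     bdd_above (variation_sums \<Omega> m)}"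

text \<open>Integration against a signed measure, by its Jordan decomposition.\<close>

definition positive_variation :: "(real^'n) set \<Rightarrow> ((real^'n) set \<Rightarrow> real) \<Rightarrow> (real^'n) measure" where
  "positive_variation \<Omega> m =
     measure_of \<Omega> (borel_in \<Omega>) (\<lambda>B. SUP A\<in>{A \<in> borel_in \<Omega>. A \<subseteq> B}. ennreal (m A))"

definition signed_integral ::
  "(real^'n) set \<Rightarrow> ((real^'n) set \<Rightarrow> real) \<Rightarrow> (real^'n \<Rightarrow> real) \<Rightarrow> real" where
  "signed_integral \<Omega> m g =
     (\<integral>x. g x \<partial>positive_variation \<Omega> m) - (\<integral>x. g x \<partial>positive_variation \<Omega> (\<lambda>A. - m A))"

definition BV_pairings :: "(real^'n) set \<Rightarrow> (real^'n \<Rightarrow> real) \<Rightarrow> real set" where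
  "BV_pairings \<Omega> u =
     {\<integral>x. u x * divg \<phi> x \<partial>lebesgue_on \<Omega> | \<phi>. \<phi> \<in> test_fields \<Omega> \<and> (\<forall>x\<in>\<Omega>. norm (\<phi> x) \<le> 1)}"

definition BV_seminorm :: "(real^'n) set \<Rightarrow> (real^'n \<Rightarrow> real) \<Rightarrow> real" where
  "BV_seminorm \<Omega> u = Sup (BV_pairings \<Omega> u)"

definition BV :: "(real^'n) set \<Rightarrow> (real^'n \<Rightarrow> real) set" where
  "BV \<Omega> = {u. integrable (lebesgue_on \<Omega>) u \<and> bdd_above (BV_pairings \<Omega> u)}"

definition BV_L2 :: "(real^'n) set \<Rightarrow> (real^'n \<Rightarrow> real) set" where
  "BV_L2 \<Omega> = BV \<Omega> \<inter> L2 \<Omega>"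

definition BV_L2_norm :: "(real^'n) set \<Rightarrow> (real^'n \<Rightarrow> real) \<Rightarrow> real" where
  "BV_L2_norm \<Omega> u = ((\<integral>x. \<bar>u x\<bar> \<partial>lebesgue_on \<Omega>) + BV_seminorm \<Omega> u) + L2_norm \<Omega> u"

definition BV_gradient :: "(real^'n) set \<Rightarrow> (real^'n \<Rightarrow> real) \<Rightarrow> (real^'n) set \<Rightarrow> real^'n" where
  "BV_gradient \<Omega> u = (SOME m. m \<in> vector_measures \<Omega> \<and>
     (\<forall>g\<in>test_funs \<Omega>. \<forall>i.
        (\<integral>x. u x * pd i g x \<partial>lebesgue_on \<Omega>) = - signed_integral \<Omega> (\<lambda>A. m A $ i) g))"

definition BV_subdifferential ::
  "(real^'n) set \<Rightarrow> (real^'n \<Rightarrow> real) \<Rightarrow> ((real^'n \<Rightarrow> real) \<Rightarrow> real) set" where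
  "BV_subdifferential \<Omega> u = subdifferential (BV_L2 \<Omega>) (BV_L2_norm \<Omega>) (BV_seminorm \<Omega>) u"

definition measure_norm_subdifferential ::
  "(real^'n) set \<Rightarrow> ((real^'n) set \<Rightarrow> real^'n) \<Rightarrow> (((real^'n) set \<Rightarrow> real^'n) \<Rightarrow> real) set" where
  "measure_norm_subdifferential \<Omega> m =
     subdifferential (vector_measures \<Omega>) (total_variation \<Omega>) (total_variation \<Omega>) m"

text \<open>\<open>- div\<close> on the dual of the vector measures is the adjoint of the gradient.\<close>

definition minus_div_dual ::
  "(real^'n) set \<Rightarrow> (((real^'n) set \<Rightarrow> real^'n) \<Rightarrow> real) \<Rightarrow> (real^'n \<Rightarrow> real) \<Rightarrow> real" where
  "minus_div_dual \<Omega> l = (\<lambda>v. l (BV_gradient \<Omega> v))"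

text \<open>\<open>div l\<close>, as a functional on \<open>BV_L2 \<Omega>\<close>, is integration against \<open>w\<close>.\<close>

definition has_dual_div ::
  "(real^'n) set \<Rightarrow> (((real^'n) set \<Rightarrow> real^'n) \<Rightarrow> real) \<Rightarrow> (real^'n \<Rightarrow> real) \<Rightarrow> bool" where
  "has_dual_div \<Omega> l w \<longleftrightarrow> (\<forall>v\<in>BV_L2 \<Omega>. - minus_div_dual \<Omega> l v = L2_inner \<Omega> w v)"

definition psi :: "real \<Rightarrow> real^'n \<Rightarrow> real" where
  "psi e t = sqrt (e + (norm t)\<^sup>2) + e * (norm t)\<^sup>2"

definition psi_deriv :: "real \<Rightarrow> real^'n \<Rightarrow> real^'n \<Rightarrow> real" where
  "psi_deriv e t = frechet_derivative (psi e) (at t)"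

definition smooth_max :: "real \<Rightarrow> real \<Rightarrow> real" where
  "smooth_max r x = (if \<bar>x\<bar> \<ge> 1 / (2 * r) then max 0 x else r / 2 * (x + 1 / (2 * r))\<^sup>2)"

definition lam_a :: "real \<Rightarrow> real \<Rightarrow> (real^'n \<Rightarrow> real) \<Rightarrow> real^'n \<Rightarrow> real" where
  "lam_a ua r u x = smooth_max r (r * (ua - u x))"

definition lam_b :: "real \<Rightarrow> real \<Rightarrow> (real^'n \<Rightarrow> real) \<Rightarrow> real^'n \<Rightarrow> real" where
  "lam_b ub r u x = smooth_max r (r * (u x - ub))"

definition U_ad :: "(real^'n) set \<Rightarrow> real \<Rightarrow> real \<Rightarrow> (real^'n \<Rightarrow> real) set" where
  "U_ad \<Omega> ua ub = {u \<in> L2 \<Omega>. AE x in lebesgue_on \<Omega>. ua \<le> u x \<and> u x \<le> ub}"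

end

theory Submission
  imports Defs "HOL-Probability.Helly_Selection"
begin

text \<open>
  Put \<open>g = \<lambda>\<^sup>a - \<lambda>\<^sup>b - \<nabla>f(u\<^sup>*)\<close>. Testing the equation with \<open>u\<^sub>k\<close> gives, by lower semicontinuity of the total
  variation, \<open>|u\<^sup>*| \<le> (g, u\<^sup>*)\<close> and \<open>\<epsilon>\<^sub>k \<parallel>\<nabla>u\<^sub>k\<parallel> \<rightarrow> 0\<close>; testing it with a fixed \<open>v\<close> in \<open>H\<^sup>1\<close> then gives
  \<open>(g, v) \<le> \<integral>|\<nabla>v|\<close>. By Hahn-Banach, applied to \<open>\<nabla>v \<mapsto> (g, v)\<close>, there is a field \<open>\<mu>\<^sup>*\<close> with \<open>|\<mu>\<^sup>*| \<le> 1\<close>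
  and \<open>(g, v) = \<integral>\<mu>\<^sup>* \<cdot> \<nabla>v\<close> for all \<open>v\<close> in \<open>H\<^sup>1\<close>. Since \<open>v\<close> need not vanish on the boundary, \<open>\<mu>\<^sup>*\<close> extended by
  zero still has divergence \<open>-g\<close>. On a Lipschitz domain the extension is a limit of test fields of length at
  most one, hence \<open>(g, v) \<le> |v|\<close> on all of \<open>BV \<inter> L\<^sup>2\<close>. With \<open>|u\<^sup>*| \<le> (g, u\<^sup>*)\<close> this makes \<open>g\<close> a subgradient,
  and \<open>\<lambda>\<^sup>*\<close> is a Hahn-Banach extension of \<open>\<nabla>v \<mapsto> (g, v)\<close> to the vector measures.
\<close>

subsection \<open>Continuously differentiable functions\<close>

text \<open>The sequence converges only in L2, so neither its gradients nor the nonlinear term has a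
  limit. What survives are two one-sided bounds on \<open>psi_deriv\<close>: from below in its own
  direction, with a small loss and a gain quadratic in the gradient, and from above by
  \<open>norm t\<close> with an error that this gain controls. The multipliers converge only weakly;
  their products with the solutions are bounded pointwise at the obstacle.

  The familiar passage from H1 to BV approximates the function. Here the field is approximated
  instead: test functions that do not vanish on the boundary encode a vanishing normal trace, so
  extension by zero creates no boundary term.

  The second subgradient lives on all vector measures, so gradient measures must exist, and their
  total variation must not exceed the BV seminorm. Existence rests on representing functionals that
  are bounded in the supremum norm, with compactness taken from Helly's theorem on an
  interval.\<close>

lemma pd_eqI: "(g has_derivative D) (at x) \<Longrightarrow> pd i g x = D (axis i 1)"
  unfolding pd_def by (metis frechet_derivative_at)

lemma has_derivative_pd:
  fixes g :: "real^'n \<Rightarrow> real"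
  assumes "g differentiable (at x)"
  shows "(g has_derivative (\<lambda>h. \<Sum>i\<in>UNIV. h $ i * pd i g x)) (at x)"
proof -
  let ?D = "frechet_derivative g (at x)"
  have D: "(g has_derivative ?D) (at x)" using assms frechet_derivative_works by blast
  then have lin: "linear ?D" using has_derivative_linear by blast
  have "?D h = (\<Sum>i\<in>UNIV. h $ i * pd i g x)" for h
  proof -
    have "?D h = ?D (\<Sum>i\<in>UNIV. h $ i *\<^sub>R axis i 1)"
      by (simp add: basis_expansion flip: scalar_mult_eq_scaleR)
    also have "\<dots> = (\<Sum>i\<in>UNIV. h $ i * pd i g x)"
      by (simp add: linear_sum[OF lin] linear_cmul[OF lin] pd_def)
    finally show ?thesis .
  qed
  then have "?D = (\<lambda>h. \<Sum>i\<in>UNIV. h $ i * pd i g x)" by blast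
  with D show ?thesis by simp
qed

text \<open>Continuity is not part of the successor clause of \<open>Ck\<close>; it comes back from
  differentiability, and the partial derivatives go down by induction.\<close>

lemma Ck_Suc_imp: "Ck (Suc k) g \<Longrightarrow> Ck k g"
proof (induction k arbitrary: g)
  case 0
  then show ?case
    by (auto simp: continuous_on_eq_continuous_at intro: differentiable_imp_continuous_within)
next
  case (Suc k)
  from Suc.prems have d: "\<forall>x. g differentiable (at x)" and p: "\<forall>i. Ck (Suc k) (pd i g)"
    unfolding Ck.simps(2)[of "Suc k"] by auto
  from p Suc.IH have "\<forall>i. Ck k (pd i g)" by blast
  with d show ?case by simp
qed

lemma Ck_continuous: "Ck k g \<Longrightarrow> continuous_on UNIV g"
  by (induction k) (use Ck_Suc_imp in auto)

lemma Ck_differentiable: "Ck (Suc k) g \<Longrightarrow> g differentiable (at x)"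
  by simp

lemma Ck_const: "Ck k (\<lambda>_::real^'n. c)"
proof (induction k arbitrary: c)
  case (Suc k)
  have "pd i (\<lambda>_::real^'n. c) = (\<lambda>_. 0)" for i
    by (rule ext, subst pd_eqI[OF has_derivative_const]) simp
  with Suc show ?case by simp
qed simp

lemma pd_coord: "pd i (\<lambda>x::real^'n. x $ j) = (\<lambda>_. if i = j then 1 else 0)"
proof (rule ext)
  fix x :: "real^'n"
  have "((\<lambda>x::real^'n. x $ j) has_derivative (\<lambda>h. h $ j)) (at x)"
    by (intro bounded_linear_imp_has_derivative bounded_linear_vec_nth)
  from pd_eqI[OF this] show "pd i (\<lambda>x::real^'n. x $ j) x = (if i = j then 1 else 0)"
    by (auto simp: axis_def)
qed

lemma Ck_coord: "Ck k (\<lambda>x::real^'n. x $ j)"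
proof (cases k)
  case (Suc m)
  have "(\<lambda>x::real^'n. x $ j) differentiable (at x)" for x
    by (auto simp: differentiable_def intro!: exI bounded_linear_imp_has_derivative bounded_linear_vec_nth)
  then show ?thesis using Suc by (auto simp: pd_coord Ck_const)
qed (auto intro: continuous_intros)

lemma pd_add:
  assumes "f differentiable (at x)" "g differentiable (at x)"
  shows "pd i (\<lambda>x. f x + g x) x = pd i f x + pd i g x"
  using pd_eqI[OF has_derivative_add[OF frechet_derivative_works[THEN iffD1, OF assms(1)]
        frechet_derivative_works[THEN iffD1, OF assms(2)]]] by (simp add: pd_def)

lemma pd_mult:
  fixes f g :: "real^'n \<Rightarrow> real"
  assumes "f differentiable (at x)" "g differentiable (at x)"
  shows "pd i (\<lambda>x. f x * g x) x = f x * pd i g x + pd i f x * g x"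
  using pd_eqI[OF has_derivative_mult[OF frechet_derivative_works[THEN iffD1, OF assms(1)]
        frechet_derivative_works[THEN iffD1, OF assms(2)]]] by (simp add: pd_def)

lemma Ck_add: "Ck k f \<Longrightarrow> Ck k g \<Longrightarrow> Ck k (\<lambda>x. f x + g x)"
proof (induction k arbitrary: f g)
  case (Suc k)
  have "pd i (\<lambda>x. f x + g x) = (\<lambda>x. pd i f x + pd i g x)" for i
    using Suc.prems by (intro ext pd_add) auto
  with Suc show ?case by (auto intro: differentiable_add)
qed (auto intro: continuous_intros)

lemma Ck_mult:
  fixes f g :: "real^'n \<Rightarrow> real"
  shows "Ck k f \<Longrightarrow> Ck k g \<Longrightarrow> Ck k (\<lambda>x. f x * g x)"
proof (induction k arbitrary: f g)
  case (Suc k)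
  have eq: "pd i (\<lambda>x. f x * g x) = (\<lambda>x. f x * pd i g x + pd i f x * g x)" for i
    using Suc.prems by (intro ext pd_mult) auto
  have "Ck k f" "Ck k g" using Suc.prems Ck_Suc_imp by blast+
  with Suc have "Ck k (\<lambda>x. f x * pd i g x + pd i f x * g x)" for i
    by (intro Ck_add Suc.IH) auto
  with Suc show ?case by (auto intro: differentiable_mult simp: eq)
qed (auto intro: continuous_intros)

lemma Ck_cmult: "Ck k f \<Longrightarrow> Ck k (\<lambda>x. c * f x)"
  by (rule Ck_mult[OF Ck_const])

lemma Ck_sum:
  assumes "finite A" "\<And>a. a \<in> A \<Longrightarrow> Ck k (f a)"
  shows "Ck k (\<lambda>x. \<Sum>a\<in>A. f a x)"
  using assms by (induction A rule: finite_induct) (auto intro: Ck_const Ck_add)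

lemma pd_affine:
  fixes f :: "real^'n \<Rightarrow> real"
  assumes "f differentiable (at (c *\<^sub>R x + z))"
  shows "pd i (\<lambda>x. f (c *\<^sub>R x + z)) x = c * pd i f (c *\<^sub>R x + z)"
    and "(\<lambda>x. f (c *\<^sub>R x + z)) differentiable (at x)"
proof -
  have "((\<lambda>x. c *\<^sub>R x + z) has_derivative (\<lambda>h. c *\<^sub>R h)) (at x)"
    by (auto intro!: derivative_eq_intros)
  from has_derivative_compose[OF this has_derivative_pd[OF assms]]
  have "((\<lambda>x. f (c *\<^sub>R x + z)) has_derivative (\<lambda>h. \<Sum>j\<in>UNIV. (c *\<^sub>R h) $ j * pd j f (c *\<^sub>R x + z))) (at x)" .
  from pd_eqI[OF this] this show "pd i (\<lambda>x. f (c *\<^sub>R x + z)) x = c * pd i f (c *\<^sub>R x + z)"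
    and "(\<lambda>x. f (c *\<^sub>R x + z)) differentiable (at x)"
    by (auto simp: axis_def differentiable_def if_distrib[of "\<lambda>t. t * _"] if_distrib[of "(*) c"] cong: if_cong)
qed

lemma Ck_affine:
  fixes f :: "real^'n \<Rightarrow> real"
  shows "Ck k f \<Longrightarrow> Ck k (\<lambda>x. f (c *\<^sub>R x + z))"
proof (induction k arbitrary: f)
  case 0
  then show ?case
    by (auto intro!: continuous_intros continuous_on_compose2[of UNIV f])
next
  case (Suc k)
  have "pd i (\<lambda>x. f (c *\<^sub>R x + z)) = (\<lambda>x. c * pd i f (c *\<^sub>R x + z))" for i
    using Suc.prems by (intro ext pd_affine) auto
  with Suc show ?case by (auto intro: pd_affine Ck_cmult)
qed

lemma Ck_reflect:
  fixes f :: "real^'n \<Rightarrow> real"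
  assumes "Ck k f"
  shows "Ck k (\<lambda>x. f (z - x))"
  using Ck_affine[OF assms, of "-1" z] by simp

lemma pd_reflect:
  fixes f :: "real^'n \<Rightarrow> real"
  assumes "Ck (Suc k) f"
  shows "pd i (\<lambda>x. f (z - x)) x = - pd i f (z - x)"
  using pd_affine(1)[of f "-1" x z] assms by simp

subsection \<open>Smooth bump functions\<close>

text \<open>The smooth function that is flat at 0, divided by powers of its argument: the family is
  closed under differentiation up to linear combination, which an induction over the order of
  smoothness needs.\<close>

definition exp_flat :: "nat \<Rightarrow> real \<Rightarrow> real" where
  "exp_flat m x = (if x > 0 then exp (- 1 / x) / x ^ m else 0)"

text \<open>From \<open>(1 + y / n) ^ n \<le> exp y\<close> with \<open>y = 1 / x\<close> and
  \<open>n = m + 2\<close>. Two powers of \<open>x\<close> are left after division by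
  \<open>x ^ m\<close>, so the difference quotient at 0 tends to 0.\<close>

lemma exp_flat_le: "\<bar>exp_flat m x\<bar> \<le> real (m + 2) ^ (m + 2) * x\<^sup>2"
proof (cases "x > 0")
  case True
  define n where "n = m + 2"
  have n: "real n > 0" by (simp add: n_def)
  have "(1 / x / real n) ^ n \<le> (1 + (1 / x) / real n) ^ n"
    using True n by (intro power_mono) auto
  also have "\<dots> \<le> exp (1 / x)"
    using True by (intro exp_ge_one_plus_x_over_n_power_n) (auto simp: n_def intro: order_trans[of _ 0])
  finally have "1 \<le> exp (1 / x) * (real n * x) ^ n"
    using True n by (simp add: power_divide field_simps)
  then have "exp (- 1 / x) * 1 \<le> exp (- 1 / x) * (exp (1 / x) * (real n * x) ^ n)"
    by (intro mult_left_mono) auto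
  also have "\<dots> = (real n * x) ^ n" by (simp add: mult.assoc[symmetric] exp_add[symmetric])
  finally have "exp (- 1 / x) / x ^ m \<le> (real n * x) ^ n / x ^ m"
    using True by (intro divide_right_mono) auto
  also have "\<dots> = real n ^ n * x\<^sup>2"
    using True by (simp add: n_def power_mult_distrib power_add power2_eq_square)
  finally show ?thesis using True by (simp add: exp_flat_def n_def)
qed (simp add: exp_flat_def)

text \<open>Away from 0 this is the quotient rule or a constant function; at 0 the quadratic bound
  \<open>exp_flat_le\<close> makes the difference quotient vanish.\<close>

lemma exp_flat_has_derivative:
  "(exp_flat m has_real_derivative exp_flat (m + 2) x - real m * exp_flat (m + 1) x) (at x)"
proof -
  consider "x > 0" | "x < 0" | "x = 0" by linarith
  then show ?thesis
  proof cases
    case 1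
    have "((\<lambda>x. exp (- 1 / x) / x ^ m) has_real_derivative
        exp_flat (m + 2) x - real m * exp_flat (m + 1) x) (at x)"
    proof (rule DERIV_cong)
      have e: "((\<lambda>x. exp (- 1 / x)) has_real_derivative exp (- 1 / x) / x\<^sup>2) (at x)"
        using 1 by (auto intro!: derivative_eq_intros simp: field_simps power2_eq_square)
      show "((\<lambda>x. exp (- 1 / x) / x ^ m) has_real_derivative
          (exp (- 1 / x) / x\<^sup>2 * x ^ m - exp (- 1 / x) * (real m * x ^ (m - Suc 0))) / (x ^ m * x ^ m)) (at x)"
        by (rule DERIV_divide[OF e DERIV_pow]) (use 1 in simp)
      have *: "real m * x ^ (m - Suc 0) = real m * x ^ m / x" using 1 by (cases m) auto
      show "(exp (- 1 / x) / x\<^sup>2 * x ^ m - exp (- 1 / x) * (real m * x ^ (m - Suc 0))) / (x ^ m * x ^ m) =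
          exp_flat (m + 2) x - real m * exp_flat (m + 1) x"
        unfolding * using 1 by (simp add: exp_flat_def power_add power2_eq_square field_simps)
    qed
    moreover have "\<forall>\<^sub>F y in nhds x. exp_flat m y = exp (- 1 / y) / y ^ m"
      using eventually_nhds_in_open[of "{0<..}" x] 1 by (auto elim!: eventually_mono simp: exp_flat_def)
    ultimately show ?thesis by (subst DERIV_cong_ev[OF refl _ refl]) auto
  next
    case 2
    have "\<forall>\<^sub>F y in nhds x. exp_flat m y = 0"
      using eventually_nhds_in_open[of "{..<0}" x] 2 by (auto elim!: eventually_mono simp: exp_flat_def)
    then have "(exp_flat m has_real_derivative 0) (at x)"
      by (subst DERIV_cong_ev[OF refl _ refl, where g = "\<lambda>_. 0"]) auto
    then show ?thesis using 2 by (simp add: exp_flat_def)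
  next
    case 3
    define C where "C = real (m + 2) ^ (m + 2)"
    have "((\<lambda>h. exp_flat m h / h) \<longlongrightarrow> 0) (at 0)"
    proof (rule Lim_null_comparison[where g = "\<lambda>h. C * \<bar>h\<bar>"])
      have "norm (exp_flat m h / h) \<le> C * \<bar>h\<bar>" if "h \<noteq> 0" for h
        using exp_flat_le[of m h] that
        by (simp add: C_def divide_le_eq power2_eq_square abs_mult)
      then show "\<forall>\<^sub>F h in at 0. norm (exp_flat m h / h) \<le> C * \<bar>h\<bar>"
        by (auto simp: eventually_at_filter)
      show "((\<lambda>h. C * \<bar>h\<bar>) \<longlongrightarrow> 0) (at 0)" by (auto intro!: tendsto_eq_intros)
    qed
    moreover have "exp_flat j 0 = 0" for j by (simp add: exp_flat_def)
    ultimately show ?thesis using 3 by (simp add: DERIV_def)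
  qed
qed

text \<open>One induction over \<open>k\<close> for all \<open>m\<close> at once, since each
  derivative raises \<open>m\<close>. The inner function only contributes factors
  \<open>pd i q\<close>, which are smooth of every order.\<close>

lemma Ck_exp_flat:
  fixes q :: "real^'n \<Rightarrow> real"
  assumes q: "\<And>j. Ck j q"
  shows "Ck k (\<lambda>x. exp_flat m (q x))"
proof (induction k arbitrary: m)
  case 0
  have "isCont (exp_flat m) y" for y using exp_flat_has_derivative DERIV_isCont by blast
  then have "continuous_on UNIV (exp_flat m)" by (simp add: continuous_on_eq_continuous_at)
  then show ?case using Ck_continuous[OF q] by (auto intro: continuous_on_compose2)
next
  case (Suc k)
  have d: "((\<lambda>x. exp_flat m (q x)) has_derivative
      (\<lambda>h. (exp_flat (m + 2) (q x) - real m * exp_flat (m + 1) (q x)) * (\<Sum>i\<in>UNIV. h $ i * pd i q x))) (at x)" for x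
    using has_derivative_compose[OF has_derivative_pd[OF Ck_differentiable[OF q[of "Suc 0"]]]
        exp_flat_has_derivative[unfolded has_field_derivative_def]] .
  have eq: "pd i (\<lambda>x. exp_flat m (q x)) =
      (\<lambda>x. (exp_flat (m + 2) (q x) + (- real m) * exp_flat (m + 1) (q x)) * pd i q x)" for i
    by (rule ext, subst pd_eqI[OF d]) (simp add: axis_def if_distrib[of "\<lambda>t. t * _"] cong: if_cong)
  have "Ck k (pd i q)" for i using q[of "Suc k"] by simp
  then have "Ck k (\<lambda>x. (exp_flat (m + 2) (q x) + (- real m) * exp_flat (m + 1) (q x)) * pd i q x)" for i
    by (intro Ck_mult Ck_add Ck_cmult Suc.IH)
  then show ?case using d by (auto simp: eq differentiable_def)
qed

subsection \<open>Test functions\<close>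

lemma test_funsD:
  assumes "g \<in> test_funs \<Omega>"
  shows "Ck k g" "compact (closure {x. g x \<noteq> 0})" "closure {x. g x \<noteq> 0} \<subseteq> \<Omega>"
    "x \<notin> \<Omega> \<Longrightarrow> g x = 0" "continuous_on UNIV g" "g \<in> borel_measurable borel"
    "g differentiable (at x)"
proof -
  show "Ck k g" "compact (closure {x. g x \<noteq> 0})" "closure {x. g x \<noteq> 0} \<subseteq> \<Omega>"
    using assms unfolding test_funs_def by blast+
  have k: "Ck k g" for k using assms unfolding test_funs_def by blast
  show "x \<notin> \<Omega> \<Longrightarrow> g x = 0"
    using assms closure_subset[of "{x. g x \<noteq> 0}"] unfolding test_funs_def by blast
  show c: "continuous_on UNIV g" using k by (rule Ck_continuous)
  then show "g \<in> borel_measurable borel" by (rule borel_measurable_continuous_onI)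
  show "g differentiable (at x)" using k Ck_differentiable by blast
qed

lemma test_funsI:
  assumes "\<And>k. Ck k g" "compact K" "K \<subseteq> \<Omega>" "\<And>x. x \<notin> K \<Longrightarrow> g x = 0"
  shows "g \<in> test_funs \<Omega>"
proof -
  have "{x. g x \<noteq> 0} \<subseteq> K" using assms by auto
  then have s: "closure {x. g x \<noteq> 0} \<subseteq> K" using assms by (simp add: closure_minimal compact_imp_closed)
  then have "compact (closure {x. g x \<noteq> 0})"
    by (meson assms(2) bounded_subset closed_closure compact_eq_bounded_closed)
  with s assms show ?thesis by (auto simp: test_funs_def)
qed

lemma test_funs_mono: "A \<subseteq> B \<Longrightarrow> g \<in> test_funs A \<Longrightarrow> g \<in> test_funs B"
  by (auto simp: test_funs_def)

lemma zero_off_support: "x \<notin> closure {x. g x \<noteq> 0} \<Longrightarrow> g x = 0"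
  by (metis (mono_tags, lifting) closure_subset mem_Collect_eq subsetD)

lemma test_funs_mult:
  fixes g h :: "real^'n \<Rightarrow> real"
  assumes "g \<in> test_funs \<Omega>" "\<And>k. Ck k h"
  shows "(\<lambda>x. h x * g x) \<in> test_funs \<Omega>"
proof (rule test_funsI)
  show "h x * g x = 0" if "x \<notin> closure {x. g x \<noteq> 0}" for x using zero_off_support[OF that] by simp
qed (use assms test_funsD(1-3)[OF assms(1)] Ck_mult in blast)+

lemma test_funs_cmult: "g \<in> test_funs \<Omega> \<Longrightarrow> (\<lambda>x. c * g x) \<in> test_funs \<Omega>"
  by (rule test_funs_mult) (auto intro: Ck_const)

lemma test_funs_add:
  assumes "g \<in> test_funs \<Omega>" "h \<in> test_funs \<Omega>"
  shows "(\<lambda>x. g x + h x) \<in> test_funs \<Omega>"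
proof (rule test_funsI)
  let ?K = "closure {x. g x \<noteq> 0} \<union> closure {x. h x \<noteq> 0}"
  show "compact ?K" "?K \<subseteq> \<Omega>"
    using test_funsD(2,3)[OF assms(1)] test_funsD(2,3)[OF assms(2)] by blast+
  show "g x + h x = 0" if "x \<notin> ?K" for x
  proof -
    have "g x = 0" "h x = 0" using that zero_off_support[of x g] zero_off_support[of x h] by auto
    then show ?thesis by simp
  qed
qed (use assms test_funsD(1) Ck_add in blast)+

lemma test_funs_0: "(\<lambda>_. 0) \<in> test_funs \<Omega>"
  by (rule test_funsI[of _ "{}"]) (auto intro: Ck_const)

lemma test_funs_sum:
  assumes "finite A" "\<And>a. a \<in> A \<Longrightarrow> f a \<in> test_funs \<Omega>"
  shows "(\<lambda>x. \<Sum>a\<in>A. f a x) \<in> test_funs \<Omega>"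
  using assms by (induction A rule: finite_induct) (auto intro: test_funs_0 test_funs_add)

text \<open>The closed support of \<open>g\<close> serves for the derivative as well: off it,
  \<open>g\<close> vanishes in a whole neighbourhood.\<close>

lemma test_funs_pd:
  assumes g: "g \<in> test_funs \<Omega>"
  shows "pd i g \<in> test_funs \<Omega>"
proof (rule test_funsI)
  let ?K = "closure {x. g x \<noteq> 0}"
  show "Ck k (pd i g)" for k using test_funsD(1)[OF g, of "Suc k"] by simp
  show "compact ?K" "?K \<subseteq> \<Omega>" using test_funsD(2,3)[OF g] by blast+
  show "pd i g x = 0" if x: "x \<notin> ?K" for x
  proof -
    have z: "g y = 0" if "y \<in> - ?K" for y using that zero_off_support[of y g] by auto
    have o: "open (- ?K)" by (intro open_Compl closed_closure)
    have x': "x \<in> - ?K" unfolding Compl_iff by (rule x)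
    have "((\<lambda>_. 0) has_derivative (\<lambda>_. 0::real)) (at x)" by simp
    then have "(g has_derivative (\<lambda>_. 0)) (at x)"
      by (rule has_derivative_transform_within_open[OF _ o x']) (simp only: z)
    then show ?thesis using pd_eqI[of g "\<lambda>_. 0" x i] by simp
  qed
qed

lemma test_funs_support_cball:
  fixes g :: "real^'n \<Rightarrow> real"
  assumes "g \<in> test_funs \<Omega>"
  obtains R where "R > 0" "\<And>x. x \<notin> cball 0 R \<Longrightarrow> g x = 0"
proof -
  have "bounded (closure {x. g x \<noteq> 0})" using test_funsD(2)[OF assms] compact_imp_bounded by blast
  then obtain R where R: "R > 0" "\<And>x. x \<in> closure {x. g x \<noteq> 0} \<Longrightarrow> norm x \<le> R" by (meson bounded_pos)
  have "g x = 0" if "x \<notin> cball 0 R" for x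
    using that R(2)[of x] closure_subset[of "{x. g x \<noteq> 0}"] by auto
  with R that show ?thesis by blast
qed

lemma test_funs_bounded:
  fixes g :: "real^'n \<Rightarrow> real"
  assumes "g \<in> test_funs \<Omega>"
  obtains B where "B > 0" "\<And>x. \<bar>g x\<bar> \<le> B"
proof -
  obtain R where R: "R > 0" "\<And>x. x \<notin> cball 0 R \<Longrightarrow> g x = 0" using test_funs_support_cball[OF assms] by metis
  have "compact (g ` cball 0 R)"
    by (rule compact_continuous_image) (auto intro: continuous_on_subset test_funsD(5)[OF assms])
  then obtain B where B: "B > 0" "\<forall>y\<in>g ` cball 0 R. norm y \<le> B" by (meson bounded_pos compact_imp_bounded)
  have "\<bar>g x\<bar> \<le> B" for x using B R(2)[of x] by (cases "x \<in> cball 0 R") auto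
  with B that show ?thesis by blast
qed

lemma test_funs_integrable:
  fixes g :: "real^'n \<Rightarrow> real"
  assumes "g \<in> test_funs \<Omega>"
  shows "integrable lborel g"
proof -
  obtain R where R: "R > 0" "\<And>x. x \<notin> cball 0 R \<Longrightarrow> g x = 0" using test_funs_support_cball[OF assms] by metis
  obtain B where B: "B > 0" "\<And>x. \<bar>g x\<bar> \<le> B" using test_funs_bounded[OF assms] by metis
  have "integrable lborel (\<lambda>x. B * indicat_real (cball 0 R) x)"
    by (intro integrable_mult_right integrable_real_indicator)
       (use emeasure_bounded_finite[of "cball 0 R"] in auto)
  then show ?thesis
    by (rule Bochner_Integration.integrable_bound)
       (use assms R B in \<open>auto simp: test_funsD indicator_def intro!: AE_I2\<close>)
qed

text \<open>Heine-Cantor on a ball whose radius is larger by one. Two points closer than 1 either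
  both lie in it or both lie outside the smaller ball, where the function is 0.\<close>

lemma compact_support_uniformly_continuous:
  fixes g :: "real^'n \<Rightarrow> real"
  assumes c: "continuous_on UNIV g" and R: "\<And>x. x \<notin> cball 0 R \<Longrightarrow> g x = 0"
  shows "uniformly_continuous_on UNIV g"
  unfolding uniformly_continuous_on_def
proof (intro allI impI)
  fix e :: real assume "e > 0"
  have "uniformly_continuous_on (cball 0 (R + 1)) g"
    by (intro compact_uniformly_continuous continuous_on_subset[OF c]) auto
  then obtain d where d: "d > 0" "\<And>x y. x \<in> cball 0 (R + 1) \<Longrightarrow> y \<in> cball 0 (R + 1) \<Longrightarrow> dist y x < d \<Longrightarrow> dist (g y) (g x) < e"
    using \<open>e > 0\<close> unfolding uniformly_continuous_on_def by metis
  have "dist (g y) (g x) < e" if xy: "dist y x < min d 1" for x y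
  proof (cases "x \<in> cball 0 R \<or> y \<in> cball 0 R")
    case True
    have "norm y \<le> norm x + dist y x" "norm x \<le> norm y + dist y x"
      using norm_triangle_ineq2[of x y] norm_triangle_ineq2[of y x] by (auto simp: dist_norm norm_minus_commute)
    then have "x \<in> cball 0 (R + 1)" "y \<in> cball 0 (R + 1)"
      using True xy by (auto simp: dist_norm)
    then show ?thesis using d(2) xy by auto
  next
    case False
    then show ?thesis using R \<open>e > 0\<close> by auto
  qed
  then show "\<exists>d>0. \<forall>x\<in>UNIV. \<forall>x'\<in>UNIV. dist x' x < d \<longrightarrow> dist (g x') (g x) < e"
    using d(1) by (intro exI[of _ "min d 1"]) auto
qed

lemma C1_mean_value:
  fixes k :: "real^'n \<Rightarrow> real"
  assumes "\<And>x. k differentiable (at x)"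
  obtains t where "0 < t" "t < 1" "k (y + h) - k y = (\<Sum>i\<in>UNIV. h $ i * pd i k (y + t *\<^sub>R h))"
proof -
  have d: "((\<lambda>t. k (y + t *\<^sub>R h)) has_real_derivative (\<Sum>i\<in>UNIV. h $ i * pd i k (y + t *\<^sub>R h))) (at t)" for t
  proof -
    have "((\<lambda>t. y + t *\<^sub>R h) has_derivative (\<lambda>s. s *\<^sub>R h)) (at t)"
      by (auto intro!: derivative_eq_intros)
    from has_derivative_compose[OF this has_derivative_pd[OF assms]]
    show ?thesis
      by (rule has_derivative_imp_has_field_derivative) (simp add: sum_distrib_left algebra_simps)
  qed
  obtain t where "0 < t" "t < 1"
    "k (y + 1 *\<^sub>R h) - k (y + 0 *\<^sub>R h) = (1 - 0) * (\<Sum>i\<in>UNIV. h $ i * pd i k (y + t *\<^sub>R h))"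
    using MVT2[of 0 1 "\<lambda>t. k (y + t *\<^sub>R h)" "\<lambda>t. \<Sum>i\<in>UNIV. h $ i * pd i k (y + t *\<^sub>R h)"] d by auto
  with that show ?thesis by simp
qed

text \<open>The mean value theorem turns the remainder into increments of the partial derivatives,
  which are uniformly continuous. That \<open>d\<close> does not depend on \<open>y\<close> is what
  permits differentiation under the convolution integral.\<close>

lemma test_funs_uniform_taylor:
  fixes k :: "real^'n \<Rightarrow> real"
  assumes k: "k \<in> test_funs \<Omega>" and e: "e > 0"
  obtains d where "d > 0"
    "\<And>y h. norm h < d \<Longrightarrow> \<bar>k (y + h) - k y - (\<Sum>i\<in>UNIV. h $ i * pd i k y)\<bar> \<le> e * norm h"
proof -
  define N where "N = real CARD('n)"
  have N: "N > 0" by (simp add: N_def)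
  have "\<exists>d>0. \<forall>x y. dist x y < d \<longrightarrow> dist (pd i k x) (pd i k y) < e / N" for i
  proof -
    obtain R where "\<And>x. x \<notin> cball 0 R \<Longrightarrow> pd i k x = 0"
      using test_funs_support_cball[OF test_funs_pd[OF k]] by metis
    then have "uniformly_continuous_on UNIV (pd i k)"
      using compact_support_uniformly_continuous test_funsD(5)[OF test_funs_pd[OF k]] by metis
    then show ?thesis using e N unfolding uniformly_continuous_on_def
      by (metis UNIV_I zero_less_divide_iff)
  qed
  then obtain d where d: "\<And>i. d i > 0" "\<And>i x y. dist x y < d i \<Longrightarrow> dist (pd i k x) (pd i k y) < e / N"
    by metis
  define dm where "dm = Min (range d)"
  have dm: "dm > 0" "\<And>i. dm \<le> d i" using d(1) by (auto simp: dm_def)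
  have "\<bar>k (y + h) - k y - (\<Sum>i\<in>UNIV. h $ i * pd i k y)\<bar> \<le> e * norm h" if h: "norm h < dm" for y h
  proof -
    obtain t where t: "0 < t" "t < 1" "k (y + h) - k y = (\<Sum>i\<in>UNIV. h $ i * pd i k (y + t *\<^sub>R h))"
      using C1_mean_value[of k y h] test_funsD(7)[OF k] by blast
    have "norm (t *\<^sub>R h) \<le> norm h" using t by (simp add: mult_left_le_one_le)
    then have "dist (y + t *\<^sub>R h) y < d i" for i using h dm(2)[of i] by (simp add: dist_norm)
    then have *: "\<bar>pd i k (y + t *\<^sub>R h) - pd i k y\<bar> \<le> e / N" for i using d(2)[of "y + t *\<^sub>R h" y i] by (simp add: dist_real_def)
    have "k (y + h) - k y - (\<Sum>i\<in>UNIV. h $ i * pd i k y) = (\<Sum>i\<in>UNIV. h $ i * (pd i k (y + t *\<^sub>R h) - pd i k y))"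
      by (simp add: t(3) sum_subtractf right_diff_distrib)
    also have "\<bar>\<dots>\<bar> \<le> (\<Sum>i\<in>UNIV. \<bar>h $ i * (pd i k (y + t *\<^sub>R h) - pd i k y)\<bar>)" by (rule sum_abs)
    also have "\<dots> \<le> (\<Sum>i\<in>(UNIV::'n set). norm h * (e / N))"
      unfolding abs_mult using * by (intro sum_mono mult_mono component_le_norm_cart) auto
    also have "\<dots> = e * norm h" using N by (simp add: N_def)
    finally show ?thesis .
  qed
  with dm(1) that show ?thesis by blast
qed

subsection \<open>Convolution\<close>

lemma distr_lborel_reflect: "distr lborel borel (\<lambda>y. x - y) = (lborel :: 'a::euclidean_space measure)"
  using lborel_affine[of "-1" x] by (simp add: density_1)

lemma integral_lborel_reflect:
  fixes F :: "'a::euclidean_space \<Rightarrow> real"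
  assumes "F \<in> borel_measurable borel"
  shows "(\<integral>y. F (x - y) \<partial>lborel) = (\<integral>y. F y \<partial>lborel)"
    and "integrable lborel (\<lambda>y. F (x - y)) \<longleftrightarrow> integrable lborel F"
proof -
  have "(\<integral>y. F y \<partial>distr lborel borel (\<lambda>y. x - y)) = (\<integral>y. F (x - y) \<partial>lborel)"
    by (rule integral_distr) (use assms in auto)
  moreover have "integrable (distr lborel borel (\<lambda>y. x - y)) F \<longleftrightarrow> integrable lborel (\<lambda>y. F (x - y))"
    by (rule integrable_distr_eq) (use assms in auto)
  ultimately show "(\<integral>y. F (x - y) \<partial>lborel) = (\<integral>y. F y \<partial>lborel)"
    "integrable lborel (\<lambda>y. F (x - y)) \<longleftrightarrow> integrable lborel F"
    by (simp_all add: distr_lborel_reflect)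
qed

lemma integral_lborel_shift:
  fixes F :: "'a::euclidean_space \<Rightarrow> real"
  assumes "F \<in> borel_measurable borel"
  shows "(\<integral>y. F (x + y) \<partial>lborel) = (\<integral>y. F y \<partial>lborel)"
    and "integrable lborel (\<lambda>y. F (x + y)) \<longleftrightarrow> integrable lborel F"
proof -
  have "(\<integral>y. F y \<partial>distr lborel borel (\<lambda>y. x + y)) = (\<integral>y. F (x + y) \<partial>lborel)"
    by (rule integral_distr) (use assms in auto)
  moreover have "integrable (distr lborel borel (\<lambda>y. x + y)) F \<longleftrightarrow> integrable lborel (\<lambda>y. F (x + y))"
    by (rule integrable_distr_eq) (use assms in auto)
  ultimately show "(\<integral>y. F (x + y) \<partial>lborel) = (\<integral>y. F y \<partial>lborel)"
    "integrable lborel (\<lambda>y. F (x + y)) \<longleftrightarrow> integrable lborel F"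
    by (simp_all add: lborel_distr_plus)
qed

text \<open>By translation invariance every difference quotient in direction \<open>i\<close> has
  integral 0. The quotients are dominated by a constant on a slightly larger ball and converge to
  the partial derivative.\<close>

lemma integral_pd_eq_0:
  fixes g :: "real^'n \<Rightarrow> real"
  assumes g: "g \<in> test_funs \<Omega>"
  shows "(\<integral>x. pd i g x \<partial>lborel) = 0"
proof -
  define t where "t n = inverse (real (Suc n))" for n
  have t: "t n > 0" "t n \<le> 1" for n by (auto simp: t_def field_simps)
  define e :: "real^'n" where "e = axis i 1"
  have [measurable]: "g \<in> borel_measurable borel" "pd i g \<in> borel_measurable borel"
    using test_funsD(6) g test_funs_pd by blast+
  define q where "q n x = (g (t n *\<^sub>R e + x) - g x) / t n" for n x
  have q0: "(\<integral>x. q n x \<partial>lborel) = 0" for n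
    using integral_lborel_shift[of g "t n *\<^sub>R e"] test_funs_integrable[OF g]
    by (simp add: q_def Bochner_Integration.integral_diff)
  obtain R where R: "R > 0" "\<And>x. x \<notin> cball 0 R \<Longrightarrow> g x = 0" using test_funs_support_cball[OF g] by metis
  obtain B where B: "B > 0" "\<And>x. \<bar>pd i g x\<bar> \<le> B" using test_funs_bounded[OF test_funs_pd[OF g]] by metis
  have mv: "\<exists>s. 0 < s \<and> s < 1 \<and> q n x = pd i g (x + (s * t n) *\<^sub>R e)" for n x
  proof -
    obtain s where s: "0 < s" "s < 1"
      "g (x + t n *\<^sub>R e) - g x = (\<Sum>j\<in>UNIV. (t n *\<^sub>R e) $ j * pd j g (x + s *\<^sub>R (t n *\<^sub>R e)))"
      using C1_mean_value[of g x "t n *\<^sub>R e"] test_funsD(7)[OF g] by blast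
    have "(\<Sum>j\<in>UNIV. (t n *\<^sub>R e) $ j * pd j g (x + s *\<^sub>R (t n *\<^sub>R e))) = t n * pd i g (x + (s * t n) *\<^sub>R e)"
      by (simp add: e_def axis_def if_distrib[of "\<lambda>t. t * _"] if_distrib[of "(*) (t n)"] cong: if_cong)
    with s t[of n] show ?thesis by (auto simp: q_def add.commute)
  qed
  have "(\<lambda>n. \<integral>x. q n x \<partial>lborel) \<longlonglongrightarrow> (\<integral>x. pd i g x \<partial>lborel)"
  proof (rule integral_dominated_convergence[where w = "\<lambda>x. B * indicator (cball 0 (R + 1)) x"])
    show "integrable lborel (\<lambda>x::real^'n. B * indicator (cball 0 (R + 1)) x)"
      by (intro integrable_mult_right integrable_real_indicator)
         (use emeasure_bounded_finite[of "cball 0 (R + 1)"] in auto)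
    show "AE x in lborel. (\<lambda>n. q n x) \<longlonglongrightarrow> pd i g x"
    proof (rule AE_I2)
      fix x :: "real^'n"
      obtain s where s: "\<And>n. 0 < s n" "\<And>n. s n < 1" "\<And>n. q n x = pd i g (x + (s n * t n) *\<^sub>R e)"
        using mv[of _ x] by metis
      have "t \<longlonglongrightarrow> 0" unfolding t_def by (rule LIMSEQ_inverse_real_of_nat)
      then have "(\<lambda>n. s n * t n) \<longlonglongrightarrow> 0"
        by (rule Lim_null_comparison[rotated])
           (use s t in \<open>auto simp: abs_mult less_imp_le intro!: always_eventually mult_left_le_one_le\<close>)
      then have "(\<lambda>n. x + (s n * t n) *\<^sub>R e) \<longlonglongrightarrow> x + 0 *\<^sub>R e" by (intro tendsto_intros)
      moreover have "isCont (pd i g) x"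
        using test_funsD(5)[OF test_funs_pd[OF g]] by (simp add: continuous_on_eq_continuous_at)
      ultimately have "(\<lambda>n. pd i g (x + (s n * t n) *\<^sub>R e)) \<longlonglongrightarrow> pd i g x"
        by (intro isCont_tendsto_compose[of x "pd i g"]) auto
      then show "(\<lambda>n. q n x) \<longlonglongrightarrow> pd i g x" by (simp add: s)
    qed
    show "AE x in lborel. norm (q n x) \<le> B * indicator (cball 0 (R + 1)) x" for n
    proof (rule AE_I2)
      fix x :: "real^'n"
      have "norm (q n x) \<le> B" using mv[of n x] B by auto
      moreover have "q n x = 0" if "x \<notin> cball 0 (R + 1)"
      proof -
        have "norm (t n *\<^sub>R e) \<le> 1" using t[of n] by (simp add: e_def)
        then have "norm (t n *\<^sub>R e + x) \<ge> norm x - 1"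
          using norm_triangle_ineq2[of x "- (t n *\<^sub>R e)"] by (simp add: add.commute)
        then have "g (t n *\<^sub>R e + x) = 0" "g x = 0" using that R by auto
        then show ?thesis by (simp add: q_def)
      qed
      ultimately show "norm (q n x) \<le> B * indicator (cball 0 (R + 1)) x"
        by (cases "x \<in> cball 0 (R + 1)") auto
    qed
    show "q n \<in> borel_measurable lborel" for n unfolding q_def by measurable
  qed auto
  then show ?thesis by (simp add: q0 LIMSEQ_const_iff)
qed

definition conv :: "(real^'n \<Rightarrow> real) \<Rightarrow> (real^'n \<Rightarrow> real) \<Rightarrow> real^'n \<Rightarrow> real" where
  "conv k F x = (\<integral>y. k (x - y) * F y \<partial>lborel)"

lemma integrable_bounded_mult:
  fixes h F :: "'a \<Rightarrow> real"
  assumes "integrable M F" "h \<in> borel_measurable M" "\<And>x. \<bar>h x\<bar> \<le> B"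
  shows "integrable M (\<lambda>x. h x * F x)"
proof (rule Bochner_Integration.integrable_bound[of _ "\<lambda>x. B * F x"])
  have "B \<ge> 0" using assms(3)[of undefined] by linarith
  then show "AE x in M. norm (h x * F x) \<le> norm (B * F x)"
    using assms(3) by (auto simp: abs_mult intro!: AE_I2 mult_right_mono)
qed (use assms in auto)

lemma conv_integrable:
  assumes k: "k \<in> test_funs \<Omega>" and F: "integrable lborel F"
  shows "integrable lborel (\<lambda>y. k (x - y) * F y)"
proof -
  obtain B where "B > 0" "\<And>x. \<bar>k x\<bar> \<le> B" using test_funs_bounded[OF k] by metis
  moreover have [measurable]: "k \<in> borel_measurable borel" using test_funsD(6)[OF k] .
  ultimately show ?thesis by (intro integrable_bounded_mult[OF F, of _ B]) auto
qed

lemma conv_eq: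
  assumes "k \<in> borel_measurable borel" "F \<in> borel_measurable borel"
  shows "conv k F x = (\<integral>z. k z * F (x - z) \<partial>lborel)"
  using integral_lborel_reflect(1)[of "\<lambda>y. k (x - y) * F y" x] assms by (simp add: conv_def)

text \<open>The derivative falls on the kernel: the uniform Taylor estimate for \<open>k\<close> is
  integrated against the absolute value of \<open>F\<close>.\<close>

lemma conv_has_derivative:
  fixes k F :: "real^'n \<Rightarrow> real"
  assumes k: "k \<in> test_funs \<Omega>" and F: "integrable lborel F"
  shows "(conv k F has_derivative (\<lambda>h. \<Sum>i\<in>UNIV. h $ i * conv (pd i k) F x)) (at x)"
  unfolding has_derivative_at_alt
proof (intro conjI allI impI)
  show "bounded_linear (\<lambda>h. \<Sum>i\<in>UNIV. h $ i * conv (pd i k) F x)"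
    by (intro bounded_linear_sum bounded_linear_mult_left[THEN bounded_linear_compose] bounded_linear_vec_nth)
  fix e :: real assume e: "e > 0"
  \<comment> \<open>The summand 1 keeps the divisor positive when \<open>F\<close> vanishes almost
    everywhere.\<close>
  define A where "A = (\<integral>y. \<bar>F y\<bar> \<partial>lborel) + 1"
  have A: "A > 0" by (simp add: A_def add_nonneg_pos)
  obtain d where d: "d > 0"
    "\<And>y h. norm h < d \<Longrightarrow> \<bar>k (y + h) - k y - (\<Sum>i\<in>UNIV. h $ i * pd i k y)\<bar> \<le> e / A * norm h"
    by (rule test_funs_uniform_taylor[OF k divide_pos_pos[OF e A]]) blast
  have "norm (conv k F y - conv k F x - (\<Sum>i\<in>UNIV. (y - x) $ i * conv (pd i k) F x)) \<le> e * norm (y - x)"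
    if "norm (y - x) < d" for y
  proof -
    define h where "h = y - x"
    have h: "norm h < d" "y = x + h" using that by (auto simp: h_def)
    note int = conv_integrable[OF k F] conv_integrable[OF test_funs_pd[OF k] F]
    have int2: "integrable lborel (\<lambda>z. (k (x - z + h) - k (x - z) - (\<Sum>i\<in>UNIV. h $ i * pd i k (x - z))) * F z)"
    proof -
      have "integrable lborel (\<lambda>z. k (x + h - z) * F z - k (x - z) * F z - (\<Sum>i\<in>UNIV. h $ i * (pd i k (x - z) * F z)))"
        by (intro Bochner_Integration.integrable_diff Bochner_Integration.integrable_sum integrable_mult_right int)
      moreover have "k (x + h - z) * F z - k (x - z) * F z - (\<Sum>i\<in>UNIV. h $ i * (pd i k (x - z) * F z)) =
        (k (x - z + h) - k (x - z) - (\<Sum>i\<in>UNIV. h $ i * pd i k (x - z))) * F z" for z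
        by (simp add: algebra_simps sum_distrib_left sum_distrib_right)
      ultimately show ?thesis by simp
    qed
    have "conv k F y - conv k F x - (\<Sum>i\<in>UNIV. h $ i * conv (pd i k) F x) =
      (\<integral>z. (k (x - z + h) - k (x - z) - (\<Sum>i\<in>UNIV. h $ i * pd i k (x - z))) * F z \<partial>lborel)"
    proof -
      have "(\<integral>z. (k (x - z + h) - k (x - z) - (\<Sum>i\<in>UNIV. h $ i * pd i k (x - z))) * F z \<partial>lborel) =
        (\<integral>z. k (x + h - z) * F z - k (x - z) * F z - (\<Sum>i\<in>UNIV. h $ i * (pd i k (x - z) * F z)) \<partial>lborel)"
        by (rule Bochner_Integration.integral_cong) (auto simp: algebra_simps sum_distrib_left sum_distrib_right)
      also have "\<dots> = conv k F y - conv k F x - (\<Sum>i\<in>UNIV. h $ i * conv (pd i k) F x)"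
        using int by (simp add: conv_def h(2))
      finally show ?thesis by simp
    qed
    also have "\<bar>\<dots>\<bar> \<le> (\<integral>z. \<bar>(k (x - z + h) - k (x - z) - (\<Sum>i\<in>UNIV. h $ i * pd i k (x - z))) * F z\<bar> \<partial>lborel)"
      by (rule integral_abs_bound)
    also have "\<dots> \<le> (\<integral>z. (e / A * norm h) * \<bar>F z\<bar> \<partial>lborel)"
    proof (rule integral_mono)
      fix z
      show "\<bar>(k (x - z + h) - k (x - z) - (\<Sum>i\<in>UNIV. h $ i * pd i k (x - z))) * F z\<bar> \<le> (e / A * norm h) * \<bar>F z\<bar>"
        unfolding abs_mult[of _ "F z"] by (rule mult_right_mono[OF d(2)[OF h(1)]]) simp
    qed (use integrable_abs[OF int2] integrable_abs[OF F] in auto)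
    also have "\<dots> = (e * norm h) * ((\<integral>y. \<bar>F y\<bar> \<partial>lborel) / A)" by simp
    also have "\<dots> \<le> (e * norm h) * 1"
      by (rule mult_left_mono) (use A e in \<open>auto simp: A_def\<close>)
    finally show ?thesis by (simp add: h_def)
  qed
  with d(1) show "\<exists>d>0. \<forall>y. norm (y - x) < d \<longrightarrow>
      norm (conv k F y - conv k F x - (\<Sum>i\<in>UNIV. (y - x) $ i * conv (pd i k) F x)) \<le> e * norm (y - x)"
    by blast
qed

lemma pd_conv:
  fixes k F :: "real^'n \<Rightarrow> real"
  assumes "k \<in> test_funs \<Omega>" "integrable lborel F"
  shows "pd i (conv k F) = conv (pd i k) F"
  by (rule ext, subst pd_eqI[OF conv_has_derivative[OF assms]])
     (simp add: axis_def if_distrib[of "\<lambda>t. t * _"] cong: if_cong)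

lemma Ck_conv:
  fixes k F :: "real^'n \<Rightarrow> real"
  assumes "k \<in> test_funs \<Omega>" "integrable lborel F"
  shows "Ck n (conv k F)"
  using assms(1)
proof (induction n arbitrary: k)
  case 0
  have "isCont (conv k F) x" for x
    using conv_has_derivative[OF 0 assms(2)] has_derivative_continuous by blast
  then show ?case by (simp add: continuous_on_eq_continuous_at)
next
  case (Suc n)
  then show ?case
    using conv_has_derivative[OF Suc.prems assms(2)] Suc.IH[OF test_funs_pd[OF Suc.prems]]
    by (auto simp: pd_conv[OF Suc.prems assms(2)] differentiable_def)
qed

text \<open>The centre is arbitrary and not just the origin: an off-centre kernel translates while
  it smooths, which is how a field is later pushed into the domain.\<close>

lemma mollifier_exists:
  fixes a :: "real^'n"
  assumes "d > 0"
  obtains k where "k \<in> test_funs (ball a d)" "\<And>x. 0 \<le> k x" "(\<integral>x. k x \<partial>lborel) = 1"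
proof -
  \<comment> \<open>A polynomial in the coordinates, written with sums and products so that the
    closure rules for \<open>Ck\<close> apply. It is positive exactly in the ball of radius
    \<open>d / 2\<close> around \<open>a\<close>, which leaves a compact support inside the open
    ball.\<close>
  define q where "q x = (d / 2)\<^sup>2 + (- 1) * (\<Sum>j\<in>UNIV. (x $ j + - (a $ j)) * (x $ j + - (a $ j)))" for x :: "real^'n"
  have q: "q x = (d / 2)\<^sup>2 - (norm (x - a))\<^sup>2" for x
    by (simp add: q_def power2_norm_eq_inner inner_vec_def)
  define b where "b x = exp_flat 0 (q x)" for x
  have Ck: "Ck j q" for j
    unfolding q_def by (intro Ck_add Ck_const Ck_cmult Ck_sum Ck_mult Ck_coord) auto
  have b: "b \<in> test_funs (ball a d)"
  proof (rule test_funsI)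
    show "Ck k b" for k unfolding b_def by (rule Ck_exp_flat[OF Ck])
    show "compact (cball a (d / 2))" by simp
    show "cball a (d / 2) \<subseteq> ball a d" using assms by auto
    show "b x = 0" if "x \<notin> cball a (d / 2)" for x
    proof -
      have "d / 2 < norm (x - a)" using that by (simp add: dist_norm norm_minus_commute)
      then have "(d / 2)\<^sup>2 < (norm (x - a))\<^sup>2" using assms by (intro power_strict_mono) auto
      then show ?thesis by (simp add: b_def exp_flat_def q)
    qed
  qed
  have b0: "b x \<ge> 0" for x by (simp add: b_def exp_flat_def)
  have int: "integrable lborel b" by (rule test_funs_integrable[OF b])
  have pos: "(\<integral>x. b x \<partial>lborel) > 0"
  proof (rule ccontr)
    assume "\<not> ?thesis"
    moreover have "(\<integral>x. b x \<partial>lborel) \<ge> 0" using b0 by simp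
    ultimately have "(\<integral>x. b x \<partial>lborel) = 0" by simp
    then have "AE x in lborel. b x = 0" using integral_nonneg_eq_0_iff_AE[OF int] b0 by simp
    then have "AE x in lborel. x \<notin> ball a (d / 2)"
    proof (rule AE_mp, intro AE_I2 impI)
      fix x assume x: "b x = 0"
      show "x \<notin> ball a (d / 2)"
      proof
        assume "x \<in> ball a (d / 2)"
        then have "norm (x - a) < d / 2" by (simp add: dist_norm norm_minus_commute)
        then have "(norm (x - a))\<^sup>2 < (d / 2)\<^sup>2" by (intro power_strict_mono) auto
        then have "b x > 0" by (simp add: b_def exp_flat_def q)
        with x show False by simp
      qed
    qed
    then have "ball a (d / 2) \<in> null_sets lborel"
      by (subst AE_iff_null_sets) auto
    then have "negligible (ball a (d / 2))"
      using negligible_iff_null_sets null_sets_completionI by blast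
    then show False using assms open_not_negligible[of "ball a (d / 2)"] by auto
  qed
  show ?thesis
  proof (rule that[of "\<lambda>x. 1 / (\<integral>x. b x \<partial>lborel) * b x"])
    show "(\<lambda>x. 1 / (\<integral>x. b x \<partial>lborel) * b x) \<in> test_funs (ball a d)" by (rule test_funs_cmult[OF b])
    show "0 \<le> 1 / (\<integral>x. b x \<partial>lborel) * b x" for x using pos b0 by simp
    show "(\<integral>x. 1 / (\<integral>x. b x \<partial>lborel) * b x \<partial>lborel) = 1" using pos by simp
  qed
qed

text \<open>The kernel is a probability density, so the convolution is an average of the values
  \<open>F (x - z)\<close> with \<open>k z \<noteq> 0\<close>, and bounds on those values carry
  over.\<close>

lemma conv_mono_const:
  fixes k F :: "real^'n \<Rightarrow> real"
  assumes k: "k \<in> test_funs \<Omega>" "\<And>x. 0 \<le> k x" "(\<integral>x. k x \<partial>lborel) = 1"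
    and F: "integrable lborel F" "F \<in> borel_measurable borel"
  shows "(\<And>z. k z \<noteq> 0 \<Longrightarrow> F (x - z) \<le> c) \<Longrightarrow> conv k F x \<le> c"
    and "(\<And>z. k z \<noteq> 0 \<Longrightarrow> c \<le> F (x - z)) \<Longrightarrow> c \<le> conv k F x"
proof -
  note [measurable] = test_funsD(6)[OF k(1)] F(2)
  have int: "integrable lborel (\<lambda>z. k z * F (x - z))" 
    using integral_lborel_reflect(2)[of "\<lambda>y. k (x - y) * F y" x] conv_integrable[OF k(1) F(1), of x] by simp
  have eq: "conv k F x = (\<integral>z. k z * F (x - z) \<partial>lborel)" by (rule conv_eq) auto
  have c: "(\<integral>z. k z * c \<partial>lborel) = c" "integrable lborel (\<lambda>z. k z * c)"
    using k test_funs_integrable[OF k(1)] by auto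
  show "conv k F x \<le> c" if *: "\<And>z. k z \<noteq> 0 \<Longrightarrow> F (x - z) \<le> c"
  proof -
    have "k z * F (x - z) \<le> k z * c" for z
      using k(2)[of z] *[of z] by (cases "k z = 0") (auto intro: mult_left_mono)
    then have "(\<integral>z. k z * F (x - z) \<partial>lborel) \<le> (\<integral>z. k z * c \<partial>lborel)"
      using int c by (intro integral_mono) auto
    then show ?thesis by (simp only: eq c)
  qed
  show "c \<le> conv k F x" if *: "\<And>z. k z \<noteq> 0 \<Longrightarrow> c \<le> F (x - z)"
  proof -
    have "k z * c \<le> k z * F (x - z)" for z
      using k(2)[of z] *[of z] by (cases "k z = 0") (auto intro: mult_left_mono)
    then have "(\<integral>z. k z * c \<partial>lborel) \<le> (\<integral>z. k z * F (x - z) \<partial>lborel)"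
      using int c by (intro integral_mono) auto
    then show ?thesis by (simp only: eq c)
  qed
qed

lemma conv_eq_0:
  assumes "\<And>y. k (x - y) \<noteq> 0 \<Longrightarrow> F y = 0"
  shows "conv k F x = 0"
proof -
  have "k (x - y) * F y = 0" for y using assms[of y] unfolding mult_eq_0_iff by blast
  then have "(\<lambda>y. k (x - y) * F y) = (\<lambda>_. 0)" by blast
  then show ?thesis unfolding conv_def by (simp only: integral_zero)
qed

subsection \<open>Square integrable functions\<close>

text \<open>The same space as \<open>L2\<close>, but over any measure:
  \<open>lebesgue_on \<Omega>\<close> carries the statement, \<open>lborel\<close> the
  convolutions.\<close>

definition sqint :: "'a measure \<Rightarrow> ('a \<Rightarrow> real) set" where
  "sqint M = {u \<in> borel_measurable M. integrable M (\<lambda>x. (u x)\<^sup>2)}"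

definition ip :: "'a measure \<Rightarrow> ('a \<Rightarrow> real) \<Rightarrow> ('a \<Rightarrow> real) \<Rightarrow> real" where
  "ip M u v = (\<integral>x. u x * v x \<partial>M)"

definition nrm :: "'a measure \<Rightarrow> ('a \<Rightarrow> real) \<Rightarrow> real" where
  "nrm M u = sqrt (ip M u u)"

lemma L2_eq: "L2 \<Omega> = sqint (lebesgue_on \<Omega>)" "L2_inner \<Omega> = ip (lebesgue_on \<Omega>)"
  "L2_norm \<Omega> = nrm (lebesgue_on \<Omega>)"
  by (auto simp: L2_def sqint_def L2_inner_def ip_def L2_norm_def nrm_def fun_eq_iff)

lemma sqint_measurable [measurable_dest]: "u \<in> sqint M \<Longrightarrow> u \<in> borel_measurable M"
  by (simp add: sqint_def)

lemma sqint_mult_integrable: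
  assumes "u \<in> sqint M" "v \<in> sqint M"
  shows "integrable M (\<lambda>x. u x * v x)"
proof (rule Bochner_Integration.integrable_bound)
  show "integrable M (\<lambda>x. (u x)\<^sup>2 + (v x)\<^sup>2)" using assms by (simp add: sqint_def)
  have "\<bar>a * b\<bar> \<le> a\<^sup>2 + b\<^sup>2" for a b :: real
  proof -
    have "2 * (\<bar>a\<bar> * \<bar>b\<bar>) \<le> a\<^sup>2 + b\<^sup>2" using zero_le_power2[of "\<bar>a\<bar> - \<bar>b\<bar>"] by (simp add: power2_diff)
    moreover have "0 \<le> \<bar>a\<bar> * \<bar>b\<bar>" by simp
    ultimately show ?thesis unfolding abs_mult by linarith
  qed
  then show "AE x in M. norm (u x * v x) \<le> norm ((u x)\<^sup>2 + (v x)\<^sup>2)" by (intro AE_I2) simp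
qed (use assms in measurable)

lemma sqint_sqI: "u \<in> borel_measurable M \<Longrightarrow> integrable M (\<lambda>x. u x * u x) \<Longrightarrow> u \<in> sqint M"
  by (simp add: sqint_def power2_eq_square)

lemma sqint_lin:
  assumes u: "u \<in> sqint M" and v: "v \<in> sqint M"
  shows "(\<lambda>x. a * u x + b * v x) \<in> sqint M"
proof (rule sqint_sqI)
  show "(\<lambda>x. a * u x + b * v x) \<in> borel_measurable M" using u v by measurable
  have "integrable M (\<lambda>x. a * a * (u x * u x) + 2 * a * b * (u x * v x) + b * b * (v x * v x))"
    using sqint_mult_integrable[OF u u] sqint_mult_integrable[OF u v] sqint_mult_integrable[OF v v] by simp
  then show "integrable M (\<lambda>x. (a * u x + b * v x) * (a * u x + b * v x))"
    by (simp add: algebra_simps)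
qed

lemma sqint_cmult: "u \<in> sqint M \<Longrightarrow> (\<lambda>x. a * u x) \<in> sqint M"
  using sqint_lin[of u M u a 0] by simp

lemma sqint_diff: "u \<in> sqint M \<Longrightarrow> v \<in> sqint M \<Longrightarrow> (\<lambda>x. u x - v x) \<in> sqint M"
  using sqint_lin[of u M v 1 "-1"] by simp

lemma sqint_add: "u \<in> sqint M \<Longrightarrow> v \<in> sqint M \<Longrightarrow> (\<lambda>x. u x + v x) \<in> sqint M"
  using sqint_lin[of u M v 1 1] by simp

lemma sqint_bound:
  assumes "u \<in> sqint M" "v \<in> borel_measurable M" "AE x in M. \<bar>v x\<bar> \<le> \<bar>u x\<bar>"
  shows "v \<in> sqint M"
proof -
  have "integrable M (\<lambda>x. (v x)\<^sup>2)"
  proof (rule Bochner_Integration.integrable_bound[of _ "\<lambda>x. (u x)\<^sup>2"])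
    show "AE x in M. norm ((v x)\<^sup>2) \<le> norm ((u x)\<^sup>2)"
      using assms(3) by eventually_elim (simp add: abs_le_square_iff)
  qed (use assms in \<open>auto simp: sqint_def\<close>)
  then show ?thesis using assms by (simp add: sqint_def)
qed

lemma sqint_AE_cong:
  assumes "u \<in> sqint M" "v \<in> borel_measurable M" "AE x in M. v x = u x"
  shows "v \<in> sqint M"
  by (rule sqint_bound[OF assms(1,2)]) (use assms(3) in \<open>auto elim: eventually_mono\<close>)

lemma sqint_bounded_mult:
  assumes "u \<in> sqint M" "h \<in> borel_measurable M" "\<And>x. \<bar>h x\<bar> \<le> B"
  shows "(\<lambda>x. h x * u x) \<in> sqint M"
proof (rule sqint_bound[OF sqint_cmult[OF assms(1), of B]])
  have "B \<ge> 0" using assms(3)[of undefined] by linarith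
  then show "AE x in M. \<bar>h x * u x\<bar> \<le> \<bar>B * u x\<bar>"
    using assms(3) by (auto simp: abs_mult intro!: AE_I2 mult_right_mono)
qed (use assms in measurable)

lemma sqint_zero: "(\<lambda>_. 0) \<in> sqint M" by (simp add: sqint_def)

lemma ip_comm: "ip M u v = ip M v u" by (simp add: ip_def mult.commute)

lemma ip_lin:
  assumes "u \<in> sqint M" "v \<in> sqint M" "w \<in> sqint M"
  shows "ip M (\<lambda>x. a * u x + b * v x) w = a * ip M u w + b * ip M v w"
proof -
  have "ip M (\<lambda>x. a * u x + b * v x) w = (\<integral>x. a * (u x * w x) + b * (v x * w x) \<partial>M)"
    unfolding ip_def by (rule Bochner_Integration.integral_cong) (auto simp: algebra_simps)
  also have "\<dots> = a * ip M u w + b * ip M v w"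
    using sqint_mult_integrable[OF assms(1,3)] sqint_mult_integrable[OF assms(2,3)] by (simp add: ip_def)
  finally show ?thesis .
qed

lemma ip_lin_right:
  assumes "u \<in> sqint M" "v \<in> sqint M" "w \<in> sqint M"
  shows "ip M w (\<lambda>x. a * u x + b * v x) = a * ip M w u + b * ip M w v"
  using ip_lin[OF assms] by (simp add: ip_comm[of M w])

lemma ip_diff:
  assumes "u \<in> sqint M" "v \<in> sqint M" "w \<in> sqint M"
  shows "ip M (\<lambda>x. u x - v x) w = ip M u w - ip M v w"
  using ip_lin[OF assms, of 1 "-1"] by simp

lemma ip_cmult: "ip M (\<lambda>x. a * u x) w = a * ip M u w"
  unfolding ip_def by (simp add: mult.assoc)

lemma ip_self_nonneg: "0 \<le> ip M u u" by (simp add: ip_def)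

lemma ip_lin_self:
  assumes u: "u \<in> sqint M" and v: "v \<in> sqint M"
  shows "ip M (\<lambda>x. a * u x + b * v x) (\<lambda>x. a * u x + b * v x) =
    a\<^sup>2 * ip M u u + 2 * a * b * ip M u v + b\<^sup>2 * ip M v v"
proof -
  let ?w = "\<lambda>x. a * u x + b * v x"
  have w: "?w \<in> sqint M" by (rule sqint_lin[OF u v])
  have "ip M ?w ?w = a * ip M u ?w + b * ip M v ?w" by (rule ip_lin[OF u v w])
  also have "\<dots> = a\<^sup>2 * ip M u u + 2 * a * b * ip M u v + b\<^sup>2 * ip M v v"
    by (simp add: ip_lin_right[OF u v u] ip_lin_right[OF u v v] ip_comm[of M v u] power2_eq_square algebra_simps)
  finally show ?thesis .
qed

text \<open>Evaluate at the vertex \<open>t = - b / c\<close>. It serves once for Cauchy-Schwarz and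
  once with a small constant term \<open>a\<close>, to show that a minimising sequence nearly solves
  its Euler equation.\<close>

lemma discriminant_le:
  fixes a b c :: real
  assumes "\<And>t. 0 \<le> a + 2 * t * b + t\<^sup>2 * c" "c \<ge> 0" "a \<ge> 0"
  shows "b\<^sup>2 \<le> a * c"
proof (cases "c = 0")
  case True
  have "b = 0"
  proof (rule ccontr)
    assume "b \<noteq> 0"
    \<comment> \<open>For \<open>c = 0\<close> the quadratic is affine; at this point its value is
      -1.\<close>
    with assms(1)[of "- (a + 1) / (2 * b)"] True show False by (simp add: field_simps)
  qed
  with True show ?thesis by simp
next
  case False
  then have "c > 0" using assms by simp
  have "0 \<le> a + 2 * (- b / c) * b + (- b / c)\<^sup>2 * c" by (rule assms)
  also have "\<dots> = a - b\<^sup>2 / c" using \<open>c > 0\<close> by (simp add: power2_eq_square field_simps)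
  finally show ?thesis using \<open>c > 0\<close> by (simp add: field_simps)
qed

lemma ip_sq_le:
  assumes "u \<in> sqint M" "v \<in> sqint M"
  shows "(ip M u v)\<^sup>2 \<le> ip M u u * ip M v v"
proof (rule discriminant_le)
  fix t
  have "0 \<le> ip M (\<lambda>x. 1 * u x + t * v x) (\<lambda>x. 1 * u x + t * v x)" by (rule ip_self_nonneg)
  then show "0 \<le> ip M u u + 2 * t * ip M u v + t\<^sup>2 * ip M v v"
    by (simp only: ip_lin_self[OF assms]) simp
qed (rule ip_self_nonneg)+

lemma nrm_nonneg [simp]: "0 \<le> nrm M u" by (simp add: nrm_def ip_self_nonneg)

lemma nrm_sq: "(nrm M u)\<^sup>2 = ip M u u" by (simp add: nrm_def ip_self_nonneg)

lemma ip_le_nrm: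
  assumes "u \<in> sqint M" "v \<in> sqint M"
  shows "\<bar>ip M u v\<bar> \<le> nrm M u * nrm M v"
proof (rule power2_le_imp_le)
  show "\<bar>ip M u v\<bar>\<^sup>2 \<le> (nrm M u * nrm M v)\<^sup>2"
    using ip_sq_le[OF assms] by (simp add: power_mult_distrib nrm_sq)
qed simp

lemma nrm_cmult: "nrm M (\<lambda>x. a * u x) = \<bar>a\<bar> * nrm M u"
proof -
  have "ip M (\<lambda>x. a * u x) (\<lambda>x. a * u x) = a\<^sup>2 * ip M u u"
    unfolding ip_cmult by (subst ip_comm, subst ip_cmult) (simp add: power2_eq_square)
  then show ?thesis by (simp add: nrm_def real_sqrt_mult)
qed

lemma nrm_triangle:
  assumes "u \<in> sqint M" "v \<in> sqint M"
  shows "nrm M (\<lambda>x. u x + v x) \<le> nrm M u + nrm M v"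
proof (rule power2_le_imp_le)
  have "(nrm M (\<lambda>x. u x + v x))\<^sup>2 = (nrm M u)\<^sup>2 + 2 * ip M u v + (nrm M v)\<^sup>2"
    using ip_lin_self[OF assms, of 1 1] by (simp add: nrm_sq)
  also have "\<dots> \<le> (nrm M u)\<^sup>2 + 2 * (nrm M u * nrm M v) + (nrm M v)\<^sup>2"
    using ip_le_nrm[OF assms] by auto
  finally show "(nrm M (\<lambda>x. u x + v x))\<^sup>2 \<le> (nrm M u + nrm M v)\<^sup>2" by (simp add: power2_sum)
qed simp

lemma nrm_minus_comm: "nrm M (\<lambda>x. u x - v x) = nrm M (\<lambda>x. v x - u x)"
  using nrm_cmult[of M "-1" "\<lambda>x. u x - v x"] by simp

lemma nrm_triangle_diff:
  assumes "u \<in> sqint M" "v \<in> sqint M" "w \<in> sqint M"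
  shows "nrm M (\<lambda>x. u x - w x) \<le> nrm M (\<lambda>x. u x - v x) + nrm M (\<lambda>x. v x - w x)"
  using nrm_triangle[OF sqint_diff[OF assms(1,2)] sqint_diff[OF assms(2,3)]] by simp

context finite_measure
begin

lemma sqint_const: "(\<lambda>_. c) \<in> sqint M"
  by (simp add: sqint_def)

lemma sqint_boundedI: "u \<in> borel_measurable M \<Longrightarrow> (\<And>x. \<bar>u x\<bar> \<le> B) \<Longrightarrow> u \<in> sqint M"
  by (rule sqint_bound[OF sqint_const[of B]]) (auto intro!: AE_I2 intro: order_trans[OF _ abs_ge_self])

lemma sqint_integrable: "u \<in> sqint M \<Longrightarrow> integrable M u"
  using sqint_mult_integrable[of u M "\<lambda>_. 1"] sqint_const by simp

lemma sqint_abs: "u \<in> sqint M \<Longrightarrow> (\<lambda>x. \<bar>u x\<bar>) \<in> sqint M"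
  by (rule sqint_bound) auto

lemma integral_abs_le_nrm:
  assumes "u \<in> sqint M"
  shows "(\<integral>x. \<bar>u x\<bar> \<partial>M) \<le> sqrt (measure M (space M)) * nrm M u"
proof -
  have "(\<integral>x. \<bar>u x\<bar> \<partial>M) = ip M (\<lambda>_. 1) (\<lambda>x. \<bar>u x\<bar>)" by (simp add: ip_def)
  also have "\<dots> \<le> nrm M (\<lambda>_. 1) * nrm M (\<lambda>x. \<bar>u x\<bar>)"
    using ip_le_nrm[OF sqint_const sqint_abs[OF assms], of 1] by linarith
  also have "nrm M (\<lambda>_. 1) = sqrt (measure M (space M))" by (simp add: nrm_def ip_def)
  also have "nrm M (\<lambda>x. \<bar>u x\<bar>) = nrm M u" by (simp add: nrm_def ip_def)
  finally show ?thesis .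
qed

text \<open>On a finite measure space L2 Cauchy implies L1 Cauchy, which provides a subsequence
  converging almost everywhere. Fatou's lemma then bounds the L2 distance of the whole sequence to
  the pointwise limit.\<close>

lemma sqint_complete:
  fixes v :: "nat \<Rightarrow> 'a \<Rightarrow> real"
  assumes v: "\<And>n. v n \<in> sqint M"
    and cauchy: "\<And>e. e > 0 \<Longrightarrow> \<exists>N. \<forall>m\<ge>N. \<forall>n\<ge>N. nrm M (\<lambda>x. v m x - v n x) < e"
  obtains w where "w \<in> sqint M" "(\<lambda>n. nrm M (\<lambda>x. v n x - w x)) \<longlonglongrightarrow> 0"
proof -
  have "\<exists>N. \<forall>i\<ge>N. \<forall>j\<ge>N. (\<integral>x. norm (v i x - v j x) \<partial>M) < e" if "e > 0" for e
  proof -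
    define c where "c = sqrt (measure M (space M)) + 1"
    have c: "c > 0" by (simp add: c_def add_nonneg_pos)
    obtain N where N: "\<forall>m\<ge>N. \<forall>n\<ge>N. nrm M (\<lambda>x. v m x - v n x) < e / c"
      using cauchy[of "e / c"] \<open>e > 0\<close> c by auto
    have "(\<integral>x. norm (v i x - v j x) \<partial>M) < e" if "i \<ge> N" "j \<ge> N" for i j
    proof -
      have "(\<integral>x. norm (v i x - v j x) \<partial>M) \<le> sqrt (measure M (space M)) * nrm M (\<lambda>x. v i x - v j x)"
        using integral_abs_le_nrm[OF sqint_diff[OF v[of i] v[of j]]] by simp
      also have "\<dots> \<le> c * nrm M (\<lambda>x. v i x - v j x)" by (intro mult_right_mono) (auto simp: c_def)
      also have "\<dots> < c * (e / c)" using N that c by (intro mult_strict_left_mono) auto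
      finally show ?thesis using c by simp
    qed
    then show ?thesis by blast
  qed
  with cauchy_L1_AE_cauchy_subseq[of M v] sqint_integrable[OF v]
  obtain r where r: "strict_mono r" and ae: "AE x in M. Cauchy (\<lambda>i. v (r i) x)" by metis
  define w where "w x = lim (\<lambda>i. v (r i) x)" for x
  have [measurable]: "v n \<in> borel_measurable M" for n using v[of n] by measurable
  have [measurable]: "w \<in> borel_measurable M" unfolding w_def by measurable
  have lim: "AE x in M. (\<lambda>i. v (r i) x) \<longlonglongrightarrow> w x"
    using ae by eventually_elim (simp add: w_def Cauchy_convergent_iff convergent_LIMSEQ_iff)
  have fatou: "(\<lambda>x. v n x - w x) \<in> sqint M \<and> nrm M (\<lambda>x. v n x - w x) \<le> e"
    if e: "e > 0" "\<forall>m\<ge>N. nrm M (\<lambda>x. v n x - v m x) < e" for n N e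
  proof -
    have "(\<integral>\<^sup>+x. ennreal ((v n x - w x)\<^sup>2) \<partial>M) = (\<integral>\<^sup>+x. liminf (\<lambda>i. ennreal ((v n x - v (r i) x)\<^sup>2)) \<partial>M)"
    proof (rule nn_integral_cong_AE, use lim in eventually_elim)
      case (elim x)
      then have "(\<lambda>i. ennreal ((v n x - v (r i) x)\<^sup>2)) \<longlonglongrightarrow> ennreal ((v n x - w x)\<^sup>2)"
        by (intro tendsto_ennrealI tendsto_intros)
      then show ?case by (rule lim_imp_Liminf[OF trivial_limit_sequentially, symmetric])
    qed
    also have "\<dots> \<le> liminf (\<lambda>i. \<integral>\<^sup>+x. ennreal ((v n x - v (r i) x)\<^sup>2) \<partial>M)"
      by (rule nn_integral_liminf) measurable
    also have "\<dots> \<le> ennreal (e\<^sup>2)"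
    proof (rule Liminf_le)
      have "(\<integral>\<^sup>+x. ennreal ((v n x - v (r i) x)\<^sup>2) \<partial>M) \<le> ennreal (e\<^sup>2)" if "i \<ge> N" for i
      proof -
        have "r i \<ge> N" using seq_suble[OF r, of i] that by simp
        have "integrable M (\<lambda>x. (v n x - v (r i) x)\<^sup>2)"
          using sqint_diff[OF v[of n] v[of "r i"]] by (simp add: sqint_def)
        then have "(\<integral>\<^sup>+x. ennreal ((v n x - v (r i) x)\<^sup>2) \<partial>M) = ennreal ((nrm M (\<lambda>x. v n x - v (r i) x))\<^sup>2)"
          unfolding nrm_sq by (subst nn_integral_eq_integral) (auto simp: ip_def power2_eq_square)
        also have "\<dots> \<le> ennreal (e\<^sup>2)"
          using e(2) \<open>r i \<ge> N\<close> by (intro ennreal_leI power_mono) (auto intro: less_imp_le)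
        finally show ?thesis .
      qed
      then show "\<forall>\<^sub>F i in sequentially. (\<integral>\<^sup>+x. ennreal ((v n x - v (r i) x)\<^sup>2) \<partial>M) \<le> ennreal (e\<^sup>2)"
        unfolding eventually_sequentially by blast
    qed auto
    finally have le: "(\<integral>\<^sup>+x. ennreal ((v n x - w x)\<^sup>2) \<partial>M) \<le> ennreal (e\<^sup>2)" .
    have int: "integrable M (\<lambda>x. (v n x - w x)\<^sup>2)"
      by (rule integrableI_nonneg) (use le in \<open>auto simp: order_le_less_trans\<close>)
    have "ennreal (\<integral>x. (v n x - w x)\<^sup>2 \<partial>M) \<le> ennreal (e\<^sup>2)"
      using le int by (subst (asm) nn_integral_eq_integral) auto
    then have "(nrm M (\<lambda>x. v n x - w x))\<^sup>2 \<le> e\<^sup>2"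
      by (simp add: nrm_sq ip_def power2_eq_square[symmetric])
    then have "nrm M (\<lambda>x. v n x - w x) \<le> e" using e(1) by (simp add: power2_le_iff_abs_le)
    with int show ?thesis by (simp add: sqint_def)
  qed
  have ev: "\<exists>N. \<forall>n\<ge>N. (\<lambda>x. v n x - w x) \<in> sqint M \<and> nrm M (\<lambda>x. v n x - w x) \<le> e" if "e > 0" for e
    using cauchy[OF that] fatou[OF that] by meson
  show ?thesis
  proof (rule that)
    obtain N where "(\<lambda>x. v N x - w x) \<in> sqint M" using ev[of 1] by auto
    from sqint_diff[OF v[of N] this] show "w \<in> sqint M" by simp
    show "(\<lambda>n. nrm M (\<lambda>x. v n x - w x)) \<longlonglongrightarrow> 0"
    proof (rule LIMSEQ_I)
      fix e :: real assume "e > 0"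
      then obtain N where "\<forall>n\<ge>N. nrm M (\<lambda>x. v n x - w x) \<le> e / 2" using ev[of "e / 2"] by auto
      then show "\<exists>N. \<forall>n\<ge>N. norm (nrm M (\<lambda>x. v n x - w x) - 0) < e"
        using \<open>e > 0\<close> by (intro exI[of _ N]) fastforce
    qed
  qed
qed

text \<open>A minimising sequence of \<open>\<parallel>v\<parallel>\<^sup>2 - 2 D v\<close> is Cauchy by the parallelogram law, and its limit represents \<open>D\<close>.\<close>

lemma riesz_representation:
  assumes lin: "\<And>u v a b. u \<in> sqint M \<Longrightarrow> v \<in> sqint M \<Longrightarrow> D (\<lambda>x. a * u x + b * v x) = a * D u + b * D v"
    and bd: "\<And>v. v \<in> sqint M \<Longrightarrow> \<bar>D v\<bar> \<le> C * nrm M v"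
  obtains g where "g \<in> sqint M" "\<And>v. v \<in> sqint M \<Longrightarrow> D v = ip M g v"
proof -
  define J where "J v = ip M v v - 2 * D v" for v
  have Jlow: "- C\<^sup>2 \<le> J v" if "v \<in> sqint M" for v
  proof -
    have "0 \<le> (nrm M v - C)\<^sup>2" by simp
    moreover have "D v \<le> nrm M v * C" using bd[OF that] by (simp add: mult.commute)
    ultimately show ?thesis unfolding J_def nrm_sq[symmetric] power2_diff by linarith
  qed
  define I where "I = Inf (J ` sqint M)"
  have bdd: "bdd_below (J ` sqint M)" using Jlow by (meson bdd_belowI2)
  have I: "I \<le> J v" if "v \<in> sqint M" for v
    unfolding I_def using bdd that by (intro cInf_lower) auto
  define \<delta> where "\<delta> n = inverse (real (Suc n))" for n
  have d0: "\<delta> n > 0" for n by (simp add: \<delta>_def)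
  have dlim: "\<delta> \<longlonglongrightarrow> 0" unfolding \<delta>_def by (rule LIMSEQ_inverse_real_of_nat)
  have "\<exists>v\<in>sqint M. J v < I + \<delta> n" for n
  proof -
    have "I < I + \<delta> n" using d0 by simp
    moreover have "J ` sqint M \<noteq> {}" using sqint_zero[of M] by blast
    ultimately show ?thesis using cInf_less_iff[OF _ bdd] unfolding I_def by blast
  qed
  then obtain v where v: "\<And>n. v n \<in> sqint M" "\<And>n. J (v n) < I + \<delta> n" by metis
  have par: "(nrm M (\<lambda>x. v m x - v n x))\<^sup>2 \<le> 2 * (\<delta> m + \<delta> n)" for m n
  proof -
    have m: "(\<lambda>x. 1/2 * v m x + 1/2 * v n x) \<in> sqint M" by (rule sqint_lin[OF v(1) v(1)])
    have "I \<le> J (\<lambda>x. 1/2 * v m x + 1/2 * v n x)" by (rule I[OF m])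
    also have "\<dots> = 1/4 * ip M (v m) (v m) + 1/2 * ip M (v m) (v n) + 1/4 * ip M (v n) (v n) - D (v m) - D (v n)"
      unfolding J_def ip_lin_self[OF v(1) v(1)] lin[OF v(1) v(1)] by (simp add: power2_eq_square)
    finally have "4 * I \<le> ip M (v m) (v m) + 2 * ip M (v m) (v n) + ip M (v n) (v n) - 4 * D (v m) - 4 * D (v n)"
      by simp
    moreover have "(nrm M (\<lambda>x. v m x - v n x))\<^sup>2 = ip M (v m) (v m) - 2 * ip M (v m) (v n) + ip M (v n) (v n)"
      using ip_lin_self[OF v(1)[of m] v(1)[of n], of 1 "-1"] by (simp add: nrm_sq)
    ultimately show ?thesis
      using v(2)[of m, unfolded J_def] v(2)[of n, unfolded J_def] by argo
  qed
  have cauchy: "\<exists>N. \<forall>m\<ge>N. \<forall>n\<ge>N. nrm M (\<lambda>x. v m x - v n x) < e" if "e > 0" for e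
  proof -
    have "\<forall>\<^sub>F n in sequentially. \<delta> n < e\<^sup>2 / 4" using dlim that by (intro order_tendstoD) auto
    then obtain N where N: "\<forall>n\<ge>N. \<delta> n < e\<^sup>2 / 4" unfolding eventually_sequentially by blast
    have "nrm M (\<lambda>x. v m x - v n x) < e" if "m \<ge> N" "n \<ge> N" for m n
    proof (rule power2_less_imp_less)
      have "\<delta> m < e\<^sup>2 / 4" "\<delta> n < e\<^sup>2 / 4" using N that by auto
      then show "(nrm M (\<lambda>x. v m x - v n x))\<^sup>2 < e\<^sup>2" using par[of m n] by argo
    qed (use \<open>e > 0\<close> in simp)
    then show ?thesis by blast
  qed
  obtain g where g: "g \<in> sqint M" and lim: "(\<lambda>n. nrm M (\<lambda>x. v n x - g x)) \<longlonglongrightarrow> 0"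
    using sqint_complete[OF v(1) cauchy] by blast
  have "D h = ip M g h" if h: "h \<in> sqint M" for h
  proof -
    \<comment> \<open>\<open>v n\<close> minimises \<open>J\<close> up to \<open>\<delta> n\<close>.
      Comparison with \<open>v n + t * h\<close> for every \<open>t\<close> bounds half the
      directional derivative through the discriminant.\<close>
    have "(ip M (v n) h - D h)\<^sup>2 \<le> \<delta> n * ip M h h" for n
    proof (rule discriminant_le)
      fix t
      have "J (v n) - \<delta> n \<le> J (\<lambda>x. 1 * v n x + t * h x)" 
        using v(2)[of n] I[OF sqint_lin[OF v(1)[of n] h], of 1 t] by linarith
      then show "0 \<le> \<delta> n + 2 * t * (ip M (v n) h - D h) + t\<^sup>2 * ip M h h"
        unfolding J_def ip_lin_self[OF v(1)[of n] h] lin[OF v(1)[of n] h] by (simp add: algebra_simps)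
    qed (use d0[of n] ip_self_nonneg in \<open>auto intro: less_imp_le\<close>)
    then have "\<forall>\<^sub>F n in sequentially. norm ((ip M (v n) h - D h)\<^sup>2) \<le> \<delta> n * ip M h h" by simp
    moreover have "(\<lambda>n. \<delta> n * ip M h h) \<longlonglongrightarrow> 0" using tendsto_mult_right[OF dlim] by simp
    ultimately have "(\<lambda>n. (ip M (v n) h - D h)\<^sup>2) \<longlonglongrightarrow> 0" by (rule Lim_null_comparison)
    from tendsto_real_sqrt[OF this] have "(\<lambda>n. ip M (v n) h - D h) \<longlonglongrightarrow> 0"
      by (simp add: tendsto_rabs_zero_iff)
    then have 1: "(\<lambda>n. ip M (v n) h) \<longlonglongrightarrow> D h" by (simp add: LIM_zero_iff)
    have "(\<lambda>n. ip M (v n) h - ip M g h) \<longlonglongrightarrow> 0"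
    proof (rule Lim_null_comparison)
      show "\<forall>\<^sub>F n in sequentially. norm (ip M (v n) h - ip M g h) \<le> nrm M (\<lambda>x. v n x - g x) * nrm M h"
        using ip_le_nrm[OF sqint_diff[OF v(1) g] h] ip_diff[OF v(1) g h] by simp
      show "(\<lambda>n. nrm M (\<lambda>x. v n x - g x) * nrm M h) \<longlonglongrightarrow> 0" using tendsto_mult_right[OF lim] by simp
    qed
    then have "(\<lambda>n. ip M (v n) h) \<longlonglongrightarrow> ip M g h" by (simp add: LIM_zero_iff)
    with 1 show ?thesis using LIMSEQ_unique by blast
  qed
  with g that show ?thesis by blast
qed

end

subsection \<open>Hahn-Banach\<close>

text \<open>Functionals are represented by their graphs, so that Zorn's lemma applies to the inclusion order.\<close>

lemma hahn_banach:
  fixes V :: "('x \<Rightarrow> 'y::real_vector) set" and p :: "('x \<Rightarrow> 'y) \<Rightarrow> real"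
    and G :: "(('x \<Rightarrow> 'y) \<times> real) set"
  assumes V: "\<And>v w a b. v \<in> V \<Longrightarrow> w \<in> V \<Longrightarrow> (\<lambda>x. a *\<^sub>R v x + b *\<^sub>R w x) \<in> V" "(\<lambda>_. 0) \<in> V"
    and p_add: "\<And>v w. v \<in> V \<Longrightarrow> w \<in> V \<Longrightarrow> p (\<lambda>x. v x + w x) \<le> p v + p w"
    and p_scale: "\<And>v a. v \<in> V \<Longrightarrow> a \<ge> 0 \<Longrightarrow> p (\<lambda>x. a *\<^sub>R v x) = a * p v"
    and G: "\<And>v s. (v, s) \<in> G \<Longrightarrow> v \<in> V \<and> s \<le> p v"
      "\<And>v s w t a b. (v, s) \<in> G \<Longrightarrow> (w, t) \<in> G \<Longrightarrow> (\<lambda>x. a *\<^sub>R v x + b *\<^sub>R w x, a * s + b * t) \<in> G"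
      "G \<noteq> {}"
  obtains \<xi> where "\<And>v w a b. v \<in> V \<Longrightarrow> w \<in> V \<Longrightarrow> \<xi> (\<lambda>x. a *\<^sub>R v x + b *\<^sub>R w x) = a * \<xi> v + b * \<xi> w"
    "\<And>v. v \<in> V \<Longrightarrow> \<xi> v \<le> p v" "\<And>v s. (v, s) \<in> G \<Longrightarrow> \<xi> v = s"
proof -
  define good where "good H \<longleftrightarrow> (\<forall>v s. (v, s) \<in> H \<longrightarrow> v \<in> V \<and> s \<le> p v) \<and>
    (\<forall>v s w t a b. (v, s) \<in> H \<longrightarrow> (w, t) \<in> H \<longrightarrow> (\<lambda>x. a *\<^sub>R v x + b *\<^sub>R w x, a * s + b * t) \<in> H) \<and> G \<subseteq> H" for H
  have "\<exists>H\<in>Collect good. \<forall>X\<in>Collect good. H \<subseteq> X \<longrightarrow> X = H"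
  proof (rule subset_Zorn_nonempty)
    have "good G"
      unfolding good_def
      by (intro conjI allI impI)
         (erule G(1)[THEN conjunct1] | erule G(1)[THEN conjunct2] | erule (1) G(2) | rule subset_refl)+
    then show "Collect good \<noteq> {}" by blast
    fix C assume ne: "C \<noteq> {}" and ch: "subset.chain (Collect good) C"
    have g: "good H" if "H \<in> C" for H using ch that unfolding subset_chain_def by auto
    have "(\<lambda>x. a *\<^sub>R v x + b *\<^sub>R w x, a * s + b * t) \<in> \<Union>C" if vw: "(v, s) \<in> \<Union>C" "(w, t) \<in> \<Union>C" for v s w t a b
    proof -
      obtain X Y where XY: "X \<in> C" "Y \<in> C" "(v, s) \<in> X" "(w, t) \<in> Y" using vw by blast
      then have "X \<subseteq> Y \<or> Y \<subseteq> X" using ch unfolding subset_chain_def by blast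
      then obtain Z where Z: "Z \<in> C" "(v, s) \<in> Z" "(w, t) \<in> Z" using XY by blast
      from g[OF Z(1)] Z(2,3) have "(\<lambda>x. a *\<^sub>R v x + b *\<^sub>R w x, a * s + b * t) \<in> Z" unfolding good_def by simp
      with Z(1) show ?thesis by blast
    qed
    moreover have "v \<in> V \<and> s \<le> p v" if "(v, s) \<in> \<Union>C" for v s
      using that g unfolding good_def by auto
    moreover have "G \<subseteq> \<Union>C" using ne g unfolding good_def by fast
    ultimately show "\<Union>C \<in> Collect good" unfolding good_def by simp
  qed
  then obtain H where H: "good H" and max: "\<And>X. good X \<Longrightarrow> H \<subseteq> X \<Longrightarrow> X = H" by auto
  have HV: "v \<in> V" "s \<le> p v" if "(v, s) \<in> H" for v s using H that unfolding good_def by auto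
  have Hlin: "(\<lambda>x. a *\<^sub>R v x + b *\<^sub>R w x, a * s + b * t) \<in> H" if "(v, s) \<in> H" "(w, t) \<in> H" for v s w t a b
    using H that unfolding good_def by simp
  have GH: "G \<subseteq> H" using H unfolding good_def by simp
  have p0: "p (\<lambda>_. 0) = 0" using p_scale[OF V(2), of 0] by simp
  \<comment> \<open>The difference of the two pairs lies over the zero function, where
    \<open>p\<close> is 0; domination by \<open>p\<close> thus makes the graph single
    valued.\<close>
  have uniq: "s = t" if "(v, s) \<in> H" "(v, t) \<in> H" for v s t
  proof -
    have "s - t \<le> 0" "t - s \<le> 0"
      using HV(2)[OF Hlin[OF that, of 1 "-1"]] HV(2)[OF Hlin[OF that(2,1), of 1 "-1"]] p0 by auto
    then show ?thesis by simp
  qed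
  have H0: "(\<lambda>_. 0, 0) \<in> H"
  proof -
    obtain v s where "(v, s) \<in> G" using G(3) by auto
    then have vs: "(v, s) \<in> H" using GH by blast
    from Hlin[OF vs vs, of 0 0] show ?thesis by simp
  qed
  have dom: "\<exists>s. (w, s) \<in> H" if w: "w \<in> V" for w
  proof (rule ccontr)
    assume nw: "\<nexists>s. (w, s) \<in> H"
    \<comment> \<open>Since \<open>v + v' = (v - w) + (v' + w)\<close>, subadditivity puts every
      lower bound for a value at \<open>w\<close> below every upper bound, so an admissible value
      exists.\<close>
    have key: "s - p (\<lambda>x. v x - w x) \<le> p (\<lambda>x. v' x + w x) - s'" if "(v, s) \<in> H" "(v', s') \<in> H" for v s v' s'
    proof -
      have vV: "v \<in> V" "v' \<in> V" using that HV by auto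
      have a: "(\<lambda>x. v x - w x) \<in> V" "(\<lambda>x. v' x + w x) \<in> V"
        using V(1)[OF vV(1) w, of 1 "-1"] V(1)[OF vV(2) w, of 1 1] by auto
      have "s + s' \<le> p (\<lambda>x. v x + v' x)" using HV(2)[OF Hlin[OF that, of 1 1]] by simp
      also have "(\<lambda>x. v x + v' x) = (\<lambda>x. (v x - w x) + (v' x + w x))" by simp
      also have "p \<dots> \<le> p (\<lambda>x. v x - w x) + p (\<lambda>x. v' x + w x)" by (rule p_add[OF a])
      finally show ?thesis by simp
    qed
    define A where "A = {s - p (\<lambda>x. v x - w x) | v s. (v, s) \<in> H}"
    define c where "c = Sup A"
    have Ane: "A \<noteq> {}" using H0 by (auto simp: A_def)
    have c1: "s - p (\<lambda>x. v x - w x) \<le> c" if "(v, s) \<in> H" for v s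
      unfolding c_def
    proof (rule cSup_upper)
      show "s - p (\<lambda>x. v x - w x) \<in> A" using that by (auto simp: A_def)
      show "bdd_above A" using key[OF _ H0] by (auto simp: A_def intro!: bdd_aboveI)
    qed
    have c2: "c \<le> p (\<lambda>x. v x + w x) - s" if "(v, s) \<in> H" for v s
      unfolding c_def using Ane key[OF _ that] by (intro cSup_least) (auto simp: A_def)
    \<comment> \<open>The graph with \<open>w\<close> adjoined at the value \<open>c\<close>. The
      lower and the upper bound on \<open>c\<close>, rescaled by \<open>\<bar>t\<bar>\<close>, give
      domination for either sign of \<open>t\<close>.\<close>
    define X where "X = {(\<lambda>x. v x + t *\<^sub>R w x, s + t * c) | v s t. (v, s) \<in> H}"
    have "good X"
      unfolding good_def
    proof (intro conjI allI impI)
      fix v' s' assume "(v', s') \<in> X"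
      then obtain v s t where e: "v' = (\<lambda>x. v x + t *\<^sub>R w x)" "s' = s + t * c" and vs: "(v, s) \<in> H"
        unfolding X_def by blast
      have vV: "v \<in> V" using HV(1)[OF vs] .
      show "v' \<in> V" unfolding e using V(1)[OF vV w, of 1 t] by simp
      have sc: "(\<lambda>x. r *\<^sub>R v x, r * s) \<in> H" for r using Hlin[OF vs vs, of r 0] by simp
      consider "t = 0" | "t > 0" | "t < 0" by linarith
      then show "s' \<le> p v'"
      proof cases
        case 1 then show ?thesis using HV(2)[OF vs] by (simp add: e)
      next
        case 2
        have V2: "(\<lambda>x. (1/t) *\<^sub>R v x + w x) \<in> V" using V(1)[OF vV w, of "1/t" 1] by simp
        have "c \<le> p (\<lambda>x. (1/t) *\<^sub>R v x + w x) - 1/t * s" by (rule c2[OF sc])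
        then have "t * c \<le> t * (p (\<lambda>x. (1/t) *\<^sub>R v x + w x) - 1/t * s)" using 2 by (intro mult_left_mono) auto
        also have "\<dots> = t * p (\<lambda>x. (1/t) *\<^sub>R v x + w x) - s" using 2 by (simp add: right_diff_distrib)
        also have "t * p (\<lambda>x. (1/t) *\<^sub>R v x + w x) = p v'"
          using p_scale[OF V2, of t] 2 by (simp add: e scaleR_add_right)
        finally show ?thesis by (simp add: e)
      next
        case 3
        define r where "r = - t"
        have r: "r > 0" "t = - r" using 3 by (auto simp: r_def)
        have V2: "(\<lambda>x. (1/r) *\<^sub>R v x - w x) \<in> V" using V(1)[OF vV w, of "1/r" "-1"] by simp
        have "1/r * s - p (\<lambda>x. (1/r) *\<^sub>R v x - w x) \<le> c" by (rule c1[OF sc])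
        then have "r * (1/r * s - p (\<lambda>x. (1/r) *\<^sub>R v x - w x)) \<le> r * c" using r by (intro mult_left_mono) auto
        moreover have "r * (1/r * s - p (\<lambda>x. (1/r) *\<^sub>R v x - w x)) = s - r * p (\<lambda>x. (1/r) *\<^sub>R v x - w x)"
          using r by (simp add: right_diff_distrib)
        moreover have "r * p (\<lambda>x. (1/r) *\<^sub>R v x - w x) = p v'"
          using p_scale[OF V2, of r] r by (simp add: e scaleR_diff_right)
        ultimately show ?thesis by (simp add: e r(2))
      qed
    next
      fix v1 s1 v2 s2 a b assume "(v1, s1) \<in> X" "(v2, s2) \<in> X"
      then obtain v s t v' s' t' where e: "v1 = (\<lambda>x. v x + t *\<^sub>R w x)" "s1 = s + t * c" "(v, s) \<in> H"
        "v2 = (\<lambda>x. v' x + t' *\<^sub>R w x)" "s2 = s' + t' * c" "(v', s') \<in> H"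
        unfolding X_def by blast
      have eq: "(\<lambda>x. a *\<^sub>R v1 x + b *\<^sub>R v2 x, a * s1 + b * s2) =
        (\<lambda>x. (a *\<^sub>R v x + b *\<^sub>R v' x) + (a * t + b * t') *\<^sub>R w x, (a * s + b * s') + (a * t + b * t') * c)"
        by (auto simp: e algebra_simps)
      show "(\<lambda>x. a *\<^sub>R v1 x + b *\<^sub>R v2 x, a * s1 + b * s2) \<in> X"
        unfolding X_def mem_Collect_eq
        by (rule exI[of _ "\<lambda>x. a *\<^sub>R v x + b *\<^sub>R v' x"], rule exI[of _ "a * s + b * s'"],
            rule exI[of _ "a * t + b * t'"], rule conjI[OF eq Hlin[OF e(3,6)]])
    next
      have "H \<subseteq> X"
      proof clarify
        fix v s assume "(v, s) \<in> H"
        moreover have "(v, s) = (\<lambda>x. v x + 0 *\<^sub>R w x, s + 0 * c)" by simp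
        ultimately show "(v, s) \<in> X" unfolding X_def by blast
      qed
      then show "G \<subseteq> X" using GH by blast
    qed
    moreover have "H \<subseteq> X"
    proof clarify
      fix v s assume "(v, s) \<in> H"
      moreover have "(v, s) = (\<lambda>x. v x + 0 *\<^sub>R w x, s + 0 * c)" by simp
      ultimately show "(v, s) \<in> X" unfolding X_def by blast
    qed
    ultimately have "X = H" by (rule max)
    moreover have "(w, c) \<in> X"
    proof -
      have "(w, c) = (\<lambda>x. (\<lambda>_. 0) x + 1 *\<^sub>R w x, 0 + 1 * c)" by simp
      then show ?thesis unfolding X_def mem_Collect_eq
        by (intro exI[of _ "\<lambda>_. 0"] exI[of _ 0] exI[of _ 1] conjI H0)
    qed
    ultimately show False using nw by blast
  qed
  define \<xi> where "\<xi> v = (THE s. (v, s) \<in> H)" for v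
  have \<xi>: "\<xi> v = s" if "(v, s) \<in> H" for v s
    unfolding \<xi>_def using that uniq by (intro the_equality) blast+
  show ?thesis
  proof (rule that[of \<xi>])
    fix v w a b assume "v \<in> V" "w \<in> V"
    then obtain s t where "(v, s) \<in> H" "(w, t) \<in> H" using dom by blast
    with \<xi> Hlin[OF this, of a b] show "\<xi> (\<lambda>x. a *\<^sub>R v x + b *\<^sub>R w x) = a * \<xi> v + b * \<xi> w" by simp
  next
    fix v assume "v \<in> V"
    then obtain s where "(v, s) \<in> H" using dom by blast
    with \<xi> HV(2) show "\<xi> v \<le> p v" by simp
  next
    fix v s assume "(v, s) \<in> G"
    then show "\<xi> v = s" using GH \<xi> by blast
  qed
qed

subsection \<open>Borel representatives\<close>

text \<open>Bridge between the completed Lebesgue measure of the statement and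
  \<open>lborel\<close>, on which convolutions are formed. Completion does not change integrals of
  Borel functions.\<close>

lemma lebesgue_on_borel_integral:
  fixes V :: "'a::euclidean_space \<Rightarrow> real"
  assumes S: "S \<in> sets borel" and V: "V \<in> borel_measurable borel" and off: "\<And>x. x \<notin> S \<Longrightarrow> V x = 0"
  shows "(\<integral>x. V x \<partial>lebesgue_on S) = (\<integral>x. V x \<partial>lborel)"
    and "integrable (lebesgue_on S) V \<longleftrightarrow> integrable lborel V"
proof -
  have S': "S \<inter> space lebesgue \<in> sets lebesgue" using S by simp
  have V': "V \<in> lborel \<rightarrow>\<^sub>M borel" using V by simp
  have eq: "(\<lambda>x. indicator S x *\<^sub>R V x) = V"
    using off by (auto simp: fun_eq_iff indicator_def)
  show "(\<integral>x. V x \<partial>lebesgue_on S) = (\<integral>x. V x \<partial>lborel)"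
    unfolding integral_restrict_space[OF S'] eq by (rule integral_completion[OF V'])
  show "integrable (lebesgue_on S) V \<longleftrightarrow> integrable lborel V"
    unfolding integrable_restrict_space[OF S'] eq by (rule integrable_completion[OF V'])
qed

lemma borel_representative:
  fixes u :: "'a::euclidean_space \<Rightarrow> real"
  assumes S: "S \<in> sets borel" and u: "u \<in> borel_measurable (lebesgue_on S)"
  obtains U where "U \<in> borel_measurable borel" "\<And>x. x \<notin> S \<Longrightarrow> U x = 0" "AE x in lebesgue_on S. U x = u x"
proof -
  have S': "S \<in> sets lebesgue" using S by simp
  have "(\<lambda>x. if x \<in> S then u x else 0) \<in> borel_measurable lebesgue"
    using borel_measurable_if[OF S'] u by blast
  then obtain g where g: "g \<in> borel_measurable lborel" and ae: "AE x in lborel. (if x \<in> S then u x else 0) = g x"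
    using completion_ex_borel_measurable_real by blast
  show ?thesis
  proof (rule that[of "\<lambda>x. if x \<in> S then g x else 0"])
    show "(\<lambda>x. if x \<in> S then g x else 0) \<in> borel_measurable borel" using g S by measurable
    have "AE x in lebesgue. x \<in> S \<longrightarrow> (if x \<in> S then g x else 0) = u x"
      using AE_completion[OF ae] by eventually_elim auto
    then show "AE x in lebesgue_on S. (if x \<in> S then g x else 0) = u x"
      using S' by (subst AE_restrict_space_iff) auto
  qed simp
qed

lemma borel_measurable_lebesgue_on:
  "U \<in> borel_measurable borel \<Longrightarrow> U \<in> borel_measurable (lebesgue_on S)"
  by (intro measurable_restrict_space1 measurable_completion) simp

text \<open>A Borel representative that vanishes off \<open>S\<close> can be convolved on the whole
  space. The last two conclusions let it replace \<open>u\<close> in pairings with a measurable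
  factor, over \<open>S\<close> or over the whole space.\<close>

lemma sqint_representative:
  fixes u :: "'a::euclidean_space \<Rightarrow> real"
  assumes S: "S \<in> sets borel" and u: "u \<in> sqint (lebesgue_on S)"
  obtains U where "U \<in> borel_measurable borel" "\<And>x. x \<notin> S \<Longrightarrow> U x = 0" "AE x in lebesgue_on S. U x = u x"
    "U \<in> sqint (lebesgue_on S)" "U \<in> sqint lborel"
    "\<And>w. w \<in> borel_measurable (lebesgue_on S) \<Longrightarrow> (\<integral>x. w x * u x \<partial>lebesgue_on S) = (\<integral>x. w x * U x \<partial>lebesgue_on S)"
    "\<And>w. w \<in> borel_measurable borel \<Longrightarrow> (\<integral>x. w x * u x \<partial>lebesgue_on S) = (\<integral>x. w x * U x \<partial>lborel)"
proof -
  have um[measurable]: "u \<in> borel_measurable (lebesgue_on S)" using u by measurable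
  obtain U where U: "U \<in> borel_measurable borel" "\<And>x. x \<notin> S \<Longrightarrow> U x = 0" "AE x in lebesgue_on S. U x = u x"
    using borel_representative[OF S um] by blast
  have Um[measurable]: "U \<in> borel_measurable (lebesgue_on S)" by (rule borel_measurable_lebesgue_on[OF U(1)])
  have sq: "U \<in> sqint (lebesgue_on S)" by (rule sqint_AE_cong[OF u Um U(3)])
  have "integrable lborel (\<lambda>x. (U x)\<^sup>2)"
    using sq U(1,2) by (subst lebesgue_on_borel_integral(2)[OF S, symmetric]) (auto simp: sqint_def)
  then have sql: "U \<in> sqint lborel" using U(1) by (simp add: sqint_def)
  have i1: "(\<integral>x. w x * u x \<partial>lebesgue_on S) = (\<integral>x. w x * U x \<partial>lebesgue_on S)"
    if [measurable]: "w \<in> borel_measurable (lebesgue_on S)" for w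
  proof (rule integral_cong_AE)
    show "AE x in lebesgue_on S. w x * u x = w x * U x" using U(3) by eventually_elim simp
  qed measurable
  have i2: "(\<integral>x. w x * u x \<partial>lebesgue_on S) = (\<integral>x. w x * U x \<partial>lborel)" if w: "w \<in> borel_measurable borel" for w
    unfolding i1[OF borel_measurable_lebesgue_on[OF w]]
    using w U(1,2) by (intro lebesgue_on_borel_integral(1)[OF S]) auto
  show ?thesis using that[OF U sq sql] i1 i2 by blast
qed

lemma finite_measure_lebesgue_on_bounded:
  fixes S :: "'a::euclidean_space set"
  assumes "S \<in> sets borel" "bounded S"
  shows "finite_measure (lebesgue_on S)"
proof (rule finite_measureI)
  have "emeasure lborel S < \<infinity>" by (rule emeasure_bounded_finite[OF assms(2)])
  then show "emeasure (lebesgue_on S) (space (lebesgue_on S)) \<noteq> \<infinity>"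
    using assms(1) by (simp add: emeasure_restrict_space space_restrict_space)
qed

subsection \<open>Approximation by continuous functions and by mollification\<close>

lemma integrable_cball_const: "integrable lborel (\<lambda>x::'a::euclidean_space. c * indicator (cball 0 R) x :: real)"
  by (intro integrable_mult_right integrable_real_indicator)
     (use emeasure_bounded_finite[of "cball 0 R :: 'a set"] in auto)

lemma bounded_support_sqint:
  fixes w :: "'a::euclidean_space \<Rightarrow> real"
  assumes "w \<in> borel_measurable borel" "\<And>x. x \<notin> cball 0 R \<Longrightarrow> w x = 0" "\<And>x. \<bar>w x\<bar> \<le> B"
  shows "w \<in> sqint lborel"
proof -
  have "integrable lborel (\<lambda>x. (w x)\<^sup>2)"
  proof (rule Bochner_Integration.integrable_bound[OF integrable_cball_const[of "B\<^sup>2" R]])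
    have "norm ((w x)\<^sup>2) \<le> norm (B\<^sup>2 * indicator (cball 0 R) x)" for x
      using assms(2)[of x] assms(3)[of x] abs_le_square_iff[of "w x" B]
      by (cases "x \<in> cball 0 R") (auto intro: order_trans)
    then show "AE x in lborel. norm ((w x)\<^sup>2) \<le> norm (B\<^sup>2 * indicator (cball 0 R) x)" by simp
  qed (use assms(1) in measurable)
  then show ?thesis using assms(1) by (simp add: sqint_def)
qed

lemma sqint_support_integrable:
  fixes w :: "'a::euclidean_space \<Rightarrow> real"
  assumes "w \<in> sqint lborel" "\<And>x. x \<notin> cball 0 R \<Longrightarrow> w x = 0"
  shows "integrable lborel w"
proof -
  have "indicat_real (cball 0 R) \<in> sqint (lborel :: 'a measure)"
    by (rule bounded_support_sqint[of _ R 1]) (auto simp: indicator_def intro!: borel_measurable_indicator borel_measurable_times)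
  then have "integrable lborel (\<lambda>x. w x * indicat_real (cball 0 R) x)"
    by (rule sqint_mult_integrable[OF assms(1)])
  moreover have "(\<lambda>x. w x * indicat_real (cball 0 R) x) = w"
    using assms(2) by (auto simp: fun_eq_iff indicator_def)
  ultimately show ?thesis by simp
qed

lemma nrm_dominated_convergence:
  fixes f :: "nat \<Rightarrow> 'a \<Rightarrow> real"
  assumes f: "\<And>n. f n \<in> borel_measurable M" and lim: "AE x in M. (\<lambda>n. f n x) \<longlonglongrightarrow> 0"
    and w: "w \<in> sqint M" "\<And>n. AE x in M. \<bar>f n x\<bar> \<le> \<bar>w x\<bar>"
  shows "(\<lambda>n. nrm M (f n)) \<longlonglongrightarrow> 0"
proof -
  have "(\<lambda>n. \<integral>x. (f n x)\<^sup>2 \<partial>M) \<longlonglongrightarrow> (\<integral>x. 0 \<partial>M)"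
  proof (rule integral_dominated_convergence)
    show "integrable M (\<lambda>x. (w x)\<^sup>2)" using w by (simp add: sqint_def)
    show "AE x in M. (\<lambda>n. (f n x)\<^sup>2) \<longlonglongrightarrow> 0"
      using lim by eventually_elim (use tendsto_power[of _ 0 _ 2] in fastforce)
    show "AE x in M. norm ((f n x)\<^sup>2) \<le> (w x)\<^sup>2" for n
      using w(2)[of n] by eventually_elim (simp add: abs_le_square_iff)
  qed (use f in measurable)
  then have "(\<lambda>n. ip M (f n) (f n)) \<longlonglongrightarrow> 0" by (simp add: ip_def power2_eq_square)
  from tendsto_real_sqrt[OF this] show ?thesis by (simp add: nrm_def)
qed

text \<open>Two approximations with half the error each: truncation of the values, then
  approximation almost everywhere by continuous functions, which are clipped to the same bound and
  cut off near the ball so that dominated convergence applies.\<close>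

lemma continuous_dense_sqint:
  fixes h :: "'a::euclidean_space \<Rightarrow> real"
  assumes h: "h \<in> sqint lborel" and off: "\<And>x. x \<notin> cball 0 R \<Longrightarrow> h x = 0" and e: "e > 0"
  obtains w B where "continuous_on UNIV w" "\<And>x. x \<notin> cball 0 (R + 1) \<Longrightarrow> w x = 0"
    "\<And>x. \<bar>w x\<bar> \<le> B" "nrm lborel (\<lambda>x. h x - w x) < e"
proof -
  have hm[measurable]: "h \<in> borel_measurable borel" using h by (simp add: sqint_def)
  define T where "T N x = max (- real N) (min (real N) (h x))" for N x
  have "(\<lambda>N. nrm lborel (\<lambda>x. h x - T N x)) \<longlonglongrightarrow> 0"
  proof (rule nrm_dominated_convergence[OF _ _ h])
    show "AE x in lborel. (\<lambda>N. h x - T N x) \<longlonglongrightarrow> 0"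
    proof (rule AE_I2)
      fix x
      obtain N0 :: nat where N0: "\<bar>h x\<bar> \<le> real N0" using real_arch_simple by blast
      have "h x - T N x = 0" if "N \<ge> N0" for N
        using N0 that by (simp add: T_def max_def min_def abs_le_iff)
      then show "(\<lambda>N. h x - T N x) \<longlonglongrightarrow> 0"
        by (intro tendsto_eventually) (auto simp: eventually_sequentially)
    qed
    show "AE x in lborel. \<bar>h x - T N x\<bar> \<le> \<bar>h x\<bar>" for N by (rule AE_I2) (auto simp: T_def)
  qed (auto simp: T_def)
  then have "\<forall>\<^sub>F N in sequentially. nrm lborel (\<lambda>x. h x - T N x) < e / 2"
    using e by (intro order_tendstoD) auto
  then obtain N where N: "nrm lborel (\<lambda>x. h x - T N x) < e / 2"
    unfolding eventually_sequentially by blast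
  have Tm: "T N \<in> borel_measurable borel" unfolding T_def by measurable
  have T0: "T N x = 0" if "x \<notin> cball 0 R" for x using off[OF that] by (simp add: T_def)
  have Tb: "\<bar>T N x\<bar> \<le> real N" for x by (auto simp: T_def)
  have Tsq: "T N \<in> sqint lborel" by (rule bounded_support_sqint[OF Tm T0 Tb])
  have "T N \<in> borel_measurable lebesgue" using Tm by (intro measurable_completion) simp
  then have "T N measurable_on UNIV" by (rule lebesgue_measurable_imp_measurable_on_real) simp
  then obtain Z g where Z: "negligible Z" and g: "\<And>n. continuous_on UNIV (g n)"
    "\<And>x. x \<notin> Z \<Longrightarrow> (\<lambda>n. g n x) \<longlonglongrightarrow> T N x"
    unfolding measurable_on_def by auto
  \<comment> \<open>Continuous, equal to 1 on the ball of radius \<open>R\<close> and to 0 from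
    radius \<open>R + 1\<close> on.\<close>
  define cf where "cf x = max 0 (min 1 (R + 1 - norm x))" for x :: 'a
  define w where "w n x = cf x * max (- real N) (min (real N) (g n x))" for n x
  have chi: "0 \<le> cf x" "cf x \<le> 1" for x by (auto simp: cf_def)
  have wc: "continuous_on UNIV (w n)" for n unfolding w_def cf_def
    by (intro continuous_intros g)
  have w0: "w n x = 0" if "x \<notin> cball 0 (R + 1)" for n x using that by (simp add: w_def cf_def)
  have wb: "\<bar>w n x\<bar> \<le> real N" for n x
  proof -
    have "\<bar>w n x\<bar> \<le> 1 * real N" unfolding w_def abs_mult using chi[of x] by (intro mult_mono) auto
    then show ?thesis by simp
  qed
  have wsq: "w n \<in> sqint lborel" for n
    by (rule bounded_support_sqint[OF borel_measurable_continuous_onI[OF wc] w0 wb])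
  have "(\<lambda>n. nrm lborel (\<lambda>x. T N x - w n x)) \<longlonglongrightarrow> 0"
  proof (rule nrm_dominated_convergence)
    show "(\<lambda>x. T N x - w n x) \<in> borel_measurable lborel" for n
      using Tm borel_measurable_continuous_onI[OF wc[of n]] by simp
    show "(\<lambda>x. (2 * real N) * indicat_real (cball 0 (R + 1)) x) \<in> sqint (lborel :: 'a measure)"
      by (rule bounded_support_sqint[of _ "R + 1" "2 * real N"]) (auto simp: indicator_def intro!: borel_measurable_indicator borel_measurable_times)
    show "AE x in lborel. \<bar>T N x - w n x\<bar> \<le> \<bar>(2 * real N) * indicat_real (cball 0 (R + 1)) x\<bar>" for n
    proof (rule AE_I2)
      fix x :: 'a
      show "\<bar>T N x - w n x\<bar> \<le> \<bar>(2 * real N) * indicat_real (cball 0 (R + 1)) x\<bar>"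
        using Tb[of x] wb[of n x] T0[of x] w0[of x n] by (cases "x \<in> cball 0 (R + 1)") auto
    qed
    have "Z \<in> null_sets lebesgue" using Z negligible_iff_null_sets by blast
    then have "AE x in lebesgue. x \<notin> Z" by (rule AE_not_in)
    then have "AE x in lborel. x \<notin> Z" by (simp add: AE_completion_iff)
    then show "AE x in lborel. (\<lambda>n. T N x - w n x) \<longlonglongrightarrow> 0"
    proof eventually_elim
      fix x assume "x \<notin> Z"
      have "(\<lambda>n. w n x) \<longlonglongrightarrow> cf x * max (- real N) (min (real N) (T N x))"
        unfolding w_def by (intro tendsto_intros g(2) \<open>x \<notin> Z\<close>)
      also have "max (- real N) (min (real N) (T N x)) = T N x" using Tb[of x] by auto
      also have "cf x * T N x = T N x" using T0[of x] by (cases "x \<in> cball 0 R") (auto simp: cf_def)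
      finally have "(\<lambda>n. T N x - w n x) \<longlonglongrightarrow> T N x - T N x" by (intro tendsto_intros)
      then show "(\<lambda>n. T N x - w n x) \<longlonglongrightarrow> 0" by simp
    qed
  qed
  then have "\<forall>\<^sub>F n in sequentially. nrm lborel (\<lambda>x. T N x - w n x) < e / 2"
    using e by (intro order_tendstoD) auto
  then obtain n where n: "nrm lborel (\<lambda>x. T N x - w n x) < e / 2"
    unfolding eventually_sequentially by blast
  have "nrm lborel (\<lambda>x. h x - w n x) \<le> nrm lborel (\<lambda>x. h x - T N x) + nrm lborel (\<lambda>x. T N x - w n x)"
    by (rule nrm_triangle_diff[OF h Tsq wsq])
  then have "nrm lborel (\<lambda>x. h x - w n x) < e" using N n by simp
  then show ?thesis using that[OF wc w0 wb] by blast
qed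

lemma conv_integral:
  fixes k F :: "real^'n \<Rightarrow> real"
  assumes k: "k \<in> test_funs \<Omega>" and F: "integrable lborel F"
  shows "integrable lborel (conv k F)" "(\<integral>x. conv k F x \<partial>lborel) = (\<integral>x. k x \<partial>lborel) * (\<integral>x. F x \<partial>lborel)"
proof -
  have [measurable]: "k \<in> borel_measurable borel" "F \<in> borel_measurable borel"
    using test_funsD(6)[OF k] borel_measurable_integrable[OF F] by auto
  have ki: "integrable lborel k" by (rule test_funs_integrable[OF k])
  have sh: "integrable lborel (\<lambda>x. k (x - y))" "(\<integral>x. k (x - y) \<partial>lborel) = (\<integral>x. k x \<partial>lborel)"
    "(\<integral>x. \<bar>k (x - y)\<bar> \<partial>lborel) = (\<integral>x. \<bar>k x\<bar> \<partial>lborel)" for y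
    using integral_lborel_shift[of k "- y"] integral_lborel_shift(1)[of "\<lambda>x. \<bar>k x\<bar>" "- y"] ki by auto
  have int: "integrable (lborel \<Otimes>\<^sub>M lborel) (\<lambda>(y, x). k (x - y) * F y)"
  proof (rule lborel_pair.Fubini_integrable)
    show "(\<lambda>(y, x). k (x - y) * F y) \<in> borel_measurable (lborel \<Otimes>\<^sub>M lborel)" by measurable
    have "(\<integral>x. norm (k (x - y) * F y) \<partial>lborel) = (\<integral>x. \<bar>k x\<bar> \<partial>lborel) * \<bar>F y\<bar>" for y
      by (simp add: abs_mult sh)
    then show "integrable lborel (\<lambda>y. \<integral>x. norm (case (y, x) of (y, x) \<Rightarrow> k (x - y) * F y) \<partial>lborel)"
      using F by simp
    show "AE y in lborel. integrable lborel (\<lambda>x. case (y, x) of (y, x) \<Rightarrow> k (x - y) * F y)"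
      using sh by simp
  qed
  from lborel_pair.integrable_snd[OF int] show "integrable lborel (conv k F)"
    unfolding conv_def[abs_def] .
  have "(\<integral>x. conv k F x \<partial>lborel) = (\<integral>y. (\<integral>x. k (x - y) * F y \<partial>lborel) \<partial>lborel)"
    unfolding conv_def using lborel_pair.integral_snd[OF int] lborel_pair.integral_fst[OF int] by simp
  also have "\<dots> = (\<integral>x. k x \<partial>lborel) * (\<integral>x. F x \<partial>lborel)" by (simp add: sh)
  finally show "(\<integral>x. conv k F x \<partial>lborel) = (\<integral>x. k x \<partial>lborel) * (\<integral>x. F x \<partial>lborel)" .
qed

lemma conv_measurable: 
  fixes k F :: "real^'n \<Rightarrow> real"
  assumes "k \<in> test_funs \<Omega>" "integrable lborel F"
  shows "conv k F \<in> borel_measurable borel"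
  by (rule borel_measurable_continuous_onI[OF Ck_continuous[OF Ck_conv[OF assms]]])

lemma conv_diff:
  fixes k F :: "real^'n \<Rightarrow> real"
  assumes "k \<in> test_funs \<Omega>" "integrable lborel F" "integrable lborel G"
  shows "conv k (\<lambda>x. F x - G x) x = conv k F x - conv k G x"
  using conv_integrable[OF assms(1,2)] conv_integrable[OF assms(1,3)]
  by (simp add: conv_def right_diff_distrib)

text \<open>Jensen's inequality for the probability density \<open>k\<close>, followed by Fubini.\<close>

lemma nrm_conv_le:
  fixes k F :: "real^'n \<Rightarrow> real"
  assumes k: "k \<in> test_funs \<Omega>" "\<And>x. 0 \<le> k x" "(\<integral>x. k x \<partial>lborel) = 1"
    and F: "integrable lborel F" "F \<in> sqint lborel"
  shows "conv k F \<in> sqint lborel" "nrm lborel (conv k F) \<le> nrm lborel F"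
proof -
  have F2: "integrable lborel (\<lambda>x. (F x)\<^sup>2)" using F by (simp add: sqint_def)
  have ki: "integrable lborel (\<lambda>y. k (x - y))" "(\<integral>y. k (x - y) \<partial>lborel) = 1" for x
    using integral_lborel_reflect[of k x] test_funsD(6)[OF k(1)] k(3) test_funs_integrable[OF k(1)] by auto
  have jensen: "(conv k F x)\<^sup>2 \<le> conv k (\<lambda>x. (F x)\<^sup>2) x" for x
  proof -
    define c where "c = conv k F x"
    have "0 \<le> (\<integral>y. k (x - y) * (F y - c)\<^sup>2 \<partial>lborel)" using k(2) by simp
    also have "\<dots> = (\<integral>y. k (x - y) * (F y)\<^sup>2 - 2 * c * (k (x - y) * F y) + c\<^sup>2 * k (x - y) \<partial>lborel)"
      by (rule Bochner_Integration.integral_cong) (auto simp: power2_diff algebra_simps)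
    also have "\<dots> = conv k (\<lambda>x. (F x)\<^sup>2) x - 2 * c * conv k F x + c\<^sup>2"
      using conv_integrable[OF k(1) F2, of x] conv_integrable[OF k(1) F(1), of x] ki by (simp add: conv_def)
    finally show ?thesis by (simp add: c_def power2_eq_square)
  qed
  have m: "conv k F \<in> borel_measurable borel" by (rule conv_measurable[OF k(1) F(1)])
  have int: "integrable lborel (\<lambda>x. (conv k F x)\<^sup>2)"
    by (rule Bochner_Integration.integrable_bound[OF conv_integral(1)[OF k(1) F2]])
       (use m jensen in \<open>auto intro: order_trans[OF _ abs_ge_self]\<close>)
  then show sq: "conv k F \<in> sqint lborel" using m by (simp add: sqint_def)
  have "(\<integral>x. (conv k F x)\<^sup>2 \<partial>lborel) \<le> (\<integral>x. conv k (\<lambda>x. (F x)\<^sup>2) x \<partial>lborel)"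
    by (rule integral_mono[OF int conv_integral(1)[OF k(1) F2] jensen])
  also have "\<dots> = (\<integral>x. (F x)\<^sup>2 \<partial>lborel)" by (simp add: conv_integral(2)[OF k(1) F2] k(3))
  finally have "ip lborel (conv k F) (conv k F) \<le> ip lborel F F" by (simp add: ip_def power2_eq_square)
  then show "nrm lborel (conv k F) \<le> nrm lborel F" by (simp add: nrm_def)
qed

text \<open>Split off a continuous \<open>w\<close> close to \<open>h\<close>. Convolution does not
  increase the L2 norm, so both difference terms stay small, and for \<open>w\<close> uniform
  continuity gives uniform convergence. The kernels only need mass, sign, smoothness and shrinking
  support, so off-centre ones are covered.\<close>

lemma conv_tendsto_weakly:
  fixes v h :: "real^'n \<Rightarrow> real" and k :: "nat \<Rightarrow> real^'n \<Rightarrow> real"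
  assumes k: "\<And>j. k j \<in> test_funs (ball 0 (d j))" "\<And>j x. 0 \<le> k j x" "\<And>j. (\<integral>x. k j x \<partial>lborel) = 1"
    and d: "d \<longlonglongrightarrow> 0"
    and v: "v \<in> sqint lborel" "\<And>x. x \<notin> cball 0 R \<Longrightarrow> v x = 0"
    and h: "h \<in> sqint lborel" "\<And>x. x \<notin> cball 0 R \<Longrightarrow> h x = 0"
  shows "(\<lambda>j. \<integral>x. v x * conv (k j) h x \<partial>lborel) \<longlonglongrightarrow> (\<integral>x. v x * h x \<partial>lborel)"
proof (rule LIMSEQ_I)
  fix e :: real assume e: "e > 0"
  define V where "V = nrm lborel v + 1"
  have V: "V > 0" by (simp add: V_def add_nonneg_pos)
  obtain w B where w: "continuous_on UNIV w" "\<And>x. x \<notin> cball 0 (R + 1) \<Longrightarrow> w x = 0"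
    "\<And>x. \<bar>w x\<bar> \<le> B" "nrm lborel (\<lambda>x. h x - w x) < e / (4 * V)"
    using continuous_dense_sqint[OF h divide_pos_pos[OF e mult_pos_pos[OF zero_less_numeral V]]] by blast
  have wm: "w \<in> borel_measurable borel" by (rule borel_measurable_continuous_onI[OF w(1)])
  have wsq: "w \<in> sqint lborel" by (rule bounded_support_sqint[OF wm w(2,3)])
  have vi: "integrable lborel v" by (rule sqint_support_integrable[OF v])
  have hi: "integrable lborel h" by (rule sqint_support_integrable[OF h])
  have wi: "integrable lborel w" by (rule sqint_support_integrable[OF wsq w(2)])
  have dsq: "(\<lambda>x. h x - w x) \<in> sqint lborel" by (rule sqint_diff[OF h(1) wsq])
  define L where "L = (\<integral>x. \<bar>v x\<bar> \<partial>lborel) + 1"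
  have L: "L > 0" by (simp add: L_def add_nonneg_pos)
  have "uniformly_continuous_on UNIV w" by (rule compact_support_uniformly_continuous[OF w(1,2)])
  then obtain \<eta> where \<eta>: "\<eta> > 0" "\<And>x y. dist x y < \<eta> \<Longrightarrow> dist (w x) (w y) < e / (4 * L)"
    unfolding uniformly_continuous_on_def using e L by (metis UNIV_I divide_pos_pos mult_pos_pos zero_less_numeral)
  have "\<forall>\<^sub>F j in sequentially. d j < \<eta>" using d \<eta>(1) by (intro order_tendstoD) auto
  then obtain J where J: "\<And>j. j \<ge> J \<Longrightarrow> d j < \<eta>" unfolding eventually_sequentially by blast
  have "norm ((\<integral>x. v x * conv (k j) h x \<partial>lborel) - (\<integral>x. v x * h x \<partial>lborel)) < e" if j: "j \<ge> J" for j
  proof -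
    note kj = k(1)[of j] k(2)[of j] k(3)[of j]
    have unif: "\<bar>conv (k j) w x - w x\<bar> \<le> e / (4 * L)" for x
    proof -
      have z: "dist (w (x - z)) (w x) < e / (4 * L)" if "k j z \<noteq> 0" for z
      proof -
        have "z \<in> ball 0 (d j)" using test_funsD(4)[OF k(1), of z j] that by blast
        then show ?thesis using J[OF j] by (intro \<eta>(2)) (simp add: dist_norm)
      qed
      have "conv (k j) w x \<le> w x + e / (4 * L)"
        by (rule conv_mono_const(1)[OF kj wi wm]) (use z in \<open>fastforce simp: dist_real_def\<close>)
      moreover have "w x - e / (4 * L) \<le> conv (k j) w x"
        by (rule conv_mono_const(2)[OF kj wi wm]) (use z in \<open>fastforce simp: dist_real_def\<close>)
      ultimately show ?thesis by auto
    qed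
    note c1 = nrm_conv_le[OF kj hi h(1)] and c2 = nrm_conv_le[OF kj wi wsq]
      and c3 = nrm_conv_le[OF kj Bochner_Integration.integrable_diff[OF hi wi] dsq]
    have i: "integrable lborel (\<lambda>x. v x * conv (k j) h x)" "integrable lborel (\<lambda>x. v x * h x)"
      "integrable lborel (\<lambda>x. v x * conv (k j) w x)" "integrable lborel (\<lambda>x. v x * w x)"
      using sqint_mult_integrable[OF v(1)] c1 c2 h(1) wsq by auto
    have t1: "\<bar>ip lborel v (conv (k j) (\<lambda>x. h x - w x))\<bar> \<le> e / 4"
    proof -
      have "\<bar>ip lborel v (conv (k j) (\<lambda>x. h x - w x))\<bar> \<le> nrm lborel v * nrm lborel (conv (k j) (\<lambda>x. h x - w x))"
        by (rule ip_le_nrm[OF v(1) c3(1)])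
      also have "\<dots> \<le> V * (e / (4 * V))"
        using c3(2) w(4) V by (intro mult_mono) (auto simp: V_def)
      finally show ?thesis using V by simp
    qed
    have t2: "\<bar>ip lborel v (\<lambda>x. h x - w x)\<bar> \<le> e / 4"
    proof -
      have "\<bar>ip lborel v (\<lambda>x. h x - w x)\<bar> \<le> nrm lborel v * nrm lborel (\<lambda>x. h x - w x)"
        by (rule ip_le_nrm[OF v(1) dsq])
      also have "\<dots> \<le> V * (e / (4 * V))"
        using w(4) V by (intro mult_mono) (auto simp: V_def)
      finally show ?thesis using V by simp
    qed
    have t3: "\<bar>\<integral>x. v x * (conv (k j) w x - w x) \<partial>lborel\<bar> \<le> e / 4"
    proof -
      have i3: "integrable lborel (\<lambda>x. v x * (conv (k j) w x - w x))"
        using i(3,4) by (simp add: right_diff_distrib)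
      have "\<bar>\<integral>x. v x * (conv (k j) w x - w x) \<partial>lborel\<bar> \<le> (\<integral>x. \<bar>v x * (conv (k j) w x - w x)\<bar> \<partial>lborel)"
        by (rule integral_abs_bound)
      also have "\<dots> \<le> (\<integral>x. \<bar>v x\<bar> * (e / (4 * L)) \<partial>lborel)"
        using integrable_abs[OF i3] vi
        by (intro integral_mono) (simp_all only: abs_mult mult_left_mono[OF unif abs_ge_zero], auto)
      also have "\<dots> \<le> L * (e / (4 * L))" using e L by (simp add: L_def divide_right_mono mult_right_mono)
      finally show ?thesis using L by simp
    qed
    have "(\<integral>x. v x * conv (k j) h x \<partial>lborel) - (\<integral>x. v x * h x \<partial>lborel) =
      ip lborel v (conv (k j) (\<lambda>x. h x - w x)) + (\<integral>x. v x * (conv (k j) w x - w x) \<partial>lborel) - ip lborel v (\<lambda>x. h x - w x)"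
      unfolding ip_def conv_diff[OF k(1) hi wi] using i by (simp add: right_diff_distrib)
    then show ?thesis using t1 t2 t3 e unfolding real_norm_def by linarith
  qed
  then show "\<exists>J. \<forall>j\<ge>J. norm ((\<integral>x. v x * conv (k j) h x \<partial>lborel) - (\<integral>x. v x * h x \<partial>lborel)) < e" by blast
qed

subsection \<open>The fundamental lemma of the calculus of variations\<close>

lemma test_funs_reflect:
  fixes k :: "real^'n \<Rightarrow> real"
  assumes k: "k \<in> test_funs (ball a d)"
  shows "(\<lambda>y. k (x - y)) \<in> test_funs (ball (x - a) d)"
proof (rule test_funsI)
  let ?K = "(\<lambda>z. x - z) ` closure {x. k x \<noteq> 0}"
  show "Ck n (\<lambda>y. k (x - y))" for n by (rule Ck_reflect[OF test_funsD(1)[OF k]])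
  show "compact ?K" by (intro compact_continuous_image continuous_intros test_funsD(2)[OF k])
  show "?K \<subseteq> ball (x - a) d" using test_funsD(3)[OF k] by (force simp: dist_norm norm_minus_commute)
  show "k (x - y) = 0" if "y \<notin> ?K" for y
  proof (rule ccontr)
    assume "k (x - y) \<noteq> 0"
    then have "x - y \<in> closure {x. k x \<noteq> 0}" using closure_subset by fast
    then have "x - (x - y) \<in> ?K" by (rule imageI)
    with that show False by simp
  qed
qed

text \<open>The complement is a union of open balls. Such inner parallel sets supply Borel sets and
  compact supports below.\<close>

lemma closed_ball_subset: "closed {x::'a::metric_space. ball x r \<subseteq> S}"
proof -
  have "- {x. ball x r \<subseteq> S} = (\<Union>z\<in>-S. ball z r)" by (auto simp: dist_commute)
  then show ?thesis unfolding closed_def by (simp add: open_UN)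
qed

lemma ball_subset_ball:
  fixes x y :: "'a::metric_space"
  assumes "dist x y + r \<le> s"
  shows "ball x r \<subseteq> ball y s"
proof
  fix z assume "z \<in> ball x r"
  then show "z \<in> ball y s" using assms dist_triangle[of y z x] by (simp add: dist_commute)
qed

lemma bounded_subset_cball0:
  fixes S :: "'a::real_normed_vector set"
  assumes "bounded S"
  obtains R where "R > 0" "S \<subseteq> cball 0 R"
  using assms by (metis bounded_pos mem_cball_0 subsetI)

lemma mollifier_sequence:
  obtains k :: "nat \<Rightarrow> real^'n \<Rightarrow> real" where "\<And>j. k j \<in> test_funs (ball 0 (inverse (real (Suc j))))"
    "\<And>j x. 0 \<le> k j x" "\<And>j. (\<integral>x. k j x \<partial>lborel) = 1"
proof -
  have "\<exists>k :: real^'n \<Rightarrow> real. k \<in> test_funs (ball 0 (inverse (real (Suc j)))) \<and> (\<forall>x. 0 \<le> k x) \<and> (\<integral>x. k x \<partial>lborel) = 1" for j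
    using mollifier_exists[of "inverse (real (Suc j))" 0] by (metis inverse_positive_iff_positive of_nat_0_less_iff zero_less_Suc)
  then show ?thesis using that by metis
qed

text \<open>On \<open>K n\<close> the reflected kernel is itself a test function of the domain from
  index \<open>n\<close> on, so the mollification of \<open>h\<close> vanishes there. Pairing it
  with \<open>h\<close> cut to \<open>K n\<close> and letting the kernels shrink makes the integral
  of the square over \<open>K n\<close> zero, and these sets exhaust the open domain.\<close>

lemma sqint_eq_0_if_orthogonal_test_funs:
  fixes h :: "real^'n \<Rightarrow> real"
  assumes \<Omega>: "open \<Omega>" "bounded \<Omega>" and h: "h \<in> sqint (lebesgue_on \<Omega>)"
    and orth: "\<And>g. g \<in> test_funs \<Omega> \<Longrightarrow> (\<integral>x. g x * h x \<partial>lebesgue_on \<Omega>) = 0"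
  shows "AE x in lebesgue_on \<Omega>. h x = 0"
proof -
  have S: "\<Omega> \<in> sets borel" using \<Omega> by simp
  obtain R where R: "R > 0" "\<Omega> \<subseteq> cball 0 R" using bounded_subset_cball0[OF \<Omega>(2)] by blast
  obtain H where H: "H \<in> borel_measurable borel" "\<And>x. x \<notin> \<Omega> \<Longrightarrow> H x = 0" "AE x in lebesgue_on \<Omega>. H x = h x"
    "H \<in> sqint lborel" "\<And>w. w \<in> borel_measurable borel \<Longrightarrow> (\<integral>x. w x * h x \<partial>lebesgue_on \<Omega>) = (\<integral>x. w x * H x \<partial>lborel)"
    by (rule sqint_representative[OF S h], rule that; assumption)
  have H0: "H x = 0" if "x \<notin> cball 0 R" for x using H(2) R that by blast
  obtain k :: "nat \<Rightarrow> real^'n \<Rightarrow> real" where k: "\<And>j. k j \<in> test_funs (ball 0 (inverse (real (Suc j))))"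
    "\<And>j x. 0 \<le> k j x" "\<And>j. (\<integral>x. k j x \<partial>lborel) = 1" using mollifier_sequence by blast
  define K where "K n = {x. ball x (inverse (real (Suc n))) \<subseteq> \<Omega>}" for n
  have Kb: "K n \<in> sets borel" for n unfolding K_def by (rule borel_closed[OF closed_ball_subset])
  have KH: "AE x in lborel. x \<in> K n \<longrightarrow> H x = 0" for n
  proof -
    define v where "v x = indicator (K n) x * H x" for x
    have v: "v \<in> sqint lborel" unfolding v_def
      by (rule sqint_bounded_mult[OF H(4), of _ 1]) (use Kb in \<open>auto simp: indicator_def\<close>)
    have v0: "v x = 0" if "x \<notin> cball 0 R" for x using H0[OF that] by (simp add: v_def)
    have "(\<integral>x. v x * conv (k j) H x \<partial>lborel) = 0" if "j \<ge> n" for j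
    proof -
      have "v x * conv (k j) H x = 0" for x
      proof (cases "x \<in> K n")
        case True
        have "ball x (inverse (real (Suc j))) \<subseteq> ball x (inverse (real (Suc n)))"
          using that by (intro subset_ball le_imp_inverse_le) auto
        also have "\<dots> \<subseteq> \<Omega>" using True by (simp add: K_def)
        finally have "(\<lambda>y. k j (x - y)) \<in> test_funs \<Omega>"
          using test_funs_reflect[OF k(1)[of j], of x] test_funs_mono by (metis diff_zero)
        note t = this
        have "conv (k j) H x = (\<integral>y. k j (x - y) * h y \<partial>lebesgue_on \<Omega>)"
          unfolding conv_def using H(5)[OF test_funsD(6)[OF t]] by simp
        then show ?thesis using orth[OF t] by simp
      qed (simp add: v_def)
      then have "(\<lambda>x. v x * conv (k j) H x) = (\<lambda>_. 0)" by blast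
      then show ?thesis by (simp only: integral_zero)
    qed
    then have "(\<lambda>j. \<integral>x. v x * conv (k j) H x \<partial>lborel) \<longlonglongrightarrow> 0"
      by (intro tendsto_eventually) (auto simp: eventually_sequentially)
    moreover have "(\<lambda>j. \<integral>x. v x * conv (k j) H x \<partial>lborel) \<longlonglongrightarrow> (\<integral>x. v x * H x \<partial>lborel)"
      by (rule conv_tendsto_weakly[OF k LIMSEQ_inverse_real_of_nat v v0 H(4) H0])
    ultimately have z: "(\<integral>x. v x * H x \<partial>lborel) = 0" using LIMSEQ_unique by blast
    have "AE x in lborel. v x * H x = 0"
      using z by (subst (asm) integral_nonneg_eq_0_iff_AE[OF sqint_mult_integrable[OF v H(4)]])
        (auto simp: v_def indicator_def)
    then show ?thesis by eventually_elim (auto simp: v_def)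
  qed
  have "AE x in lborel. \<forall>n. x \<in> K n \<longrightarrow> H x = 0" unfolding AE_all_countable using KH by blast
  then have "AE x in lborel. H x = 0"
  proof eventually_elim
    case (elim x)
    show ?case
    proof (cases "x \<in> \<Omega>")
      case True
      then obtain e where e: "e > 0" "ball x e \<subseteq> \<Omega>" using \<Omega>(1) open_contains_ball by blast
      obtain n where "inverse (real (Suc n)) < e" using reals_Archimedean[OF e(1)] by blast
      then have "ball x (inverse (real (Suc n))) \<subseteq> ball x e" by (intro subset_ball less_imp_le)
      with e(2) have "x \<in> K n" unfolding K_def by blast
      with elim show ?thesis by blast
    qed (rule H(2))
  qed
  then have "AE x in lebesgue. H x = 0" by (rule AE_completion)
  then have "AE x in lebesgue_on \<Omega>. H x = 0" using \<Omega>(1) by (subst AE_restrict_space_iff) (auto elim: eventually_mono)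
  with H(3) show ?thesis by eventually_elim simp
qed

subsection \<open>Smooth partitions of unity\<close>

lemma sum_indicator_disjointed:
  fixes m :: nat
  shows "(\<Sum>k<m. indicator (C k - (\<Union>l<k. C l)) y :: real) = indicator (\<Union>k<m. C k) y"
proof (induction m)
  case (Suc m)
  then show ?case by (auto simp: lessThan_Suc indicator_def)
qed simp

text \<open>Indicators of a disjoint family are mollified, instead of dividing bumps by their sum:
  smoothness and the bound by 1 come from convolution, and the sum is the mollified indicator of the
  union.\<close>

lemma smooth_partition_of_unity:
  fixes K :: "(real^'n) set"
  assumes K: "compact K" "K \<noteq> {}" and s: "\<And>x. x \<in> K \<Longrightarrow> s x > 0"
  obtains m :: nat and c \<theta> where "\<And>k. k < m \<Longrightarrow> c k \<in> K"
    "\<And>k. k < m \<Longrightarrow> \<theta> k \<in> test_funs (ball (c k) (s (c k)))" "\<And>k x. k < m \<Longrightarrow> 0 \<le> \<theta> k x"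
    "\<And>x. (\<Sum>k<m. \<theta> k x) \<le> 1" "\<And>x. x \<in> K \<Longrightarrow> (\<Sum>k<m. \<theta> k x) = 1"
proof -
  have "K \<subseteq> (\<Union>x\<in>K. ball x (s x))" using s by force
  then obtain I where I: "I \<subseteq> K" "finite I" "K \<subseteq> (\<Union>x\<in>I. ball x (s x))"
    using compactE_image[OF K(1), of K "\<lambda>x. ball x (s x)"] by auto
  obtain xs where xs: "set xs = I" using finite_list[OF I(2)] by blast
  define m where "m = length xs"
  define c where "c k = xs ! k" for k
  have cK: "c k \<in> K" if "k < m" for k using that I(1) xs unfolding c_def m_def by (metis nth_mem subsetD)
  \<comment> \<open>A Lebesgue number of the finite cover. With \<open>\<delta> / 2\<close> in
    \<open>C\<close> and a kernel of radius \<open>\<delta> / 4\<close>, mollification neither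
    leaves the balls nor drops the sum below 1 on \<open>K\<close>.\<close>
  obtain \<delta> where \<delta>: "\<delta> > 0" "\<And>x. x \<in> K \<Longrightarrow> \<exists>G\<in>(\<lambda>x. ball x (s x)) ` I. ball x \<delta> \<subseteq> G"
    using Heine_Borel_lemma[OF K(1), of "(\<lambda>x. ball x (s x)) ` I"] I(3) by auto
  define C where "C k = {y. ball y (\<delta> / 2) \<subseteq> ball (c k) (s (c k))}" for k
  define A where "A k = C k - (\<Union>l<k. C l)" for k
  have Cb: "C k \<in> sets borel" for k unfolding C_def by (rule borel_closed[OF closed_ball_subset])
  have Ab[measurable]: "A k \<in> sets borel" for k unfolding A_def by (intro sets.Diff sets.finite_UN Cb) auto
  have Csub: "C k \<subseteq> ball (c k) (s (c k))" for k unfolding C_def using \<delta>(1) by (auto dest: subsetD[of _ _ "_"])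
  have Ai: "integrable lborel (indicat_real (A k))" for k
  proof (rule integrable_real_indicator)
    have "bounded (A k)" using Csub[of k] by (rule bounded_subset[OF bounded_ball order_trans[rotated]]) (auto simp: A_def)
    then show "emeasure lborel (A k) < \<infinity>" by (rule emeasure_bounded_finite)
  qed simp
  obtain \<kappa> :: "real^'n \<Rightarrow> real" where \<kappa>: "\<kappa> \<in> test_funs (ball 0 (\<delta> / 4))" "\<And>x. 0 \<le> \<kappa> x" "(\<integral>x. \<kappa> x \<partial>lborel) = 1"
    using mollifier_exists[of "\<delta> / 4" 0] \<delta>(1) by auto
  have \<kappa>z: "norm z < \<delta> / 4" if "\<kappa> z \<noteq> 0" for z using test_funsD(4)[OF \<kappa>(1), of z] that by (auto simp: dist_norm)
  define \<theta> where "\<theta> k = conv \<kappa> (indicat_real (A k))" for k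
  define U where "U = (\<Union>k<m. C k)"
  have Ub: "U \<in> sets borel" unfolding U_def by (intro sets.finite_UN Cb) auto
  have ind: "indicat_real U = (\<lambda>y. \<Sum>k<m. indicat_real (A k) y)"
    unfolding U_def A_def by (rule ext, rule sum_indicator_disjointed[symmetric])
  have Ui: "integrable lborel (indicat_real U)" unfolding ind by (intro Bochner_Integration.integrable_sum Ai)
  have sum: "(\<Sum>k<m. \<theta> k x) = conv \<kappa> (indicat_real U) x" for x
    unfolding \<theta>_def conv_def ind sum_distrib_left
    by (rule Bochner_Integration.integral_sum[symmetric]) (rule conv_integrable[OF \<kappa>(1) Ai])
  have Um: "indicat_real U \<in> borel_measurable borel" "indicat_real (A k) \<in> borel_measurable borel" for k
    using Ub Ab by (auto intro: borel_measurable_indicator)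
  show ?thesis
  proof (rule that[of m c \<theta>])
    show "c k \<in> K" if "k < m" for k by (rule cK[OF that])
    show "0 \<le> \<theta> k x" if "k < m" for k x
      unfolding \<theta>_def by (rule conv_mono_const(2)[OF \<kappa> Ai Um(2)]) simp
    show "(\<Sum>k<m. \<theta> k x) \<le> 1" for x
      unfolding sum by (rule conv_mono_const(1)[OF \<kappa> Ui Um(1)]) (simp add: indicator_def)
    show "(\<Sum>k<m. \<theta> k x) = 1" if x: "x \<in> K" for x
    proof (rule antisym)
      have "x - z \<in> U" if "\<kappa> z \<noteq> 0" for z
      proof -
        obtain i where i: "i \<in> I" "ball x \<delta> \<subseteq> ball i (s i)" using \<delta>(2)[OF x] by blast
        obtain k where k: "k < m" "c k = i" using i(1) xs unfolding m_def c_def by (metis in_set_conv_nth)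
        have "ball (x - z) (\<delta> / 2) \<subseteq> ball x \<delta>"
          using \<kappa>z[OF that] \<delta>(1) by (intro ball_subset_ball) (simp add: dist_norm)
        with i k have "x - z \<in> C k" by (auto simp: C_def)
        with k show ?thesis by (auto simp: U_def)
      qed
      then show "1 \<le> (\<Sum>k<m. \<theta> k x)"
        unfolding sum by (intro conv_mono_const(2)[OF \<kappa> Ui Um(1)]) simp
      show "(\<Sum>k<m. \<theta> k x) \<le> 1"
        unfolding sum by (rule conv_mono_const(1)[OF \<kappa> Ui Um(1)]) (simp add: indicator_def)
    qed
    show "\<theta> k \<in> test_funs (ball (c k) (s (c k)))" if "k < m" for k
    proof (rule test_funsI)
      let ?K = "{x. ball x (\<delta> / 4) \<subseteq> ball (c k) (s (c k))}"
      show "Ck j (\<theta> k)" for j unfolding \<theta>_def by (rule Ck_conv[OF \<kappa>(1) Ai])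
      show sub: "?K \<subseteq> ball (c k) (s (c k))" using \<delta>(1) by (auto dest: subsetD[of _ _ "_"])
      show "compact ?K" using closed_ball_subset bounded_subset[OF bounded_ball sub] by (simp add: compact_eq_bounded_closed)
      show "\<theta> k x = 0" if "x \<notin> ?K" for x
        unfolding \<theta>_def
      proof (rule conv_eq_0)
        fix y assume y: "\<kappa> (x - y) \<noteq> 0"
        show "indicat_real (A k) y = 0"
        proof (rule ccontr)
          assume "indicat_real (A k) y \<noteq> 0"
          then have "y \<in> C k" by (auto simp: A_def indicator_def split: if_splits)
          then have "ball y (\<delta> / 2) \<subseteq> ball (c k) (s (c k))" by (simp add: C_def)
          moreover have "ball x (\<delta> / 4) \<subseteq> ball y (\<delta> / 2)"
            using \<kappa>z[OF y] by (intro ball_subset_ball) (simp add: dist_norm)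
          ultimately show False using that by blast
        qed
      qed
    qed
  qed
qed

subsection \<open>Pushing a Lipschitz domain inwards\<close>

lemma lipschitz_boundary_push:
  fixes \<Omega> :: "(real^'n) set"
  assumes \<Omega>: "open \<Omega>" "lipschitz_boundary \<Omega>" and x: "x \<in> closure \<Omega>"
  shows "\<exists>s>0. \<forall>d>0. \<exists>a \<tau>. \<tau> > 0 \<and> norm a + \<tau> < d \<and> (\<forall>y\<in>\<Omega> \<inter> ball x s. ball (y + a) \<tau> \<subseteq> \<Omega>)"
proof (cases "x \<in> \<Omega>")
  case True
  then obtain r where r: "r > 0" "ball x r \<subseteq> \<Omega>" using \<Omega>(1) open_contains_ball by blast
  have "\<exists>a \<tau>. \<tau> > 0 \<and> norm a + \<tau> < d \<and> (\<forall>y\<in>\<Omega> \<inter> ball x (r / 2). ball (y + a) \<tau> \<subseteq> \<Omega>)" if "d > 0" for d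
  proof (rule exI[of _ 0], rule exI[of _ "min (d / 2) (r / 2)"], intro conjI ballI)
    fix y assume "y \<in> \<Omega> \<inter> ball x (r / 2)"
    then have "ball (y + 0) (min (d / 2) (r / 2)) \<subseteq> ball x r"
      by (intro ball_subset_ball) (auto simp: dist_commute)
    with r show "ball (y + 0) (min (d / 2) (r / 2)) \<subseteq> \<Omega>" by blast
  qed (use that r in auto)
  then show ?thesis using r(1) by (intro exI[of _ "r / 2"]) auto
next
  case False
  then have "x \<in> frontier \<Omega>" using x \<Omega>(1) by (simp add: frontier_def interior_open)
  then obtain r e \<gamma> L where r: "r > 0" "norm e = 1" and lip: "L-lipschitz_on {z. z \<bullet> e = 0} \<gamma>"
    and eq: "\<Omega> \<inter> ball x r = {y \<in> ball x r. \<gamma> (y - (y \<bullet> e) *\<^sub>R e) < y \<bullet> e}"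
    using \<Omega>(2) unfolding lipschitz_boundary_def by blast
  have L: "L \<ge> 0" using lip by (rule lipschitz_on_nonneg)
  have ee: "e \<bullet> e = 1" using r(2) by (simp add: norm_eq_1)
  have "\<exists>a \<tau>. \<tau> > 0 \<and> norm a + \<tau> < d \<and> (\<forall>y\<in>\<Omega> \<inter> ball x (r / 2). ball (y + a) \<tau> \<subseteq> \<Omega>)" if d: "d > 0" for d
  proof -
    \<comment> \<open>Small against \<open>d\<close>, and small enough for the shifted ball to stay
      in the chart of radius \<open>r\<close> when \<open>y\<close> lies in the ball of half that
      radius.\<close>
    define h where "h = min d r / 4"
    have h: "h > 0" "2 * h < d" "2 * h < r / 2 + r / 2" "h \<le> r / 4" using d r by (auto simp: h_def)
    \<comment> \<open>A displacement \<open>z\<close> lowers the height by at most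
      \<open>norm z\<close> and raises the graph by at most \<open>L * norm z\<close>; for
      \<open>norm z < \<tau>\<close> the sum stays within the gain \<open>h\<close>.\<close>
    define \<tau> where "\<tau> = h / (1 + L)"
    have \<tau>: "\<tau> > 0" "\<tau> \<le> h" "(1 + L) * \<tau> = h" using h L by (auto simp: \<tau>_def field_simps)
    have "ball (y + h *\<^sub>R e) \<tau> \<subseteq> \<Omega>" if y: "y \<in> \<Omega> \<inter> ball x (r / 2)" for y
    proof
      fix p assume p: "p \<in> ball (y + h *\<^sub>R e) \<tau>"
      define z where "z = p - (y + h *\<^sub>R e)"
      have z: "norm z < \<tau>" "p = y + h *\<^sub>R e + z" using p by (auto simp: z_def dist_norm norm_minus_commute)
      have nh: "norm (h *\<^sub>R e) = h" using h r by simp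
      have "norm (p - x) \<le> norm (y - x) + norm (h *\<^sub>R e) + norm z"
      proof -
        have eq: "p - x = (y - x) + h *\<^sub>R e + z" by (simp add: z(2))
        show ?thesis unfolding eq
          using norm_triangle_ineq[of "(y - x) + h *\<^sub>R e" z] norm_triangle_ineq[of "y - x" "h *\<^sub>R e"] by linarith
      qed
      also have "\<dots> < r / 2 + h + h" using y z(1) \<tau>(2) nh by (auto simp: dist_norm norm_minus_commute)
      also have "\<dots> \<le> r" using h(4) by simp
      finally have pb: "p \<in> ball x r" by (simp add: dist_norm norm_minus_commute)
      have yb: "y \<in> ball x r" using y r(1) by auto
      have gy: "\<gamma> (y - (y \<bullet> e) *\<^sub>R e) < y \<bullet> e" using eq y yb by blast
      let ?P = "\<lambda>y. y - (y \<bullet> e) *\<^sub>R e"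
      have P0: "?P q \<in> {z. z \<bullet> e = 0}" for q by (simp add: inner_diff_left ee)
      have Pd: "?P p - ?P y = z - (z \<bullet> e) *\<^sub>R e" by (simp add: z(2) inner_add_left ee algebra_simps)
      have "norm (z - (z \<bullet> e) *\<^sub>R e) \<le> norm z"
      proof (rule power2_le_imp_le)
        have "(norm (z - (z \<bullet> e) *\<^sub>R e))\<^sup>2 = (norm z)\<^sup>2 - (z \<bullet> e)\<^sup>2"
          unfolding power2_norm_eq_inner
          by (simp only: inner_diff_left inner_diff_right inner_scaleR_left
              inner_scaleR_right ee inner_commute[of e z] power2_eq_square) simp
        then show "(norm (z - (z \<bullet> e) *\<^sub>R e))\<^sup>2 \<le> (norm z)\<^sup>2" by simp
      qed simp
      then have "\<bar>\<gamma> (?P p) - \<gamma> (?P y)\<bar> \<le> L * norm z"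
        using lipschitz_onD[OF lip P0 P0, of p y] L Pd by (simp add: dist_norm order_trans[OF _ mult_left_mono])
      moreover have "- norm z \<le> z \<bullet> e" using Cauchy_Schwarz_ineq2[of z e] r(2) by auto
      moreover have "p \<bullet> e = y \<bullet> e + h + z \<bullet> e" by (simp add: z(2) inner_add_left ee)
      moreover have "(1 + L) * norm z \<le> h" using \<tau>(3) z(1) L by (metis add_increasing less_imp_le mult_left_mono zero_le_one)
      ultimately have "\<gamma> (?P p) < p \<bullet> e" using gy by (simp add: distrib_right)
      with eq pb show "p \<in> \<Omega>" by blast
    qed
    moreover have "norm (h *\<^sub>R e) + \<tau> < d" using h \<tau> r by simp
    ultimately show ?thesis using \<tau>(1) by blast
  qed
  then show ?thesis using r(1) by (intro exI[of _ "r / 2"]) auto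
qed

subsection \<open>Pairings with fields of bounded length\<close>

lemma pd_cmult:
  fixes f :: "real^'n \<Rightarrow> real"
  assumes "f differentiable (at x)"
  shows "pd i (\<lambda>x. c * f x) x = c * pd i f x"
proof -
  have "((\<lambda>x. c * f x) has_derivative (\<lambda>h. c * (\<Sum>i\<in>UNIV. h $ i * pd i f x))) (at x)"
    by (intro has_derivative_mult_right has_derivative_pd assms)
  from pd_eqI[OF this, of i] show ?thesis
    by (simp add: axis_def if_distrib[of "\<lambda>t. t * _"] cong: if_cong)
qed

lemma pd_sum:
  fixes f :: "'a \<Rightarrow> real^'n \<Rightarrow> real"
  assumes "\<And>a. a \<in> A \<Longrightarrow> f a differentiable (at x)"
  shows "pd i (\<lambda>x. \<Sum>a\<in>A. f a x) x = (\<Sum>a\<in>A. pd i (f a) x)"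
proof -
  have "((\<lambda>x. \<Sum>a\<in>A. f a x) has_derivative (\<lambda>h. \<Sum>a\<in>A. frechet_derivative (f a) (at x) h)) (at x)"
    by (intro has_derivative_sum) (use assms frechet_derivative_works in blast)
  from pd_eqI[OF this] show ?thesis by (simp add: pd_def)
qed

lemma pd_eq_0_if_const_near:
  fixes f :: "real^'n \<Rightarrow> real"
  assumes "open S" "x \<in> S" "\<And>y. y \<in> S \<Longrightarrow> f y = c"
  shows "pd i f x = 0"
proof -
  have "((\<lambda>_. c) has_derivative (\<lambda>_. 0)) (at x)" by simp
  then have "(f has_derivative (\<lambda>_. 0)) (at x)"
    by (rule has_derivative_transform_within_open[OF _ assms(1,2)]) (simp add: assms(3))
  from pd_eqI[OF this] show ?thesis by simp
qed

lemma test_fieldsD: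
  assumes "\<phi> \<in> test_fields \<Omega>"
  shows "(\<lambda>x. \<phi> x $ i) \<in> test_funs \<Omega>"
  using assms by (auto simp: test_fields_def)

lemma divg_test_funs:
  fixes \<phi> :: "real^'n \<Rightarrow> real^'n"
  assumes "\<phi> \<in> test_fields \<Omega>"
  shows "divg \<phi> \<in> test_funs \<Omega>"
  unfolding divg_def[abs_def] using test_funs_sum[of UNIV "\<lambda>i. pd i (\<lambda>y. \<phi> y $ i)" \<Omega>]
    test_funs_pd test_fieldsD[OF assms] by auto

lemma divg_scale:
  fixes \<phi> :: "real^'n \<Rightarrow> real^'n"
  assumes "\<phi> \<in> test_fields \<Omega>"
  shows "divg (\<lambda>x. c *\<^sub>R \<phi> x) x = c * divg \<phi> x"
proof -
  have "pd i (\<lambda>y. c * \<phi> y $ i) x = c * pd i (\<lambda>y. \<phi> y $ i) x" for i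
    using test_funsD(7)[OF test_fieldsD[OF assms]] by (rule pd_cmult)
  then show ?thesis by (simp add: divg_def sum_distrib_left)
qed

lemma test_fields_scale: "\<phi> \<in> test_fields \<Omega> \<Longrightarrow> (\<lambda>x. c *\<^sub>R \<phi> x) \<in> test_fields \<Omega>"
  by (auto simp: test_fields_def test_funs_cmult)

text \<open>The field divided by \<open>c\<close> is admissible for the seminorm.\<close>

lemma BV_pairings_le:
  assumes "bdd_above (BV_pairings \<Omega> v)" "\<phi> \<in> test_fields \<Omega>" "\<And>x. norm (\<phi> x) \<le> c" "c > 0"
  shows "(\<integral>x. v x * divg \<phi> x \<partial>lebesgue_on \<Omega>) \<le> c * BV_seminorm \<Omega> v"
proof -
  let ?\<phi> = "\<lambda>x. (1 / c) *\<^sub>R \<phi> x"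
  have "(\<integral>x. v x * divg ?\<phi> x \<partial>lebesgue_on \<Omega>) \<in> BV_pairings \<Omega> v"
    unfolding BV_pairings_def
    using test_fields_scale[OF assms(2), of "1 / c"] assms(3,4) by (auto intro!: exI[of _ ?\<phi>] simp: field_simps)
  then have "(\<integral>x. v x * divg ?\<phi> x \<partial>lebesgue_on \<Omega>) \<le> BV_seminorm \<Omega> v"
    unfolding BV_seminorm_def using assms(1) by (rule cSup_upper)
  then have "(1 / c) * (\<integral>x. v x * divg \<phi> x \<partial>lebesgue_on \<Omega>) \<le> BV_seminorm \<Omega> v"
    by (simp add: divg_scale[OF assms(2)] mult.left_commute[of "v _"])
  then show ?thesis using assms(4) by (simp add: field_simps)
qed

lemma BV_seminorm_nonneg:
  fixes v :: "real^'n \<Rightarrow> real"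
  assumes "bdd_above (BV_pairings \<Omega> v)"
  shows "0 \<le> BV_seminorm \<Omega> v"
proof -
  have "(\<lambda>_. 0) \<in> test_fields \<Omega>" by (simp add: test_fields_def test_funs_0)
  moreover have "divg (\<lambda>_::real^'n. 0::real^'n) x = 0" for x
    by (simp add: divg_def pd_eq_0_if_const_near[of UNIV x "\<lambda>_. 0" 0])
  ultimately show ?thesis using BV_pairings_le[OF assms, of "\<lambda>_. 0" 1] by simp
qed

text \<open>Tested with \<open>sgn p\<close>; it reduces bounds on vector-valued convolutions to
  scalar ones.\<close>

lemma norm_leI_inner:
  fixes p :: "'a::real_inner"
  assumes "\<And>e. norm e \<le> 1 \<Longrightarrow> e \<bullet> p \<le> c"
  shows "norm p \<le> c"
proof -
  have "sgn p \<bullet> p = norm p"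
    by (cases "p = 0") (auto simp: sgn_div_norm power2_norm_eq_inner[symmetric] power2_eq_square)
  then show ?thesis using assms[of "sgn p"] by (simp add: norm_sgn)
qed

text \<open>
  The extension of \<open>\<mu>\<close> by zero has distributional divergence \<open>- g\<close> on the whole space. Cut into pieces
  by a partition of unity, mollified and pushed inwards, it becomes a test field that is admissible,
  up to a factor tending to 1, in the definition of the BV seminorm.
\<close>

lemma pairing_le_BV_seminorm:
  fixes \<Omega> :: "(real^'n) set" and \<mu> :: "'n \<Rightarrow> real^'n \<Rightarrow> real"
  assumes \<Omega>: "open \<Omega>" "bounded \<Omega>" "lipschitz_boundary \<Omega>" "\<Omega> \<noteq> {}"
    and g: "g \<in> borel_measurable borel" "g \<in> sqint lborel" "\<And>x. x \<notin> \<Omega> \<Longrightarrow> g x = 0"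
    and \<mu>: "\<And>l. \<mu> l \<in> borel_measurable borel" "\<And>l. \<mu> l \<in> sqint lborel" "\<And>l x. x \<notin> \<Omega> \<Longrightarrow> \<mu> l x = 0"
    and \<mu>1: "AE x in lborel. norm (\<chi> l. \<mu> l x) \<le> 1"
    and weak: "\<And>w. w \<in> test_funs UNIV \<Longrightarrow> (\<integral>x. (\<Sum>l\<in>UNIV. \<mu> l x * pd l w x) \<partial>lborel) = (\<integral>x. g x * w x \<partial>lborel)"
    and v: "v \<in> borel_measurable borel" "v \<in> sqint lborel" "\<And>x. x \<notin> \<Omega> \<Longrightarrow> v x = 0"
    and bdd: "bdd_above (BV_pairings \<Omega> v)"
  shows "(\<integral>x. v x * g x \<partial>lborel) \<le> BV_seminorm \<Omega> v"
proof -
  obtain R where R: "R > 0" "\<Omega> \<subseteq> cball 0 R" using bounded_subset_cball0[OF \<Omega>(2)] by blast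
  define push where "push s x \<longleftrightarrow> (\<forall>d>0. \<exists>a \<tau>. \<tau> > 0 \<and> norm a + \<tau> < d \<and> (\<forall>y\<in>\<Omega> \<inter> ball x s. ball (y + a) \<tau> \<subseteq> \<Omega>))" for s x
  have "\<forall>x\<in>closure \<Omega>. \<exists>s>0. push s x"
    using lipschitz_boundary_push[OF \<Omega>(1,3)] unfolding push_def by blast
  then obtain s where s: "\<And>x. x \<in> closure \<Omega> \<Longrightarrow> s x > 0" "\<And>x. x \<in> closure \<Omega> \<Longrightarrow> push (s x) x" by metis
  have cl: "compact (closure \<Omega>)" "closure \<Omega> \<noteq> {}" using \<Omega>(2,4) compact_closure by auto
  obtain m :: nat and c \<theta> where c: "\<And>k. k < m \<Longrightarrow> c k \<in> closure \<Omega>"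
    and \<theta>: "\<And>k. k < m \<Longrightarrow> \<theta> k \<in> test_funs (ball (c k) (s (c k)))" "\<And>k x. k < m \<Longrightarrow> 0 \<le> \<theta> k x"
    "\<And>x. (\<Sum>k<m. \<theta> k x) \<le> 1" "\<And>x. x \<in> closure \<Omega> \<Longrightarrow> (\<Sum>k<m. \<theta> k x) = 1"
    by (rule smooth_partition_of_unity[OF cl s(1)], assumption, rule that; assumption)
  define d where "d j = inverse (real (Suc j))" for j
  have d: "d j > 0" for j by (simp add: d_def)
  \<comment> \<open>One kernel does both jobs: its support lies in \<open>ball 0 (d j)\<close>, so
    it approximates the identity, and in \<open>ball a \<tau>\<close>, so convolution moves the
    \<open>k\<close>-th piece into the domain.\<close>
  have "\<exists>\<kappa>. \<kappa> \<in> test_funs (ball 0 (d j)) \<and> (\<forall>x. 0 \<le> \<kappa> x) \<and> (\<integral>x. \<kappa> x \<partial>lborel) = 1 \<and>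
      (\<exists>a \<tau>. \<kappa> \<in> test_funs (ball a \<tau>) \<and> (\<forall>y\<in>\<Omega> \<inter> ball (c k) (s (c k)). ball (y + a) \<tau> \<subseteq> \<Omega>))" if k: "k < m" for k j
  proof -
    obtain a \<tau> where at: "\<tau> > 0" "norm a + \<tau> < d j" "\<forall>y\<in>\<Omega> \<inter> ball (c k) (s (c k)). ball (y + a) \<tau> \<subseteq> \<Omega>"
      using s(2)[OF c[OF k]] d[of j] unfolding push_def by blast
    obtain \<kappa> :: "real^'n \<Rightarrow> real" where \<kappa>: "\<kappa> \<in> test_funs (ball a \<tau>)" "\<And>x. 0 \<le> \<kappa> x" "(\<integral>x. \<kappa> x \<partial>lborel) = 1"
      using mollifier_exists[OF at(1), of a] by blast
    have "ball a \<tau> \<subseteq> ball 0 (d j)" using at(2) by (intro ball_subset_ball) (simp add: dist_norm)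
    then have "\<kappa> \<in> test_funs (ball 0 (d j))" using \<kappa>(1) test_funs_mono by blast
    with \<kappa> at(3) show ?thesis by blast
  qed
  then have "\<forall>k j. \<exists>\<kappa>. k < m \<longrightarrow> \<kappa> \<in> test_funs (ball 0 (d j)) \<and> (\<forall>x. 0 \<le> \<kappa> x) \<and> (\<integral>x. \<kappa> x \<partial>lborel) = 1 \<and>
      (\<exists>a \<tau>. \<kappa> \<in> test_funs (ball a \<tau>) \<and> (\<forall>y\<in>\<Omega> \<inter> ball (c k) (s (c k)). ball (y + a) \<tau> \<subseteq> \<Omega>))" by blast
  then obtain \<kappa> where \<kappa>': "\<And>k j. k < m \<Longrightarrow> \<kappa> k j \<in> test_funs (ball 0 (d j)) \<and> (\<forall>x. 0 \<le> \<kappa> k j x) \<and> (\<integral>x. \<kappa> k j x \<partial>lborel) = 1 \<and>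
      (\<exists>a \<tau>. \<kappa> k j \<in> test_funs (ball a \<tau>) \<and> (\<forall>y\<in>\<Omega> \<inter> ball (c k) (s (c k)). ball (y + a) \<tau> \<subseteq> \<Omega>))" by metis
  have \<kappa>: "\<kappa> k j \<in> test_funs (ball 0 (d j))" "\<And>x. 0 \<le> \<kappa> k j x" "(\<integral>x. \<kappa> k j x \<partial>lborel) = 1" if "k < m" for k j
    using \<kappa>'[OF that] by auto
  have \<theta>m: "\<theta> k \<in> borel_measurable borel" if "k < m" for k using test_funsD(6)[OF \<theta>(1)[OF that]] .
  have \<theta>le: "\<bar>\<theta> k x\<bar> \<le> 1" if "k < m" for k x
  proof -
    have "\<theta> k x \<le> (\<Sum>k<m. \<theta> k x)" using that \<theta>(2) by (intro member_le_sum) auto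
    then show ?thesis using \<theta>(2)[OF that, of x] \<theta>(3)[of x] by linarith
  qed
  have sq: "(\<lambda>y. \<theta> k y * F y) \<in> sqint lborel" if "k < m" "F \<in> sqint lborel" for k F
    by (rule sqint_bounded_mult[OF that(2), of _ 1]) (use \<theta>m[OF that(1)] \<theta>le[OF that(1)] in auto)
  have int: "integrable lborel F" if "F \<in> sqint lborel" "\<And>x. x \<notin> \<Omega> \<Longrightarrow> F x = 0" for F :: "real^'n \<Rightarrow> real"
    by (rule sqint_support_integrable[OF that(1), of R]) (use that(2) R in blast)
  define F where "F k l y = \<theta> k y * \<mu> l y" for k l y
  have Fs: "F k l \<in> sqint lborel" if "k < m" for k l unfolding F_def by (rule sq[OF that \<mu>(2)])
  have F0: "F k l x = 0" if "x \<notin> \<Omega>" for k l x using \<mu>(3)[OF that] by (simp add: F_def)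
  have Fi: "integrable lborel (F k l)" if "k < m" for k l by (rule int[OF Fs[OF that] F0])
  \<comment> \<open>The factor -1 turns the divergence \<open>- g\<close> of the extended field into
    \<open>g\<close>.\<close>
  define \<Phi> where "\<Phi> j x = (\<chi> l. \<Sum>k<m. (- 1) * conv (\<kappa> k j) (F k l) x)" for j x
  have \<Phi>_comp: "(\<lambda>x. \<Phi> j x $ l) = (\<lambda>x. \<Sum>k<m. (- 1) * conv (\<kappa> k j) (F k l) x)" for j l
    by (simp add: \<Phi>_def)
  have conv_tf: "conv (\<kappa> k j) (F k l) \<in> test_funs \<Omega>" if k: "k < m" for k j l
  proof -
    obtain a \<tau> where at: "\<kappa> k j \<in> test_funs (ball a \<tau>)" "\<And>y. y \<in> \<Omega> \<inter> ball (c k) (s (c k)) \<Longrightarrow> ball (y + a) \<tau> \<subseteq> \<Omega>"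
      using \<kappa>'[OF k] by blast
    let ?S = "closure (\<Omega> \<inter> ball (c k) (s (c k)))" and ?T = "closure {x. \<kappa> k j x \<noteq> 0}"
    \<comment> \<open>The support of the kernel is compact in an open ball. This slack lets a point
      \<open>y\<close> of the closure be replaced by a nearby \<open>y'\<close> of the set itself,
      for which the push is known.\<close>
    let ?K = "{y + z |y z. y \<in> ?S \<and> z \<in> ?T}"
    show ?thesis
    proof (rule test_funsI)
      show "Ck i (conv (\<kappa> k j) (F k l))" for i by (rule Ck_conv[OF at(1) Fi[OF k]])
      have "compact ?S" by (intro compact_closure[THEN iffD2] bounded_Int) simp
      then show "compact ?K" using test_funsD(2)[OF at(1)] by (rule compact_sums)
      show "?K \<subseteq> \<Omega>"
      proof clarify
        fix y z assume y: "y \<in> ?S" and z: "z \<in> ?T"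
        have "z \<in> ball a \<tau>" using z test_funsD(3)[OF at(1)] by blast
        then have z': "norm (z - a) < \<tau>" by (simp add: dist_norm norm_minus_commute)
        then obtain y' where y': "y' \<in> \<Omega> \<inter> ball (c k) (s (c k))" "dist y' y < \<tau> - norm (z - a)"
          using y closure_approachable[of y] by (metis diff_gt_0_iff_gt)
        have "dist (y' + a) (y + z) \<le> dist y' y + norm (z - a)"
          using norm_triangle_ineq[of "y' - y" "a - z"] by (simp add: dist_norm norm_minus_commute algebra_simps)
        then have "y + z \<in> ball (y' + a) \<tau>" using y'(2) by simp
        then show "y + z \<in> \<Omega>" using at(2)[OF y'(1)] by blast
      qed
      show "conv (\<kappa> k j) (F k l) x = 0" if x: "x \<notin> ?K" for x
      proof (rule conv_eq_0, rule ccontr)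
        fix y assume 1: "\<kappa> k j (x - y) \<noteq> 0" and 2: "F k l y \<noteq> 0"
        have "y \<in> \<Omega>" using 2 F0 by blast
        moreover have "y \<in> ball (c k) (s (c k))" using 2 test_funsD(4)[OF \<theta>(1)[OF k]] by (auto simp: F_def)
        ultimately have "y \<in> \<Omega> \<inter> ball (c k) (s (c k))" by blast
        then have "y \<in> ?S" by (rule subsetD[OF closure_subset])
        moreover have "x - y \<in> {x. \<kappa> k j x \<noteq> 0}" using 1 by simp
        then have "x - y \<in> ?T" by (rule subsetD[OF closure_subset])
        moreover have "x = y + (x - y)" by simp
        ultimately have "x \<in> ?K" by blast
        then show False by (rule notE[OF x])
      qed
    qed
  qed
  have \<Phi>_tf: "\<Phi> j \<in> test_fields \<Omega>" for j
    unfolding test_fields_def mem_Collect_eq \<Phi>_comp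
    by (intro allI test_funs_sum test_funs_cmult conv_tf) auto
  have \<theta>i: "integrable lborel (\<theta> k)" if "k < m" for k by (rule test_funs_integrable[OF \<theta>(1)[OF that]])
  \<comment> \<open>Each mollified piece is bounded by the mollified \<open>\<theta> k\<close>,
    hence by \<open>\<theta> k\<close> plus a small error, and these bounds add up to at most
    \<open>1 + \<eta>\<close> although the kernels differ. Taking the inner product with a vector of
    length at most 1 first preserves the Euclidean bound on the field.\<close>
  have unif: "\<exists>J. \<forall>j\<ge>J. \<forall>x. norm (\<Phi> j x) \<le> 1 + \<eta>" if \<eta>: "\<eta> > 0" for \<eta>
  proof -
    define \<eta>' where "\<eta>' = \<eta> / real (m + 1)"
    have \<eta>': "\<eta>' > 0" "real m * \<eta>' \<le> \<eta>" using \<eta> by (auto simp: \<eta>'_def field_simps)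
    have "\<exists>e>0. \<forall>x z. norm z < e \<longrightarrow> \<theta> k (x - z) \<le> \<theta> k x + \<eta>'" if k: "k < m" for k
    proof -
      obtain r where "\<And>x. x \<notin> cball 0 r \<Longrightarrow> \<theta> k x = 0" using test_funs_support_cball[OF \<theta>(1)[OF k]] by blast
      then have "uniformly_continuous_on UNIV (\<theta> k)"
        by (rule compact_support_uniformly_continuous[OF test_funsD(5)[OF \<theta>(1)[OF k]]])
      then obtain e where e: "e > 0" "\<And>x y. dist y x < e \<Longrightarrow> dist (\<theta> k y) (\<theta> k x) < \<eta>'"
        using \<eta>'(1) unfolding uniformly_continuous_on_def by (metis UNIV_I)
      have "\<theta> k (x - z) \<le> \<theta> k x + \<eta>'" if "norm z < e" for x z
        using e(2)[of "x - z" x] that by (simp add: dist_norm)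
      with e(1) show ?thesis by blast
    qed
    then obtain e where e: "\<And>k. k < m \<Longrightarrow> e k > 0" "\<And>k x z. k < m \<Longrightarrow> norm z < e k \<Longrightarrow> \<theta> k (x - z) \<le> \<theta> k x + \<eta>'" by metis
    have dlim: "d \<longlonglongrightarrow> 0" unfolding d_def by (rule LIMSEQ_inverse_real_of_nat)
    have "\<forall>k\<in>{..<m}. \<forall>\<^sub>F j in sequentially. d j < e k"
      using e(1) order_tendstoD(2)[OF dlim] by blast
    then have "\<forall>\<^sub>F j in sequentially. \<forall>k\<in>{..<m}. d j < e k" by (intro eventually_ball_finite) auto
    then obtain J where J: "\<And>j k. j \<ge> J \<Longrightarrow> k < m \<Longrightarrow> d j < e k" unfolding eventually_sequentially by blast
    have "norm (\<Phi> j x) \<le> 1 + \<eta>" if j: "j \<ge> J" for j x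
    proof (rule norm_leI_inner)
      fix p :: "real^'n" assume p: "norm p \<le> 1"
      have cb: "(\<Sum>l\<in>UNIV. (- p $ l) * conv (\<kappa> k j) (F k l) x) \<le> \<theta> k x + \<eta>'" if k: "k < m" for k
      proof -
        have iF: "integrable lborel (\<lambda>y. \<kappa> k j (x - y) * F k l y)" for l by (rule conv_integrable[OF \<kappa>(1)[OF k] Fi[OF k]])
        have i\<theta>: "integrable lborel (\<lambda>y. \<kappa> k j (x - y) * \<theta> k y)" by (rule conv_integrable[OF \<kappa>(1)[OF k] \<theta>i[OF k]])
        have "(\<Sum>l\<in>UNIV. (- p $ l) * conv (\<kappa> k j) (F k l) x) = (\<integral>y. (\<Sum>l\<in>UNIV. (- p $ l) * (\<kappa> k j (x - y) * F k l y)) \<partial>lborel)"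
          unfolding conv_def using iF by (subst Bochner_Integration.integral_sum) auto
        also have "\<dots> \<le> (\<integral>y. \<kappa> k j (x - y) * \<theta> k y \<partial>lborel)"
        proof (rule integral_mono_AE)
          show "integrable lborel (\<lambda>y. \<Sum>l\<in>UNIV. (- p $ l) * (\<kappa> k j (x - y) * F k l y))"
            using iF by (intro Bochner_Integration.integrable_sum integrable_mult_right)
          show "AE y in lborel. (\<Sum>l\<in>UNIV. (- p $ l) * (\<kappa> k j (x - y) * F k l y)) \<le> \<kappa> k j (x - y) * \<theta> k y"
            using \<mu>1
          proof eventually_elim
            case (elim y)
            have "(\<Sum>l\<in>UNIV. (- p $ l) * (\<kappa> k j (x - y) * F k l y)) = (\<kappa> k j (x - y) * \<theta> k y) * ((- p) \<bullet> (\<chi> l. \<mu> l y))"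
              by (simp add: F_def inner_vec_def sum_distrib_left algebra_simps)
            also have "\<dots> \<le> (\<kappa> k j (x - y) * \<theta> k y) * 1"
            proof (rule mult_left_mono)
              have "(- p) \<bullet> (\<chi> l. \<mu> l y) \<le> norm (- p) * norm (\<chi> l. \<mu> l y)" by (rule norm_cauchy_schwarz)
              also have "\<dots> \<le> 1 * 1" using p elim by (intro mult_mono) auto
              finally show "(- p) \<bullet> (\<chi> l. \<mu> l y) \<le> 1" by simp
              show "0 \<le> \<kappa> k j (x - y) * \<theta> k y" using \<kappa>(2)[OF k] \<theta>(2)[OF k] by simp
            qed
            finally show ?case by simp
          qed
        qed (rule i\<theta>)
        also have "\<dots> = conv (\<kappa> k j) (\<theta> k) x" by (simp add: conv_def)
        also have "\<dots> \<le> \<theta> k x + \<eta>'"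
        proof (rule conv_mono_const(1)[OF \<kappa>(1)[OF k] \<kappa>(2)[OF k] \<kappa>(3)[OF k] \<theta>i[OF k] \<theta>m[OF k]])
          fix z assume "\<kappa> k j z \<noteq> 0"
          then have "norm z < d j" using test_funsD(4)[OF \<kappa>(1)[OF k], of z j] by (auto simp: dist_norm)
          also have "\<dots> < e k" by (rule J[OF j k])
          finally show "\<theta> k (x - z) \<le> \<theta> k x + \<eta>'" by (rule e(2)[OF k])
        qed
        finally show ?thesis .
      qed
      have "p \<bullet> \<Phi> j x = (\<Sum>k<m. \<Sum>l\<in>UNIV. (- p $ l) * conv (\<kappa> k j) (F k l) x)"
        unfolding inner_vec_def \<Phi>_def by (subst sum.swap) (simp add: sum_distrib_left)
      also have "\<dots> \<le> (\<Sum>k<m. \<theta> k x + \<eta>')" by (rule sum_mono) (use cb in auto)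
      also have "\<dots> = (\<Sum>k<m. \<theta> k x) + real m * \<eta>'" by (simp add: sum.distrib)
      also have "\<dots> \<le> 1 + \<eta>" using \<theta>(3)[of x] \<eta>'(2) by linarith
      finally show "p \<bullet> \<Phi> j x \<le> 1 + \<eta>" .
    qed
    then show ?thesis by blast
  qed
  \<comment> \<open>The commutator that arises from differentiating the partition of unity. Its sum
    over \<open>k\<close> vanishes in the domain, because the \<open>\<theta> k\<close> sum to 1
    there.\<close>
  define H where "H k y = (\<Sum>l\<in>UNIV. pd l (\<theta> k) y * \<mu> l y)" for k y
  define G where "G k y = \<theta> k y * g y" for k y
  have Gs: "G k \<in> sqint lborel" if "k < m" for k unfolding G_def by (rule sq[OF that g(2)])
  have G0: "G k x = 0" if "x \<notin> \<Omega>" for k x using g(3)[OF that] by (simp add: G_def)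
  have Hs: "H k \<in> sqint lborel" if k: "k < m" for k
  proof -
    have hs: "(\<lambda>y. pd l (\<theta> k) y * \<mu> l y) \<in> sqint lborel" for l
    proof -
      have t: "pd l (\<theta> k) \<in> test_funs (ball (c k) (s (c k)))" by (rule test_funs_pd[OF \<theta>(1)[OF k]])
      obtain B where "\<And>x. \<bar>pd l (\<theta> k) x\<bar> \<le> B" using test_funs_bounded[OF t] by blast
      then show ?thesis using test_funsD(6)[OF t] by (intro sqint_bounded_mult[OF \<mu>(2)]) auto
    qed
    have "(\<lambda>y. \<Sum>l\<in>A. pd l (\<theta> k) y * \<mu> l y) \<in> sqint lborel" if "finite A" for A
      using that by (induction A rule: finite_induct) (auto intro: sqint_zero sqint_add[OF hs])
    then show ?thesis unfolding H_def by simp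
  qed
  have H0: "H k x = 0" if "x \<notin> \<Omega>" for k x using \<mu>(3)[OF that] by (simp add: H_def)
  have Hi: "integrable lborel (H k)" and Gi: "integrable lborel (G k)" if "k < m" for k
    using int[OF Hs[OF that] H0] int[OF Gs[OF that] G0] by auto
  \<comment> \<open>The weak equation tested with the product of the reflected kernel and
    \<open>\<theta> k\<close>, a test function on the whole space that need not vanish at the
    boundary of the domain.\<close>
  have key: "(\<Sum>l\<in>UNIV. conv (pd l (\<kappa> k j)) (F k l) x) = conv (\<kappa> k j) (H k) x - conv (\<kappa> k j) (G k) x" if k: "k < m" for k j x
  proof -
    let ?w = "\<lambda>y. \<kappa> k j (x - y) * \<theta> k y"
    have w: "?w \<in> test_funs UNIV"
      using test_funs_mono[OF subset_UNIV \<theta>(1)[OF k]] Ck_reflect[OF test_funsD(1)[OF \<kappa>(1)[OF k]]]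
      by (intro test_funs_mult) auto
    have pdw: "pd l ?w y = \<kappa> k j (x - y) * pd l (\<theta> k) y - pd l (\<kappa> k j) (x - y) * \<theta> k y" for l y
      using pd_mult[of "\<lambda>y. \<kappa> k j (x - y)" y "\<theta> k" l] test_funsD(7)[OF \<theta>(1)[OF k]]
        Ck_differentiable[OF Ck_reflect[OF test_funsD(1)[OF \<kappa>(1)[OF k], of "Suc 0"]]]
        pd_reflect[OF test_funsD(1)[OF \<kappa>(1)[OF k], of "Suc 0"]] by simp
    have i1: "integrable lborel (\<lambda>y. pd l (\<kappa> k j) (x - y) * F k l y)" for l
      by (rule conv_integrable[OF test_funs_pd[OF \<kappa>(1)[OF k]] Fi[OF k]])
    have i2: "integrable lborel (\<lambda>y. \<kappa> k j (x - y) * H k y)" by (rule conv_integrable[OF \<kappa>(1)[OF k] Hi[OF k]])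
    have "(\<integral>y. (\<Sum>l\<in>UNIV. \<mu> l y * pd l ?w y) \<partial>lborel) = (\<integral>y. \<kappa> k j (x - y) * H k y - (\<Sum>l\<in>UNIV. pd l (\<kappa> k j) (x - y) * F k l y) \<partial>lborel)"
      by (rule Bochner_Integration.integral_cong)
         (simp_all only: pdw H_def F_def sum_distrib_left sum_subtractf[symmetric] refl, auto intro!: sum.cong simp: algebra_simps)
    also have "\<dots> = conv (\<kappa> k j) (H k) x - (\<Sum>l\<in>UNIV. conv (pd l (\<kappa> k j)) (F k l) x)"
      using i1 i2 by (simp add: conv_def Bochner_Integration.integral_sum)
    also have "(\<integral>y. (\<Sum>l\<in>UNIV. \<mu> l y * pd l ?w y) \<partial>lborel) = conv (\<kappa> k j) (G k) x"
      unfolding weak[OF w] by (simp add: conv_def G_def mult_ac)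
    finally show ?thesis by simp
  qed
  have div\<Phi>: "divg (\<Phi> j) x = (\<Sum>k<m. conv (\<kappa> k j) (G k) x - conv (\<kappa> k j) (H k) x)" for j x
  proof -
    have df: "conv (\<kappa> k j) (F k l) differentiable (at x)" if "k < m" for k l
      by (rule test_funsD(7)[OF conv_tf[OF that]])
    have "pd l (\<lambda>x. \<Phi> j x $ l) x = (\<Sum>k<m. (- 1) * conv (pd l (\<kappa> k j)) (F k l) x)" for l
    proof -
      have "pd l (\<lambda>x. \<Phi> j x $ l) x = (\<Sum>k<m. pd l (\<lambda>x. (- 1) * conv (\<kappa> k j) (F k l) x) x)"
        unfolding \<Phi>_comp by (rule pd_sum) (use df in \<open>auto intro!: differentiable_mult\<close>)
      also have "\<dots> = (\<Sum>k<m. (- 1) * conv (pd l (\<kappa> k j)) (F k l) x)"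
      proof (rule sum.cong[OF refl])
        fix k assume "k \<in> {..<m}"
        then have k: "k < m" by simp
        show "pd l (\<lambda>x. (- 1) * conv (\<kappa> k j) (F k l) x) x = (- 1) * conv (pd l (\<kappa> k j)) (F k l) x"
          by (subst pd_cmult[OF df[OF k]]) (simp add: pd_conv[OF \<kappa>(1)[OF k] Fi[OF k]])
      qed
      finally show ?thesis .
    qed
    then have "divg (\<Phi> j) x = (\<Sum>k<m. - (\<Sum>l\<in>UNIV. conv (pd l (\<kappa> k j)) (F k l) x))"
      unfolding divg_def by (simp add: sum.swap[of _ "{..<m}"] sum_negf)
    also have "\<dots> = (\<Sum>k<m. conv (\<kappa> k j) (G k) x - conv (\<kappa> k j) (H k) x)"
      by (rule sum.cong) (auto simp: key)
    finally show ?thesis .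
  qed
  have vi: "integrable lborel (\<lambda>x. v x * conv (\<kappa> k j) h x)" if "k < m" "h \<in> sqint lborel" "integrable lborel h" for k j h
    by (rule sqint_mult_integrable[OF v(2) nrm_conv_le(1)[OF \<kappa>(1)[OF that(1)] \<kappa>(2)[OF that(1)] \<kappa>(3)[OF that(1)] that(3,2)]])
  have "(\<integral>x. v x * divg (\<Phi> j) x \<partial>lborel) = (\<Sum>k<m. (\<integral>x. v x * conv (\<kappa> k j) (G k) x \<partial>lborel) - (\<integral>x. v x * conv (\<kappa> k j) (H k) x \<partial>lborel))" for j
  proof -
    have "(\<integral>x. v x * divg (\<Phi> j) x \<partial>lborel) = (\<integral>x. (\<Sum>k<m. v x * conv (\<kappa> k j) (G k) x - v x * conv (\<kappa> k j) (H k) x) \<partial>lborel)"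
      by (simp add: div\<Phi> sum_distrib_left right_diff_distrib)
    also have "\<dots> = (\<Sum>k<m. (\<integral>x. v x * conv (\<kappa> k j) (G k) x - v x * conv (\<kappa> k j) (H k) x \<partial>lborel))"
      by (rule Bochner_Integration.integral_sum) (use vi Gs Gi Hs Hi in auto)
    also have "\<dots> = (\<Sum>k<m. (\<integral>x. v x * conv (\<kappa> k j) (G k) x \<partial>lborel) - (\<integral>x. v x * conv (\<kappa> k j) (H k) x \<partial>lborel))"
      by (rule sum.cong[OF refl], rule Bochner_Integration.integral_diff) (use vi Gs Gi Hs Hi in auto)
    finally show ?thesis .
  qed
  moreover have "(\<lambda>j. \<Sum>k<m. (\<integral>x. v x * conv (\<kappa> k j) (G k) x \<partial>lborel) - (\<integral>x. v x * conv (\<kappa> k j) (H k) x \<partial>lborel))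
      \<longlonglongrightarrow> (\<Sum>k<m. (\<integral>x. v x * G k x \<partial>lborel) - (\<integral>x. v x * H k x \<partial>lborel))"
  proof (intro tendsto_sum tendsto_diff)
    fix k assume "k \<in> {..<m}"
    then have k: "k < m" by simp
    have off: "v x = 0" "G k x = 0" "H k x = 0" if "x \<notin> cball 0 R" for x
    proof -
      have "x \<notin> \<Omega>" using that R(2) by blast
      then show "v x = 0" "G k x = 0" "H k x = 0" using v(3) G0 H0 by blast+
    qed
    have dlim: "d \<longlonglongrightarrow> 0" unfolding d_def by (rule LIMSEQ_inverse_real_of_nat)
    note ct = conv_tendsto_weakly[where k = "\<kappa> k" and d = d and v = v and R = R,
      OF \<kappa>(1)[OF k] \<kappa>(2)[OF k] \<kappa>(3)[OF k] dlim v(2) off(1)]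
    show "(\<lambda>j. \<integral>x. v x * conv (\<kappa> k j) (G k) x \<partial>lborel) \<longlonglongrightarrow> (\<integral>x. v x * G k x \<partial>lborel)"
      by (rule ct[OF _ Gs[OF k] off(2)])
    show "(\<lambda>j. \<integral>x. v x * conv (\<kappa> k j) (H k) x \<partial>lborel) \<longlonglongrightarrow> (\<integral>x. v x * H k x \<partial>lborel)"
      by (rule ct[OF _ Hs[OF k] off(3)])
  qed
  moreover have "(\<Sum>k<m. (\<integral>x. v x * G k x \<partial>lborel) - (\<integral>x. v x * H k x \<partial>lborel)) = (\<integral>x. v x * g x \<partial>lborel)"
  proof -
    have "(\<Sum>k<m. (\<integral>x. v x * G k x \<partial>lborel) - (\<integral>x. v x * H k x \<partial>lborel)) = (\<integral>x. (\<Sum>k<m. v x * G k x - v x * H k x) \<partial>lborel)"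
      by (subst Bochner_Integration.integral_sum)
         (use sqint_mult_integrable[OF v(2) Gs] sqint_mult_integrable[OF v(2) Hs] in auto)
    also have "\<dots> = (\<integral>x. v x * g x \<partial>lborel)"
    proof (rule Bochner_Integration.integral_cong[OF refl])
      fix x
      show "(\<Sum>k<m. v x * G k x - v x * H k x) = v x * g x"
      proof (cases "x \<in> \<Omega>")
        case True
        have 1: "(\<Sum>k<m. \<theta> k y) = 1" if "y \<in> \<Omega>" for y using that \<theta>(4) closure_subset by blast
        have "(\<Sum>k<m. pd l (\<theta> k) x) = 0" for l
          using pd_sum[of "{..<m}" \<theta> x l] test_funsD(7)[OF \<theta>(1)]
            pd_eq_0_if_const_near[where i = l, OF \<Omega>(1) True 1] by simp
        then have "(\<Sum>k<m. H k x) = 0"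
          unfolding H_def by (subst sum.swap) (simp add: sum_distrib_right[symmetric])
        moreover have "(\<Sum>k<m. G k x) = g x" unfolding G_def by (simp add: sum_distrib_right[symmetric] 1[OF True])
        ultimately show ?thesis by (simp add: sum_subtractf sum_distrib_left[symmetric])
      qed (simp add: v(3))
    qed
    finally show ?thesis .
  qed
  ultimately have lim: "(\<lambda>j. \<integral>x. v x * divg (\<Phi> j) x \<partial>lborel) \<longlonglongrightarrow> (\<integral>x. v x * g x \<partial>lborel)" by simp
  \<comment> \<open>From some index on, \<open>\<Phi> j\<close> divided by \<open>1 + \<eta>\<close>
    is admissible for the seminorm.\<close>
  have le: "(\<integral>x. v x * g x \<partial>lborel) \<le> (1 + \<eta>) * BV_seminorm \<Omega> v" if \<eta>: "\<eta> > 0" for \<eta>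
  proof -
    obtain J where J: "\<forall>j\<ge>J. \<forall>x. norm (\<Phi> j x) \<le> 1 + \<eta>" using unif[OF \<eta>] by blast
    have "(\<integral>x. v x * divg (\<Phi> j) x \<partial>lborel) \<le> (1 + \<eta>) * BV_seminorm \<Omega> v" if "j \<ge> J" for j
    proof -
      have "(\<integral>x. v x * divg (\<Phi> j) x \<partial>lebesgue_on \<Omega>) = (\<integral>x. v x * divg (\<Phi> j) x \<partial>lborel)"
        using v \<Omega>(1) test_funsD(6)[OF divg_test_funs[OF \<Phi>_tf[of j]]] by (intro lebesgue_on_borel_integral) auto
      moreover have "(\<integral>x. v x * divg (\<Phi> j) x \<partial>lebesgue_on \<Omega>) \<le> (1 + \<eta>) * BV_seminorm \<Omega> v"
        using J that \<eta> by (intro BV_pairings_le[OF bdd \<Phi>_tf]) auto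
      ultimately show ?thesis by simp
    qed
    then show ?thesis using lim by (intro LIMSEQ_le_const2[OF lim]) blast
  qed
  show ?thesis
  proof (rule field_le_epsilon)
    fix e :: real assume e: "e > 0"
    let ?S = "BV_seminorm \<Omega> v"
    have S: "?S \<ge> 0" by (rule BV_seminorm_nonneg[OF bdd])
    have "(\<integral>x. v x * g x \<partial>lborel) \<le> (1 + e / (?S + 1)) * ?S" using e S by (intro le) auto
    also have "\<dots> = ?S + e * (?S / (?S + 1))" by (simp add: field_simps)
    also have "\<dots> \<le> ?S + e * 1" using e S by (intro add_left_mono mult_left_mono) (auto simp: field_simps)
    finally show "(\<integral>x. v x * g x \<partial>lborel) \<le> ?S + e" by simp
  qed
qed

subsection \<open>The dual field\<close>

lemma BV_pairings_AE_cong: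
  fixes u v :: "real^'n \<Rightarrow> real"
  assumes "u \<in> borel_measurable (lebesgue_on \<Omega>)" "v \<in> borel_measurable (lebesgue_on \<Omega>)"
    "AE x in lebesgue_on \<Omega>. u x = v x"
  shows "BV_pairings \<Omega> u = BV_pairings \<Omega> v"
proof -
  have "(\<integral>x. u x * divg \<phi> x \<partial>lebesgue_on \<Omega>) = (\<integral>x. v x * divg \<phi> x \<partial>lebesgue_on \<Omega>)" if "\<phi> \<in> test_fields \<Omega>" for \<phi>
  proof (rule integral_cong_AE)
    have [measurable]: "divg \<phi> \<in> borel_measurable (lebesgue_on \<Omega>)"
      using test_funsD(6)[OF divg_test_funs[OF that]] by (rule borel_measurable_lebesgue_on)
    show "(\<lambda>x. u x * divg \<phi> x) \<in> borel_measurable (lebesgue_on \<Omega>)"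
      "(\<lambda>x. v x * divg \<phi> x) \<in> borel_measurable (lebesgue_on \<Omega>)" using assms(1,2) by measurable
    show "AE x in lebesgue_on \<Omega>. u x * divg \<phi> x = v x * divg \<phi> x" using assms(3) by eventually_elim simp
  qed
  then show ?thesis unfolding BV_pairings_def by (intro Collect_cong ex_cong1) auto
qed

section \<open>Weak gradients of smooth functions, linearity and uniqueness\<close>

lemma test_funs_sqint:
  fixes w :: "real^'n \<Rightarrow> real"
  assumes "open \<Omega>" "bounded \<Omega>" "w \<in> test_funs S"
  shows "w \<in> sqint (lebesgue_on \<Omega>)"
proof -
  interpret finite_measure "lebesgue_on \<Omega>" using assms by (intro finite_measure_lebesgue_on_bounded) auto
  obtain B where "\<And>x. \<bar>w x\<bar> \<le> B" using test_funs_bounded[OF assms(3)] by blast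
  then show ?thesis
    by (rule sqint_boundedI[OF borel_measurable_lebesgue_on[OF test_funsD(6)[OF assms(3)]]])
qed

lemma test_funs_sqint_lborel:
  fixes w :: "real^'n \<Rightarrow> real"
  assumes "w \<in> test_funs S"
  shows "w \<in> sqint lborel"
  using test_funs_integrable[OF test_funs_mult[OF assms test_funsD(1)[OF assms]]] test_funsD(6)[OF assms]
  by (intro sqint_sqI) auto

lemma test_funs_has_weak_gradient:
  fixes w :: "real^'n \<Rightarrow> real"
  assumes \<Omega>: "open \<Omega>" "bounded \<Omega>" and w: "w \<in> test_funs S"
  shows "has_weak_gradient \<Omega> w (\<lambda>x. \<chi> i. pd i w x)"
  unfolding has_weak_gradient_def
proof (intro conjI allI ballI)
  show "(\<lambda>x. (\<chi> i. pd i w x) $ i) \<in> L2 \<Omega>" for i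
    using test_funs_sqint[OF \<Omega> test_funs_pd[OF w]] by (simp add: L2_eq)
  fix g i assume g: "g \<in> test_funs \<Omega>"
  have wg: "(\<lambda>x. w x * g x) \<in> test_funs \<Omega>" by (rule test_funs_mult[OF g test_funsD(1)[OF w]])
  have e: "pd i (\<lambda>x. w x * g x) x = w x * pd i g x + pd i w x * g x" for x
    by (rule pd_mult[OF test_funsD(7)[OF w] test_funsD(7)[OF g]])
  have i1: "integrable lborel (\<lambda>x. w x * pd i g x)"
    by (rule test_funs_integrable[OF test_funs_mult[OF test_funs_pd[OF g] test_funsD(1)[OF w]]])
  have i2: "integrable lborel (\<lambda>x. pd i w x * g x)"
    by (rule test_funs_integrable[OF test_funs_mult[OF g test_funsD(1)[OF test_funs_pd[OF w]]]])
  have "(\<integral>x. w x * pd i g x \<partial>lborel) + (\<integral>x. pd i w x * g x \<partial>lborel) = 0"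
    using integral_pd_eq_0[OF wg, of i] i1 i2 by (simp add: e)
  moreover have "(\<integral>x. w x * pd i g x \<partial>lebesgue_on \<Omega>) = (\<integral>x. w x * pd i g x \<partial>lborel)"
    using \<Omega>(1) test_funsD(6)[OF w] test_funsD(4,6)[OF test_funs_pd[OF g]]
    by (intro lebesgue_on_borel_integral) auto
  moreover have "(\<integral>x. pd i w x * g x \<partial>lebesgue_on \<Omega>) = (\<integral>x. pd i w x * g x \<partial>lborel)"
    using \<Omega>(1) test_funsD(6)[OF test_funs_pd[OF w]] test_funsD(4,6)[OF g]
    by (intro lebesgue_on_borel_integral) auto
  ultimately show "L2_inner \<Omega> w (pd i g) = - L2_inner \<Omega> (\<lambda>x. (\<chi> i. pd i w x) $ i) g"
    by (simp add: L2_inner_def)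
qed

lemma has_weak_gradient_lin:
  fixes v w :: "real^'n \<Rightarrow> real"
  assumes \<Omega>: "open \<Omega>" "bounded \<Omega>" and v: "v \<in> L2 \<Omega>" "has_weak_gradient \<Omega> v F" and w: "w \<in> L2 \<Omega>" "has_weak_gradient \<Omega> w G"
  shows "has_weak_gradient \<Omega> (\<lambda>x. a * v x + b * w x) (\<lambda>x. a *\<^sub>R F x + b *\<^sub>R G x)"
  unfolding has_weak_gradient_def
proof (intro conjI allI ballI)
  have F: "(\<lambda>x. F x $ i) \<in> sqint (lebesgue_on \<Omega>)" "(\<lambda>x. G x $ i) \<in> sqint (lebesgue_on \<Omega>)" for i
    using v w by (auto simp: has_weak_gradient_def L2_eq)
  show "(\<lambda>x. (a *\<^sub>R F x + b *\<^sub>R G x) $ i) \<in> L2 \<Omega>" for i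
    using sqint_lin[OF F] by (simp add: L2_eq)
  fix g i assume g: "g \<in> test_funs \<Omega>"
  have gs: "g \<in> sqint (lebesgue_on \<Omega>)" "pd i g \<in> sqint (lebesgue_on \<Omega>)"
    using test_funs_sqint[OF \<Omega>] g test_funs_pd by blast+
  show "L2_inner \<Omega> (\<lambda>x. a * v x + b * w x) (pd i g) = - L2_inner \<Omega> (\<lambda>x. (a *\<^sub>R F x + b *\<^sub>R G x) $ i) g"
    using v w g ip_lin[OF F gs(1)] ip_lin[OF _ _ gs(2), of v w a b]
    by (simp add: has_weak_gradient_def L2_eq)
qed

text \<open>The components of the difference are orthogonal to all test functions. Later arguments
  thus become independent of the gradient picked by \<open>weak_gradient\<close>.\<close>

lemma has_weak_gradient_unique:
  fixes u :: "real^'n \<Rightarrow> real"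
  assumes \<Omega>: "open \<Omega>" "bounded \<Omega>" and "has_weak_gradient \<Omega> u F" "has_weak_gradient \<Omega> u G"
  shows "AE x in lebesgue_on \<Omega>. F x = G x"
proof -
  have F: "(\<lambda>x. F x $ i) \<in> sqint (lebesgue_on \<Omega>)" "(\<lambda>x. G x $ i) \<in> sqint (lebesgue_on \<Omega>)" for i
    using assms by (auto simp: has_weak_gradient_def L2_eq)
  have "AE x in lebesgue_on \<Omega>. F x $ i - G x $ i = 0" for i
  proof (rule sqint_eq_0_if_orthogonal_test_funs[OF \<Omega> sqint_diff[OF F]])
    fix g assume g: "g \<in> test_funs \<Omega>"
    have "ip (lebesgue_on \<Omega>) (\<lambda>x. F x $ i - G x $ i) g = 0"
      using assms(3,4) g ip_diff[OF F test_funs_sqint[OF \<Omega> g], of i i]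
      by (auto simp: has_weak_gradient_def L2_eq)
    then show "(\<integral>x. g x * (F x $ i - G x $ i) \<partial>lebesgue_on \<Omega>) = 0" by (simp add: ip_def mult.commute)
  qed
  then have "AE x in lebesgue_on \<Omega>. \<forall>i. F x $ i = G x $ i" unfolding AE_all_countable by simp
  then show ?thesis by eventually_elim (simp add: vec_eq_iff)
qed

lemma borel_measurable_vec:
  fixes F :: "'a \<Rightarrow> real^'n"
  assumes "\<And>i. (\<lambda>x. F x $ i) \<in> borel_measurable M"
  shows "F \<in> borel_measurable M"
  unfolding borel_measurable_euclidean_space[of F]
  using assms by (auto simp: Basis_vec_def inner_axis)

section \<open>Functionals bounded by the L1 norm of a field\<close>

context finite_measure
begin

lemma sqint_norm_field:
  fixes F :: "'a \<Rightarrow> real^'n"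
  assumes F: "\<And>i. (\<lambda>x. F x $ i) \<in> sqint M"
  shows "(\<lambda>x. norm (F x)) \<in> sqint M" "integrable M (\<lambda>x. norm (F x))"
proof -
  have m: "F \<in> borel_measurable M" by (rule borel_measurable_vec) (use F in measurable)
  have "(\<lambda>x. \<Sum>i\<in>A. \<bar>F x $ i\<bar>) \<in> sqint M" if "finite A" for A
    using that by (induction A rule: finite_induct) (auto intro: sqint_zero sqint_add[OF sqint_abs[OF F]])
  then have "(\<lambda>x. \<Sum>i\<in>UNIV. \<bar>F x $ i\<bar>) \<in> sqint M" by simp
  then show 1: "(\<lambda>x. norm (F x)) \<in> sqint M"
    by (rule sqint_bound) (use m norm_le_l1_cart in \<open>auto simp: sum_nonneg abs_of_nonneg\<close>)
  then show "integrable M (\<lambda>x. norm (F x))" by (rule sqint_integrable)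
qed

text \<open>An L1 bound is also an L2 bound on a finite measure space, so each component has a Riesz
  representative. The sharp Euclidean bound 1 then comes from a single test field.\<close>

lemma L1_bounded_functional_field:
  fixes \<xi> :: "('a \<Rightarrow> real^'n) \<Rightarrow> real"
  defines "V \<equiv> {F. \<forall>i. (\<lambda>x. F x $ i) \<in> sqint M}"
  assumes lin: "\<And>F G a b. F \<in> V \<Longrightarrow> G \<in> V \<Longrightarrow> \<xi> (\<lambda>x. a *\<^sub>R F x + b *\<^sub>R G x) = a * \<xi> F + b * \<xi> G"
    and le: "\<And>F. F \<in> V \<Longrightarrow> \<xi> F \<le> (\<integral>x. norm (F x) \<partial>M)"
  obtains \<mu> where "\<mu> \<in> V" "AE x in M. norm (\<mu> x) \<le> 1" "\<And>F. F \<in> V \<Longrightarrow> \<xi> F = (\<integral>x. \<mu> x \<bullet> F x \<partial>M)"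
proof -
  define E where "E i f x = f x *\<^sub>R (axis i 1 :: real^'n)" for i and f :: "'a \<Rightarrow> real" and x
  have EV: "E i f \<in> V" if "f \<in> sqint M" for i f
  proof -
    have "(\<lambda>x. E i f x $ j) = (if i = j then f else (\<lambda>_. 0))" for j
      by (auto simp: E_def axis_def)
    then show ?thesis using that by (auto simp: V_def sqint_zero)
  qed
  have El: "E i (\<lambda>x. a * f x + b * h x) = (\<lambda>x. a *\<^sub>R E i f x + b *\<^sub>R E i h x)" for i f h a b
    by (simp add: E_def fun_eq_iff scaleR_add_left)
  have "\<exists>g\<in>sqint M. \<forall>f\<in>sqint M. \<xi> (E i f) = ip M g f" for i
  proof -
    have "\<exists>g. g \<in> sqint M \<and> (\<forall>f. f \<in> sqint M \<longrightarrow> \<xi> (E i f) = ip M g f)"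
    proof (rule riesz_representation[where D = "\<lambda>f. \<xi> (E i f)" and C = "sqrt (measure M (space M))"])
      show "\<xi> (E i (\<lambda>x. a * u x + b * v x)) = a * \<xi> (E i u) + b * \<xi> (E i v)" if "u \<in> sqint M" "v \<in> sqint M" for u v a b
        unfolding El by (rule lin[OF EV[OF that(1)] EV[OF that(2)]])
      fix v assume v: "v \<in> sqint M"
      have "\<xi> (E i v) \<le> (\<integral>x. \<bar>v x\<bar> \<partial>M)" using le[OF EV[OF v, of i]] by (simp add: E_def)
      moreover have "- \<xi> (E i v) \<le> (\<integral>x. \<bar>v x\<bar> \<partial>M)"
      proof -
        have e: "E i (\<lambda>x. - v x) = (\<lambda>x. (-1) *\<^sub>R E i v x + 0 *\<^sub>R E i v x)" by (simp add: E_def fun_eq_iff)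
        have "- \<xi> (E i v) = \<xi> (E i (\<lambda>x. - v x))" unfolding e lin[OF EV[OF v] EV[OF v]] by simp
        also have "\<dots> \<le> (\<integral>x. \<bar>v x\<bar> \<partial>M)"
          using le[OF EV[OF sqint_cmult[OF v, of "-1"], of i]] by (simp add: E_def)
        finally show ?thesis .
      qed
      ultimately show "\<bar>\<xi> (E i v)\<bar> \<le> sqrt (measure M (space M)) * nrm M v"
        using integral_abs_le_nrm[OF v] by linarith
    qed blast
    then show ?thesis by blast
  qed
  then obtain m where m: "\<And>i. m i \<in> sqint M" "\<And>i f. f \<in> sqint M \<Longrightarrow> \<xi> (E i f) = ip M (m i) f" by metis
  define \<mu> where "\<mu> x = (\<chi> i. m i x)" for x
  have \<mu>V: "\<mu> \<in> V" using m(1) by (simp add: V_def \<mu>_def)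
  have VD: "(\<lambda>x. F x $ i) \<in> sqint M" if "F \<in> V" for F i using that by (simp add: V_def)
  have ii: "integrable M (\<lambda>x. m i x * F x $ i)" if "F \<in> V" for F i
    by (rule sqint_mult_integrable[OF m(1) VD[OF that]])
  have rep: "\<xi> F = (\<integral>x. \<mu> x \<bullet> F x \<partial>M)" if F: "F \<in> V" for F
  proof -
    have V0: "(\<lambda>_. 0) \<in> V" by (simp add: V_def sqint_zero)
    have ind: "(\<lambda>x. \<Sum>i\<in>A. E i (\<lambda>x. F x $ i) x) \<in> V \<and> \<xi> (\<lambda>x. \<Sum>i\<in>A. E i (\<lambda>x. F x $ i) x) = (\<Sum>i\<in>A. \<xi> (E i (\<lambda>x. F x $ i)))" if "finite A" for A
      using that
    proof (induction A rule: finite_induct)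
      case empty
      have "\<xi> (\<lambda>_. 0) = 0" using lin[OF V0 V0, of 0 0] by simp
      then show ?case using V0 by simp
    next
      case (insert i A)
      have e: "(\<lambda>x. \<Sum>j\<in>insert i A. E j (\<lambda>x. F x $ j) x) = (\<lambda>x. 1 *\<^sub>R E i (\<lambda>x. F x $ i) x + 1 *\<^sub>R (\<Sum>j\<in>A. E j (\<lambda>x. F x $ j) x))"
        using insert.hyps by (simp add: fun_eq_iff)
      have Ei: "E i (\<lambda>x. F x $ i) \<in> V" by (rule EV[OF VD[OF F]])
      have "(\<lambda>x. \<Sum>j\<in>insert i A. E j (\<lambda>x. F x $ j) x) \<in> V"
        using Ei insert.IH unfolding e by (auto simp: V_def intro: sqint_add)
      moreover have "\<xi> (\<lambda>x. \<Sum>j\<in>insert i A. E j (\<lambda>x. F x $ j) x) = (\<Sum>j\<in>insert i A. \<xi> (E j (\<lambda>x. F x $ j)))"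
        using insert lin[OF Ei, of "\<lambda>x. \<Sum>j\<in>A. E j (\<lambda>x. F x $ j) x" 1 1] by (simp add: e)
      ultimately show ?case ..
    qed
    have eq: "(\<lambda>x. \<Sum>i\<in>UNIV. E i (\<lambda>x. F x $ i) x) = F"
      by (simp add: E_def fun_eq_iff basis_expansion flip: scalar_mult_eq_scaleR)
    have "\<xi> F = (\<Sum>i\<in>UNIV. \<xi> (E i (\<lambda>x. F x $ i)))" using ind[OF finite[of UNIV]] unfolding eq by blast
    also have "\<dots> = (\<Sum>i\<in>UNIV. (\<integral>x. m i x * F x $ i \<partial>M))" using m(2)[OF VD[OF F]] by (simp add: ip_def)
    also have "\<dots> = (\<integral>x. (\<Sum>i\<in>UNIV. m i x * F x $ i) \<partial>M)"
      by (rule Bochner_Integration.integral_sum[symmetric]) (rule ii[OF F])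
    finally show ?thesis by (simp add: \<mu>_def inner_vec_def)
  qed
  have \<mu>m[measurable]: "\<mu> \<in> borel_measurable M" by (rule borel_measurable_vec) (use VD[OF \<mu>V] in measurable)
  define A where "A = {x \<in> space M. norm (\<mu> x) > 1}"
  have [measurable]: "A \<in> sets M" unfolding A_def by measurable
  \<comment> \<open>Where \<open>\<mu>\<close> is longer than 1, the functional would produce the
    square of its length against the permitted length itself; that set is therefore null.\<close>
  define F where "F x = indicator A x *\<^sub>R \<mu> x" for x
  have FV: "F \<in> V"
    unfolding V_def F_def using sqint_bounded_mult[OF VD[OF \<mu>V], of "indicator A" 1] by (auto simp: indicator_def)
  have i1: "integrable M (\<lambda>x. norm (F x))" by (rule sqint_norm_field(2)) (rule VD[OF FV])
  have i2: "integrable M (\<lambda>x. \<mu> x \<bullet> F x)"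
    unfolding inner_vec_def using ii[OF FV] by (simp add: \<mu>_def)
  have "(\<integral>x. \<mu> x \<bullet> F x - norm (F x) \<partial>M) \<le> 0" using le[OF FV] rep[OF FV] i1 i2 by simp
  moreover have eq: "\<mu> x \<bullet> F x - norm (F x) = indicator A x * (norm (\<mu> x) * (norm (\<mu> x) - 1))" for x
    by (simp add: F_def power2_norm_eq_inner[symmetric] power2_eq_square indicator_def right_diff_distrib)
  have nn: "0 \<le> \<mu> x \<bullet> F x - norm (F x)" for x unfolding eq by (auto simp: A_def indicator_def)
  have "0 \<le> (\<integral>x. \<mu> x \<bullet> F x - norm (F x) \<partial>M)" by (rule Bochner_Integration.integral_nonneg[OF nn])
  ultimately have "(\<integral>x. \<mu> x \<bullet> F x - norm (F x) \<partial>M) = 0" by linarith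
  then have "AE x in M. \<mu> x \<bullet> F x - norm (F x) = 0"
    using i1 i2 nn by (subst (asm) integral_nonneg_eq_0_iff_AE) auto
  then have "AE x in M. norm (\<mu> x) \<le> 1"
    using AE_space
  proof eventually_elim
    case (elim x)
    show ?case
    proof (rule ccontr)
      assume n: "\<not> norm (\<mu> x) \<le> 1"
      then have "x \<in> A" using elim by (simp add: A_def)
      then have "norm (\<mu> x) * (norm (\<mu> x) - 1) = 0" using elim(1) unfolding eq by simp
      with n show False by auto
    qed
  qed
  then show ?thesis using that[OF \<mu>V _ rep] by blast
qed

end

text \<open>The functional on gradients is given by its graph, since a gradient does not determine
  \<open>w\<close>. That \<open>L2_inner \<Omega> g w\<close> depends on the gradient alone follows
  from the domination \<open>le\<close>, inside \<open>hahn_banach\<close>.\<close>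

lemma dual_field_exists:
  fixes \<Omega> :: "(real^'n) set" and g :: "real^'n \<Rightarrow> real"
  assumes \<Omega>: "open \<Omega>" "bounded \<Omega>" and g: "g \<in> L2 \<Omega>"
    and le: "\<And>w G. w \<in> L2 \<Omega> \<Longrightarrow> has_weak_gradient \<Omega> w G \<Longrightarrow> L2_inner \<Omega> g w \<le> (\<integral>x. norm (G x) \<partial>lebesgue_on \<Omega>)"
  obtains \<mu> where "\<And>i. (\<lambda>x. \<mu> x $ i) \<in> L2 \<Omega>" "AE x in lebesgue_on \<Omega>. norm (\<mu> x) \<le> 1"
    "\<And>w G. w \<in> L2 \<Omega> \<Longrightarrow> has_weak_gradient \<Omega> w G \<Longrightarrow> (\<integral>x. \<mu> x \<bullet> G x \<partial>lebesgue_on \<Omega>) = L2_inner \<Omega> g w"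
proof -
  let ?M = "lebesgue_on \<Omega>"
  interpret finite_measure ?M using \<Omega> by (intro finite_measure_lebesgue_on_bounded) auto
  define V where "V = {F :: real^'n \<Rightarrow> real^'n. \<forall>i. (\<lambda>x. F x $ i) \<in> sqint ?M}"
  define p where "p F = (\<integral>x. norm (F x) \<partial>?M)" for F :: "real^'n \<Rightarrow> real^'n"
  define Gr where "Gr = {(F, L2_inner \<Omega> g w) | F w. w \<in> L2 \<Omega> \<and> has_weak_gradient \<Omega> w F}"
  have ni: "integrable ?M (\<lambda>x. norm (F x))" if "F \<in> V" for F
    by (rule sqint_norm_field(2)) (use that in \<open>simp add: V_def\<close>)
  obtain \<xi> where \<xi>: "\<And>F G a b. F \<in> V \<Longrightarrow> G \<in> V \<Longrightarrow> \<xi> (\<lambda>x. a *\<^sub>R F x + b *\<^sub>R G x) = a * \<xi> F + b * \<xi> G"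
    "\<And>F. F \<in> V \<Longrightarrow> \<xi> F \<le> p F" "\<And>F s. (F, s) \<in> Gr \<Longrightarrow> \<xi> F = s"
  proof (rule hahn_banach[of V p Gr])
    show VL: "(\<lambda>x. a *\<^sub>R F x + b *\<^sub>R G x) \<in> V" if "F \<in> V" "G \<in> V" for F G a b
      using that by (auto simp: V_def intro: sqint_lin)
    show "(\<lambda>_. 0) \<in> V" by (simp add: V_def sqint_zero)
    show "p (\<lambda>x. F x + G x) \<le> p F + p G" if "F \<in> V" "G \<in> V" for F G
    proof -
      have "p (\<lambda>x. F x + G x) \<le> (\<integral>x. norm (F x) + norm (G x) \<partial>?M)"
        unfolding p_def using ni[OF that(1)] ni[OF that(2)] ni[OF VL[OF that, of 1 1]]
        by (intro integral_mono) (auto intro: norm_triangle_ineq)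
      also have "\<dots> = p F + p G" unfolding p_def using ni that by simp
      finally show ?thesis .
    qed
    show "p (\<lambda>x. a *\<^sub>R F x) = a * p F" if "a \<ge> 0" for F a using that by (simp add: p_def)
    show "F \<in> V \<and> s \<le> p F" if "(F, s) \<in> Gr" for F s
      using that le by (auto simp: Gr_def V_def p_def has_weak_gradient_def L2_eq)
    show "(\<lambda>x. a *\<^sub>R F x + b *\<^sub>R G x, a * s + b * t) \<in> Gr" if "(F, s) \<in> Gr" "(G, t) \<in> Gr" for F s G t a b
    proof -
      obtain v w where v: "v \<in> L2 \<Omega>" "has_weak_gradient \<Omega> v F" "s = L2_inner \<Omega> g v"
        and w: "w \<in> L2 \<Omega>" "has_weak_gradient \<Omega> w G" "t = L2_inner \<Omega> g w" using \<open>(F, s) \<in> Gr\<close> \<open>(G, t) \<in> Gr\<close> unfolding Gr_def by blast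
      have "a * s + b * t = L2_inner \<Omega> g (\<lambda>x. a * v x + b * w x)"
        using v w g ip_lin_right[of v ?M w g a b] by (simp add: L2_eq)
      moreover have "(\<lambda>x. a * v x + b * w x) \<in> L2 \<Omega>" using v w by (simp add: L2_eq sqint_lin)
      ultimately show ?thesis using has_weak_gradient_lin[OF \<Omega> v(1,2) w(1,2), of a b] unfolding Gr_def by blast
    qed
    have "((\<lambda>x. \<chi> i. pd i (\<lambda>_. 0) x), L2_inner \<Omega> g (\<lambda>_. 0)) \<in> Gr"
      unfolding Gr_def using test_funs_has_weak_gradient[OF \<Omega> test_funs_0] by (auto simp: L2_eq sqint_zero)
    then show "Gr \<noteq> {}" by blast
  qed blast
  have \<xi>le: "\<xi> F \<le> (\<integral>x. norm (F x) \<partial>?M)" if "F \<in> V" for F using \<xi>(2)[OF that] by (simp add: p_def)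
  obtain \<mu> where \<mu>: "\<mu> \<in> V" "AE x in ?M. norm (\<mu> x) \<le> 1" "\<And>F. F \<in> V \<Longrightarrow> \<xi> F = (\<integral>x. \<mu> x \<bullet> F x \<partial>?M)"
    using L1_bounded_functional_field[of \<xi>] \<xi>(1) \<xi>le unfolding V_def by blast
  show ?thesis
  proof (rule that)
    show "(\<lambda>x. \<mu> x $ i) \<in> L2 \<Omega>" for i using \<mu>(1) by (simp add: V_def L2_eq)
    show "AE x in ?M. norm (\<mu> x) \<le> 1" by (rule \<mu>(2))
    fix w G assume w: "w \<in> L2 \<Omega>" "has_weak_gradient \<Omega> w G"
    then have "(G, L2_inner \<Omega> g w) \<in> Gr" unfolding Gr_def by blast
    moreover have "G \<in> V" using w by (simp add: V_def has_weak_gradient_def L2_eq)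
    ultimately show "(\<integral>x. \<mu> x \<bullet> G x \<partial>?M) = L2_inner \<Omega> g w" using \<mu>(3) \<xi>(3) by metis
  qed
qed

text \<open>All functions are replaced by Borel representatives that vanish outside the domain, so
  that the field becomes one on the whole space.\<close>

lemma dual_field_pairing_le:
  fixes \<Omega> :: "(real^'n) set" and g v :: "real^'n \<Rightarrow> real"
  assumes \<Omega>: "open \<Omega>" "bounded \<Omega>" "lipschitz_boundary \<Omega>" "\<Omega> \<noteq> {}" and g: "g \<in> L2 \<Omega>"
    and \<mu>: "\<And>i. (\<lambda>x. \<mu> x $ i) \<in> L2 \<Omega>" "AE x in lebesgue_on \<Omega>. norm (\<mu> x) \<le> 1"
    "\<And>w G. w \<in> L2 \<Omega> \<Longrightarrow> has_weak_gradient \<Omega> w G \<Longrightarrow> (\<integral>x. \<mu> x \<bullet> G x \<partial>lebesgue_on \<Omega>) = L2_inner \<Omega> g w"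
    and v: "v \<in> BV_L2 \<Omega>"
  shows "L2_inner \<Omega> g v \<le> BV_seminorm \<Omega> v"
proof -
  let ?M = "lebesgue_on \<Omega>"
  have S: "\<Omega> \<in> sets borel" using \<Omega>(1) by simp
  have v2: "v \<in> sqint ?M" and bdd: "bdd_above (BV_pairings \<Omega> v)" using v by (auto simp: BV_L2_def BV_def L2_eq)
  have g2: "g \<in> sqint ?M" and \<mu>2: "\<And>i. (\<lambda>x. \<mu> x $ i) \<in> sqint ?M" using g \<mu>(1) by (auto simp: L2_eq)
  obtain V where V: "V \<in> borel_measurable borel" "\<And>x. x \<notin> \<Omega> \<Longrightarrow> V x = 0" "AE x in ?M. V x = v x"
    "V \<in> sqint ?M" "V \<in> sqint lborel"
    "\<And>w. w \<in> borel_measurable ?M \<Longrightarrow> (\<integral>x. w x * v x \<partial>?M) = (\<integral>x. w x * V x \<partial>?M)"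
    "\<And>w. w \<in> borel_measurable borel \<Longrightarrow> (\<integral>x. w x * v x \<partial>?M) = (\<integral>x. w x * V x \<partial>lborel)"
    by (rule sqint_representative[OF S v2], rule that; assumption)
  obtain G where G: "G \<in> borel_measurable borel" "\<And>x. x \<notin> \<Omega> \<Longrightarrow> G x = 0" "AE x in ?M. G x = g x"
    "G \<in> sqint ?M" "G \<in> sqint lborel"
    "\<And>w. w \<in> borel_measurable ?M \<Longrightarrow> (\<integral>x. w x * g x \<partial>?M) = (\<integral>x. w x * G x \<partial>?M)"
    "\<And>w. w \<in> borel_measurable borel \<Longrightarrow> (\<integral>x. w x * g x \<partial>?M) = (\<integral>x. w x * G x \<partial>lborel)"
    by (rule sqint_representative[OF S g2], rule that; assumption)
  define Q where "Q l m \<longleftrightarrow> m \<in> borel_measurable borel \<and> (\<forall>x. x \<notin> \<Omega> \<longrightarrow> m x = 0) \<and> (AE x in ?M. m x = \<mu> x $ l) \<and> m \<in> sqint lborel \<and>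
    (\<forall>w. w \<in> borel_measurable borel \<longrightarrow> (\<integral>x. w x * \<mu> x $ l \<partial>?M) = (\<integral>x. w x * m x \<partial>lborel))" for l m
  have "\<exists>m. Q l m" for l
  proof -
    obtain U where U: "U \<in> borel_measurable borel" "\<And>x. x \<notin> \<Omega> \<Longrightarrow> U x = 0" "AE x in ?M. U x = \<mu> x $ l"
      "U \<in> sqint ?M" "U \<in> sqint lborel"
      "\<And>w. w \<in> borel_measurable ?M \<Longrightarrow> (\<integral>x. w x * \<mu> x $ l \<partial>?M) = (\<integral>x. w x * U x \<partial>?M)"
      "\<And>w. w \<in> borel_measurable borel \<Longrightarrow> (\<integral>x. w x * \<mu> x $ l \<partial>?M) = (\<integral>x. w x * U x \<partial>lborel)"
      by (rule sqint_representative[OF S \<mu>2[of l]], rule that; assumption)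
    show ?thesis
      unfolding Q_def
      by (rule exI[of _ U], intro conjI allI impI, rule U(1), erule U(2), rule U(3), rule U(5), erule U(7))
  qed
  then obtain m where Q: "\<And>l. Q l (m l)" by metis
  have m: "\<And>l. m l \<in> borel_measurable borel" "\<And>l x. x \<notin> \<Omega> \<Longrightarrow> m l x = 0" "\<And>l. AE x in ?M. m l x = \<mu> x $ l"
    "\<And>l. m l \<in> sqint lborel" "\<And>l w. w \<in> borel_measurable borel \<Longrightarrow> (\<integral>x. w x * \<mu> x $ l \<partial>?M) = (\<integral>x. w x * m l x \<partial>lborel)"
    using Q unfolding Q_def by blast+
  have BVeq: "BV_pairings \<Omega> V = BV_pairings \<Omega> v"
    by (rule BV_pairings_AE_cong[OF sqint_measurable[OF V(4)] sqint_measurable[OF v2] V(3)])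
  have "AE x in ?M. \<forall>l. m l x = \<mu> x $ l" unfolding AE_all_countable using m(3) by blast
  then have "AE x in ?M. norm (\<chi> l. m l x) \<le> 1"
    using \<mu>(2) by eventually_elim (simp add: vec_lambda_eta)
  then have "AE x in lebesgue. x \<in> \<Omega> \<longrightarrow> norm (\<chi> l. m l x) \<le> 1"
    using S by (subst (asm) AE_restrict_space_iff) auto
  then have m1: "AE x in lborel. norm (\<chi> l. m l x) \<le> 1"
    unfolding AE_completion_iff
  proof eventually_elim
    case (elim x)
    show ?case
    proof (cases "x \<in> \<Omega>")
      case False
      then have "(\<chi> l. m l x) = 0" using m(2) by (simp add: vec_eq_iff)
      then show ?thesis by simp
    qed (use elim in blast)
  qed
  \<comment> \<open>No boundary term appears although \<open>w\<close> need not vanish on the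
    boundary: its restriction is an H1 function, and \<open>\<mu>(3)\<close> holds for all of
    those.\<close>
  have weak: "(\<integral>x. (\<Sum>l\<in>UNIV. m l x * pd l w x) \<partial>lborel) = (\<integral>x. G x * w x \<partial>lborel)" if w: "w \<in> test_funs UNIV" for w
  proof -
    have pm: "pd l w \<in> borel_measurable borel" for l by (rule test_funsD(6)[OF test_funs_pd[OF w]])
    have i1: "integrable lborel (\<lambda>x. pd l w x * m l x)" for l
      by (rule sqint_mult_integrable[OF test_funs_sqint_lborel[OF test_funs_pd[OF w]] m(4)])
    have i2: "integrable ?M (\<lambda>x. \<mu> x $ l * pd l w x)" for l
      by (rule sqint_mult_integrable[OF \<mu>2 test_funs_sqint[OF \<Omega>(1,2) test_funs_pd[OF w]]])
    have "(\<integral>x. (\<Sum>l\<in>UNIV. m l x * pd l w x) \<partial>lborel) = (\<Sum>l\<in>UNIV. (\<integral>x. pd l w x * m l x \<partial>lborel))"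
      by (subst Bochner_Integration.integral_sum) (use i1 in \<open>auto simp: mult.commute\<close>)
    also have "\<dots> = (\<Sum>l\<in>UNIV. (\<integral>x. \<mu> x $ l * pd l w x \<partial>?M))"
      using m(5)[OF pm] by (simp add: mult.commute)
    also have "\<dots> = (\<integral>x. \<mu> x \<bullet> (\<chi> l. pd l w x) \<partial>?M)"
      unfolding inner_vec_def by (subst Bochner_Integration.integral_sum) (use i2 in auto)
    also have "\<dots> = L2_inner \<Omega> g w"
      using test_funs_sqint[OF \<Omega>(1,2) w] by (intro \<mu>(3) test_funs_has_weak_gradient[OF \<Omega>(1,2) w]) (simp add: L2_eq)
    also have "\<dots> = (\<integral>x. G x * w x \<partial>lborel)"
      using G(7)[OF test_funsD(6)[OF w]] by (simp add: L2_inner_def mult.commute)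
    finally show ?thesis .
  qed
  have "(\<integral>x. V x * G x \<partial>lborel) \<le> BV_seminorm \<Omega> V"
    by (rule pairing_le_BV_seminorm[OF \<Omega> G(1,5,2) m(1,4,2) m1 weak V(1,5,2)]) (use bdd BVeq in auto)
  moreover have "BV_seminorm \<Omega> V = BV_seminorm \<Omega> v" by (simp add: BV_seminorm_def BVeq)
  moreover have "L2_inner \<Omega> g v = (\<integral>x. V x * G x \<partial>lborel)"
  proof -
    have gm: "g \<in> borel_measurable ?M" by (rule sqint_measurable[OF g2])
    have "L2_inner \<Omega> g v = (\<integral>x. V x * g x \<partial>?M)" using V(6)[OF gm] by (simp add: L2_inner_def mult.commute)
    also have "\<dots> = (\<integral>x. V x * G x \<partial>lborel)" by (rule G(7)[OF V(1)])
    finally show ?thesis .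
  qed
  ultimately show ?thesis by simp
qed

subsection \<open>Signed measures\<close>

lemma borel_in_iff: "\<Omega> \<in> sets borel \<Longrightarrow> B \<in> borel_in \<Omega> \<longleftrightarrow> B \<in> sets borel \<and> B \<subseteq> \<Omega>"
  by (auto simp: borel_in_def sets_restrict_space_iff)

lemma space_eq_if_sets_borel_in:
  assumes "\<Omega> \<in> sets borel" "sets \<mu> = borel_in \<Omega>"
  shows "space \<mu> = \<Omega>"
  using assms sets_eq_imp_space_eq[of \<mu> "restrict_space borel \<Omega>"]
  by (simp add: borel_in_def space_restrict_space)

lemma measurable_if_sets_borel_in:
  assumes "sets \<mu> = borel_in \<Omega>" "g \<in> borel_measurable borel"
  shows "g \<in> borel_measurable \<mu>"
proof -
  have "g \<in> borel_measurable (restrict_space borel \<Omega>)" using assms(2) by (rule measurable_restrict_space1)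
  moreover have "sets \<mu> = sets (restrict_space borel \<Omega>)" using assms(1) by (simp add: borel_in_def)
  ultimately show ?thesis using measurable_cong_sets by blast
qed

text \<open>What one component of a vector measure satisfies, with boundedness in place of the bound
  on variation sums.\<close>

definition signed_measure :: "(real^'n) set \<Rightarrow> ((real^'n) set \<Rightarrow> real) \<Rightarrow> bool" where
  "signed_measure \<Omega> m \<longleftrightarrow>
     (\<forall>A. range A \<subseteq> borel_in \<Omega> \<longrightarrow> disjoint_family A \<longrightarrow> (\<lambda>k::nat. m (A k)) sums m (\<Union>k. A k)) \<and>
     (\<exists>C. \<forall>B\<in>borel_in \<Omega>. \<bar>m B\<bar> \<le> C)"

text \<open>The real supremum behind the \<open>ennreal\<close> supremum in
  \<open>positive_variation\<close>. There negative values are sent to 0, which is harmless since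
  the empty set contributes 0 anyway.\<close>

definition pvar :: "(real^'n) set \<Rightarrow> ((real^'n) set \<Rightarrow> real) \<Rightarrow> (real^'n) set \<Rightarrow> real" where
  "pvar \<Omega> m B = Sup (m ` {A \<in> borel_in \<Omega>. A \<subseteq> B})"

context
  fixes \<Omega> :: "(real^'n) set" and m :: "(real^'n) set \<Rightarrow> real"
  assumes \<Omega>: "\<Omega> \<in> sets borel" and m: "signed_measure \<Omega> m"
begin

lemma signed_measure_sums:
  "range A \<subseteq> borel_in \<Omega> \<Longrightarrow> disjoint_family A \<Longrightarrow> (\<lambda>k::nat. m (A k)) sums m (\<Union>k. A k)"
  using m unfolding signed_measure_def by blast

lemma empty_borel_in: "{} \<in> borel_in \<Omega>" using \<Omega> by (simp add: borel_in_iff)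

lemma signed_measure_empty: "m {} = 0"
proof -
  have "(\<lambda>k::nat. m {}) sums m (\<Union>k::nat. {})"
    by (rule signed_measure_sums) (use empty_borel_in in \<open>auto simp: disjoint_family_on_def\<close>)
  then have "summable (\<lambda>k::nat. m {})" by (rule sums_summable)
  then show ?thesis by (simp add: summable_const_iff)
qed

lemma signed_measure_Un:
  assumes "A \<in> borel_in \<Omega>" "B \<in> borel_in \<Omega>" "A \<inter> B = {}"
  shows "m (A \<union> B) = m A + m B"
proof -
  define F where "F k = (if k = 0 then A else if k = (1::nat) then B else {})" for k
  have "(\<lambda>k. m (F k)) sums m (\<Union>k. F k)"
    by (rule signed_measure_sums) (use assms empty_borel_in in \<open>auto simp: F_def disjoint_family_on_def split: if_splits\<close>)
  moreover have "(\<Union>k. F k) = A \<union> B" by (auto simp: F_def split: if_splits)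
  moreover have "(\<lambda>k. m (F k)) sums (\<Sum>k\<in>{0, 1}. m (F k))"
    by (rule sums_finite) (auto simp: F_def signed_measure_empty)
  ultimately show ?thesis using sums_unique2 by (fastforce simp: F_def)
qed

lemma signed_measure_Diff:
  assumes "A \<in> borel_in \<Omega>" "B \<in> borel_in \<Omega>" "A \<subseteq> B"
  shows "m (B - A) = m B - m A"
proof -
  have "B - A \<in> borel_in \<Omega>" using assms \<Omega> by (auto simp: borel_in_iff)
  from signed_measure_Un[OF assms(1) this] assms(3) show ?thesis by (simp add: Un_absorb1)
qed

lemma signed_measure_uminus: "signed_measure \<Omega> (\<lambda>A. - m A)"
  using m unfolding signed_measure_def by (auto intro: sums_minus)

lemma signed_measure_bdd: "bdd_above (m ` {A \<in> borel_in \<Omega>. A \<subseteq> B})"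
  using m unfolding signed_measure_def bdd_above_def by (force intro: order_trans[OF abs_ge_self])

lemma le_pvar: "A \<in> borel_in \<Omega> \<Longrightarrow> A \<subseteq> B \<Longrightarrow> m A \<le> pvar \<Omega> m B"
  unfolding pvar_def by (intro cSup_upper signed_measure_bdd) auto

lemma pvar_nonneg: "0 \<le> pvar \<Omega> m B"
  using le_pvar[OF empty_borel_in, of B] signed_measure_empty by simp

lemma pvar_empty: "pvar \<Omega> m {} = 0"
proof -
  have "{A \<in> borel_in \<Omega>. A \<subseteq> {}} = {{}}" using empty_borel_in by auto
  then show ?thesis by (simp add: pvar_def signed_measure_empty)
qed

lemma pvar_least: "(\<And>A. A \<in> borel_in \<Omega> \<Longrightarrow> A \<subseteq> B \<Longrightarrow> m A \<le> c) \<Longrightarrow> pvar \<Omega> m B \<le> c"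
  unfolding pvar_def using empty_borel_in by (intro cSup_least) auto

lemma pvar_approx:
  assumes "e > 0"
  obtains A where "A \<in> borel_in \<Omega>" "A \<subseteq> B" "pvar \<Omega> m B - e < m A"
proof -
  have "\<exists>y\<in>m ` {A \<in> borel_in \<Omega>. A \<subseteq> B}. pvar \<Omega> m B - e < y"
    unfolding pvar_def by (rule less_cSup_iff[THEN iffD1]) (use empty_borel_in signed_measure_bdd assms in auto)
  then show ?thesis using that by blast
qed

text \<open>Near-optimal subsets of finitely many parts unite to a subset of the union, which gives
  one inequality; for the other, a subset of the union is cut along the parts.\<close>

lemma pvar_sums:
  assumes B: "range B \<subseteq> borel_in \<Omega>" "disjoint_family B"
  shows "(\<lambda>k::nat. pvar \<Omega> m (B k)) sums pvar \<Omega> m (\<Union>k. B k)"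
proof -
  have part: "(\<Sum>k<n. pvar \<Omega> m (B k)) \<le> pvar \<Omega> m (\<Union>k. B k)" for n
  proof (rule field_le_epsilon)
    fix e :: real assume e: "e > 0"
    define e' where "e' = e / real (n + 1)"
    have e': "e' > 0" "real n * e' \<le> e" using e by (auto simp: e'_def field_simps)
    have "\<forall>k. \<exists>A. A \<in> borel_in \<Omega> \<and> A \<subseteq> B k \<and> pvar \<Omega> m (B k) - e' < m A"
    proof
      fix k
      obtain A where "A \<in> borel_in \<Omega>" "A \<subseteq> B k" "pvar \<Omega> m (B k) - e' < m A" by (rule pvar_approx[OF e'(1)])
      then show "\<exists>A. A \<in> borel_in \<Omega> \<and> A \<subseteq> B k \<and> pvar \<Omega> m (B k) - e' < m A" by blast
    qed
    then obtain A where "\<forall>k. A k \<in> borel_in \<Omega> \<and> A k \<subseteq> B k \<and> pvar \<Omega> m (B k) - e' < m (A k)"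
      by (rule choice[THEN exE])
    then have A: "\<And>k. A k \<in> borel_in \<Omega>" "\<And>k. A k \<subseteq> B k" "\<And>k. pvar \<Omega> m (B k) - e' < m (A k)" by blast+
    define F where "F k = (if k < n then A k else {})" for k
    have F: "range F \<subseteq> borel_in \<Omega>" using A(1) empty_borel_in by (auto simp: F_def)
    have "F k \<subseteq> B k" for k using A(2) by (auto simp: F_def)
    then have dF: "disjoint_family F" using B(2) unfolding disjoint_family_on_def by blast
    have "(\<lambda>k. m (F k)) sums m (\<Union>k. F k)" by (rule signed_measure_sums[OF F dF])
    moreover have "(\<lambda>k. m (F k)) sums (\<Sum>k\<in>{..<n}. m (F k))"
      by (rule sums_finite) (auto simp: F_def signed_measure_empty)
    ultimately have "m (\<Union>k. F k) = (\<Sum>k<n. m (F k))" using sums_unique2 by blast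
    moreover have "(\<Union>k. F k) \<in> borel_in \<Omega>" using F \<Omega> unfolding borel_in_def by (intro sets.countable_UN) auto
    then have "m (\<Union>k. F k) \<le> pvar \<Omega> m (\<Union>k. B k)"
      by (rule le_pvar) (use A(2) in \<open>auto simp: F_def split: if_splits\<close>)
    moreover have "(\<Sum>k<n. pvar \<Omega> m (B k)) \<le> (\<Sum>k<n. m (F k) + e')"
    proof (intro sum_mono)
      fix k assume "k \<in> {..<n}"
      then show "pvar \<Omega> m (B k) \<le> m (F k) + e'" using A(3)[of k] by (simp add: F_def)
    qed
    ultimately show "(\<Sum>k<n. pvar \<Omega> m (B k)) \<le> pvar \<Omega> m (\<Union>k. B k) + e"
      using e'(2) by (simp add: sum.distrib)
  qed
  have sm: "summable (\<lambda>k. pvar \<Omega> m (B k))"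
    using part pvar_nonneg by (intro summableI_nonneg_bounded) auto
  have "(\<Sum>k. pvar \<Omega> m (B k)) \<le> pvar \<Omega> m (\<Union>k. B k)"
    by (rule suminf_le_const[OF sm part])
  moreover have "pvar \<Omega> m (\<Union>k. B k) \<le> (\<Sum>k. pvar \<Omega> m (B k))"
  proof (rule pvar_least)
    fix A assume A: "A \<in> borel_in \<Omega>" "A \<subseteq> (\<Union>k. B k)"
    have AB: "A \<inter> B k \<in> borel_in \<Omega>" for k using A(1) B(1) unfolding borel_in_def by (intro sets.Int) auto
    have "(\<lambda>k. m (A \<inter> B k)) sums m (\<Union>k. A \<inter> B k)"
      by (rule signed_measure_sums) (use AB B(2) in \<open>auto simp: disjoint_family_on_def\<close>)
    moreover have "(\<Union>k. A \<inter> B k) = A" using A(2) by blast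
    ultimately have s: "(\<lambda>k. m (A \<inter> B k)) sums m A" by simp
    then have "m A = (\<Sum>k. m (A \<inter> B k))" by (rule sums_unique)
    also have "\<dots> \<le> (\<Sum>k. pvar \<Omega> m (B k))"
      by (rule suminf_le[OF _ sums_summable[OF s] sm]) (use le_pvar[OF AB] in auto)
    finally show "m A \<le> (\<Sum>k. pvar \<Omega> m (B k))" .
  qed
  ultimately have eq: "(\<Sum>k. pvar \<Omega> m (B k)) = pvar \<Omega> m (\<Union>k. B k)" by (rule antisym)
  from summable_sums[OF sm] show ?thesis unfolding eq .
qed

lemma SUP_ennreal_pvar: "(SUP A\<in>{A \<in> borel_in \<Omega>. A \<subseteq> B}. ennreal (m A)) = ennreal (pvar \<Omega> m B)"
proof (rule antisym)
  show "(SUP A\<in>{A \<in> borel_in \<Omega>. A \<subseteq> B}. ennreal (m A)) \<le> ennreal (pvar \<Omega> m B)"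
    by (rule SUP_least) (auto intro!: ennreal_leI le_pvar)
  then obtain t where t: "(SUP A\<in>{A \<in> borel_in \<Omega>. A \<subseteq> B}. ennreal (m A)) = ennreal t" "t \<ge> 0"
    by (cases "SUP A\<in>{A \<in> borel_in \<Omega>. A \<subseteq> B}. ennreal (m A)") (auto simp: top_unique)
  have "m A \<le> t" if "A \<in> borel_in \<Omega>" "A \<subseteq> B" for A
  proof -
    have "ennreal (m A) \<le> ennreal t" unfolding t(1)[symmetric] using that by (intro SUP_upper) auto
    then show ?thesis using t(2) by (simp add: ennreal_le_iff)
  qed
  then have "pvar \<Omega> m B \<le> t" by (rule pvar_least)
  then show "ennreal (pvar \<Omega> m B) \<le> (SUP A\<in>{A \<in> borel_in \<Omega>. A \<subseteq> B}. ennreal (m A))"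
    unfolding t(1) by (rule ennreal_leI)
qed

lemma positive_variation_measure:
  shows "sets (positive_variation \<Omega> m) = borel_in \<Omega>" "finite_measure (positive_variation \<Omega> m)"
    "\<And>B. B \<in> borel_in \<Omega> \<Longrightarrow> measure (positive_variation \<Omega> m) B = pvar \<Omega> m B"
proof -
  have sa: "sigma_algebra \<Omega> (borel_in \<Omega>)"
    using sets.sigma_algebra_axioms[of "restrict_space borel \<Omega>"] by (simp add: borel_in_def space_restrict_space)
  have eq: "positive_variation \<Omega> m = measure_of \<Omega> (borel_in \<Omega>) (\<lambda>B. ennreal (pvar \<Omega> m B))"
    unfolding positive_variation_def SUP_ennreal_pvar ..
  show s: "sets (positive_variation \<Omega> m) = borel_in \<Omega>"
    unfolding eq using sa by (simp add: sigma_algebra.sets_measure_of_eq)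
  have em: "emeasure (positive_variation \<Omega> m) B = ennreal (pvar \<Omega> m B)" if "B \<in> borel_in \<Omega>" for B
    unfolding eq
  proof (rule emeasure_measure_of_sigma[OF sa _ _ that])
    show "positive (borel_in \<Omega>) (\<lambda>B. ennreal (pvar \<Omega> m B))" by (simp add: positive_def pvar_empty)
    show "countably_additive (borel_in \<Omega>) (\<lambda>B. ennreal (pvar \<Omega> m B))"
    proof (rule countably_additiveI)
      fix A :: "nat \<Rightarrow> (real^'n) set" assume "range A \<subseteq> borel_in \<Omega>" "disjoint_family A"
      from pvar_sums[OF this] show "(\<Sum>i. ennreal (pvar \<Omega> m (A i))) = ennreal (pvar \<Omega> m (\<Union>i. A i))"
        by (intro suminf_ennreal_eq pvar_nonneg)
    qed
  qed
  show "measure (positive_variation \<Omega> m) B = pvar \<Omega> m B" if "B \<in> borel_in \<Omega>" for B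
    using em[OF that] pvar_nonneg by (simp add: measure_def)
  have sp: "space (positive_variation \<Omega> m) = \<Omega>" by (rule space_eq_if_sets_borel_in[OF \<Omega> s])
  show "finite_measure (positive_variation \<Omega> m)"
    by (rule finite_measureI) (use em[of \<Omega>] \<Omega> sp in \<open>auto simp: borel_in_iff\<close>)
qed

end

text \<open>Exchanging \<open>A\<close> for \<open>B - A\<close> turns \<open>m A\<close> into
  \<open>m B - m A\<close>, so the suprema of \<open>m\<close> and of \<open>- m\<close> over
  subsets of \<open>B\<close> differ by \<open>m B\<close>.\<close>

lemma jordan_decomposition:
  assumes \<Omega>: "\<Omega> \<in> sets borel" and m: "signed_measure \<Omega> m" and B: "B \<in> borel_in \<Omega>"
  shows "m B = measure (positive_variation \<Omega> m) B - measure (positive_variation \<Omega> (\<lambda>A. - m A)) B"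
proof -
  note m' = signed_measure_uminus[OF \<Omega> m]
  have "pvar \<Omega> m B - m B \<le> pvar \<Omega> (\<lambda>A. - m A) B"
  proof -
    have "pvar \<Omega> m B \<le> pvar \<Omega> (\<lambda>A. - m A) B + m B"
    proof (rule pvar_least[OF \<Omega> m])
      fix A assume A: "A \<in> borel_in \<Omega>" "A \<subseteq> B"
      have "B - A \<in> borel_in \<Omega>" using A B unfolding borel_in_def by (intro sets.Diff)
      then have "- m (B - A) \<le> pvar \<Omega> (\<lambda>A. - m A) B" by (rule le_pvar[OF \<Omega> m']) auto
      then show "m A \<le> pvar \<Omega> (\<lambda>A. - m A) B + m B" by (simp add: signed_measure_Diff[OF \<Omega> m A(1) B A(2)])
    qed
    then show ?thesis by simp
  qed
  moreover have "pvar \<Omega> (\<lambda>A. - m A) B \<le> pvar \<Omega> m B - m B"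
  proof (rule pvar_least[OF \<Omega> m'])
    fix A assume A: "A \<in> borel_in \<Omega>" "A \<subseteq> B"
    have "B - A \<in> borel_in \<Omega>" using A B unfolding borel_in_def by (intro sets.Diff)
    then have "m (B - A) \<le> pvar \<Omega> m B" by (rule le_pvar[OF \<Omega> m]) auto
    then show "- m A \<le> pvar \<Omega> m B - m B" by (simp add: signed_measure_Diff[OF \<Omega> m A(1) B A(2)])
  qed
  ultimately show ?thesis
    by (simp add: positive_variation_measure(3)[OF \<Omega> m B] positive_variation_measure(3)[OF \<Omega> m' B])
qed

text \<open>
  The integral is determined by its values on step functions: this is how linearity in the measure
  and independence of the chosen decomposition are obtained.
\<close>

definition step_approx :: "(real^'n) set \<Rightarrow> ((real^'n) set \<Rightarrow> real) \<Rightarrow> (real^'n \<Rightarrow> real) \<Rightarrow> real \<Rightarrow> bool" where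
  "step_approx \<Omega> m g I \<longleftrightarrow> (\<exists>K. \<forall>e>0. \<forall>P c. finite P \<longrightarrow> P \<subseteq> borel_in \<Omega> \<longrightarrow> partition_on \<Omega> P \<longrightarrow>
     (\<forall>B\<in>P. \<forall>x\<in>B. \<bar>g x - c B\<bar> \<le> e) \<longrightarrow> \<bar>I - (\<Sum>B\<in>P. c B * m B)\<bar> \<le> e * K)"

lemma step_approxE:
  assumes "step_approx \<Omega> m g I"
  obtains K where "\<And>e P c. e > 0 \<Longrightarrow> finite P \<Longrightarrow> P \<subseteq> borel_in \<Omega> \<Longrightarrow> partition_on \<Omega> P \<Longrightarrow>
    \<forall>B\<in>P. \<forall>x\<in>B. \<bar>g x - c B\<bar> \<le> e \<Longrightarrow> \<bar>I - (\<Sum>B\<in>P. c B * m B)\<bar> \<le> e * K"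
proof -
  from assms[unfolded step_approx_def] obtain K where K: "\<forall>e>0. \<forall>P c. finite P \<longrightarrow> P \<subseteq> borel_in \<Omega> \<longrightarrow> partition_on \<Omega> P \<longrightarrow>
     (\<forall>B\<in>P. \<forall>x\<in>B. \<bar>g x - c B\<bar> \<le> e) \<longrightarrow> \<bar>I - (\<Sum>B\<in>P. c B * m B)\<bar> \<le> e * K" ..
  show ?thesis
    by (rule that, rule K[THEN spec, THEN mp, THEN spec, THEN spec, THEN mp, THEN mp, THEN mp, THEN mp])
qed

text \<open>Common level sets of the rounded quotients \<open>g i / e\<close>. One partition serves
  the whole finite family, as estimates for fields require, and the points \<open>p B\<close> allow
  a field to be evaluated where its bound holds.\<close>

lemma step_partition_exists:
  fixes g :: "'i::finite \<Rightarrow> real^'n \<Rightarrow> real"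
  assumes \<Omega>: "\<Omega> \<in> sets borel" and g: "\<And>i. g i \<in> borel_measurable borel" "\<And>i x. \<bar>g i x\<bar> \<le> b" and e: "e > 0"
  obtains P p where "finite P" "P \<subseteq> borel_in \<Omega>" "partition_on \<Omega> P" "\<And>B. B \<in> P \<Longrightarrow> p B \<in> B"
    "\<And>i B x. B \<in> P \<Longrightarrow> x \<in> B \<Longrightarrow> \<bar>g i x - g i (p B)\<bar> \<le> e"
proof -
  define q where "q x = (\<lambda>i. \<lfloor>g i x / e\<rfloor>)" for x
  define N where "N = \<lfloor>b / e\<rfloor> + 1"
  have "q x i \<in> {- N..N}" for x i
  proof -
    have "\<bar>g i x / e\<bar> \<le> b / e" using g(2)[of i x] e by (simp add: abs_divide divide_right_mono)
    then have "g i x / e \<le> b / e" "- (b / e) \<le> g i x / e" by linarith+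
    then show ?thesis unfolding q_def N_def by (simp, linarith)
  qed
  then have "range q \<subseteq> {f. \<forall>i. f i \<in> {- N..N}}" by auto
  moreover have "finite {f :: 'i \<Rightarrow> int. \<forall>i. f i \<in> {- N..N}}"
    using finite_PiE[of "UNIV :: 'i set" "\<lambda>_. {- N..N}"] by (simp add: PiE_def Pi_def)
  ultimately have fin: "finite (range q)" by (rule finite_subset)
  define P where "P = (\<lambda>c. {x \<in> \<Omega>. q x = c}) ` (q ` \<Omega>)"
  have qm: "{x. q x = c} \<in> sets borel" for c
  proof -
    have "{x. q x = c} = (\<Inter>i. {x. \<lfloor>g i x / e\<rfloor> = c i})" by (auto simp: q_def fun_eq_iff)
    moreover have "{x. \<lfloor>g i x / e\<rfloor> = c i} \<in> sets borel" for i
    proof -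
      have "{x. \<lfloor>g i x / e\<rfloor> = c i} = {x. of_int (c i) \<le> g i x / e \<and> g i x / e < of_int (c i) + 1}"
        by (simp add: floor_eq_iff)
      then show ?thesis using g(1)[of i] by simp
    qed
    ultimately show ?thesis by auto
  qed
  have P: "{x \<in> \<Omega>. q x = c} \<in> borel_in \<Omega>" for c
  proof -
    have "{x \<in> \<Omega>. q x = c} = \<Omega> \<inter> {x. q x = c}" by blast
    then show ?thesis using qm[of c] \<Omega> by (auto simp: borel_in_iff)
  qed
  show ?thesis
  proof (rule that[of P "\<lambda>B. SOME x. x \<in> B"])
    show "finite P" unfolding P_def using fin by (meson finite_imageI finite_subset image_mono subset_UNIV)
    show "P \<subseteq> borel_in \<Omega>" using P by (auto simp: P_def)
    show "partition_on \<Omega> P" unfolding partition_on_def P_def disjoint_def by auto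
    have some: "(SOME x. x \<in> B) \<in> B" if "B \<in> P" for B
    proof -
      have "\<exists>x. x \<in> B" using that by (auto simp: P_def)
      then show ?thesis by (rule someI_ex)
    qed
    then show "(SOME x. x \<in> B) \<in> B" if "B \<in> P" for B using that .
    show "\<bar>g i x - g i (SOME x. x \<in> B)\<bar> \<le> e" if B: "B \<in> P" and x: "x \<in> B" for i B x
    proof -
      let ?y = "SOME x. x \<in> B"
      have "q x = q ?y" using B x some[OF B] by (auto simp: P_def)
      then have "\<lfloor>g i x / e\<rfloor> = \<lfloor>g i ?y / e\<rfloor>" unfolding q_def by (rule fun_cong)
      then have "\<bar>g i x / e - g i ?y / e\<bar> < 1" by linarith
      then have "\<bar>g i x - g i ?y\<bar> / e < 1" using e by (simp add: diff_divide_distrib[symmetric] abs_divide)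
      then show ?thesis using e by (simp add: divide_less_eq)
    qed
  qed
qed

text \<open>Both numbers are within a multiple of \<open>e\<close> of the same step sum, for every
  positive \<open>e\<close>.\<close>

lemma step_approx_unique:
  assumes \<Omega>: "\<Omega> \<in> sets borel" and g: "g \<in> borel_measurable borel" "\<And>x. \<bar>g x\<bar> \<le> b"
    and IJ: "step_approx \<Omega> m g I" "step_approx \<Omega> m g J"
  shows "I = J"
proof -
  obtain K1 where K1: "\<And>e P c. e > 0 \<Longrightarrow> finite P \<Longrightarrow> P \<subseteq> borel_in \<Omega> \<Longrightarrow> partition_on \<Omega> P \<Longrightarrow>
    (\<forall>B\<in>P. \<forall>x\<in>B. \<bar>g x - c B\<bar> \<le> e) \<Longrightarrow> \<bar>I - (\<Sum>B\<in>P. c B * m B)\<bar> \<le> e * K1"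
    by (rule step_approxE[OF IJ(1)], rule that; assumption)
  obtain K2 where K2: "\<And>e P c. e > 0 \<Longrightarrow> finite P \<Longrightarrow> P \<subseteq> borel_in \<Omega> \<Longrightarrow> partition_on \<Omega> P \<Longrightarrow>
    (\<forall>B\<in>P. \<forall>x\<in>B. \<bar>g x - c B\<bar> \<le> e) \<Longrightarrow> \<bar>J - (\<Sum>B\<in>P. c B * m B)\<bar> \<le> e * K2"
    by (rule step_approxE[OF IJ(2)], rule that; assumption)
  have le: "\<bar>I - J\<bar> \<le> e * (K1 + K2)" if e: "e > 0" for e
  proof -
    obtain P p where P: "finite P" "P \<subseteq> borel_in \<Omega>" "partition_on \<Omega> P"
      "\<And>i B x. B \<in> P \<Longrightarrow> x \<in> B \<Longrightarrow> \<bar>(\<lambda>_::unit. g) i x - (\<lambda>_::unit. g) i (p B)\<bar> \<le> e"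
      using step_partition_exists[OF \<Omega>, of "\<lambda>_::unit. g" b e] g e by metis
    have "\<forall>B\<in>P. \<forall>x\<in>B. \<bar>g x - g (p B)\<bar> \<le> e" using P(4) by simp
    from K1[OF e P(1-3) this] K2[OF e P(1-3) this] show ?thesis by (simp add: distrib_left)
  qed
  show ?thesis
  proof (rule ccontr)
    assume "I \<noteq> J"
    define D where "D = \<bar>K1 + K2\<bar> + 1"
    have D: "D > 0" "K1 + K2 \<le> D" by (auto simp: D_def add_nonneg_pos)
    define e where "e = \<bar>I - J\<bar> / (2 * D)"
    have e: "e > 0" unfolding e_def using \<open>I \<noteq> J\<close> D by (intro divide_pos_pos mult_pos_pos) auto
    have "\<bar>I - J\<bar> \<le> e * (K1 + K2)" by (rule le[OF e])
    also have "\<dots> \<le> e * D" using e D by (intro mult_left_mono) auto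
    also have "\<dots> = \<bar>I - J\<bar> / 2" using D by (simp add: e_def)
    finally show False using \<open>I \<noteq> J\<close> by simp
  qed
qed

lemma step_approx_lin:
  assumes "step_approx \<Omega> m g I" "step_approx \<Omega> m' g J"
  shows "step_approx \<Omega> (\<lambda>B. a * m B + b * m' B) g (a * I + b * J)"
proof -
  obtain K1 where K1: "\<And>e P c. e > 0 \<Longrightarrow> finite P \<Longrightarrow> P \<subseteq> borel_in \<Omega> \<Longrightarrow> partition_on \<Omega> P \<Longrightarrow>
    (\<forall>B\<in>P. \<forall>x\<in>B. \<bar>g x - c B\<bar> \<le> e) \<Longrightarrow> \<bar>I - (\<Sum>B\<in>P. c B * m B)\<bar> \<le> e * K1"
    by (rule step_approxE[OF assms(1)], rule that; assumption)
  obtain K2 where K2: "\<And>e P c. e > 0 \<Longrightarrow> finite P \<Longrightarrow> P \<subseteq> borel_in \<Omega> \<Longrightarrow> partition_on \<Omega> P \<Longrightarrow>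
    (\<forall>B\<in>P. \<forall>x\<in>B. \<bar>g x - c B\<bar> \<le> e) \<Longrightarrow> \<bar>J - (\<Sum>B\<in>P. c B * m' B)\<bar> \<le> e * K2"
    by (rule step_approxE[OF assms(2)], rule that; assumption)
  show ?thesis
    unfolding step_approx_def
  proof (intro exI[of _ "\<bar>a\<bar> * K1 + \<bar>b\<bar> * K2"] allI impI)
    fix e :: real and P c
    assume e: "e > 0" and P: "finite P" "P \<subseteq> borel_in \<Omega>" "partition_on \<Omega> P" "\<forall>B\<in>P. \<forall>x\<in>B. \<bar>g x - c B\<bar> \<le> e"
    let ?I = "I - (\<Sum>B\<in>P. c B * m B)" and ?J = "J - (\<Sum>B\<in>P. c B * m' B)"
    have "a * I + b * J - (\<Sum>B\<in>P. c B * (a * m B + b * m' B)) = a * ?I + b * ?J"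
      by (simp add: sum.distrib sum_distrib_left algebra_simps)
    also have "\<bar>\<dots>\<bar> \<le> \<bar>a\<bar> * \<bar>?I\<bar> + \<bar>b\<bar> * \<bar>?J\<bar>" using abs_triangle_ineq[of "a * ?I" "b * ?J"] by (simp add: abs_mult)
    also have "\<dots> \<le> \<bar>a\<bar> * (e * K1) + \<bar>b\<bar> * (e * K2)"
      using K1[OF e P] K2[OF e P] by (intro add_mono mult_left_mono) auto
    finally show "\<bar>a * I + b * J - (\<Sum>B\<in>P. c B * (a * m B + b * m' B))\<bar> \<le> e * (\<bar>a\<bar> * K1 + \<bar>b\<bar> * K2)"
      by (simp add: algebra_simps)
  qed
qed

lemma step_approx_integral:
  assumes \<Omega>: "\<Omega> \<in> sets borel" and g: "g \<in> borel_measurable borel" "\<And>x. \<bar>g x\<bar> \<le> b"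
    and \<mu>: "finite_measure \<mu>" "sets \<mu> = borel_in \<Omega>"
  shows "integrable \<mu> g" "step_approx \<Omega> (measure \<mu>) g (\<integral>x. g x \<partial>\<mu>)"
proof -
  interpret finite_measure \<mu> by (rule \<mu>(1))
  have sp: "space \<mu> = \<Omega>" by (rule space_eq_if_sets_borel_in[OF \<Omega> \<mu>(2)])
  show gi: "integrable \<mu> g"
    using measurable_if_sets_borel_in[OF \<mu>(2) g(1)] g(2) by (intro integrable_const_bound[of _ b]) auto
  show "step_approx \<Omega> (measure \<mu>) g (\<integral>x. g x \<partial>\<mu>)"
    unfolding step_approx_def
  proof (intro exI[of _ "measure \<mu> \<Omega>"] allI impI)
    fix e :: real and P c
    assume e: "e > 0" and P: "finite P" "P \<subseteq> borel_in \<Omega>" "partition_on \<Omega> P" "\<forall>B\<in>P. \<forall>x\<in>B. \<bar>g x - c B\<bar> \<le> e"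
    have Bm: "B \<in> sets \<mu>" if "B \<in> P" for B using P(2) that \<mu>(2) by blast
    define s where "s x = (\<Sum>B\<in>P. c B * indicator B x)" for x
    have s_eq: "s x = c B" if "B \<in> P" "x \<in> B" for B x
    proof -
      have "indicator B' x = (if B' = B then 1 else (0::real))" if "B' \<in> P" for B'
        using P(3) that \<open>B \<in> P\<close> \<open>x \<in> B\<close> unfolding partition_on_def disjoint_def indicator_def by auto
      then have "s x = (\<Sum>B'\<in>P. if B' = B then c B' else 0)"
        unfolding s_def by (intro sum.cong) auto
      then show ?thesis using P(1) \<open>B \<in> P\<close> by simp
    qed
    have si: "integrable \<mu> s" unfolding s_def using Bm
      by (intro Bochner_Integration.integrable_sum integrable_mult_right integrable_real_indicator) (auto simp: emeasure_eq_measure)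
    have "(\<integral>x. s x \<partial>\<mu>) = (\<Sum>B\<in>P. c B * measure \<mu> B)"
      unfolding s_def using Bm sp \<Omega>
      by (subst Bochner_Integration.integral_sum) (auto simp: emeasure_eq_measure Int_absorb2 sets.sets_into_space)
    then have "(\<integral>x. g x \<partial>\<mu>) - (\<Sum>B\<in>P. c B * measure \<mu> B) = (\<integral>x. g x - s x \<partial>\<mu>)"
      using gi si by simp
    also have "\<bar>\<dots>\<bar> \<le> (\<integral>x. \<bar>g x - s x\<bar> \<partial>\<mu>)" by (rule integral_abs_bound)
    also have "\<dots> \<le> (\<integral>x. e \<partial>\<mu>)"
    proof (rule integral_mono)
      fix x assume "x \<in> space \<mu>"
      then obtain B where B: "B \<in> P" "x \<in> B" using P(3) sp unfolding partition_on_def by blast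
      then show "\<bar>g x - s x\<bar> \<le> e" using P(4) s_eq[OF B] by auto
    qed (use gi si in auto)
    also have "\<dots> = e * measure \<mu> \<Omega>" by (simp add: sp)
    finally show "\<bar>(\<integral>x. g x \<partial>\<mu>) - (\<Sum>B\<in>P. c B * measure \<mu> B)\<bar> \<le> e * measure \<mu> \<Omega>" .
  qed
qed

lemma step_approx_cong:
  assumes "\<And>B. B \<in> borel_in \<Omega> \<Longrightarrow> m B = m' B" "step_approx \<Omega> m g I"
  shows "step_approx \<Omega> m' g I"
proof -
  have "(\<Sum>B\<in>P. c B * m B) = (\<Sum>B\<in>P. c B * m' B)" if "P \<subseteq> borel_in \<Omega>" for P c
    using that assms(1) by (intro sum.cong) auto
  note eq = this
  show ?thesis
  proof (rule step_approxE[OF assms(2)])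
    fix K assume K: "\<And>e P c. e > 0 \<Longrightarrow> finite P \<Longrightarrow> P \<subseteq> borel_in \<Omega> \<Longrightarrow> partition_on \<Omega> P \<Longrightarrow>
      \<forall>B\<in>P. \<forall>x\<in>B. \<bar>g x - c B\<bar> \<le> e \<Longrightarrow> \<bar>I - (\<Sum>B\<in>P. c B * m B)\<bar> \<le> e * K"
    show ?thesis
      unfolding step_approx_def
    proof (intro exI[of _ K] allI impI)
      fix e :: real and P c
      assume "e > 0" and P: "finite P" "P \<subseteq> borel_in \<Omega>" "partition_on \<Omega> P" "\<forall>B\<in>P. \<forall>x\<in>B. \<bar>g x - c B\<bar> \<le> e"
      from K[OF this] show "\<bar>I - (\<Sum>B\<in>P. c B * m' B)\<bar> \<le> e * K" unfolding eq[OF P(2)] .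
    qed
  qed
qed

text \<open>Any pair of finite measures with difference \<open>m\<close> serves, not only the Jordan
  decomposition; uniqueness then identifies the integrals.\<close>

lemma step_approx_difference:
  assumes \<Omega>: "\<Omega> \<in> sets borel" and g: "g \<in> borel_measurable borel" "\<And>x. \<bar>g x\<bar> \<le> b"
    and \<alpha>: "finite_measure \<alpha>" "sets \<alpha> = borel_in \<Omega>" and \<beta>: "finite_measure \<beta>" "sets \<beta> = borel_in \<Omega>"
    and m: "\<And>B. B \<in> borel_in \<Omega> \<Longrightarrow> m B = measure \<alpha> B - measure \<beta> B"
  shows "step_approx \<Omega> m g ((\<integral>x. g x \<partial>\<alpha>) - (\<integral>x. g x \<partial>\<beta>))"
  using step_approx_cong[OF _ step_approx_lin[OF step_approx_integral(2)[OF \<Omega> g \<alpha>] step_approx_integral(2)[OF \<Omega> g \<beta>], of 1 "-1"], of m] m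
  by simp

lemma step_approx_signed_integral:
  assumes \<Omega>: "\<Omega> \<in> sets borel" and g: "g \<in> borel_measurable borel" "\<And>x. \<bar>g x\<bar> \<le> b"
    and m: "signed_measure \<Omega> m"
  shows "step_approx \<Omega> m g (signed_integral \<Omega> m g)"
  unfolding signed_integral_def
  by (rule step_approx_difference[OF \<Omega> g positive_variation_measure(2,1)[OF \<Omega> m]
        positive_variation_measure(2,1)[OF \<Omega> signed_measure_uminus[OF \<Omega> m]] jordan_decomposition[OF \<Omega> m]])

subsection \<open>Vector measures and their total variation\<close>

lemma vector_measuresD:
  assumes "m \<in> vector_measures \<Omega>"
  shows "B \<notin> borel_in \<Omega> \<Longrightarrow> m B = 0"
    "range A \<subseteq> borel_in \<Omega> \<Longrightarrow> disjoint_family A \<Longrightarrow> (\<lambda>k::nat. m (A k)) sums m (\<Union>k. A k)"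
    "bdd_above (variation_sums \<Omega> m)"
proof -
  show "bdd_above (variation_sums \<Omega> m)"
    using assms unfolding vector_measures_def mem_Collect_eq by (elim conjE)
qed (use assms in \<open>unfold vector_measures_def, blast\<close>)+

lemma variation_sums_le_total_variation:
  assumes "m \<in> vector_measures \<Omega>" "finite P" "P \<subseteq> borel_in \<Omega>" "partition_on \<Omega> P"
  shows "(\<Sum>B\<in>P. norm (m B)) \<le> total_variation \<Omega> m"
  unfolding total_variation_def
  by (rule cSup_upper[OF _ vector_measuresD(3)[OF assms(1)]])
     (use assms(2-) in \<open>auto simp: variation_sums_def\<close>)

text \<open>Removing the empty set makes this a partition also when \<open>\<Omega>\<close> is
  empty.\<close>

lemma trivial_partition:
  assumes "\<Omega> \<in> sets borel"
  shows "finite ({\<Omega>} - {{}})" "{\<Omega>} - {{}} \<subseteq> borel_in \<Omega>" "partition_on \<Omega> ({\<Omega>} - {{}})"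
  using assms by (auto simp: borel_in_iff partition_on_def disjoint_def)

lemma total_variation_least:
  assumes "\<Omega> \<in> sets borel"
    and "\<And>P. finite P \<Longrightarrow> P \<subseteq> borel_in \<Omega> \<Longrightarrow> partition_on \<Omega> P \<Longrightarrow> (\<Sum>B\<in>P. norm (m B)) \<le> c"
  shows "total_variation \<Omega> m \<le> c"
  unfolding total_variation_def
proof (rule cSup_least)
  show "variation_sums \<Omega> m \<noteq> {}"
    unfolding variation_sums_def using trivial_partition[OF assms(1)] by blast
  show "x \<le> c" if "x \<in> variation_sums \<Omega> m" for x
    using that assms(2) unfolding variation_sums_def by blast
qed

lemma total_variation_nonneg:
  assumes "\<Omega> \<in> sets borel" "m \<in> vector_measures \<Omega>"
  shows "0 \<le> total_variation \<Omega> m"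
  using variation_sums_le_total_variation[OF assms(2) trivial_partition[OF assms(1)]]
  by (rule order_trans[rotated]) (intro sum_nonneg norm_ge_zero)

lemma variation_sum_lin_le:
  assumes "finite P"
  shows "(\<Sum>B\<in>P. norm (a *\<^sub>R m B + b *\<^sub>R m' B)) \<le> \<bar>a\<bar> * (\<Sum>B\<in>P. norm (m B)) + \<bar>b\<bar> * (\<Sum>B\<in>P. norm (m' B))"
proof -
  have "(\<Sum>B\<in>P. norm (a *\<^sub>R m B + b *\<^sub>R m' B)) \<le> (\<Sum>B\<in>P. \<bar>a\<bar> * norm (m B) + \<bar>b\<bar> * norm (m' B))"
    by (intro sum_mono order_trans[OF norm_triangle_ineq]) simp
  then show ?thesis by (simp add: sum.distrib sum_distrib_left)
qed

lemma vector_measures_lin: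
  assumes \<Omega>: "\<Omega> \<in> sets borel" and m: "m \<in> vector_measures \<Omega>" "m' \<in> vector_measures \<Omega>"
  shows "(\<lambda>B. a *\<^sub>R m B + b *\<^sub>R m' B) \<in> vector_measures \<Omega>"
    and "total_variation \<Omega> (\<lambda>B. a *\<^sub>R m B + b *\<^sub>R m' B) \<le> \<bar>a\<bar> * total_variation \<Omega> m + \<bar>b\<bar> * total_variation \<Omega> m'"
proof -
  have le: "(\<Sum>B\<in>P. norm (a *\<^sub>R m B + b *\<^sub>R m' B)) \<le> \<bar>a\<bar> * total_variation \<Omega> m + \<bar>b\<bar> * total_variation \<Omega> m'"
    if P: "finite P" "P \<subseteq> borel_in \<Omega>" "partition_on \<Omega> P" for P
    using variation_sum_lin_le[OF P(1), of a m b m']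
      mult_left_mono[OF variation_sums_le_total_variation[OF m(1) P] abs_ge_zero[of a]]
      mult_left_mono[OF variation_sums_le_total_variation[OF m(2) P] abs_ge_zero[of b]] by linarith
  show "total_variation \<Omega> (\<lambda>B. a *\<^sub>R m B + b *\<^sub>R m' B) \<le> \<bar>a\<bar> * total_variation \<Omega> m + \<bar>b\<bar> * total_variation \<Omega> m'"
    by (rule total_variation_least[OF \<Omega> le])
  show "(\<lambda>B. a *\<^sub>R m B + b *\<^sub>R m' B) \<in> vector_measures \<Omega>"
    unfolding vector_measures_def mem_Collect_eq
  proof (intro conjI allI impI)
    show "a *\<^sub>R m B + b *\<^sub>R m' B = 0" if "B \<notin> borel_in \<Omega>" for B
      using vector_measuresD(1)[OF m(1) that] vector_measuresD(1)[OF m(2) that] by simp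
    show "(\<lambda>k. a *\<^sub>R m (A k) + b *\<^sub>R m' (A k)) sums (a *\<^sub>R m (\<Union> (range A)) + b *\<^sub>R m' (\<Union> (range A)))"
      if "range A \<subseteq> borel_in \<Omega>" "disjoint_family A" for A :: "nat \<Rightarrow> _"
      by (intro sums_add sums_scaleR_right vector_measuresD(2)[OF m(1) that] vector_measuresD(2)[OF m(2) that])
    show "bdd_above (variation_sums \<Omega> (\<lambda>B. a *\<^sub>R m B + b *\<^sub>R m' B))"
      by (rule bdd_aboveI[of _ "\<bar>a\<bar> * total_variation \<Omega> m + \<bar>b\<bar> * total_variation \<Omega> m'"])
         (use le in \<open>auto simp: variation_sums_def\<close>)
  qed
qed

lemma zero_vector_measure: "(\<lambda>_. 0) \<in> vector_measures \<Omega>"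
  unfolding vector_measures_def variation_sums_def by (auto simp: bdd_above_def)

text \<open>One inequality is \<open>vector_measures_lin\<close>; for nonzero \<open>a\<close> the
  other is the same bound with the factor \<open>1 / a\<close>.\<close>

lemma total_variation_scale:
  fixes m :: "(real^'n) set \<Rightarrow> real^'n"
  assumes \<Omega>: "\<Omega> \<in> sets borel" and m: "m \<in> vector_measures \<Omega>"
  shows "total_variation \<Omega> (\<lambda>B. a *\<^sub>R m B) = \<bar>a\<bar> * total_variation \<Omega> m"
proof (cases "a = 0")
  case True
  have "total_variation \<Omega> (\<lambda>B. 0 *\<^sub>R m B) \<le> 0" using vector_measures_lin(2)[OF \<Omega> m m, of 0 0] by simp
  moreover have "0 \<le> total_variation \<Omega> (\<lambda>B. 0 *\<^sub>R m B)"
    using total_variation_nonneg[OF \<Omega> vector_measures_lin(1)[OF \<Omega> m m, of 0 0]] by simp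
  ultimately show ?thesis using True by simp
next
  case False
  have s: "(\<lambda>B. c *\<^sub>R m B) \<in> vector_measures \<Omega>" "total_variation \<Omega> (\<lambda>B. c *\<^sub>R m B) \<le> \<bar>c\<bar> * total_variation \<Omega> m"
    if "m \<in> vector_measures \<Omega>" for c and m :: "(real^'n) set \<Rightarrow> real^'n"
    using vector_measures_lin[OF \<Omega> that that, of c 0] by auto
  have "total_variation \<Omega> m \<le> \<bar>1 / a\<bar> * total_variation \<Omega> (\<lambda>B. a *\<^sub>R m B)"
    using s(2)[OF s(1)[OF m, of a], of "1 / a"] False by simp
  then have "\<bar>a\<bar> * total_variation \<Omega> m \<le> total_variation \<Omega> (\<lambda>B. a *\<^sub>R m B)" using False by (simp add: field_simps)
  with s(2)[OF m, of a] show ?thesis by simp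
qed

lemma vector_measure_empty:
  assumes "\<Omega> \<in> sets borel" "m \<in> vector_measures \<Omega>"
  shows "m {} = 0"
proof -
  have "(\<lambda>k::nat. m {}) sums m (\<Union>k::nat. {})"
    by (rule vector_measuresD(2)[OF assms(2)]) (use assms(1) in \<open>auto simp: disjoint_family_on_def borel_in_iff\<close>)
  then have "summable (\<lambda>k::nat. m {})" by (rule sums_summable)
  then show ?thesis by (simp add: summable_const_iff)
qed

text \<open>A nonempty \<open>B\<close> is completed to a partition by its complement.\<close>

lemma norm_vector_measure_le:
  assumes \<Omega>: "\<Omega> \<in> sets borel" and m: "m \<in> vector_measures \<Omega>" and B: "B \<in> borel_in \<Omega>"
  shows "norm (m B) \<le> total_variation \<Omega> m"
proof (cases "B = {}")
  case True
  then show ?thesis using vector_measure_empty[OF \<Omega> m] total_variation_nonneg[OF \<Omega> m] by simp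
next
  case False
  let ?P = "{B, \<Omega> - B} - {{}}"
  have "B \<in> ?P" using False by simp
  then have "norm (m B) \<le> (\<Sum>B\<in>?P. norm (m B))" by (intro member_le_sum) auto
  also have "\<dots> \<le> total_variation \<Omega> m"
    by (rule variation_sums_le_total_variation[OF m])
       (use B \<Omega> in \<open>auto simp: borel_in_iff partition_on_def disjoint_def\<close>)
  finally show ?thesis .
qed

lemma vector_measure_component:
  assumes \<Omega>: "\<Omega> \<in> sets borel" and m: "m \<in> vector_measures \<Omega>"
  shows "signed_measure \<Omega> (\<lambda>A. m A $ i)"
  unfolding signed_measure_def
proof (intro conjI allI impI)
  show "(\<lambda>k. m (A k) $ i) sums (m (\<Union> (range A)) $ i)" if "range A \<subseteq> borel_in \<Omega>" "disjoint_family A" for A :: "nat \<Rightarrow> _"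
    by (rule bounded_linear.sums[OF bounded_linear_vec_nth vector_measuresD(2)[OF m that]])
  show "\<exists>C. \<forall>B\<in>borel_in \<Omega>. \<bar>m B $ i\<bar> \<le> C"
    using norm_vector_measure_le[OF \<Omega> m] by (meson component_le_norm_cart order_trans)
qed

text \<open>The property selected in \<open>BV_gradient\<close>, stated for an arbitrary measure:
  linearity can be proved for it, while it cannot be read off the choice.\<close>

definition represents_gradient ::
  "(real^'n) set \<Rightarrow> (real^'n \<Rightarrow> real) \<Rightarrow> ((real^'n) set \<Rightarrow> real^'n) \<Rightarrow> bool" where
  "represents_gradient \<Omega> v m \<longleftrightarrow> m \<in> vector_measures \<Omega> \<and>
     (\<forall>g\<in>test_funs \<Omega>. \<forall>i.
        (\<integral>x. v x * pd i g x \<partial>lebesgue_on \<Omega>) = - signed_integral \<Omega> (\<lambda>A. m A $ i) g)"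

lemma sqint_mult_test_funs:
  fixes v :: "real^'n \<Rightarrow> real"
  assumes "open \<Omega>" "bounded \<Omega>" "v \<in> L2 \<Omega>" "g \<in> test_funs S"
  shows "integrable (lebesgue_on \<Omega>) (\<lambda>x. v x * g x)"
  using sqint_mult_integrable[OF _ test_funs_sqint[OF assms(1,2,4)]] assms(3) by (simp add: L2_eq)

text \<open>Jordan decompositions do not add up, so the integral against the combined measure is
  compared with the combined integrals through step approximations.\<close>

lemma represents_gradient_lin:
  fixes v w :: "real^'n \<Rightarrow> real"
  assumes \<Omega>: "open \<Omega>" "bounded \<Omega>" and v: "v \<in> L2 \<Omega>" "represents_gradient \<Omega> v m"
    and w: "w \<in> L2 \<Omega>" "represents_gradient \<Omega> w m'"
  shows "represents_gradient \<Omega> (\<lambda>x. a * v x + b * w x) (\<lambda>B. a *\<^sub>R m B + b *\<^sub>R m' B)"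
  unfolding represents_gradient_def
proof (intro conjI ballI allI)
  have S: "\<Omega> \<in> sets borel" using \<Omega> by simp
  have m: "m \<in> vector_measures \<Omega>" "m' \<in> vector_measures \<Omega>" using v w by (auto simp: represents_gradient_def)
  show l: "(\<lambda>B. a *\<^sub>R m B + b *\<^sub>R m' B) \<in> vector_measures \<Omega>" by (rule vector_measures_lin(1)[OF S m])
  fix g i assume g: "g \<in> test_funs \<Omega>"
  obtain c where c: "\<And>x. \<bar>g x\<bar> \<le> c" using test_funs_bounded[OF g] by blast
  note gc = test_funsD(6)[OF g] c
  have 1: "step_approx \<Omega> (\<lambda>B. a * m B $ i + b * m' B $ i) g
    (a * signed_integral \<Omega> (\<lambda>A. m A $ i) g + b * signed_integral \<Omega> (\<lambda>A. m' A $ i) g)"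
    by (intro step_approx_lin step_approx_signed_integral[OF S gc] vector_measure_component[OF S] m)
  have 2: "step_approx \<Omega> (\<lambda>B. a * m B $ i + b * m' B $ i) g (signed_integral \<Omega> (\<lambda>B. a * m B $ i + b * m' B $ i) g)"
    using step_approx_signed_integral[OF S gc vector_measure_component[OF S l, of i]] by simp
  have "signed_integral \<Omega> (\<lambda>B. a * m B $ i + b * m' B $ i) g =
    a * signed_integral \<Omega> (\<lambda>A. m A $ i) g + b * signed_integral \<Omega> (\<lambda>A. m' A $ i) g"
    by (rule step_approx_unique[OF S gc 2 1])
  moreover have "(\<integral>x. (a * v x + b * w x) * pd i g x \<partial>lebesgue_on \<Omega>) =
    a * (\<integral>x. v x * pd i g x \<partial>lebesgue_on \<Omega>) + b * (\<integral>x. w x * pd i g x \<partial>lebesgue_on \<Omega>)"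
    using ip_lin[of v "lebesgue_on \<Omega>" w "pd i g" a b] v(1) w(1) test_funs_sqint[OF \<Omega> test_funs_pd[OF g]]
    by (simp add: L2_eq ip_def)
  ultimately show "(\<integral>x. (a * v x + b * w x) * pd i g x \<partial>lebesgue_on \<Omega>) =
      - signed_integral \<Omega> (\<lambda>A. (a *\<^sub>R m A + b *\<^sub>R m' A) $ i) g"
    using v(2) w(2) g by (simp add: represents_gradient_def)
qed

lemma integral_divg_eq:
  fixes v :: "real^'n \<Rightarrow> real"
  assumes \<Omega>: "open \<Omega>" "bounded \<Omega>" and v: "v \<in> L2 \<Omega>" "represents_gradient \<Omega> v m" and \<phi>: "\<phi> \<in> test_fields \<Omega>"
  shows "(\<integral>x. v x * divg \<phi> x \<partial>lebesgue_on \<Omega>) = - (\<Sum>i\<in>UNIV. signed_integral \<Omega> (\<lambda>A. m A $ i) (\<lambda>x. \<phi> x $ i))"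
proof -
  note t = test_fieldsD[OF \<phi>]
  have "(\<integral>x. v x * divg \<phi> x \<partial>lebesgue_on \<Omega>) = (\<integral>x. (\<Sum>i\<in>UNIV. v x * pd i (\<lambda>y. \<phi> y $ i) x) \<partial>lebesgue_on \<Omega>)"
    by (simp add: divg_def sum_distrib_left)
  also have "\<dots> = (\<Sum>i\<in>UNIV. (\<integral>x. v x * pd i (\<lambda>y. \<phi> y $ i) x \<partial>lebesgue_on \<Omega>))"
    by (rule Bochner_Integration.integral_sum) (rule sqint_mult_test_funs[OF \<Omega> v(1) test_funs_pd[OF t]])
  also have "\<dots> = - (\<Sum>i\<in>UNIV. signed_integral \<Omega> (\<lambda>A. m A $ i) (\<lambda>x. \<phi> x $ i))"
    using v(2) t by (simp add: represents_gradient_def sum_negf)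
  finally show ?thesis .
qed

text \<open>On a partition that is fine for all components at once, \<open>\<phi>\<close> becomes a
  step field. Its values are taken at points \<open>p B\<close> of the parts, where the bound 1
  holds, and Cauchy-Schwarz on each part gives the variation sum.\<close>

lemma BV_pairings_le_total_variation:
  fixes v :: "real^'n \<Rightarrow> real"
  assumes \<Omega>: "open \<Omega>" "bounded \<Omega>" and v: "v \<in> L2 \<Omega>" "represents_gradient \<Omega> v m" and s: "s \<in> BV_pairings \<Omega> v"
  shows "s \<le> total_variation \<Omega> m"
proof -
  have S: "\<Omega> \<in> sets borel" using \<Omega> by simp
  have m: "m \<in> vector_measures \<Omega>" using v by (simp add: represents_gradient_def)
  obtain \<phi> where \<phi>: "\<phi> \<in> test_fields \<Omega>" "\<forall>x\<in>\<Omega>. norm (\<phi> x) \<le> 1" "s = (\<integral>x. v x * divg \<phi> x \<partial>lebesgue_on \<Omega>)"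
    using s unfolding BV_pairings_def by blast
  note t = test_fieldsD[OF \<phi>(1)]
  have c: "\<bar>\<phi> x $ i\<bar> \<le> 1" for x i
  proof (cases "x \<in> \<Omega>")
    case True
    then show ?thesis using \<phi>(2) component_le_norm_cart[of "\<phi> x" i] by force
  qed (use test_funsD(4)[OF t] in simp)
  define Q where "Q i K \<longleftrightarrow> (\<forall>e>0. \<forall>P c. finite P \<longrightarrow> P \<subseteq> borel_in \<Omega> \<longrightarrow> partition_on \<Omega> P \<longrightarrow>
    (\<forall>B\<in>P. \<forall>x\<in>B. \<bar>\<phi> x $ i - c B\<bar> \<le> e) \<longrightarrow> \<bar>signed_integral \<Omega> (\<lambda>A. m A $ i) (\<lambda>x. \<phi> x $ i) - (\<Sum>B\<in>P. c B * m B $ i)\<bar> \<le> e * K)" for i K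
  have "\<exists>K. Q i K" for i
    using step_approx_signed_integral[OF S test_funsD(6)[OF t] c vector_measure_component[OF S m], of i i]
    unfolding step_approx_def Q_def .
  then obtain K where Q: "\<And>i. Q i (K i)" by metis
  note K = Q[unfolded Q_def]
  show ?thesis
  proof (rule field_le_epsilon)
    fix e :: real assume e: "e > 0"
    \<comment> \<open>Chosen so that the constants of all components together cost at most
      \<open>e\<close>; their sign is unknown, hence the absolute value.\<close>
    define e' where "e' = e / (\<bar>\<Sum>i\<in>UNIV. K i\<bar> + 1)"
    have e': "e' > 0" unfolding e'_def using e by (intro divide_pos_pos) auto
    have e'K: "e' * (\<Sum>i\<in>UNIV. K i) \<le> e"
    proof -
      have "e' * (\<Sum>i\<in>UNIV. K i) \<le> e' * (\<bar>\<Sum>i\<in>UNIV. K i\<bar> + 1)" using e' by (intro mult_left_mono) auto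
      also have "\<dots> = e" by (simp add: e'_def)
      finally show ?thesis .
    qed
    obtain P p where P: "finite P" "P \<subseteq> borel_in \<Omega>" "partition_on \<Omega> P" "\<And>B. B \<in> P \<Longrightarrow> p B \<in> B"
      "\<And>i B x. B \<in> P \<Longrightarrow> x \<in> B \<Longrightarrow> \<bar>\<phi> x $ i - \<phi> (p B) $ i\<bar> \<le> e'"
      by (rule step_partition_exists[of \<Omega> "\<lambda>i x. \<phi> x $ i" 1 e', OF S test_funsD(6)[OF t] c e'], rule that; assumption)
    have b: "- signed_integral \<Omega> (\<lambda>A. m A $ i) (\<lambda>x. \<phi> x $ i) \<le> - (\<Sum>B\<in>P. \<phi> (p B) $ i * m B $ i) + e' * K i" for i
    proof -
      have "\<forall>B\<in>P. \<forall>x\<in>B. \<bar>\<phi> x $ i - \<phi> (p B) $ i\<bar> \<le> e'" using P(5) by blast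
      from K[THEN spec, THEN mp, OF e', THEN spec, THEN spec, THEN mp, OF P(1), THEN mp, OF P(2), THEN mp, OF P(3), THEN mp, OF this]
      show ?thesis by linarith
    qed
    have "s \<le> (\<Sum>i\<in>UNIV. - (\<Sum>B\<in>P. \<phi> (p B) $ i * m B $ i) + e' * K i)"
    proof -
      have eq: "s = (\<Sum>i\<in>UNIV. - signed_integral \<Omega> (\<lambda>A. m A $ i) (\<lambda>x. \<phi> x $ i))"
        by (simp only: \<phi>(3) integral_divg_eq[OF \<Omega> v \<phi>(1)] sum_negf)
      show ?thesis unfolding eq by (rule sum_mono) (rule b)
    qed
    also have "\<dots> = (\<Sum>B\<in>P. - (\<phi> (p B) \<bullet> m B)) + e' * (\<Sum>i\<in>UNIV. K i)"
    proof -
      have "(\<Sum>i\<in>UNIV. \<Sum>B\<in>P. \<phi> (p B) $ i * m B $ i) = (\<Sum>B\<in>P. \<Sum>i\<in>UNIV. \<phi> (p B) $ i * m B $ i)" by (rule sum.swap)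
      then show ?thesis unfolding inner_vec_def by (simp add: sum_subtractf sum_negf sum_distrib_left)
    qed
    also have "\<dots> \<le> (\<Sum>B\<in>P. norm (m B)) + e"
    proof (intro add_mono sum_mono e'K)
      fix B assume B: "B \<in> P"
      then have "p B \<in> \<Omega>" using P(4)[OF B] P(3) unfolding partition_on_def by blast
      have "- (\<phi> (p B) \<bullet> m B) \<le> norm (\<phi> (p B)) * norm (m B)" using Cauchy_Schwarz_ineq2[of "\<phi> (p B)" "m B"] by linarith
      also have "\<dots> \<le> 1 * norm (m B)" using \<phi>(2) \<open>p B \<in> \<Omega>\<close> by (intro mult_right_mono) auto
      finally show "- (\<phi> (p B) \<bullet> m B) \<le> norm (m B)" by simp
    qed
    also have "\<dots> \<le> total_variation \<Omega> m + e" using variation_sums_le_total_variation[OF m P(1-3)] by simp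
    finally show "s \<le> total_variation \<Omega> m + e" .
  qed
qed

text \<open>The measure lives on the trace of the Borel sets. Its image under inclusion is a Borel
  measure on the whole space, and inner regularity is read off there.\<close>

lemma finite_measure_inner_compact:
  fixes \<Omega> :: "(real^'n) set"
  assumes \<Omega>: "\<Omega> \<in> sets borel" and \<mu>: "finite_measure \<mu>" "sets \<mu> = borel_in \<Omega>" and B: "B \<in> borel_in \<Omega>" and e: "e > 0"
  obtains K where "compact K" "K \<subseteq> B" "measure \<mu> (B - K) \<le> e"
proof -
  interpret finite_measure \<mu> by (rule \<mu>(1))
  have sp: "space \<mu> = \<Omega>" by (rule space_eq_if_sets_borel_in[OF \<Omega> \<mu>(2)])
  define \<nu> where "\<nu> = distr \<mu> borel (\<lambda>x. x)"
  have "(\<lambda>x. x) \<in> measurable (restrict_space borel \<Omega>) borel" by (rule measurable_restrict_space1) simp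
  then have idm: "(\<lambda>x. x) \<in> measurable \<mu> borel"
    using measurable_cong_sets[of \<mu> "restrict_space borel \<Omega>" borel borel] \<mu>(2) by (simp add: borel_in_def)
  have em: "emeasure \<nu> A = emeasure \<mu> A" if "A \<in> borel_in \<Omega>" for A
  proof -
    have "A \<in> sets borel" "A \<subseteq> \<Omega>" using that \<Omega> by (auto simp: borel_in_iff)
    then show ?thesis unfolding \<nu>_def by (subst emeasure_distr[OF idm]) (auto simp: sp Int_absorb2)
  qed
  have fin: "emeasure \<nu> (space \<nu>) \<noteq> \<infinity>"
    unfolding \<nu>_def by (subst emeasure_distr[OF idm]) (auto simp: emeasure_eq_measure)
  have Bb: "B \<in> sets borel" "B \<subseteq> \<Omega>" using B \<Omega> by (auto simp: borel_in_iff)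
  have SUP: "emeasure \<nu> B = (SUP K\<in>{K. K \<subseteq> B \<and> compact K}. emeasure \<nu> K)"
    by (rule inner_regular[OF _ fin Bb(1)]) (simp add: \<nu>_def)
  have Kb: "K \<in> borel_in \<Omega>" if "K \<subseteq> B" "compact K" for K
    using that Bb \<Omega> by (auto simp: borel_in_iff borel_compact)
  have "\<exists>K\<in>{K. K \<subseteq> B \<and> compact K}. emeasure \<nu> B < emeasure \<nu> K + ennreal e"
  proof (rule SUP_approx_ennreal[OF _ _ SUP])
    show "0 < e" by (rule e)
    show "{K. K \<subseteq> B \<and> compact K} \<noteq> {}" by (auto intro: exI[of _ "{}"])
    show "emeasure \<nu> B \<noteq> \<infinity>" unfolding em[OF B] by (simp add: emeasure_eq_measure)
  qed
  then obtain K where K: "K \<subseteq> B" "compact K" "emeasure \<nu> B \<le> emeasure \<nu> K + ennreal e"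
    using less_imp_le by blast
  have "measure \<mu> B \<le> measure \<mu> K + e"
    using K(3) e unfolding em[OF B] em[OF Kb[OF K(1,2)]]
    by (simp add: emeasure_eq_measure ennreal_plus[symmetric] del: ennreal_plus)
  moreover have "measure \<mu> (B - K) = measure \<mu> B - measure \<mu> K"
    by (rule finite_measure_Diff) (use B Kb[OF K(1,2)] \<mu>(2) K(1) in auto)
  ultimately show ?thesis using that[OF K(2,1)] by simp
qed

text \<open>One compact set for the positive and one for the negative variation of each component;
  their union works for all, as removing more only decreases the remaining mass.\<close>

lemma vector_measure_inner_compact:
  fixes \<Omega> :: "(real^'n) set"
  assumes \<Omega>: "\<Omega> \<in> sets borel" and m: "m \<in> vector_measures \<Omega>" and B: "B \<in> borel_in \<Omega>" and e: "e > 0"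
  obtains K where "compact K" "K \<subseteq> B" "norm (m B - m K) \<le> e"
proof -
  define e' where "e' = e / real CARD('n)"
  have e': "e' > 0" using e by (simp add: e'_def)
  note sm = vector_measure_component[OF \<Omega> m]
  define p where "p i = positive_variation \<Omega> (\<lambda>A. m A $ i)" for i
  define n where "n i = positive_variation \<Omega> (\<lambda>A. - m A $ i)" for i
  note pm = positive_variation_measure[OF \<Omega> sm, folded p_def]
    and nm = positive_variation_measure[OF \<Omega> signed_measure_uminus[OF \<Omega> sm], folded n_def]
    and jd = jordan_decomposition[OF \<Omega> sm, folded p_def n_def]
  have "\<exists>K. compact K \<and> K \<subseteq> B \<and> measure (p i) (B - K) \<le> e'" for i
    by (rule finite_measure_inner_compact[OF \<Omega> pm(2,1) B e']) blast
  then obtain K1 where K1: "\<And>i. compact (K1 i)" "\<And>i. K1 i \<subseteq> B" "\<And>i. measure (p i) (B - K1 i) \<le> e'" by metis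
  have "\<exists>K. compact K \<and> K \<subseteq> B \<and> measure (n i) (B - K) \<le> e'" for i
    by (rule finite_measure_inner_compact[OF \<Omega> nm(2,1) B e']) blast
  then obtain K2 where K2: "\<And>i. compact (K2 i)" "\<And>i. K2 i \<subseteq> B" "\<And>i. measure (n i) (B - K2 i) \<le> e'" by metis
  define K where "K = (\<Union>i. K1 i \<union> K2 i)"
  have K: "compact K" "K \<subseteq> B"
    unfolding K_def using K1(2) K2(2) by (intro compact_UN compact_Un K1(1) K2(1) finite UN_least Un_least; simp)+
  have Bb: "B \<in> sets borel" "B \<subseteq> \<Omega>" using B \<Omega> by (auto simp: borel_in_iff)
  have D: "B - L \<in> borel_in \<Omega>" if "compact L" for L using Bb that \<Omega> by (auto simp: borel_in_iff borel_compact)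
  have Kb: "K \<in> borel_in \<Omega>" using K Bb \<Omega> by (auto simp: borel_in_iff borel_compact)
  have comp: "\<bar>(m B - m K) $ i\<bar> \<le> e'" for i
  proof -
    have "(m B - m K) $ i = m (B - K) $ i" using signed_measure_Diff[OF \<Omega> sm Kb B K(2), of i] by simp
    also have "\<dots> = measure (p i) (B - K) - measure (n i) (B - K)" by (rule jd[OF D[OF K(1)]])
    finally have eq: "(m B - m K) $ i = measure (p i) (B - K) - measure (n i) (B - K)" .
    have "measure (p i) (B - K) \<le> measure (p i) (B - K1 i)"
      by (rule finite_measure.finite_measure_mono[OF pm(2)]) (use D[OF K1(1)] pm(1) in \<open>auto simp: K_def\<close>)
    moreover have "measure (n i) (B - K) \<le> measure (n i) (B - K2 i)"
      by (rule finite_measure.finite_measure_mono[OF nm(2)]) (use D[OF K2(1)] nm(1) in \<open>auto simp: K_def\<close>)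
    ultimately show ?thesis unfolding eq
      using K1(3)[of i] K2(3)[of i] measure_nonneg[of "p i" "B - K"] measure_nonneg[of "n i" "B - K"] by linarith
  qed
  have "norm (m B - m K) \<le> (\<Sum>i\<in>UNIV. \<bar>(m B - m K) $ i\<bar>)" by (rule norm_le_l1_cart)
  also have "\<dots> \<le> (\<Sum>i\<in>(UNIV::'n set). e')" by (intro sum_mono comp)
  also have "\<dots> = e" by (simp add: e'_def)
  finally show ?thesis using that[OF K] by blast
qed

subsection \<open>The total variation of the gradient measure is the BV seminorm\<close>

lemma integral_step_function:
  assumes \<Omega>: "\<Omega> \<in> sets borel" and \<mu>: "finite_measure \<mu>" "sets \<mu> = borel_in \<Omega>"
    and P: "\<And>B. B \<in> P \<Longrightarrow> K B \<in> borel_in \<Omega>"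
  shows "(\<integral>x. (\<Sum>B\<in>P. c B * indicator (K B) x) \<partial>\<mu>) = (\<Sum>B\<in>P. c B * measure \<mu> (K B))"
proof -
  interpret finite_measure \<mu> by (rule \<mu>(1))
  have K: "K B \<in> sets \<mu>" if "B \<in> P" for B using P[OF that] \<mu>(2) by simp
  have i: "(\<integral>x. c B * indicator (K B) x \<partial>\<mu>) = c B * measure \<mu> (K B)" "integrable \<mu> (\<lambda>x. c B * indicator (K B) x)" if "B \<in> P" for B
    using K[OF that] sets.sets_into_space[OF K[OF that]] by (auto simp: Int_absorb2 emeasure_eq_measure)
  have "(\<integral>x. (\<Sum>B\<in>P. c B * indicator (K B) x) \<partial>\<mu>) = (\<Sum>B\<in>P. (\<integral>x. c B * indicator (K B) x \<partial>\<mu>))"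
    by (rule Bochner_Integration.integral_sum) (rule i(2))
  also have "\<dots> = (\<Sum>B\<in>P. c B * measure \<mu> (K B))" by (rule sum.cong[OF refl]) (rule i(1))
  finally show ?thesis .
qed

lemma signed_integral_bounded_convergence:
  fixes f :: "nat \<Rightarrow> real^'n \<Rightarrow> real"
  assumes \<Omega>: "\<Omega> \<in> sets borel" and m: "signed_measure \<Omega> m"
    and f: "\<And>j. f j \<in> borel_measurable borel" "\<And>j x. \<bar>f j x\<bar> \<le> b" "g \<in> borel_measurable borel"
    "\<And>x. (\<lambda>j. f j x) \<longlonglongrightarrow> g x"
  shows "(\<lambda>j. signed_integral \<Omega> m (f j)) \<longlonglongrightarrow> signed_integral \<Omega> m g"
proof -
  have lim: "(\<lambda>j. \<integral>x. f j x \<partial>\<mu>) \<longlonglongrightarrow> (\<integral>x. g x \<partial>\<mu>)" if \<mu>: "finite_measure \<mu>" "sets \<mu> = borel_in \<Omega>" for \<mu>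
  proof -
    interpret finite_measure \<mu> by (rule \<mu>(1))
    show ?thesis
      by (rule integral_dominated_convergence[where w = "\<lambda>_. b"])
         (use f(2,4) measurable_if_sets_borel_in[OF \<mu>(2) f(1)] measurable_if_sets_borel_in[OF \<mu>(2) f(3)] in auto)
  qed
  show ?thesis
    unfolding signed_integral_def
    by (intro tendsto_diff lim positive_variation_measure[OF \<Omega> m]
        positive_variation_measure[OF \<Omega> signed_measure_uminus[OF \<Omega> m]])
qed

lemma compact_plus_cball:
  fixes K :: "(real^'n) set"
  assumes "compact K"
  shows "compact {x + z |x z. x \<in> K \<and> z \<in> cball 0 d}"
  by (rule compact_sums[OF assms compact_cball])

text \<open>The indicator of the closed neighbourhood of radius \<open>d j\<close> is mollified by a
  kernel of the same radius: the result is 1 on \<open>K\<close> and lives in the neighbourhood of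
  radius \<open>2 * d j\<close>.\<close>

lemma smooth_compact_cutoff:
  fixes K :: "(real^'n) set"
  assumes K: "compact K"
  obtains \<theta> :: "nat \<Rightarrow> real^'n \<Rightarrow> real" where
    "\<And>j S. {x + z |x z. x \<in> K \<and> z \<in> cball 0 (2 * inverse (real (Suc j)))} \<subseteq> S \<Longrightarrow> \<theta> j \<in> test_funs S"
    "\<And>j x. 0 \<le> \<theta> j x" "\<And>j x. \<theta> j x \<le> 1" "\<And>j. \<theta> j \<in> borel_measurable borel"
    "\<And>j x. \<theta> j x \<noteq> 0 \<Longrightarrow> \<exists>y\<in>K. dist x y \<le> 2 * inverse (real (Suc j))"
    "\<And>x. (\<lambda>j. \<theta> j x) \<longlonglongrightarrow> indicator K x"
proof -
  define d where "d j = inverse (real (Suc j))" for j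
  have d: "d j > 0" for j by (simp add: d_def)
  obtain \<kappa> :: "nat \<Rightarrow> real^'n \<Rightarrow> real" where \<kappa>: "\<And>j. \<kappa> j \<in> test_funs (ball 0 (d j))"
    "\<And>j x. 0 \<le> \<kappa> j x" "\<And>j. (\<integral>x. \<kappa> j x \<partial>lborel) = 1" unfolding d_def by (rule mollifier_sequence) blast
  have \<kappa>z: "norm z < d j" if "\<kappa> j z \<noteq> 0" for j z using test_funsD(4)[OF \<kappa>(1), of z j] that by (auto simp: dist_norm)
  define T where "T r = {x + z |x z. x \<in> K \<and> z \<in> cball 0 r}" for r
  have Tc: "compact (T r)" for r unfolding T_def by (rule compact_plus_cball[OF K])
  have Tm: "indicat_real (T r) \<in> borel_measurable borel" for r
    using Tc by (intro borel_measurable_indicator borel_compact)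
  have Ti: "integrable lborel (indicat_real (T r))" for r
    by (rule integrable_real_indicator)
       (use Tc[of r] borel_compact emeasure_bounded_finite[OF compact_imp_bounded[OF Tc[of r]]] in auto)
  define \<theta> where "\<theta> j = conv (\<kappa> j) (indicat_real (T (d j)))" for j
  have off: "x \<in> T (2 * d j)" if "\<theta> j x \<noteq> 0" for j x
  proof (rule ccontr)
    assume x: "x \<notin> T (2 * d j)"
    have "\<theta> j x = 0" unfolding \<theta>_def
    proof (rule conv_eq_0, rule ccontr)
      fix y assume 1: "\<kappa> j (x - y) \<noteq> 0" and "indicat_real (T (d j)) y \<noteq> 0"
      then have "y \<in> T (d j)" by (auto simp: indicator_def split: if_splits)
      then obtain k z where kz: "y = k + z" "k \<in> K" "norm z \<le> d j" by (auto simp: T_def)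
      have "norm (x - k) \<le> norm (x - y) + norm z" using norm_triangle_ineq[of "x - y" z] by (simp add: kz(1))
      then have "norm (x - k) \<le> 2 * d j" using kz(3) \<kappa>z[OF 1] by linarith
      then have "k + (x - k) \<in> T (2 * d j)" unfolding T_def using kz(2) by (intro CollectI exI[of _ k] exI[of _ "x - k"]) auto
      with x show False by simp
    qed
    with that show False by simp
  qed
  show ?thesis
  proof (rule that[of \<theta>])
    fix j S assume S: "{x + z |x z. x \<in> K \<and> z \<in> cball 0 (2 * inverse (real (Suc j)))} \<subseteq> S"
    show "\<theta> j \<in> test_funs S"
    proof (rule test_funsI)
      show "Ck k (\<theta> j)" for k unfolding \<theta>_def by (rule Ck_conv[OF \<kappa>(1) Ti])
      show "compact (T (2 * d j))" by (rule Tc)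
      show "T (2 * d j) \<subseteq> S" using S by (simp add: T_def d_def)
      show "\<theta> j x = 0" if "x \<notin> T (2 * d j)" for x using off that by blast
    qed
  next
    fix j x
    show "0 \<le> \<theta> j x" unfolding \<theta>_def by (rule conv_mono_const(2)[OF \<kappa> Ti Tm]) simp
    show "\<theta> j x \<le> 1" unfolding \<theta>_def by (rule conv_mono_const(1)[OF \<kappa> Ti Tm]) (simp add: indicator_def)
    show "\<theta> j \<in> borel_measurable borel" unfolding \<theta>_def by (rule conv_measurable[OF \<kappa>(1) Ti])
    show "\<exists>y\<in>K. dist x y \<le> 2 * inverse (real (Suc j))" if n0: "\<theta> j x \<noteq> 0"
    proof -
      obtain k z where "x = k + z" "k \<in> K" "norm z \<le> 2 * d j" using off[OF n0] by (auto simp: T_def)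
      then show ?thesis by (intro bexI[of _ k]) (auto simp: dist_norm d_def)
    qed
  next
    fix x
    show "(\<lambda>j. \<theta> j x) \<longlonglongrightarrow> indicator K x"
    proof (cases "x \<in> K")
      case True
      have "\<theta> j x = 1" for j
      proof (rule antisym)
        show "\<theta> j x \<le> 1" unfolding \<theta>_def by (rule conv_mono_const(1)[OF \<kappa> Ti Tm]) (simp add: indicator_def)
        have "x - z \<in> T (d j)" if "\<kappa> j z \<noteq> 0" for z
          unfolding T_def using True \<kappa>z[OF that] by (intro CollectI exI[of _ x] exI[of _ "- z"]) auto
        then show "1 \<le> \<theta> j x" unfolding \<theta>_def by (intro conv_mono_const(2)[OF \<kappa> Ti Tm]) simp
      qed
      with True show ?thesis by simp
    next
      case False
      have "open (- K)" using K by (simp add: compact_imp_closed open_Compl)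
      then obtain r where r: "r > 0" "ball x r \<subseteq> - K" using False open_contains_ball by blast
      have "(\<lambda>j. 2 * d j) \<longlonglongrightarrow> 2 * 0" unfolding d_def by (intro tendsto_intros LIMSEQ_inverse_real_of_nat)
      then have "\<forall>\<^sub>F j in sequentially. 2 * d j < r" using r(1) by (intro order_tendstoD) auto
      then have "\<forall>\<^sub>F j in sequentially. \<theta> j x = 0"
      proof eventually_elim
        case (elim j)
        show ?case
        proof (rule ccontr)
          assume "\<theta> j x \<noteq> 0"
          from off[OF this] obtain k z where kz: "x = k + z" "k \<in> K" "norm z \<le> 2 * d j" by (auto simp: T_def)
          then have "k \<in> ball x r" using elim by (simp add: dist_norm)
          with r(2) kz(2) show False by blast
        qed
      qed
      then show ?thesis using False by (simp add: tendsto_eventually)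
    qed
  qed
qed

lemma sum_at_most_one:
  fixes f :: "'b \<Rightarrow> real"
  assumes "finite P" "\<And>B. B \<in> P \<Longrightarrow> f B \<le> 1" "\<And>B B'. B \<in> P \<Longrightarrow> B' \<in> P \<Longrightarrow> f B \<noteq> 0 \<Longrightarrow> f B' \<noteq> 0 \<Longrightarrow> B = B'"
  shows "(\<Sum>B\<in>P. f B) \<le> 1"
proof (cases "\<exists>B\<in>P. f B \<noteq> 0")
  case True
  then obtain B where B: "B \<in> P" "f B \<noteq> 0" by blast
  have "(\<Sum>B\<in>P. f B) = f B + (\<Sum>B\<in>P - {B}. f B)" by (rule sum.remove[OF assms(1) B(1)])
  also have "(\<Sum>B\<in>P - {B}. f B) = 0" using assms(3)[OF B(1) _ B(2)] by (intro sum.neutral) blast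
  finally show ?thesis using assms(2)[OF B(1)] by simp
next
  case False
  then have "(\<Sum>B\<in>P. f B) = 0" by (intro sum.neutral) blast
  then show ?thesis by simp
qed

text \<open>The step field with value \<open>a B\<close> on \<open>K B\<close> is a pointwise limit
  of smooth fields. The compact sets have positive mutual distance, so eventually at most one cutoff
  is nonzero at each point and the smooth fields keep length at most 1.\<close>

lemma compact_family_pairing_le_BV:
  fixes \<Omega> :: "(real^'n) set" and v :: "real^'n \<Rightarrow> real" and K :: "'b \<Rightarrow> (real^'n) set"
  assumes \<Omega>: "open \<Omega>" "bounded \<Omega>" and v: "v \<in> L2 \<Omega>" "represents_gradient \<Omega> v m" and bdd: "bdd_above (BV_pairings \<Omega> v)"
    and P: "finite P" and K: "\<And>B. B \<in> P \<Longrightarrow> compact (K B)" "\<And>B. B \<in> P \<Longrightarrow> K B \<subseteq> \<Omega>"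
    "\<And>B B'. B \<in> P \<Longrightarrow> B' \<in> P \<Longrightarrow> B \<noteq> B' \<Longrightarrow> K B \<inter> K B' = {}"
    and a: "\<And>B. norm (a B :: real^'n) \<le> 1"
  shows "(\<Sum>B\<in>P. a B \<bullet> m (K B)) \<le> BV_seminorm \<Omega> v"
proof -
  have S: "\<Omega> \<in> sets borel" using \<Omega> by simp
  have m: "m \<in> vector_measures \<Omega>" using v by (simp add: represents_gradient_def)
  note sm = vector_measure_component[OF S m]
  define d where "d j = inverse (real (Suc j))" for j
  define T where "T B j = {x + z |x z. x \<in> K B \<and> z \<in> cball 0 (2 * d j)}" for B j
  have "\<exists>\<theta>. (\<forall>j S. T B j \<subseteq> S \<longrightarrow> \<theta> j \<in> test_funs S) \<and> (\<forall>j x. 0 \<le> \<theta> j x) \<and> (\<forall>j x. \<theta> j x \<le> 1) \<and>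
    (\<forall>j. \<theta> j \<in> borel_measurable borel) \<and> (\<forall>j x. \<theta> j x \<noteq> 0 \<longrightarrow> (\<exists>y\<in>K B. dist x y \<le> 2 * d j)) \<and>
    (\<forall>x. (\<lambda>j. \<theta> j x) \<longlonglongrightarrow> indicator (K B) x)" if B: "B \<in> P" for B
    unfolding T_def d_def
    by (rule smooth_compact_cutoff[OF K(1)[OF B]], rule exI, intro conjI allI impI) assumption+
  then have "\<forall>B\<in>P. \<exists>\<theta>. (\<forall>j S. T B j \<subseteq> S \<longrightarrow> \<theta> j \<in> test_funs S) \<and> (\<forall>j x. 0 \<le> \<theta> j x) \<and> (\<forall>j x. \<theta> j x \<le> 1) \<and>
    (\<forall>j. \<theta> j \<in> borel_measurable borel) \<and> (\<forall>j x. \<theta> j x \<noteq> 0 \<longrightarrow> (\<exists>y\<in>K B. dist x y \<le> 2 * d j)) \<and>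
    (\<forall>x. (\<lambda>j. \<theta> j x) \<longlonglongrightarrow> indicator (K B) x)" by blast
  from bchoice[OF this] obtain \<theta> where \<theta>': "\<forall>B\<in>P. (\<forall>j S. T B j \<subseteq> S \<longrightarrow> \<theta> B j \<in> test_funs S) \<and> (\<forall>j x. 0 \<le> \<theta> B j x) \<and> (\<forall>j x. \<theta> B j x \<le> 1) \<and>
    (\<forall>j. \<theta> B j \<in> borel_measurable borel) \<and> (\<forall>j x. \<theta> B j x \<noteq> 0 \<longrightarrow> (\<exists>y\<in>K B. dist x y \<le> 2 * d j)) \<and>
    (\<forall>x. (\<lambda>j. \<theta> B j x) \<longlonglongrightarrow> indicator (K B) x)" ..
  have \<theta>: "\<And>j S. T B j \<subseteq> S \<Longrightarrow> \<theta> B j \<in> test_funs S" "\<And>j x. 0 \<le> \<theta> B j x" "\<And>j x. \<theta> B j x \<le> 1"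
    "\<And>j. \<theta> B j \<in> borel_measurable borel" "\<And>j x. \<theta> B j x \<noteq> 0 \<Longrightarrow> \<exists>y\<in>K B. dist x y \<le> 2 * d j"
    "\<And>x. (\<lambda>j. \<theta> B j x) \<longlonglongrightarrow> indicator (K B) x" if "B \<in> P" for B
    using bspec[OF \<theta>' that] by blast+
  have "\<exists>r>0. (\<forall>x\<in>K B. \<forall>y\<in>- \<Omega>. r \<le> dist x y) \<and> (\<forall>B'\<in>P - {B}. \<forall>x\<in>K B. \<forall>y\<in>K B'. r \<le> dist x y)" if B: "B \<in> P" for B
  proof -
    obtain r1 where r1: "r1 > 0" "\<forall>x\<in>K B. \<forall>y\<in>- \<Omega>. r1 \<le> dist x y"
      using separate_compact_closed[OF K(1)[OF B], of "- \<Omega>"] K(2)[OF B] \<Omega>(1) by (auto simp: closed_Compl)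
    have "compact (\<Union>B'\<in>P - {B}. K B')" using P K(1) by (intro compact_UN) auto
    then obtain r2 where r2: "r2 > 0" "\<forall>x\<in>K B. \<forall>y\<in>(\<Union>B'\<in>P - {B}. K B'). r2 \<le> dist x y"
      using separate_compact_closed[OF K(1)[OF B], of "\<Union>B'\<in>P - {B}. K B'"] K(3)[OF B] by (auto simp: compact_imp_closed)
    show ?thesis using r1 r2 by (intro exI[of _ "min r1 r2"]) (auto simp: min_le_iff_disj)
  qed
  then obtain r where r: "\<And>B. B \<in> P \<Longrightarrow> r B > 0" "\<And>B x y. B \<in> P \<Longrightarrow> x \<in> K B \<Longrightarrow> y \<in> - \<Omega> \<Longrightarrow> r B \<le> dist x y"
    "\<And>B B' x y. B \<in> P \<Longrightarrow> B' \<in> P - {B} \<Longrightarrow> x \<in> K B \<Longrightarrow> y \<in> K B' \<Longrightarrow> r B \<le> dist x y" by metis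
  define \<phi> where "\<phi> j x = (\<Sum>B\<in>P. \<theta> B j x *\<^sub>R a B)" for j x
  have comp: "\<phi> j x $ i = (\<Sum>B\<in>P. a B $ i * \<theta> B j x)" for j x i by (simp add: \<phi>_def mult.commute)
  define \<Psi> where "\<Psi> i x = (\<Sum>B\<in>P. a B $ i * indicator (K B) x)" for i x
  have Km: "K B \<in> sets borel" if "B \<in> P" for B using K(1)[OF that] by (rule borel_compact)
  have Kin: "K B \<in> borel_in \<Omega>" if "B \<in> P" for B using Km[OF that] K(2)[OF that] S by (simp add: borel_in_iff)
  have lim: "(\<lambda>j. signed_integral \<Omega> (\<lambda>A. m A $ i) (\<lambda>x. \<phi> j x $ i)) \<longlonglongrightarrow> signed_integral \<Omega> (\<lambda>A. m A $ i) (\<Psi> i)" for i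
  proof (rule signed_integral_bounded_convergence[OF S sm, where b = "real (card P)"])
    show "(\<lambda>x. \<phi> j x $ i) \<in> borel_measurable borel" for j unfolding comp using \<theta>(4) by (intro borel_measurable_sum) auto
    show "\<Psi> i \<in> borel_measurable borel" unfolding \<Psi>_def using Km by (intro borel_measurable_sum) auto
    show "(\<lambda>j. \<phi> j x $ i) \<longlonglongrightarrow> \<Psi> i x" for x unfolding comp \<Psi>_def by (intro tendsto_sum tendsto_mult tendsto_const \<theta>(6))
    show "\<bar>\<phi> j x $ i\<bar> \<le> real (card P)" for j x
    proof -
      have "\<bar>\<phi> j x $ i\<bar> \<le> (\<Sum>B\<in>P. \<bar>a B $ i * \<theta> B j x\<bar>)" unfolding comp by (rule sum_abs)
      also have "\<dots> \<le> (\<Sum>B\<in>P. 1 * 1)"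
        unfolding abs_mult using \<theta>(2,3) order_trans[OF component_le_norm_cart a] by (intro sum_mono mult_mono) (auto simp: abs_of_nonneg)
      finally show ?thesis by simp
    qed
  qed
  have SI: "signed_integral \<Omega> (\<lambda>A. m A $ i) (\<Psi> i) = (\<Sum>B\<in>P. a B $ i * m (K B) $ i)" for i
  proof -
    note p = positive_variation_measure[OF S sm[of i]] and n = positive_variation_measure[OF S signed_measure_uminus[OF S sm[of i]]]
    have "signed_integral \<Omega> (\<lambda>A. m A $ i) (\<Psi> i) =
      (\<Sum>B\<in>P. a B $ i * measure (positive_variation \<Omega> (\<lambda>A. m A $ i)) (K B)) -
      (\<Sum>B\<in>P. a B $ i * measure (positive_variation \<Omega> (\<lambda>A. - m A $ i)) (K B))"
      unfolding signed_integral_def \<Psi>_def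
      using integral_step_function[OF S p(2,1) Kin, where c = "\<lambda>B. a B $ i"] integral_step_function[OF S n(2,1) Kin, where c = "\<lambda>B. a B $ i"] by simp
    also have "\<dots> = (\<Sum>B\<in>P. a B $ i * m (K B) $ i)"
      unfolding sum_subtractf[symmetric] right_diff_distrib[symmetric]
      by (rule sum.cong[OF refl]) (simp add: jordan_decomposition[OF S sm Kin])
    finally show ?thesis .
  qed
  have le: "\<forall>\<^sub>F j in sequentially. (\<Sum>i\<in>UNIV. signed_integral \<Omega> (\<lambda>A. m A $ i) (\<lambda>x. \<phi> j x $ i)) \<le> BV_seminorm \<Omega> v"
  proof -
    \<comment> \<open>Neighbourhoods of radius \<open>2 * d j\<close> meet only if the two compact
      sets come within \<open>4 * d j\<close> of each other.\<close>
    have "(\<lambda>j. 4 * d j) \<longlonglongrightarrow> 4 * 0" unfolding d_def by (intro tendsto_intros LIMSEQ_inverse_real_of_nat)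
    then have l4: "(\<lambda>j. 4 * d j) \<longlonglongrightarrow> 0" by simp
    have "\<forall>\<^sub>F j in sequentially. \<forall>B\<in>P. 4 * d j < r B"
      by (intro eventually_ball_finite[OF P] ballI order_tendstoD(2)[OF l4] r(1))
    then show ?thesis
    proof eventually_elim
      case (elim j)
      have dj: "d j > 0" by (simp add: d_def)
      have Tsub: "T B j \<subseteq> \<Omega>" if B: "B \<in> P" for B
      proof
        fix y assume "y \<in> T B j"
        then obtain x z where xz: "y = x + z" "x \<in> K B" "norm z \<le> 2 * d j" by (auto simp: T_def)
        show "y \<in> \<Omega>"
        proof (rule ccontr)
          assume "y \<notin> \<Omega>"
          then have "r B \<le> dist x y" using r(2)[OF B xz(2)] by simp
          then show False using xz(1,3) elim B dj by (force simp: dist_norm)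
        qed
      qed
      have tf: "\<phi> j \<in> test_fields \<Omega>"
        unfolding test_fields_def mem_Collect_eq comp using \<theta>(1)[OF _ Tsub] P by (intro allI test_funs_sum test_funs_cmult) auto
      have n1: "norm (\<phi> j x) \<le> 1" for x
      proof -
        have "norm (\<phi> j x) \<le> (\<Sum>B\<in>P. norm (\<theta> B j x *\<^sub>R a B))" unfolding \<phi>_def by (rule norm_sum)
        also have "\<dots> \<le> (\<Sum>B\<in>P. \<theta> B j x)"
          using \<theta>(2) a by (intro sum_mono) (auto simp: mult_left_le)
        also have "\<dots> \<le> 1"
        proof (rule sum_at_most_one[OF P \<theta>(3)])
          fix B B' assume B: "B \<in> P" "B' \<in> P" "\<theta> B j x \<noteq> 0" "\<theta> B' j x \<noteq> 0"
          show "B = B'"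
          proof (rule ccontr)
            assume ne: "B \<noteq> B'"
            obtain y y' where y: "y \<in> K B" "dist x y \<le> 2 * d j" "y' \<in> K B'" "dist x y' \<le> 2 * d j"
              using \<theta>(5)[OF B(1,3)] \<theta>(5)[OF B(2,4)] by blast
            have "r B \<le> dist y y'" using r(3)[OF B(1) _ y(1,3)] B(2) ne by simp
            also have "\<dots> \<le> 4 * d j" using dist_triangle3[of y y' x] y by linarith
            finally show False using elim B(1) by force
          qed
        qed
        finally show ?thesis .
      qed
      \<comment> \<open>The pairing with the gradient measure carries a minus sign, and the negated
        field is just as admissible.\<close>
      have tf': "(\<lambda>x. (-1) *\<^sub>R \<phi> j x) \<in> test_fields \<Omega>" by (rule test_fields_scale[OF tf])
      have "(\<integral>x. v x * divg (\<lambda>x. (-1) *\<^sub>R \<phi> j x) x \<partial>lebesgue_on \<Omega>) \<le> 1 * BV_seminorm \<Omega> v"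
        by (rule BV_pairings_le[OF bdd tf']) (use n1 in auto)
      moreover have "(\<integral>x. v x * divg (\<lambda>x. (-1) *\<^sub>R \<phi> j x) x \<partial>lebesgue_on \<Omega>) = - (\<integral>x. v x * divg (\<phi> j) x \<partial>lebesgue_on \<Omega>)"
        unfolding divg_scale[OF tf] by simp
      ultimately show ?case unfolding integral_divg_eq[OF \<Omega> v tf] by simp
    qed
  qed
  have "(\<lambda>j. \<Sum>i\<in>UNIV. signed_integral \<Omega> (\<lambda>A. m A $ i) (\<lambda>x. \<phi> j x $ i)) \<longlonglongrightarrow> (\<Sum>i\<in>UNIV. signed_integral \<Omega> (\<lambda>A. m A $ i) (\<Psi> i))"
    by (intro tendsto_sum lim)
  moreover have "(\<Sum>i\<in>UNIV. signed_integral \<Omega> (\<lambda>A. m A $ i) (\<Psi> i)) = (\<Sum>B\<in>P. a B \<bullet> m (K B))"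
    unfolding SI inner_vec_def by (subst sum.swap) simp
  ultimately have lim': "(\<lambda>j. \<Sum>i\<in>UNIV. signed_integral \<Omega> (\<lambda>A. m A $ i) (\<lambda>x. \<phi> j x $ i)) \<longlonglongrightarrow> (\<Sum>B\<in>P. a B \<bullet> m (K B))" by simp
  show ?thesis by (rule tendsto_upperbound[OF lim' le]) simp
qed

text \<open>Each part of a partition is replaced by a compact subset on which \<open>m\<close> has
  almost the same value, paired with the direction \<open>sgn (m B)\<close>. Compact subsets of
  disjoint parts are disjoint, so smooth fields can attain these directions simultaneously in the
  limit.\<close>

lemma total_variation_le_BV_seminorm:
  fixes \<Omega> :: "(real^'n) set" and v :: "real^'n \<Rightarrow> real"
  assumes \<Omega>: "open \<Omega>" "bounded \<Omega>" and v: "v \<in> L2 \<Omega>" "represents_gradient \<Omega> v m" and bdd: "bdd_above (BV_pairings \<Omega> v)"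
  shows "total_variation \<Omega> m \<le> BV_seminorm \<Omega> v"
proof (rule total_variation_least)
  show S: "\<Omega> \<in> sets borel" using \<Omega> by simp
  have m: "m \<in> vector_measures \<Omega>" using v by (simp add: represents_gradient_def)
  fix P assume P: "finite P" "P \<subseteq> borel_in \<Omega>" "partition_on \<Omega> P"
  show "(\<Sum>B\<in>P. norm (m B)) \<le> BV_seminorm \<Omega> v"
  proof (rule field_le_epsilon)
    fix e :: real assume e: "e > 0"
    define e' where "e' = e / (real (card P) + 1)"
    have e': "e' > 0" unfolding e'_def using e by (intro divide_pos_pos) auto
    have e'2: "real (card P) * e' \<le> e" unfolding e'_def using e by (simp add: field_simps)
    have "\<forall>B\<in>P. \<exists>K. compact K \<and> K \<subseteq> B \<and> norm (m B - m K) \<le> e'"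
    proof
      fix B assume "B \<in> P"
      then have "B \<in> borel_in \<Omega>" using P(2) by blast
      then show "\<exists>K. compact K \<and> K \<subseteq> B \<and> norm (m B - m K) \<le> e'"
        by (rule vector_measure_inner_compact[OF S m _ e']) blast
    qed
    from bchoice[OF this] obtain K where K': "\<forall>B\<in>P. compact (K B) \<and> K B \<subseteq> B \<and> norm (m B - m (K B)) \<le> e'" ..
    have K: "compact (K B)" "K B \<subseteq> B" "norm (m B - m (K B)) \<le> e'" if "B \<in> P" for B using bspec[OF K' that] by auto
    have dis: "B \<inter> B' = {}" if "B \<in> P" "B' \<in> P" "B \<noteq> B'" for B B'
      using P(3) that unfolding partition_on_def disjoint_def by blast
    have "(\<Sum>B\<in>P. sgn (m B) \<bullet> m (K B)) \<le> BV_seminorm \<Omega> v"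
    proof (rule compact_family_pairing_le_BV[OF \<Omega> v bdd P(1) K(1)])
      show "K B \<subseteq> \<Omega>" if "B \<in> P" for B using K(2)[OF that] P(3) that unfolding partition_on_def by blast
      show "K B \<inter> K B' = {}" if "B \<in> P" "B' \<in> P" "B \<noteq> B'" for B B' using dis[OF that] K(2) that by blast
      show "norm (sgn (m B)) \<le> 1" for B by (simp add: norm_sgn)
    qed
    moreover have "norm (m B) \<le> sgn (m B) \<bullet> m (K B) + e'" if B: "B \<in> P" for B
    proof -
      have "norm (m B) = sgn (m B) \<bullet> m B"
        by (cases "m B = 0") (auto simp: sgn_div_norm power2_norm_eq_inner[symmetric] power2_eq_square)
      also have "\<dots> = sgn (m B) \<bullet> m (K B) + sgn (m B) \<bullet> (m B - m (K B))" by (simp add: inner_diff_right)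
      also have "sgn (m B) \<bullet> (m B - m (K B)) \<le> norm (sgn (m B)) * norm (m B - m (K B))" by (rule norm_cauchy_schwarz)
      also have "\<dots> \<le> 1 * e'" using K(3)[OF B] e' by (intro mult_mono) (auto simp: norm_sgn)
      finally show ?thesis by simp
    qed
    then have "(\<Sum>B\<in>P. norm (m B)) \<le> (\<Sum>B\<in>P. sgn (m B) \<bullet> m (K B) + e')" by (rule sum_mono)
    ultimately show "(\<Sum>B\<in>P. norm (m B)) \<le> BV_seminorm \<Omega> v + e" using e'2 by (simp add: sum.distrib)
  qed
qed

subsection \<open>A continuous curve through every point of a cube\<close>

text \<open>
  Schoenberg's curve: the base 4 digits 0 and 1 of the parameter are read off by a continuous
  1-periodic function and used as the binary digits of the coordinates.
\<close>

definition digit_fun :: "real \<Rightarrow> real" where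
  "digit_fun t = max 0 (min 1 (2 * (4 / 5 - cos (2 * pi * t))))"

lemma digit_fun_bounds: "0 \<le> digit_fun t" "digit_fun t \<le> 1"
  by (auto simp: digit_fun_def)

lemma digit_fun_continuous: "continuous_on UNIV (\<lambda>t. digit_fun (c * t))"
  unfolding digit_fun_def by (intro continuous_intros)

lemma digit_fun_int: "digit_fun (of_int k + t) = digit_fun t"
proof -
  have "cos (2 * pi * (of_int k + t)) = cos (2 * pi * of_int k + 2 * pi * t)" by (simp add: distrib_left)
  also have "\<dots> = cos (2 * pi * t)" by (simp add: cos_add)
  finally show ?thesis by (simp add: digit_fun_def)
qed

text \<open>\<open>1 / 12\<close> is the most that the digits behind the leading one can add to a
  number with base 4 digits 0 and 1. The constant \<open>4 / 5\<close> in \<open>digit_fun\<close>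
  lies below \<open>cos (pi / 6)\<close>, so the clipping at 0 is active on this range.\<close>

lemma digit_fun_0:
  assumes "0 \<le> s" "s \<le> 1 / 12"
  shows "digit_fun s = 0"
proof -
  have "cos (pi / 6) \<le> cos (2 * pi * s)"
    using assms by (intro cos_monotone_0_pi_le) (auto simp: field_simps)
  moreover have "4 / 5 \<le> cos (pi / 6)"
  proof -
    have "8 / 5 \<le> sqrt 3" by (rule real_le_rsqrt) (simp add: power2_eq_square)
    then show ?thesis by (simp add: cos_30)
  qed
  ultimately show ?thesis by (simp add: digit_fun_def)
qed

text \<open>Here the cosine is nonpositive and twice \<open>4 / 5\<close> exceeds 1, so the clipping
  at 1 is active.\<close>

lemma digit_fun_1:
  assumes "0 \<le> s" "s \<le> 1 / 12"
  shows "digit_fun (1 / 4 + s) = 1"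
proof -
  have "cos (2 * pi * (1 / 4 + s)) \<le> cos (pi / 2)"
    using assms by (intro cos_monotone_0_pi_le) (auto simp: field_simps)
  then show ?thesis by (simp add: digit_fun_def)
qed

text \<open>The number with base 4 digits \<open>a l\<close> behind the point. With digits 0 and 1
  only, it avoids the ranges where \<open>digit_fun\<close> is not constant, and so do its digit
  shifts modulo integers.\<close>

definition code4 :: "(nat \<Rightarrow> nat) \<Rightarrow> real" where
  "code4 a = (\<Sum>l. real (a l) * (1 / 4) ^ (l + 1))"

lemma code4_summable:
  assumes "\<And>l. a l \<le> 1"
  shows "summable (\<lambda>l. real (a l) * (1 / 4) ^ (l + 1))"
proof (rule summable_comparison_test')
  show "summable (\<lambda>l. (1 / 4 :: real) ^ (l + 1))" by (intro summable_ignore_initial_segment summable_geometric) auto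
  show "norm (real (a l) * (1 / 4) ^ (l + 1)) \<le> (1 / 4) ^ (l + 1)" if "l \<ge> 0" for l
    using assms[of l] by (simp add: mult_left_le_one_le)
qed

lemma code4_bounds:
  assumes "\<And>l. a l \<le> 1"
  shows "0 \<le> code4 a" "code4 a \<le> 1 / 3"
proof -
  note s = code4_summable[of a, OF assms]
  show "0 \<le> code4 a" unfolding code4_def by (rule suminf_nonneg[OF s]) simp
  have g: "(\<lambda>l. 1 / 4 * (1 / 4 :: real) ^ l) sums (1 / 4 * (1 / (1 - 1 / 4)))"
    by (intro sums_mult geometric_sums) simp
  have "code4 a \<le> (\<Sum>l. 1 / 4 * (1 / 4) ^ l)"
    unfolding code4_def
  proof (rule suminf_le[OF _ s sums_summable[OF g]])
    show "real (a l) * (1 / 4) ^ (l + 1) \<le> 1 / 4 * (1 / 4) ^ l" for l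
      using assms[of l] by (simp add: mult_left_le_one_le)
  qed
  also have "\<dots> = 1 / 3" using sums_unique[OF g] by simp
  finally show "code4 a \<le> 1 / 3" .
qed

lemma code4_shift:
  assumes "\<And>l. a l \<le> 1"
  shows "code4 a = real (a 0) / 4 + code4 (\<lambda>l. a (Suc l)) / 4"
proof -
  note s = code4_summable[of "\<lambda>l. a (Suc l)", OF assms]
  have "code4 a = real (a 0) / 4 + (\<Sum>l. real (a (Suc l)) * (1 / 4) ^ (Suc l + 1))"
    unfolding code4_def using suminf_split_head[OF code4_summable[of a, OF assms]] by simp
  also have "(\<Sum>l. real (a (Suc l)) * (1 / 4) ^ (Suc l + 1)) = (\<Sum>l. 1 / 4 * (real (a (Suc l)) * (1 / 4) ^ (l + 1)))"
    by (simp add: mult_ac)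
  also have "\<dots> = 1 / 4 * (\<Sum>l. real (a (Suc l)) * (1 / 4) ^ (l + 1))" by (rule suminf_mult[OF s])
  finally show ?thesis by (simp add: code4_def)
qed

lemma code4_power_shift:
  assumes "\<And>l. a l \<le> 1"
  shows "\<exists>k::int. 4 ^ m * code4 a = of_int k + code4 (\<lambda>l. a (m + l))"
proof (induction m)
  case 0
  show ?case by (intro exI[of _ 0]) simp
next
  case (Suc m)
  then obtain k :: int where k: "4 ^ m * code4 a = of_int k + code4 (\<lambda>l. a (m + l))" by blast
  have "code4 (\<lambda>l. a (m + l)) = real (a m) / 4 + code4 (\<lambda>l. a (Suc m + l)) / 4"
    using code4_shift[of "\<lambda>l. a (m + l)"] assms by simp
  then have "4 ^ Suc m * code4 a = of_int (4 * k + int (a m)) + code4 (\<lambda>l. a (Suc m + l))"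
    using k by simp
  then show ?case by blast
qed

text \<open>Multiplication by \<open>4 ^ m\<close> shifts the digits; the integer part is invisible
  to a 1-periodic function, and the remaining fraction lies on a flat part that shows the
  digit.\<close>

lemma digit_fun_code4:
  assumes "\<And>l. a l \<le> 1"
  shows "digit_fun (4 ^ m * code4 a) = real (a m)"
proof -
  obtain k :: int where k: "4 ^ m * code4 a = of_int k + code4 (\<lambda>l. a (m + l))" using code4_power_shift[of a, OF assms] by blast
  define s where "s = code4 (\<lambda>l. a (Suc m + l)) / 4"
  have s: "0 \<le> s" "s \<le> 1 / 12" using code4_bounds[of "\<lambda>l. a (Suc m + l)", OF assms] by (auto simp: s_def)
  have "code4 (\<lambda>l. a (m + l)) = real (a m) / 4 + s"
    using code4_shift[of "\<lambda>l. a (m + l)"] assms by (simp add: s_def)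
  then have "digit_fun (4 ^ m * code4 a) = digit_fun (real (a m) / 4 + s)" by (simp add: k digit_fun_int)
  moreover have "a m = 0 \<or> a m = 1" using assms[of m] by linarith
  ultimately show ?thesis using digit_fun_0[OF s] digit_fun_1[OF s] by auto
qed

definition bin_digit :: "real \<Rightarrow> nat \<Rightarrow> nat" where
  "bin_digit y k = nat (\<lfloor>2 ^ Suc k * y\<rfloor> - 2 * \<lfloor>2 ^ k * y\<rfloor>)"

lemma floor_double_diff: "0 \<le> \<lfloor>2 * x\<rfloor> - 2 * \<lfloor>x :: real\<rfloor>" "\<lfloor>2 * x\<rfloor> - 2 * \<lfloor>x\<rfloor> \<le> 1"
  by linarith+

lemma bin_digit_le: "bin_digit y k \<le> 1"
  using floor_double_diff(2)[of "2 ^ k * y"] by (simp add: bin_digit_def mult.assoc)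

text \<open>Dyadic truncations converge to \<open>y\<close>, and the digits are their scaled
  increments, so the series telescopes. The first truncation is 0 because
  \<open>0 \<le> y < 1\<close>.\<close>

lemma bin_digit_sums:
  assumes "0 \<le> y" "y < 1"
  shows "(\<lambda>k. real (bin_digit y k) * (1 / 2) ^ (k + 1)) sums y"
proof -
  define f where "f k = real_of_int \<lfloor>2 ^ k * y\<rfloor> / 2 ^ k" for k
  have lim: "f \<longlonglongrightarrow> y"
  proof (rule tendsto_sandwich[of "\<lambda>k. y - (1 / 2) ^ k" _ _ "\<lambda>_. y"])
    have "y - (1 / 2) ^ k \<le> f k \<and> f k \<le> y" for k
    proof -
      have "2 ^ k * y - 1 \<le> real_of_int \<lfloor>2 ^ k * y\<rfloor>" "real_of_int \<lfloor>2 ^ k * y\<rfloor> \<le> 2 ^ k * y" by linarith+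
      then have "(2 ^ k * y - 1) / 2 ^ k \<le> f k" "f k \<le> (2 ^ k * y) / 2 ^ k"
        unfolding f_def by (intro divide_right_mono; simp)+
      then show ?thesis by (simp add: diff_divide_distrib power_one_over)
    qed
    then show "\<forall>\<^sub>F k in sequentially. y - (1 / 2) ^ k \<le> f k" "\<forall>\<^sub>F k in sequentially. f k \<le> y" by auto
    have "(\<lambda>k. y - (1 / 2 :: real) ^ k) \<longlonglongrightarrow> y - 0" by (intro tendsto_intros LIMSEQ_power_zero) auto
    then show "(\<lambda>k. y - (1 / 2 :: real) ^ k) \<longlonglongrightarrow> y" by simp
  qed simp
  have "f 0 = 0" using assms by (simp add: f_def floor_eq_iff)
  moreover have "f (Suc k) - f k = real (bin_digit y k) * (1 / 2) ^ (k + 1)" for k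
  proof -
    have "real (bin_digit y k) = real_of_int (\<lfloor>2 ^ Suc k * y\<rfloor> - 2 * \<lfloor>2 ^ k * y\<rfloor>)"
      unfolding bin_digit_def using floor_double_diff(1)[of "2 ^ k * y"] by (simp add: mult.assoc)
    then show ?thesis by (simp add: f_def field_simps power_one_over)
  qed
  then have "(\<lambda>k. f (Suc k) - f k) = (\<lambda>k. real (bin_digit y k) * (1 / 2) ^ (k + 1))" by (rule ext)
  with telescope_sums[OF lim] have "(\<lambda>k. real (bin_digit y k) * (1 / 2) ^ (k + 1)) sums (y - f 0)" by (simp only:)
  ultimately show ?thesis by simp
qed

text \<open>The digit positions \<open>k * n + ix i\<close> are reserved for coordinate
  \<open>i\<close>, so all coordinates are prescribed independently by one parameter. The cube is
  half open to match the binary expansion of numbers below 1.\<close>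

lemma schoenberg_curve:
  fixes R :: real
  assumes "R > 0"
  obtains \<gamma> :: "real \<Rightarrow> real^'n" where "continuous_on UNIV \<gamma>"
    "\<And>x. (\<And>i. - R \<le> x $ i \<and> x $ i < R) \<Longrightarrow> \<exists>t\<in>{0..1}. \<gamma> t = x"
proof -
  define n where "n = CARD('n)"
  have n: "n > 0" by (simp add: n_def)
  obtain h where "bij_betw h {0..<n} (UNIV :: 'n set)" using ex_bij_betw_nat_finite[of "UNIV :: 'n set"] n_def by auto
  then have bij: "bij_betw h {..<n} UNIV" by (simp add: atLeast0LessThan)
  define ix where "ix i = inv_into {..<n} h i" for i
  have ix: "ix i < n" "h (ix i) = i" for i
  proof -
    have "i \<in> h ` {..<n}" using bij by (simp add: bij_betw_def)
    then show "ix i < n" "h (ix i) = i" using inv_into_into[of i h "{..<n}"] f_inv_into_f[of i h "{..<n}"] by (auto simp: ix_def)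
  qed
  define c where "c i t = (\<Sum>k. digit_fun (4 ^ (k * n + ix i) * t) * (1 / 2) ^ (k + 1))" for i t
  have cc: "continuous_on UNIV (c i)" for i
  proof (rule uniform_limit_theorem)
    show "uniform_limit UNIV (\<lambda>m t. \<Sum>k<m. digit_fun (4 ^ (k * n + ix i) * t) * (1 / 2) ^ (k + 1)) (c i) sequentially"
      unfolding c_def
    proof (rule Weierstrass_m_test)
      show "norm (digit_fun (4 ^ (k * n + ix i) * t) * (1 / 2) ^ (k + 1)) \<le> (1 / 2) ^ (k + 1)" for k t
        using digit_fun_bounds[of "4 ^ (k * n + ix i) * t"] by (simp add: mult_left_le_one_le)
      show "summable (\<lambda>k. (1 / 2 :: real) ^ (k + 1))" by (intro summable_ignore_initial_segment summable_geometric) auto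
    qed
    show "\<forall>\<^sub>F m in sequentially. continuous_on UNIV (\<lambda>t. \<Sum>k<m. digit_fun (4 ^ (k * n + ix i) * t) * (1 / 2) ^ (k + 1))"
      by (intro always_eventually allI continuous_on_sum continuous_on_mult digit_fun_continuous continuous_on_const)
  qed simp
  define \<gamma> where "\<gamma> t = (\<chi> i. - R + 2 * R * c i t)" for t
  show ?thesis
  proof (rule that[of \<gamma>])
    show "continuous_on UNIV \<gamma>" unfolding \<gamma>_def
      by (intro continuous_on_vec_lambda continuous_on_add continuous_on_mult continuous_on_const cc)
    fix x :: "real^'n" assume x: "\<And>i. - R \<le> x $ i \<and> x $ i < R"
    define y where "y i = (x $ i + R) / (2 * R)" for i
    have y: "0 \<le> y i" "y i < 1" for i using x[of i] assms by (auto simp: y_def field_simps)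
    \<comment> \<open>Interleaved digits: position \<open>l\<close> belongs to coordinate
      \<open>h (l mod n)\<close> and holds its digit number \<open>l div n\<close>.\<close>
    define a where "a l = bin_digit (y (h (l mod n))) (l div n)" for l
    have a: "a l \<le> 1" for l unfolding a_def by (rule bin_digit_le)
    have ad: "a (k * n + ix i) = bin_digit (y i) k" for k i using ix[of i] n by (simp add: a_def)
    have "c i (code4 a) = y i" for i
      unfolding c_def digit_fun_code4[of a, OF a] ad using sums_unique[OF bin_digit_sums[OF y]] by simp
    then have "\<gamma> (code4 a) $ i = x $ i" for i using assms by (simp add: \<gamma>_def y_def)
    then have "\<gamma> (code4 a) = x" by (simp add: vec_eq_iff)
    moreover have "code4 a \<in> {0..1}" using code4_bounds[of a, OF a] by auto
    ultimately show "\<exists>t\<in>{0..1}. \<gamma> t = x" by blast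
  qed
qed

subsection \<open>Representation of bounded functionals by measures\<close>

text \<open>Atoms are indexed and then mapped, so that several of them may sit at the same
  place.\<close>

definition discrete_measure :: "nat \<Rightarrow> (nat \<Rightarrow> real) \<Rightarrow> (nat \<Rightarrow> real) \<Rightarrow> real measure" where
  "discrete_measure m w loc = distr (point_measure {..m} (\<lambda>k. ennreal (w k))) borel loc"

lemma discrete_measure:
  assumes w: "\<And>k. k \<le> m \<Longrightarrow> 0 \<le> w k" "(\<Sum>k\<le>m. w k) = 1"
  shows "real_distribution (discrete_measure m w loc)"
    and "f \<in> borel_measurable borel \<Longrightarrow> (\<integral>x. f x \<partial>discrete_measure m w loc) = (\<Sum>k\<le>m. w k * (f (loc k) :: real))"
    and "(\<And>k. loc k \<in> {0..1}) \<Longrightarrow> measure (discrete_measure m w loc) {-1<..1} = 1"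
proof -
  let ?p = "point_measure {..m} (\<lambda>k. ennreal (w k))"
  have lm: "loc \<in> measurable ?p borel" by simp
  have em: "emeasure ?p {..m} = 1"
    using w by (simp add: emeasure_point_measure_finite, subst sum_ennreal) auto
  have sp: "space ?p = {..m}" by (simp add: space_point_measure)
  interpret p: prob_space ?p by (rule prob_spaceI) (simp add: sp em)
  interpret d: prob_space "discrete_measure m w loc" unfolding discrete_measure_def by (rule p.prob_space_distr[OF lm])
  show "real_distribution (discrete_measure m w loc)"
    by (intro real_distribution.intro d.prob_space_axioms real_distribution_axioms.intro) (simp add: discrete_measure_def)
  show "(\<integral>x. f x \<partial>discrete_measure m w loc) = (\<Sum>k\<le>m. w k * f (loc k))" if "f \<in> borel_measurable borel"
    unfolding discrete_measure_def using w(1)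
    by (subst integral_distr[OF lm that], subst lebesgue_integral_point_measure_finite) auto
  show "measure (discrete_measure m w loc) {-1<..1} = 1" if l: "\<And>k. loc k \<in> {0..1}"
  proof -
    have "loc -` {-1<..1} \<inter> space ?p = {..m}" using l by (force simp: sp)
    then have "emeasure (discrete_measure m w loc) {-1<..1} = 1"
      unfolding discrete_measure_def by (subst emeasure_distr[OF lm]) (simp_all add: em)
    then show ?thesis by (simp add: measure_def)
  qed
qed

text \<open>
  The functional is a limit of discrete measures. Transported to the unit interval along a continuous
  curve through every point of a cube, they have a weakly convergent subsequence by Helly's theorem.
\<close>

lemma bounded_functional_representation:
  fixes \<Omega> :: "(real^'n) set" and L :: "(real^'n \<Rightarrow> real) \<Rightarrow> real"
  assumes \<Omega>: "open \<Omega>" "bounded \<Omega>" "\<Omega> \<noteq> {}"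
    and lin: "\<And>f g a b. f \<in> test_funs \<Omega> \<Longrightarrow> g \<in> test_funs \<Omega> \<Longrightarrow> L (\<lambda>x. a * f x + b * g x) = a * L f + b * L g"
    and bd: "\<And>f c. f \<in> test_funs \<Omega> \<Longrightarrow> (\<And>x. \<bar>f x\<bar> \<le> c) \<Longrightarrow> \<bar>L f\<bar> \<le> C * c"
  obtains \<alpha> \<beta> D where "finite_measure \<alpha>" "sets \<alpha> = borel_in \<Omega>" "finite_measure \<beta>" "sets \<beta> = borel_in \<Omega>"
    "\<And>f. f \<in> test_funs \<Omega> \<Longrightarrow> L f = D * ((\<integral>x. f x \<partial>\<alpha>) - (\<integral>x. f x \<partial>\<beta>))"
proof -
  have S: "\<Omega> \<in> sets borel" using \<Omega> by simp
  obtain R where R: "R > 0" "\<Omega> \<subseteq> cball 0 R" using bounded_subset_cball0[OF \<Omega>(2)] by blast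
  obtain \<gamma> :: "real \<Rightarrow> real^'n" where \<gamma>: "continuous_on UNIV \<gamma>"
    "\<And>x. (\<And>i. - (R + 1) \<le> x $ i \<and> x $ i < R + 1) \<Longrightarrow> \<exists>t\<in>{0..1}. \<gamma> t = x"
    using schoenberg_curve[of "R + 1"] R(1) by (metis add_pos_pos zero_less_one)
  \<comment> \<open>A corner of a cube larger than the domain: it will carry the mass that is
    missing to a probability measure, unseen by test functions.\<close>
  have "\<exists>t\<in>{0..1}. \<gamma> t = (\<chi> i. - (R + 1))" by (rule \<gamma>(2)) (use R in simp)
  then obtain t0 where t0: "t0 \<in> {0..1}" "\<gamma> t0 = (\<chi> i. - (R + 1))" by blast
  have t0\<Omega>: "\<gamma> t0 \<notin> \<Omega>"
  proof
    assume "\<gamma> t0 \<in> \<Omega>"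
    then have "norm (\<gamma> t0) \<le> R" using R by auto
    moreover have "\<bar>\<gamma> t0 $ undefined\<bar> \<le> norm (\<gamma> t0)" by (rule component_le_norm_cart)
    ultimately show False using R(1) by (simp add: t0(2))
  qed
  have "\<forall>x\<in>\<Omega>. \<exists>t. t \<in> {0..1} \<and> \<gamma> t = x"
  proof
    fix x assume "x \<in> \<Omega>"
    then have "norm x \<le> R" using R by auto
    then have "- (R + 1) \<le> x $ i \<and> x $ i < R + 1" for i
      using component_le_norm_cart[of x i] by linarith
    then have "\<exists>t\<in>{0..1}. \<gamma> t = x" by (rule \<gamma>(2))
    then show "\<exists>t. t \<in> {0..1} \<and> \<gamma> t = x" by blast
  qed
  \<comment> \<open>A section of the curve without any regularity, since only finitely many of its
    values are used for each \<open>j\<close>.\<close>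
  from bchoice[OF this] obtain s where s: "\<And>x. x \<in> \<Omega> \<Longrightarrow> s x \<in> {0..1}" "\<And>x. x \<in> \<Omega> \<Longrightarrow> \<gamma> (s x) = x" by blast
  obtain x0 where x0: "x0 \<in> \<Omega>" using \<Omega>(3) by blast
  then obtain r0 where r0: "r0 > 0" "ball x0 r0 \<subseteq> \<Omega>" using \<Omega>(1) open_contains_ball by blast
  define d where "d j = r0 * inverse (real (Suc j))" for j
  have d: "d j > 0" "d j \<le> r0" for j using r0(1) by (auto simp: d_def field_simps)
  have dlim: "d \<longlonglongrightarrow> 0" unfolding d_def using tendsto_mult_left[OF LIMSEQ_inverse_real_of_nat, of r0] by simp
  define K where "K j = {x. ball x (d j) \<subseteq> \<Omega>}" for j
  have K\<Omega>: "K j \<subseteq> \<Omega>" for j using d(1)[of j] by (auto simp: K_def dest: subsetD[OF _ centre_in_ball[THEN iffD2]])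
  have Kc: "compact (K j)" for j
    using closed_ball_subset bounded_subset[OF \<Omega>(2) K\<Omega>[of j]] by (simp add: compact_eq_bounded_closed K_def)
  have Kne: "K j \<noteq> {}" for j
  proof -
    have "ball x0 (d j) \<subseteq> \<Omega>" using subset_ball[OF d(2)[of j], of x0] r0(2) by blast
    then show ?thesis by (auto simp: K_def)
  qed
  define good where "good j m c \<theta> \<longleftrightarrow> (\<forall>k<m. c k \<in> K j \<and> \<theta> k \<in> test_funs (ball (c k) (d j)) \<and> (\<forall>x. 0 \<le> \<theta> k x)) \<and>
    (\<forall>x. (\<Sum>k<m. \<theta> k x) \<le> 1) \<and> (\<forall>x\<in>K j. (\<Sum>k<m. \<theta> k x) = 1)" for j and m :: nat and c :: "nat \<Rightarrow> real^'n" and \<theta>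
  have "\<exists>m c \<theta>. good j m c \<theta>" for j
  proof -
    obtain m :: nat and c \<theta> where "\<And>k. k < m \<Longrightarrow> c k \<in> K j"
      "\<And>k. k < m \<Longrightarrow> \<theta> k \<in> test_funs (ball (c k) (d j))" "\<And>k x. k < m \<Longrightarrow> 0 \<le> \<theta> k x"
      "\<And>x. (\<Sum>k<m. \<theta> k x) \<le> 1" "\<And>x. x \<in> K j \<Longrightarrow> (\<Sum>k<m. \<theta> k x) = 1"
      by (rule smooth_partition_of_unity[where s = "\<lambda>_. d j", OF Kc[of j] Kne[of j] d(1)[of j]], rule that; assumption)
    then have "good j m c \<theta>" unfolding good_def by blast
    then show ?thesis by blast
  qed
  then obtain m c \<theta> where good: "\<And>j. good j (m j) (c j) (\<theta> j)" by metis
  have g: "\<And>k. k < m j \<Longrightarrow> c j k \<in> K j" "\<And>k. k < m j \<Longrightarrow> \<theta> j k \<in> test_funs (ball (c j k) (d j))"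
    "\<And>k x. k < m j \<Longrightarrow> 0 \<le> \<theta> j k x" "\<And>x. (\<Sum>k<m j. \<theta> j k x) \<le> 1" "\<And>x. x \<in> K j \<Longrightarrow> (\<Sum>k<m j. \<theta> j k x) = 1" for j
    using good[of j] unfolding good_def by blast+
  have c\<Omega>: "c j k \<in> \<Omega>" if "k < m j" for j k using g(1)[OF that] K\<Omega> by blast
  have \<theta>t: "\<theta> j k \<in> test_funs \<Omega>" if "k < m j" for j k
    using g(1,2)[OF that] test_funs_mono unfolding K_def by blast
  have L0: "L (\<lambda>_. 0) = 0" using lin[OF test_funs_0 test_funs_0, of 0 0] by simp
  have Lsum: "L (\<lambda>x. \<Sum>k\<in>A. e k * \<theta> j k x) = (\<Sum>k\<in>A. e k * L (\<theta> j k))" if "finite A" "A \<subseteq> {..<m j}" for A e j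
    using that
  proof (induction A rule: finite_induct)
    case (insert k A)
    have "(\<lambda>x. \<Sum>k\<in>A. e k * \<theta> j k x) \<in> test_funs \<Omega>"
      using insert by (intro test_funs_sum test_funs_cmult \<theta>t) auto
    then show ?case using insert lin[OF \<theta>t[of k j], of _ "e k" 1] by simp
  qed (simp add: L0)
  have C0: "C \<ge> 0" using bd[OF test_funs_0, of 1] by auto
  define C' where "C' = C + 1"
  have C': "C' > 0" using C0 by (simp add: C'_def)
  \<comment> \<open>Masses of the approximating signed measure, located at the centres
    \<open>c j k\<close>.\<close>
  define W where "W j k = L (\<theta> j k)" for j k
  \<comment> \<open>Test with the sum of the \<open>\<theta> j k\<close> signed like
    \<open>W j k\<close>: it is bounded by 1, and \<open>L\<close> maps it to the total
    mass.\<close>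
  have Wsum: "(\<Sum>k<m j. \<bar>W j k\<bar>) \<le> C'" for j
  proof -
    have t: "(\<lambda>x. \<Sum>k<m j. sgn (W j k) * \<theta> j k x) \<in> test_funs \<Omega>" by (intro test_funs_sum test_funs_cmult \<theta>t) auto
    have "\<bar>\<Sum>k<m j. sgn (W j k) * \<theta> j k x\<bar> \<le> 1" for x
    proof -
      have "\<bar>\<Sum>k<m j. sgn (W j k) * \<theta> j k x\<bar> \<le> (\<Sum>k<m j. \<bar>sgn (W j k) * \<theta> j k x\<bar>)" by (rule sum_abs)
      also have "\<dots> \<le> (\<Sum>k<m j. \<theta> j k x)"
        using g(3) by (intro sum_mono) (auto simp: abs_mult abs_sgn_eq)
      finally show ?thesis using g(4)[of j x] by linarith
    qed
    from bd[OF t this] have "\<bar>L (\<lambda>x. \<Sum>k<m j. sgn (W j k) * \<theta> j k x)\<bar> \<le> C" by simp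
    moreover have "L (\<lambda>x. \<Sum>k<m j. sgn (W j k) * \<theta> j k x) = (\<Sum>k<m j. \<bar>W j k\<bar>)"
      by (subst Lsum) (auto simp: W_def[symmetric] abs_sgn mult.commute)
    ultimately show ?thesis by (simp add: C'_def)
  qed
  \<comment> \<open>The sum is \<open>L\<close> applied to an interpolant of \<open>f\<close> at the
    centres. Once \<open>d j\<close> is small, the support of \<open>f\<close> lies in
    \<open>K j\<close>, where the partition sums to 1, and the interpolant is uniformly close to
    \<open>f\<close>.\<close>
  have disc: "(\<lambda>j. \<Sum>k<m j. W j k * f (c j k)) \<longlonglongrightarrow> L f" if f: "f \<in> test_funs \<Omega>" for f
  proof (rule LIMSEQ_I)
    fix e :: real assume e: "e > 0"
    obtain \<rho> where "\<And>x. x \<notin> cball 0 \<rho> \<Longrightarrow> f x = 0" using test_funs_support_cball[OF f] by blast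
    then have "uniformly_continuous_on UNIV f" by (rule compact_support_uniformly_continuous[OF test_funsD(5)[OF f]])
    then obtain \<eta> where \<eta>: "\<eta> > 0" "\<And>x y. dist x y < \<eta> \<Longrightarrow> dist (f x) (f y) < e / (2 * C')"
      unfolding uniformly_continuous_on_def using e C' by (metis UNIV_I divide_pos_pos mult_pos_pos zero_less_numeral)
    obtain r where r: "r > 0" "\<forall>x\<in>closure {x. f x \<noteq> 0}. \<forall>y\<in>- \<Omega>. r \<le> dist x y"
      using separate_compact_closed[OF test_funsD(2)[OF f], of "- \<Omega>"] test_funsD(3)[OF f] \<Omega>(1) by (auto simp: closed_Compl)
    have "\<forall>\<^sub>F j in sequentially. d j < \<eta> \<and> d j < r"
      using order_tendstoD(2)[OF dlim \<eta>(1)] order_tendstoD(2)[OF dlim r(1)] by eventually_elim simp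
    then obtain J where J: "\<And>j. j \<ge> J \<Longrightarrow> d j < \<eta> \<and> d j < r" unfolding eventually_sequentially by blast
    have "norm ((\<Sum>k<m j. W j k * f (c j k)) - L f) < e" if j: "j \<ge> J" for j
    proof -
      let ?h = "\<lambda>x. \<Sum>k<m j. f (c j k) * \<theta> j k x"
      have h: "?h \<in> test_funs \<Omega>" by (intro test_funs_sum test_funs_cmult \<theta>t) auto
      have hL: "L ?h = (\<Sum>k<m j. W j k * f (c j k))" by (subst Lsum) (auto simp: W_def mult.commute)
      have t: "(\<lambda>x. 1 * ?h x + (- 1) * f x) \<in> test_funs \<Omega>" by (intro test_funs_add test_funs_cmult h f)
      have "\<bar>1 * ?h x + (- 1) * f x\<bar> \<le> e / (2 * C')" for x
      proof -
        have fx: "f x = (\<Sum>k<m j. f x * \<theta> j k x)"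
        proof (cases "f x = 0")
          case False
          then have xs: "x \<in> closure {x. f x \<noteq> 0}" using zero_off_support by blast
          have "ball x (d j) \<subseteq> \<Omega>"
          proof
            fix y assume y: "y \<in> ball x (d j)"
            show "y \<in> \<Omega>"
            proof (rule ccontr)
              assume "y \<notin> \<Omega>"
              then have "r \<le> dist x y" using r(2) xs by blast
              with y J[OF j] show False by auto
            qed
          qed
          then have "x \<in> K j" by (simp add: K_def)
          then show ?thesis by (simp add: sum_distrib_left[symmetric] g(5))
        qed simp
        have "1 * ?h x + (- 1) * f x = (\<Sum>k<m j. (f (c j k) - f x) * \<theta> j k x)"
          by (subst fx) (simp add: left_diff_distrib sum_subtractf)
        also have "\<bar>\<dots>\<bar> \<le> (\<Sum>k<m j. \<bar>(f (c j k) - f x) * \<theta> j k x\<bar>)" by (rule sum_abs)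
        also have "\<dots> \<le> (\<Sum>k<m j. e / (2 * C') * \<theta> j k x)"
        proof (rule sum_mono)
          fix k assume "k \<in> {..<m j}"
          then have k: "k < m j" by simp
          show "\<bar>(f (c j k) - f x) * \<theta> j k x\<bar> \<le> e / (2 * C') * \<theta> j k x"
          proof (cases "\<theta> j k x = 0")
            case False
            then have "x \<in> ball (c j k) (d j)" using test_funsD(4)[OF g(2)[OF k]] by blast
            then have "dist (c j k) x < \<eta>" using J[OF j] by auto
            then have "\<bar>f (c j k) - f x\<bar> \<le> e / (2 * C')" using \<eta>(2)[of "c j k" x] by (simp add: dist_real_def)
            then show ?thesis unfolding abs_mult abs_of_nonneg[OF g(3)[OF k]] by (rule mult_right_mono[OF _ g(3)[OF k]])
          qed simp
        qed
        also have "\<dots> \<le> e / (2 * C') * 1"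
          unfolding sum_distrib_left[symmetric] using e C' g(4)[of j x] by (intro mult_left_mono) auto
        finally show ?thesis by simp
      qed
      from bd[OF t this] have "\<bar>L ?h - L f\<bar> \<le> C * (e / (2 * C'))" unfolding lin[OF h f] by simp
      also have "\<dots> \<le> C' * (e / (2 * C'))" using e C' by (intro mult_right_mono) (auto simp: C'_def)
      also have "\<dots> = e / 2" using C' by simp
      finally show ?thesis using e by (simp add: hL)
    qed
    then show "\<exists>J. \<forall>j\<ge>J. norm ((\<Sum>k<m j. W j k * f (c j k)) - L f) < e" by blast
  qed
  define loc where "loc j k = (if k < m j then s (c j k) else t0)" for j k
  have loc01: "loc j k \<in> {0..1}" for j k using s(1)[OF c\<Omega>] t0(1) by (auto simp: loc_def)
  \<comment> \<open>For \<open>\<sigma>\<close> equal to 1 and -1 these are the positive and the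
    negative parts of the masses, normalised by \<open>C'\<close>. The extra index
    \<open>m j\<close> receives the rest and sits at \<open>t0\<close>.\<close>
  define wt where "wt \<sigma> j k = (if k < m j then max 0 (\<sigma> * W j k) / C' else 1 - (\<Sum>k<m j. max 0 (\<sigma> * W j k) / C'))" for \<sigma> j k
  have wt0: "0 \<le> wt \<sigma> j k" and wt1: "(\<Sum>k\<le>m j. wt \<sigma> j k) = 1" if \<sigma>: "\<sigma> \<in> {-1, 1}" for \<sigma> j k
  proof -
    have "(\<Sum>k<m j. max 0 (\<sigma> * W j k) / C') \<le> (\<Sum>k<m j. \<bar>W j k\<bar> / C')"
      using \<sigma> C' by (intro sum_mono divide_right_mono) auto
    also have "\<dots> \<le> 1" using Wsum[of j] C' by (simp add: sum_divide_distrib[symmetric])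
    finally show "0 \<le> wt \<sigma> j k" using C' by (simp add: wt_def)
    show "(\<Sum>k\<le>m j. wt \<sigma> j k) = 1"
      unfolding lessThan_Suc_atMost[symmetric] by (simp add: wt_def)
  qed
  define M where "M \<sigma> j = discrete_measure (m j) (wt \<sigma> j) (loc j)" for \<sigma> j
  have Mr: "real_distribution (M \<sigma> j)" if "\<sigma> \<in> {-1, 1}" for \<sigma> j
    unfolding M_def by (rule discrete_measure(1)[OF wt0[OF that] wt1[OF that]])
  have M1: "measure (M \<sigma> j) {-1<..1} = 1" if "\<sigma> \<in> {-1, 1}" for \<sigma> j
    unfolding M_def by (rule discrete_measure(3)[OF wt0[OF that] wt1[OF that] loc01])
  have tight: "tight (M \<sigma>)" if \<sigma>: "\<sigma> \<in> {-1, 1}" for \<sigma>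
    unfolding tight_def using Mr[OF \<sigma>] M1[OF \<sigma>] by (intro conjI allI impI exI[of _ "-1"] exI[of _ 1]) auto
  \<comment> \<open>The second subsequence is extracted from the first, so that both parts converge
    along the composition.\<close>
  obtain r1 \<mu>p where r1: "strict_mono r1" "real_distribution \<mu>p" "weak_conv_m (M 1 \<circ> id \<circ> r1) \<mu>p"
    using tight_imp_convergent_subsubsequence[OF tight[of 1] strict_mono_id] by auto
  obtain r2 \<mu>n where r2: "strict_mono r2" "real_distribution \<mu>n" "weak_conv_m (M (-1) \<circ> r1 \<circ> r2) \<mu>n"
    using tight_imp_convergent_subsubsequence[OF tight[of "-1"] r1(1)] by auto
  have gm: "\<gamma> \<in> borel_measurable borel" by (rule borel_measurable_continuous_onI[OF \<gamma>(1)])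
  \<comment> \<open>The limit may put mass on parameters whose image lies outside the domain;
    restriction removes it without changing integrals of test functions.\<close>
  define \<alpha> where "\<alpha> \<nu> = restrict_space (distr \<nu> borel \<gamma>) \<Omega>" for \<nu>
  have \<alpha>: "sets (\<alpha> \<nu>) = borel_in \<Omega>" "finite_measure (\<alpha> \<nu>)"
    "\<And>f. f \<in> test_funs \<Omega> \<Longrightarrow> (\<integral>x. f x \<partial>\<alpha> \<nu>) = (\<integral>t. f (\<gamma> t) \<partial>\<nu>)" if \<nu>: "real_distribution \<nu>" for \<nu>
  proof -
    interpret real_distribution \<nu> by (rule \<nu>)
    have gm': "\<gamma> \<in> measurable \<nu> borel" using gm by simp
    interpret D: prob_space "distr \<nu> borel \<gamma>" by (rule prob_space_distr[OF gm'])
    show "sets (\<alpha> \<nu>) = borel_in \<Omega>" unfolding \<alpha>_def borel_in_def by (rule sets_restrict_space_cong) simp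
    show "finite_measure (\<alpha> \<nu>)" unfolding \<alpha>_def
      using S by (intro finite_measure_restrict_space D.finite_measure_axioms) simp
    show "(\<integral>x. f x \<partial>\<alpha> \<nu>) = (\<integral>t. f (\<gamma> t) \<partial>\<nu>)" if f: "f \<in> test_funs \<Omega>" for f
    proof -
      have "(\<integral>x. f x \<partial>\<alpha> \<nu>) = (\<integral>x. indicator \<Omega> x *\<^sub>R f x \<partial>distr \<nu> borel \<gamma>)"
        unfolding \<alpha>_def using S by (intro integral_restrict_space) simp
      also have "(\<lambda>x. indicator \<Omega> x *\<^sub>R f x) = f" using test_funsD(4)[OF f] by (auto simp: fun_eq_iff indicator_def)
      also have "(\<integral>x. f x \<partial>distr \<nu> borel \<gamma>) = (\<integral>t. f (\<gamma> t) \<partial>\<nu>)" by (rule integral_distr[OF gm' test_funsD(6)[OF f]])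
      finally show ?thesis .
    qed
  qed
  show ?thesis
  proof (rule that[of "\<alpha> \<mu>p" "\<alpha> \<mu>n" C'])
    show "finite_measure (\<alpha> \<mu>p)" "sets (\<alpha> \<mu>p) = borel_in \<Omega>" using \<alpha>[OF r1(2)] by auto
    show "finite_measure (\<alpha> \<mu>n)" "sets (\<alpha> \<mu>n) = borel_in \<Omega>" using \<alpha>[OF r2(2)] by auto
    fix f assume f: "f \<in> test_funs \<Omega>"
    obtain B where B: "\<And>x. \<bar>f x\<bar> \<le> B" using test_funs_bounded[OF f] by blast
    have fg: "continuous_on UNIV (\<lambda>t. f (\<gamma> t))" by (rule continuous_on_compose2[OF test_funsD(5)[OF f] \<gamma>(1)]) simp
    have iso: "isCont (\<lambda>t. f (\<gamma> t)) t" for t using fg by (simp add: continuous_on_eq_continuous_at)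
    have nb: "norm (f (\<gamma> t)) \<le> B" for t using B by simp
    have int: "(\<integral>t. f (\<gamma> t) \<partial>M \<sigma> j) = (\<Sum>k<m j. max 0 (\<sigma> * W j k) / C' * f (c j k))" if \<sigma>: "\<sigma> \<in> {-1, 1}" for \<sigma> j
    proof -
      have "(\<integral>t. f (\<gamma> t) \<partial>M \<sigma> j) = (\<Sum>k\<le>m j. wt \<sigma> j k * f (\<gamma> (loc j k)))"
        unfolding M_def by (rule discrete_measure(2)[OF wt0[OF \<sigma>] wt1[OF \<sigma>] borel_measurable_continuous_onI[OF fg]])
      also have "\<dots> = (\<Sum>k<m j. wt \<sigma> j k * f (\<gamma> (loc j k)))"
        unfolding lessThan_Suc_atMost[symmetric] using test_funsD(4)[OF f t0\<Omega>] by (simp add: loc_def)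
      also have "\<dots> = (\<Sum>k<m j. max 0 (\<sigma> * W j k) / C' * f (c j k))"
        by (rule sum.cong[OF refl]) (simp add: wt_def loc_def s(2)[OF c\<Omega>])
      finally show ?thesis .
    qed
    have l1: "(\<lambda>i. \<integral>t. f (\<gamma> t) \<partial>M 1 (r1 i)) \<longlonglongrightarrow> (\<integral>t. f (\<gamma> t) \<partial>\<mu>p)"
      using weak_conv_imp_integral_bdd_continuous_conv[of "M 1 \<circ> id \<circ> r1" \<mu>p, OF _ r1(2,3) iso nb] Mr[of 1] by simp
    have l2: "(\<lambda>i. \<integral>t. f (\<gamma> t) \<partial>M (-1) (r1 (r2 i))) \<longlonglongrightarrow> (\<integral>t. f (\<gamma> t) \<partial>\<mu>n)"
      using weak_conv_imp_integral_bdd_continuous_conv[of "M (-1) \<circ> r1 \<circ> r2" \<mu>n, OF _ r2(2,3) iso nb] Mr[of "-1"] by simp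
    have l1': "(\<lambda>i. \<integral>t. f (\<gamma> t) \<partial>M 1 (r1 (r2 i))) \<longlonglongrightarrow> (\<integral>t. f (\<gamma> t) \<partial>\<mu>p)"
      using LIMSEQ_subseq_LIMSEQ[OF l1 r2(1)] by (simp add: o_def)
    have "(\<lambda>i. C' * ((\<integral>t. f (\<gamma> t) \<partial>M 1 (r1 (r2 i))) - (\<integral>t. f (\<gamma> t) \<partial>M (-1) (r1 (r2 i)))))
        \<longlonglongrightarrow> C' * ((\<integral>t. f (\<gamma> t) \<partial>\<mu>p) - (\<integral>t. f (\<gamma> t) \<partial>\<mu>n))"
      by (intro tendsto_intros l1' l2)
    moreover have "C' * ((\<integral>t. f (\<gamma> t) \<partial>M 1 j) - (\<integral>t. f (\<gamma> t) \<partial>M (-1) j)) = (\<Sum>k<m j. W j k * f (c j k))" for j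
    proof -
      have "C' * ((\<integral>t. f (\<gamma> t) \<partial>M 1 j) - (\<integral>t. f (\<gamma> t) \<partial>M (-1) j)) =
        (\<Sum>k<m j. C' * (max 0 (1 * W j k) / C' * f (c j k) - max 0 ((- 1) * W j k) / C' * f (c j k)))"
        by (simp only: int[of 1] int[of "-1"] insert_iff sum_subtractf[symmetric] sum_distrib_left simp_thms)
      also have "\<dots> = (\<Sum>k<m j. W j k * f (c j k))"
      proof (rule sum.cong[OF refl])
        fix k
        have "C' * (max 0 (1 * W j k) / C' * f (c j k) - max 0 ((- 1) * W j k) / C' * f (c j k)) =
          (max 0 (W j k) - max 0 (- W j k)) * f (c j k)"
          using C' by (simp add: right_diff_distrib left_diff_distrib)
        also have "max 0 (W j k) - max 0 (- W j k) = W j k" by (simp add: max_def)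
        finally show "C' * (max 0 (1 * W j k) / C' * f (c j k) - max 0 ((- 1) * W j k) / C' * f (c j k)) = W j k * f (c j k)" .
      qed
      finally show ?thesis .
    qed
    ultimately have "(\<lambda>i. \<Sum>k<m (r1 (r2 i)). W (r1 (r2 i)) k * f (c (r1 (r2 i)) k))
        \<longlonglongrightarrow> C' * ((\<integral>t. f (\<gamma> t) \<partial>\<mu>p) - (\<integral>t. f (\<gamma> t) \<partial>\<mu>n))" by simp
    moreover have "(\<lambda>i. \<Sum>k<m (r1 (r2 i)). W (r1 (r2 i)) k * f (c (r1 (r2 i)) k)) \<longlonglongrightarrow> L f"
      using LIMSEQ_subseq_LIMSEQ[OF disc[OF f] strict_mono_o[OF r1(1) r2(1)]] by (simp add: o_def)
    ultimately have "L f = C' * ((\<integral>t. f (\<gamma> t) \<partial>\<mu>p) - (\<integral>t. f (\<gamma> t) \<partial>\<mu>n))" using LIMSEQ_unique by blast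
    then show "L f = C' * ((\<integral>x. f x \<partial>\<alpha> \<mu>p) - (\<integral>x. f x \<partial>\<alpha> \<mu>n))"
      by (simp add: \<alpha>(3)[OF r1(2) f] \<alpha>(3)[OF r2(2) f])
  qed
qed

subsection \<open>The gradient measure of a function of bounded variation\<close>

lemma sums_vecI:
  fixes f :: "nat \<Rightarrow> real^'n"
  assumes "\<And>i. (\<lambda>k. f k $ i) sums (x $ i)"
  shows "f sums x"
  using assms unfolding sums_def by (intro vec_tendstoI) simp

text \<open>Each partial derivative, as a functional on test functions, is bounded in the supremum
  norm by the BV seminorm and so is, up to a factor, a difference of finite measures. Uniqueness of
  step approximations identifies this difference with the integral by Jordan decomposition.\<close>

lemma gradient_measure_exists:
  fixes v :: "real^'n \<Rightarrow> real"
  assumes \<Omega>: "open \<Omega>" "bounded \<Omega>" and v: "v \<in> BV_L2 \<Omega>"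
  shows "\<exists>m. represents_gradient \<Omega> v m"
\<comment> \<open>The representation starts from a point of the domain, so the empty domain is
  treated apart.\<close>
proof (cases "\<Omega> = {}")
  case True
  have "(\<integral>x. h x \<partial>lebesgue_on {}) = 0" for h :: "real^'n \<Rightarrow> real"
  proof -
    have "(\<integral>x. h x \<partial>lebesgue_on {}) = (\<integral>x. 0 \<partial>lebesgue_on ({} :: (real^'n) set))"
      by (rule Bochner_Integration.integral_cong) auto
    then show ?thesis by simp
  qed
  then have "represents_gradient \<Omega> v (\<lambda>_. 0)"
    unfolding represents_gradient_def using True zero_vector_measure by (simp add: signed_integral_def)
  then show ?thesis by blast
next
  case False
  let ?M = "lebesgue_on \<Omega>"
  have S: "\<Omega> \<in> sets borel" using \<Omega> by simp
  have v2: "v \<in> L2 \<Omega>" and bdd: "bdd_above (BV_pairings \<Omega> v)" using v by (auto simp: BV_L2_def BV_def)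
  define L where "L i g = - (\<integral>x. v x * pd i g x \<partial>?M)" for i g
  have Lint: "integrable ?M (\<lambda>x. v x * pd i g x)" if "g \<in> test_funs \<Omega>" for i g
    by (rule sqint_mult_test_funs[OF \<Omega> v2 test_funs_pd[OF that]])
  have Llin: "L i (\<lambda>x. a * f x + b * g x) = a * L i f + b * L i g" if f: "f \<in> test_funs \<Omega>" and g: "g \<in> test_funs \<Omega>" for i f g a b
  proof -
    have "pd i (\<lambda>x. a * f x + b * g x) x = a * pd i f x + b * pd i g x" for x
      using pd_add[of "\<lambda>x. a * f x" x "\<lambda>x. b * g x" i] pd_cmult[of f x i a] pd_cmult[of g x i b]
        test_funsD(7)[OF f] test_funsD(7)[OF g] test_funsD(7)[OF test_funs_cmult[OF f]] test_funsD(7)[OF test_funs_cmult[OF g]] by simp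
    then have "L i (\<lambda>x. a * f x + b * g x) = - (\<integral>x. a * (v x * pd i f x) + b * (v x * pd i g x) \<partial>?M)"
      by (simp add: L_def algebra_simps)
    then show ?thesis using Lint[OF f] Lint[OF g] by (simp add: L_def)
  qed
  \<comment> \<open>A scalar test function in direction \<open>i\<close> is a test field whose
    divergence is the partial derivative; its negative gives the other sign.\<close>
  have one: "\<bar>L i g\<bar> \<le> BV_seminorm \<Omega> v * c" if g: "g \<in> test_funs \<Omega>" and le: "\<And>x. \<bar>g x\<bar> \<le> c" and c: "c > 0" for i g c
  proof -
    have L: "(\<integral>x. v x * pd i h x \<partial>?M) \<le> BV_seminorm \<Omega> v * c" if h: "h \<in> test_funs \<Omega>" and hle: "\<And>x. \<bar>h x\<bar> \<le> c" for h
    proof -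
      define \<phi> where "\<phi> x = h x *\<^sub>R (axis i 1 :: real^'n)" for x
      have comp: "(\<lambda>x. \<phi> x $ j) = (if j = i then h else (\<lambda>_. 0))" for j by (auto simp: \<phi>_def axis_def fun_eq_iff)
      have tf: "\<phi> \<in> test_fields \<Omega>" unfolding test_fields_def mem_Collect_eq comp using h test_funs_0 by auto
      have "pd j (\<lambda>x. \<phi> x $ j) x = (if j = i then pd i h x else 0)" for j x
        unfolding comp using pd_eq_0_if_const_near[of UNIV x "\<lambda>_. 0" 0 j] by auto
      then have "divg \<phi> x = pd i h x" for x by (simp add: divg_def)
      moreover have "(\<integral>x. v x * divg \<phi> x \<partial>?M) \<le> c * BV_seminorm \<Omega> v"
        by (rule BV_pairings_le[OF bdd tf _ c]) (simp add: \<phi>_def hle)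
      ultimately show ?thesis by (simp add: mult.commute)
    qed
    have "pd i (\<lambda>x. - g x) x = - pd i g x" for x using pd_cmult[OF test_funsD(7)[OF g], of i "-1" x] by simp
    then have "- (\<integral>x. v x * pd i g x \<partial>?M) \<le> BV_seminorm \<Omega> v * c"
      using L[of "\<lambda>x. - g x"] test_funs_cmult[OF g, of "-1"] le by simp
    then show ?thesis using L[OF g le] by (simp add: L_def abs_le_iff)
  qed
  have Lbd: "\<bar>L i g\<bar> \<le> BV_seminorm \<Omega> v * c" if g: "g \<in> test_funs \<Omega>" and le: "\<And>x. \<bar>g x\<bar> \<le> c" for i g c
  proof (cases "c > 0")
    case False
    have "g x = 0" for x using le[of x] False by auto
    then have "g = (\<lambda>_. 0)" by auto
    moreover have "c = 0" using le[of undefined] False by auto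
    ultimately show ?thesis using pd_eq_0_if_const_near[of UNIV _ "\<lambda>_. 0" 0 i] by (simp add: L_def)
  qed (rule one[OF g le])
  define Q where "Q i \<alpha> \<beta> D \<longleftrightarrow> finite_measure \<alpha> \<and> sets \<alpha> = borel_in \<Omega> \<and> finite_measure \<beta> \<and> sets \<beta> = borel_in \<Omega> \<and>
    (\<forall>g\<in>test_funs \<Omega>. L i g = D * ((\<integral>x. g x \<partial>\<alpha>) - (\<integral>x. g x \<partial>\<beta>)))" for i \<alpha> \<beta> and D :: real
  have "\<exists>\<alpha> \<beta> D. Q i \<alpha> \<beta> D" for i
  proof -
    obtain \<alpha> \<beta> D where "finite_measure \<alpha>" "sets \<alpha> = borel_in \<Omega>" "finite_measure \<beta>" "sets \<beta> = borel_in \<Omega>"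
      "\<And>f. f \<in> test_funs \<Omega> \<Longrightarrow> L i f = D * ((\<integral>x. f x \<partial>\<alpha>) - (\<integral>x. f x \<partial>\<beta>))"
      by (rule bounded_functional_representation[OF \<Omega> False Llin Lbd], assumption+, rule that; assumption)
    then have "Q i \<alpha> \<beta> D" unfolding Q_def by blast
    then show ?thesis by blast
  qed
  then obtain \<alpha> \<beta> D where Q: "\<And>i. Q i (\<alpha> i) (\<beta> i) (D i)" by metis
  have \<alpha>: "finite_measure (\<alpha> i)" "sets (\<alpha> i) = borel_in \<Omega>" and \<beta>: "finite_measure (\<beta> i)" "sets (\<beta> i) = borel_in \<Omega>"
    and rep: "\<And>g. g \<in> test_funs \<Omega> \<Longrightarrow> L i g = D i * ((\<integral>x. g x \<partial>\<alpha> i) - (\<integral>x. g x \<partial>\<beta> i))" for i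
    using Q[of i] unfolding Q_def by blast+
  define m where "m B = (if B \<in> borel_in \<Omega> then (\<chi> i. D i * measure (\<alpha> i) B + (- D i) * measure (\<beta> i) B) else 0)" for B
  have mB: "m B $ i = D i * measure (\<alpha> i) B + (- D i) * measure (\<beta> i) B" if "B \<in> borel_in \<Omega>" for B i
    using that by (simp add: m_def)
  have vm: "m \<in> vector_measures \<Omega>"
    unfolding vector_measures_def mem_Collect_eq
  proof (intro conjI allI impI)
    show "m B = 0" if "B \<notin> borel_in \<Omega>" for B using that by (simp add: m_def)
    show "(\<lambda>k. m (A k)) sums m (\<Union> (range A))" if A: "range A \<subseteq> borel_in \<Omega>" "disjoint_family A" for A :: "nat \<Rightarrow> _"
    proof (rule sums_vecI)
      fix i
      have Ak: "A k \<in> borel_in \<Omega>" for k using A(1) by blast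
      have U: "\<Union> (range A) \<in> borel_in \<Omega>" using A(1) unfolding borel_in_def by (intro sets.countable_UN) auto
      have "(\<lambda>k. D i * measure (\<alpha> i) (A k) + (- D i) * measure (\<beta> i) (A k)) sums
          (D i * measure (\<alpha> i) (\<Union> (range A)) + (- D i) * measure (\<beta> i) (\<Union> (range A)))"
        using A \<alpha>(2)[of i] \<beta>(2)[of i]
        by (intro sums_add sums_mult finite_measure.finite_measure_UNION[OF \<alpha>(1)] finite_measure.finite_measure_UNION[OF \<beta>(1)]) auto
      then show "(\<lambda>k. m (A k) $ i) sums (m (\<Union> (range A)) $ i)" unfolding mB[OF Ak] mB[OF U] .
    qed
    have le: "(\<Sum>B\<in>P. norm (m B)) \<le> (\<Sum>i\<in>UNIV. \<bar>D i\<bar> * (measure (\<alpha> i) \<Omega> + measure (\<beta> i) \<Omega>))"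
      if P: "finite P" "P \<subseteq> borel_in \<Omega>" "partition_on \<Omega> P" for P
    proof -
      have tot: "(\<Sum>B\<in>P. measure \<mu> B) = measure \<mu> \<Omega>" if "finite_measure \<mu>" "sets \<mu> = borel_in \<Omega>" for \<mu>
      proof -
        have "measure \<mu> (\<Union>B\<in>P. B) = (\<Sum>B\<in>P. measure \<mu> B)"
          by (rule finite_measure.finite_measure_finite_Union[OF that(1) P(1)])
             (use P that(2) in \<open>auto simp: partition_on_def disjoint_def disjoint_family_on_def\<close>)
        moreover have "(\<Union>B\<in>P. B) = \<Omega>" using P(3) by (simp add: partition_on_def)
        ultimately show ?thesis by simp
      qed
      have "norm (m B) \<le> (\<Sum>i\<in>UNIV. \<bar>D i\<bar> * (measure (\<alpha> i) B + measure (\<beta> i) B))" if B: "B \<in> P" for B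
      proof -
        have Bb: "B \<in> borel_in \<Omega>" using B P(2) by blast
        have "norm (m B) \<le> (\<Sum>i\<in>UNIV. \<bar>m B $ i\<bar>)" by (rule norm_le_l1_cart)
        also have "\<dots> \<le> (\<Sum>i\<in>UNIV. \<bar>D i\<bar> * (measure (\<alpha> i) B + measure (\<beta> i) B))"
        proof (rule sum_mono)
          fix i
          have "\<bar>m B $ i\<bar> \<le> \<bar>D i * measure (\<alpha> i) B\<bar> + \<bar>(- D i) * measure (\<beta> i) B\<bar>"
            unfolding mB[OF Bb] by (rule abs_triangle_ineq)
          then show "\<bar>m B $ i\<bar> \<le> \<bar>D i\<bar> * (measure (\<alpha> i) B + measure (\<beta> i) B)"
            by (simp add: abs_mult distrib_left)
        qed
        finally show ?thesis .
      qed
      then have "(\<Sum>B\<in>P. norm (m B)) \<le> (\<Sum>B\<in>P. \<Sum>i\<in>UNIV. \<bar>D i\<bar> * (measure (\<alpha> i) B + measure (\<beta> i) B))" by (rule sum_mono)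
      also have "\<dots> = (\<Sum>i\<in>UNIV. \<Sum>B\<in>P. \<bar>D i\<bar> * (measure (\<alpha> i) B + measure (\<beta> i) B))" by (rule sum.swap)
      also have "\<dots> = (\<Sum>i\<in>UNIV. \<bar>D i\<bar> * (measure (\<alpha> i) \<Omega> + measure (\<beta> i) \<Omega>))"
        by (rule sum.cong[OF refl])
           (simp add: sum_distrib_left[symmetric] sum.distrib tot[OF \<alpha>] tot[OF \<beta>])
      finally show ?thesis .
    qed
    show "bdd_above (variation_sums \<Omega> m)"
      by (rule bdd_aboveI[of _ "\<Sum>i\<in>UNIV. \<bar>D i\<bar> * (measure (\<alpha> i) \<Omega> + measure (\<beta> i) \<Omega>)"])
         (use le in \<open>auto simp: variation_sums_def\<close>)
  qed
  have "(\<integral>x. v x * pd i g x \<partial>?M) = - signed_integral \<Omega> (\<lambda>A. m A $ i) g" if g: "g \<in> test_funs \<Omega>" for g i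
  proof -
    obtain c where c: "\<And>x. \<bar>g x\<bar> \<le> c" using test_funs_bounded[OF g] by blast
    note gc = test_funsD(6)[OF g] c
    have 1: "step_approx \<Omega> (\<lambda>A. m A $ i) g (signed_integral \<Omega> (\<lambda>A. m A $ i) g)"
      by (rule step_approx_signed_integral[OF S gc vector_measure_component[OF S vm]])
    have 2: "step_approx \<Omega> (\<lambda>A. m A $ i) g (D i * (\<integral>x. g x \<partial>\<alpha> i) + (- D i) * (\<integral>x. g x \<partial>\<beta> i))"
      by (rule step_approx_cong[OF _ step_approx_lin[OF step_approx_integral(2)[OF S gc \<alpha>] step_approx_integral(2)[OF S gc \<beta>]]])
         (rule mB[symmetric])
    have "signed_integral \<Omega> (\<lambda>A. m A $ i) g = L i g"
      using step_approx_unique[OF S gc 1 2] rep[OF g, of i] by (simp add: right_diff_distrib)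
    then show ?thesis by (simp add: L_def)
  qed
  then have "represents_gradient \<Omega> v m" unfolding represents_gradient_def using vm by blast
  then show ?thesis by blast
qed

lemma BV_gradient_represents:
  fixes v :: "real^'n \<Rightarrow> real"
  assumes "open \<Omega>" "bounded \<Omega>" "v \<in> BV_L2 \<Omega>"
  shows "represents_gradient \<Omega> v (BV_gradient \<Omega> v)"
  using someI_ex[OF gradient_measure_exists[OF assms]]
  unfolding BV_gradient_def represents_gradient_def .

subsection \<open>Subdifferentials\<close>

lemma L2_inner_in_BV_subdifferential:
  fixes g us :: "real^'n \<Rightarrow> real"
  assumes g: "g \<in> L2 \<Omega>" and le: "\<And>v. v \<in> BV_L2 \<Omega> \<Longrightarrow> L2_inner \<Omega> g v \<le> BV_seminorm \<Omega> v"
    and us: "us \<in> BV_L2 \<Omega>" "BV_seminorm \<Omega> us \<le> L2_inner \<Omega> g us"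
  shows "L2_inner \<Omega> g \<in> BV_subdifferential \<Omega> us"
proof -
  have L: "v \<in> sqint (lebesgue_on \<Omega>)" if "v \<in> BV_L2 \<Omega>" for v using that by (simp add: BV_L2_def L2_eq)
  have g2: "g \<in> sqint (lebesgue_on \<Omega>)" using g by (simp add: L2_eq)
  have "L2_inner \<Omega> g \<in> dual_space (BV_L2 \<Omega>) (BV_L2_norm \<Omega>)"
    unfolding dual_space_def mem_Collect_eq
  proof (intro conjI ballI allI)
    show "L2_inner \<Omega> g (\<lambda>x. a *\<^sub>R v x + b *\<^sub>R w x) = a * L2_inner \<Omega> g v + b * L2_inner \<Omega> g w"
      if "v \<in> BV_L2 \<Omega>" "w \<in> BV_L2 \<Omega>" for v w a b
      using ip_lin_right[OF L[OF that(1)] L[OF that(2)] g2] by (simp add: L2_eq)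
    show "\<exists>C. \<forall>v\<in>BV_L2 \<Omega>. \<bar>L2_inner \<Omega> g v\<bar> \<le> C * BV_L2_norm \<Omega> v"
    proof (intro exI[of _ "L2_norm \<Omega> g"] ballI)
      fix v assume v: "v \<in> BV_L2 \<Omega>"
      have "0 \<le> (\<integral>x. \<bar>v x\<bar> \<partial>lebesgue_on \<Omega>)" by simp
      moreover have "0 \<le> BV_seminorm \<Omega> v" using v by (intro BV_seminorm_nonneg) (simp add: BV_L2_def BV_def)
      ultimately have "L2_norm \<Omega> v \<le> BV_L2_norm \<Omega> v" by (simp add: BV_L2_norm_def)
      then have "nrm (lebesgue_on \<Omega>) g * nrm (lebesgue_on \<Omega>) v \<le> nrm (lebesgue_on \<Omega>) g * BV_L2_norm \<Omega> v"
        by (intro mult_left_mono) (auto simp: L2_eq)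
      then show "\<bar>L2_inner \<Omega> g v\<bar> \<le> L2_norm \<Omega> g * BV_L2_norm \<Omega> v"
        using ip_le_nrm[OF g2 L[OF v]] by (simp add: L2_eq)
    qed
  qed
  moreover have "BV_seminorm \<Omega> us + L2_inner \<Omega> g (\<lambda>x. v x - us x) \<le> BV_seminorm \<Omega> v" if v: "v \<in> BV_L2 \<Omega>" for v
    using le[OF v] us(2) ip_lin_right[OF L[OF v] L[OF us(1)] g2, of 1 "-1"] by (simp add: L2_eq)
  ultimately show ?thesis using us(1) unfolding BV_subdifferential_def subdifferential_def by blast
qed

text \<open>The graph contains every measure that represents a gradient, not only the chosen
  \<open>BV_gradient\<close>: the choice is not visibly linear, representation is. Domination gives
  norm at most 1, and bounding the total variation at \<open>us\<close> by the seminorm turns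
  \<open>us(2)\<close> into the subgradient inequality.\<close>

lemma measure_subgradient_exists:
  fixes g us :: "real^'n \<Rightarrow> real"
  assumes \<Omega>: "open \<Omega>" "bounded \<Omega>"
    and g: "g \<in> L2 \<Omega>" and le: "\<And>v. v \<in> BV_L2 \<Omega> \<Longrightarrow> L2_inner \<Omega> g v \<le> BV_seminorm \<Omega> v"
    and us: "us \<in> BV_L2 \<Omega>" "BV_seminorm \<Omega> us \<le> L2_inner \<Omega> g us"
  obtains l where "l \<in> measure_norm_subdifferential \<Omega> (BV_gradient \<Omega> us)" "has_dual_div \<Omega> l (\<lambda>x. - g x)"
proof -
  have S: "\<Omega> \<in> sets borel" using \<Omega> by simp
  interpret finite_measure "lebesgue_on \<Omega>" using S \<Omega> by (intro finite_measure_lebesgue_on_bounded)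
  have BVI: "v \<in> BV_L2 \<Omega>" if "v \<in> L2 \<Omega>" "represents_gradient \<Omega> v m" for v m
  proof -
    have "bdd_above (BV_pairings \<Omega> v)" by (rule bdd_aboveI) (rule BV_pairings_le_total_variation[OF \<Omega> that])
    then show ?thesis using that(1) sqint_integrable[of v] by (simp add: BV_L2_def BV_def L2_eq)
  qed
  have L: "v \<in> L2 \<Omega>" if "v \<in> BV_L2 \<Omega>" for v using that by (simp add: BV_L2_def)
  define G where "G = {(m, L2_inner \<Omega> g v) | m v. v \<in> L2 \<Omega> \<and> represents_gradient \<Omega> v m}"
  let ?V = "vector_measures \<Omega>" and ?p = "total_variation \<Omega>"
  obtain l where l: "\<And>v w a b. v \<in> ?V \<Longrightarrow> w \<in> ?V \<Longrightarrow> l (\<lambda>x. a *\<^sub>R v x + b *\<^sub>R w x) = a * l v + b * l w"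
    "\<And>v. v \<in> ?V \<Longrightarrow> l v \<le> ?p v" "\<And>v s. (v, s) \<in> G \<Longrightarrow> l v = s"
  proof (rule hahn_banach[of ?V ?p G])
    show "(\<lambda>x. a *\<^sub>R v x + b *\<^sub>R w x) \<in> ?V" if "v \<in> ?V" "w \<in> ?V" for v w a b by (rule vector_measures_lin(1)[OF S that])
    show "(\<lambda>_. 0) \<in> ?V" by (rule zero_vector_measure)
    show "?p (\<lambda>x. v x + w x) \<le> ?p v + ?p w" if "v \<in> ?V" "w \<in> ?V" for v w
      using vector_measures_lin(2)[OF S that, of 1 1] by simp
    show "?p (\<lambda>x. a *\<^sub>R v x) = a * ?p v" if "v \<in> ?V" "a \<ge> 0" for v a
      using total_variation_scale[OF S that(1), of a] that(2) by simp
    show "m \<in> ?V \<and> s \<le> ?p m" if ms: "(m, s) \<in> G" for m s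
    proof -
      obtain v where v: "s = L2_inner \<Omega> g v" "v \<in> L2 \<Omega>" "represents_gradient \<Omega> v m" using ms unfolding G_def by blast
      have "s \<le> BV_seminorm \<Omega> v" using le[OF BVI[OF v(2,3)]] v(1) by simp
      also have "\<dots> \<le> ?p m"
        unfolding BV_seminorm_def
      proof (rule cSup_least)
        have "(\<lambda>_. 0) \<in> test_fields \<Omega>" by (simp add: test_fields_def test_funs_0)
        then show "BV_pairings \<Omega> v \<noteq> {}" unfolding BV_pairings_def by (auto intro!: exI[of _ "\<lambda>_. 0"])
      qed (rule BV_pairings_le_total_variation[OF \<Omega> v(2,3)])
      finally show ?thesis using v(3) by (simp add: represents_gradient_def)
    qed
    show "(\<lambda>x. a *\<^sub>R m x + b *\<^sub>R m' x, a * s + b * t) \<in> G" if "(m, s) \<in> G" "(m', t) \<in> G" for m s m' t a b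
    proof -
      obtain v w where v: "s = L2_inner \<Omega> g v" "v \<in> L2 \<Omega>" "represents_gradient \<Omega> v m"
        and w: "t = L2_inner \<Omega> g w" "w \<in> L2 \<Omega>" "represents_gradient \<Omega> w m'" using \<open>(m, s) \<in> G\<close> \<open>(m', t) \<in> G\<close> unfolding G_def by blast
      have "a * s + b * t = L2_inner \<Omega> g (\<lambda>x. a * v x + b * w x)"
        using v w g ip_lin_right[of v "lebesgue_on \<Omega>" w g a b] by (simp add: L2_eq)
      moreover have "(\<lambda>x. a * v x + b * w x) \<in> L2 \<Omega>" using v w by (simp add: L2_eq sqint_lin)
      ultimately show ?thesis using represents_gradient_lin[OF \<Omega> v(2,3) w(2,3), of a b] unfolding G_def by blast
    qed
    show "G \<noteq> {}" using BV_gradient_represents[OF \<Omega> us(1)] L[OF us(1)] unfolding G_def by blast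
  qed blast
  have lv: "l (BV_gradient \<Omega> v) = L2_inner \<Omega> g v" if "v \<in> BV_L2 \<Omega>" for v
    using l(3) BV_gradient_represents[OF \<Omega> that] L[OF that] unfolding G_def by blast
  have m0: "BV_gradient \<Omega> us \<in> ?V" using BV_gradient_represents[OF \<Omega> us(1)] by (simp add: represents_gradient_def)
  have labs: "\<bar>l m\<bar> \<le> 1 * ?p m" if m: "m \<in> ?V" for m
  proof -
    have "- l m = l (\<lambda>x. (-1) *\<^sub>R m x + 0 *\<^sub>R m x)" using l(1)[OF m m, of "-1" 0] by simp
    also have "\<dots> \<le> ?p (\<lambda>x. (-1) *\<^sub>R m x + 0 *\<^sub>R m x)" by (rule l(2)[OF vector_measures_lin(1)[OF S m m]])
    also have "\<dots> = ?p m" using total_variation_scale[OF S m, of "-1"] by simp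
    finally show ?thesis using l(2)[OF m] by linarith
  qed
  show ?thesis
  proof (rule that)
    have "l \<in> dual_space ?V ?p" unfolding dual_space_def using l(1) labs by blast
    moreover have "?p (BV_gradient \<Omega> us) + l (\<lambda>x. m x - BV_gradient \<Omega> us x) \<le> ?p m" if m: "m \<in> ?V" for m
    proof -
      have "?p (BV_gradient \<Omega> us) \<le> BV_seminorm \<Omega> us"
        by (rule total_variation_le_BV_seminorm[OF \<Omega> L[OF us(1)] BV_gradient_represents[OF \<Omega> us(1)]])
           (use us(1) in \<open>simp add: BV_L2_def BV_def\<close>)
      also have "\<dots> \<le> l (BV_gradient \<Omega> us)" using us(2) lv[OF us(1)] by simp
      finally show ?thesis using l(1)[OF m m0, of 1 "-1"] l(2)[OF m] by simp
    qed
    ultimately show "l \<in> measure_norm_subdifferential \<Omega> (BV_gradient \<Omega> us)"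
      unfolding measure_norm_subdifferential_def subdifferential_def using m0 by blast
    show "has_dual_div \<Omega> l (\<lambda>x. - g x)"
      unfolding has_dual_div_def minus_div_dual_def using lv by (simp add: L2_inner_def)
  qed
qed

subsection \<open>The gradient of a differentiable functional\<close>

text \<open>Both derivatives are homogeneous, so \<open>h\<close> can be scaled until the two
  remainder estimates apply; the factor then cancels.\<close>

lemma frechet_L2_unique:
  assumes D: "has_frechet_L2 \<Omega> f u D" "has_frechet_L2 \<Omega> f u D'" and h: "h \<in> L2 \<Omega>"
  shows "D h = D' h"
proof -
  let ?N = "L2_norm \<Omega> h"
  have N: "?N \<ge> 0" by (simp add: L2_eq)
  have hom: "A (\<lambda>x. t * h x) = t * A h" if "has_frechet_L2 \<Omega> f u A" for A t
  proof -
    have "A (\<lambda>x. t *\<^sub>R h x + 0 *\<^sub>R h x) = t * A h + 0 * A h"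
      using that h unfolding has_frechet_L2_def dual_space_def by blast
    then show ?thesis by simp
  qed
  have le: "\<bar>D h - D' h\<bar> \<le> 2 * e * ?N" if e: "e > 0" for e
  proof -
    obtain d1 where d1: "d1 > 0" "\<And>h. h \<in> L2 \<Omega> \<Longrightarrow> L2_norm \<Omega> h < d1 \<Longrightarrow> \<bar>f (\<lambda>x. u x + h x) - f u - D h\<bar> \<le> e * L2_norm \<Omega> h"
      using D(1) e unfolding has_frechet_L2_def by blast
    obtain d2 where d2: "d2 > 0" "\<And>h. h \<in> L2 \<Omega> \<Longrightarrow> L2_norm \<Omega> h < d2 \<Longrightarrow> \<bar>f (\<lambda>x. u x + h x) - f u - D' h\<bar> \<le> e * L2_norm \<Omega> h"
      using D(2) e unfolding has_frechet_L2_def by blast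
    define K where "K = ?N + 1"
    have K: "K > 0" "?N \<le> K" using N by (auto simp: K_def)
    define t where "t = min d1 d2 / (2 * K)"
    have t: "t > 0" unfolding t_def using d1(1) d2(1) K by (intro divide_pos_pos) auto
    have "t * ?N \<le> t * K" using t K by (intro mult_left_mono) auto
    also have "\<dots> = min d1 d2 / 2" using K by (simp add: t_def)
    also have "\<dots> < min d1 d2" using d1(1) d2(1) by (simp add: min_def)
    finally have tN: "t * ?N < d1" "t * ?N < d2" by auto
    have n: "L2_norm \<Omega> (\<lambda>x. t * h x) = t * ?N" using t by (simp add: L2_eq nrm_cmult)
    have th: "(\<lambda>x. t * h x) \<in> L2 \<Omega>" using h by (simp add: L2_eq sqint_cmult)
    have "\<bar>t * D h - t * D' h\<bar> \<le> 2 * (e * (t * ?N))"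
      using d1(2)[OF th] d2(2)[OF th] tN unfolding n hom[OF D(1)] hom[OF D(2)] by linarith
    then have "t * \<bar>D h - D' h\<bar> \<le> t * (2 * e * ?N)" using t by (simp add: right_diff_distrib[symmetric] abs_mult mult_ac)
    then show ?thesis using t by simp
  qed
  have "\<bar>D h - D' h\<bar> \<le> 0"
  proof (rule field_le_epsilon)
    fix e :: real assume e: "e > 0"
    have "\<bar>D h - D' h\<bar> \<le> 2 * (e / (2 * (?N + 1))) * ?N" using e N by (intro le divide_pos_pos) auto
    also have "\<dots> = e * (?N / (?N + 1))" using N by (simp add: field_simps)
    also have "\<dots> \<le> e * 1" using e N by (intro mult_left_mono) (auto simp: field_simps)
    finally show "\<bar>D h - D' h\<bar> \<le> 0 + e" by simp
  qed
  then show ?thesis by simp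
qed

text \<open>The Riesz representation theorem provides a witness for the choice in
  \<open>L2_gradient\<close>.\<close>

lemma L2_gradient:
  fixes \<Omega> :: "(real^'n) set"
  assumes \<Omega>: "open \<Omega>" "bounded \<Omega>" and f: "continuously_frechet_L2 \<Omega> f" and u: "u \<in> L2 \<Omega>"
  shows "L2_gradient \<Omega> f u \<in> L2 \<Omega>" "has_frechet_L2 \<Omega> f u (L2_inner \<Omega> (L2_gradient \<Omega> f u))"
proof -
  interpret finite_measure "lebesgue_on \<Omega>" using \<Omega> by (intro finite_measure_lebesgue_on_bounded) auto
  obtain D where D: "has_frechet_L2 \<Omega> f u D" using f u unfolding continuously_frechet_L2_def by blast
  then have lin: "\<And>v w a b. v \<in> L2 \<Omega> \<Longrightarrow> w \<in> L2 \<Omega> \<Longrightarrow> D (\<lambda>x. a *\<^sub>R v x + b *\<^sub>R w x) = a * D v + b * D w"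
    and "\<exists>C. \<forall>v\<in>L2 \<Omega>. \<bar>D v\<bar> \<le> C * L2_norm \<Omega> v"
    unfolding has_frechet_L2_def dual_space_def by blast+
  then obtain C where C: "\<And>v. v \<in> L2 \<Omega> \<Longrightarrow> \<bar>D v\<bar> \<le> C * L2_norm \<Omega> v" by blast
  obtain g where g: "g \<in> L2 \<Omega>" "\<And>v. v \<in> L2 \<Omega> \<Longrightarrow> D v = L2_inner \<Omega> g v"
    using riesz_representation[of D C] lin C unfolding L2_eq real_scaleR_def by blast
  have "has_frechet_L2 \<Omega> f u (L2_inner \<Omega> g)"
    unfolding has_frechet_L2_def
  proof (intro conjI)
    have "(\<lambda>x. a *\<^sub>R v x + b *\<^sub>R w x) \<in> L2 \<Omega>" if "v \<in> L2 \<Omega>" "w \<in> L2 \<Omega>" for v w a b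
      using that by (simp add: L2_eq sqint_lin)
    then show "L2_inner \<Omega> g \<in> dual_space (L2 \<Omega>) (L2_norm \<Omega>)"
      using lin C unfolding dual_space_def by (simp add: g(2)[symmetric]) blast
    show "\<forall>e>0. \<exists>d>0. \<forall>h\<in>L2 \<Omega>. L2_norm \<Omega> h < d \<longrightarrow>
        \<bar>f (\<lambda>x. u x + h x) - f u - L2_inner \<Omega> g h\<bar> \<le> e * L2_norm \<Omega> h"
    proof (intro allI impI)
      fix e :: real assume "e > 0"
      then obtain d where d: "d > 0" "\<And>h. h \<in> L2 \<Omega> \<Longrightarrow> L2_norm \<Omega> h < d \<Longrightarrow> \<bar>f (\<lambda>x. u x + h x) - f u - D h\<bar> \<le> e * L2_norm \<Omega> h"
        using D unfolding has_frechet_L2_def by blast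
      show "\<exists>d>0. \<forall>h\<in>L2 \<Omega>. L2_norm \<Omega> h < d \<longrightarrow>
          \<bar>f (\<lambda>x. u x + h x) - f u - L2_inner \<Omega> g h\<bar> \<le> e * L2_norm \<Omega> h"
        using d(1) d(2) by (intro exI[of _ d] conjI ballI impI) (simp_all add: g(2)[symmetric])
    qed
  qed
  with g(1) have "\<exists>g. g \<in> L2 \<Omega> \<and> has_frechet_L2 \<Omega> f u (L2_inner \<Omega> g)" by blast
  from someI_ex[OF this] show "L2_gradient \<Omega> f u \<in> L2 \<Omega>" "has_frechet_L2 \<Omega> f u (L2_inner \<Omega> (L2_gradient \<Omega> f u))"
    unfolding L2_gradient_def by blast+
qed

text \<open>The difference of the derivatives is evaluated at the difference of the gradients
  itself, which produces its squared norm; one factor is then divided out.\<close>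

lemma L2_gradient_continuous:
  fixes \<Omega> :: "(real^'n) set"
  assumes \<Omega>: "open \<Omega>" "bounded \<Omega>" and f: "continuously_frechet_L2 \<Omega> f" and u: "L2_tendsto \<Omega> U u"
  shows "(\<lambda>n. L2_norm \<Omega> (\<lambda>x. L2_gradient \<Omega> f (U n) x - L2_gradient \<Omega> f u x)) \<longlonglongrightarrow> 0"
proof (rule LIMSEQ_I)
  fix e :: real assume e: "e > 0"
  have U: "U n \<in> L2 \<Omega>" "u \<in> L2 \<Omega>" and lim: "(\<lambda>n. L2_norm \<Omega> (\<lambda>x. U n x - u x)) \<longlonglongrightarrow> 0" for n
    using u by (auto simp: L2_tendsto_def)
  obtain D where D: "\<And>u. u \<in> L2 \<Omega> \<Longrightarrow> has_frechet_L2 \<Omega> f u (D u)"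
    "\<And>u e. u \<in> L2 \<Omega> \<Longrightarrow> e > 0 \<Longrightarrow> \<exists>d>0. \<forall>v\<in>L2 \<Omega>. L2_norm \<Omega> (\<lambda>x. v x - u x) < d \<longrightarrow>
           (\<forall>h\<in>L2 \<Omega>. \<bar>D v h - D u h\<bar> \<le> e * L2_norm \<Omega> h)"
    using f unfolding continuously_frechet_L2_def by blast
  note gr = L2_gradient[OF \<Omega> f]
  obtain d where d: "d > 0" "\<And>v h. v \<in> L2 \<Omega> \<Longrightarrow> L2_norm \<Omega> (\<lambda>x. v x - u x) < d \<Longrightarrow> h \<in> L2 \<Omega> \<Longrightarrow> \<bar>D v h - D u h\<bar> \<le> e / 2 * L2_norm \<Omega> h"
    using D(2)[OF U(2), of "e / 2"] e by (meson half_gt_zero)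
  obtain N where N: "\<And>n. n \<ge> N \<Longrightarrow> L2_norm \<Omega> (\<lambda>x. U n x - u x) < d"
    using order_tendstoD(2)[OF lim d(1)] unfolding eventually_sequentially by blast
  have "norm (L2_norm \<Omega> (\<lambda>x. L2_gradient \<Omega> f (U n) x - L2_gradient \<Omega> f u x) - 0) < e" if n: "n \<ge> N" for n
  proof -
    let ?h = "\<lambda>x. L2_gradient \<Omega> f (U n) x - L2_gradient \<Omega> f u x"
    have h: "?h \<in> L2 \<Omega>" using gr(1)[OF U(1)] gr(1)[OF U(2)] by (simp add: L2_eq sqint_diff)
    have "\<bar>D (U n) ?h - D u ?h\<bar> \<le> e / 2 * L2_norm \<Omega> ?h" by (rule d(2)[OF U(1) N[OF n] h])
    moreover have "D (U n) ?h = L2_inner \<Omega> (L2_gradient \<Omega> f (U n)) ?h" by (rule frechet_L2_unique[OF D(1)[OF U(1)] gr(2)[OF U(1)] h])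
    moreover have "D u ?h = L2_inner \<Omega> (L2_gradient \<Omega> f u) ?h" by (rule frechet_L2_unique[OF D(1)[OF U(2)] gr(2)[OF U(2)] h])
    moreover have "L2_inner \<Omega> (L2_gradient \<Omega> f (U n)) ?h - L2_inner \<Omega> (L2_gradient \<Omega> f u) ?h = (L2_norm \<Omega> ?h)\<^sup>2"
      using ip_diff[of "L2_gradient \<Omega> f (U n)" "lebesgue_on \<Omega>" "L2_gradient \<Omega> f u" ?h] gr(1)[OF U(1)] gr(1)[OF U(2)] h
      by (simp add: L2_eq nrm_sq)
    ultimately have "(L2_norm \<Omega> ?h)\<^sup>2 \<le> e / 2 * L2_norm \<Omega> ?h" by linarith
    then have "L2_norm \<Omega> ?h * L2_norm \<Omega> ?h \<le> e / 2 * L2_norm \<Omega> ?h" by (simp add: power2_eq_square)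
    moreover have "0 \<le> L2_norm \<Omega> ?h" by (simp add: L2_eq)
    ultimately have "L2_norm \<Omega> ?h \<le> e / 2 \<or> L2_norm \<Omega> ?h = 0"
      using mult_right_le_imp_le[of "L2_norm \<Omega> ?h" "L2_norm \<Omega> ?h" "e / 2"] by linarith
    then show ?thesis using e nrm_nonneg[of "lebesgue_on \<Omega>" ?h] by (auto simp: L2_eq)
  qed
  then show "\<exists>N. \<forall>n\<ge>N. norm (L2_norm \<Omega> (\<lambda>x. L2_gradient \<Omega> f (U n) x - L2_gradient \<Omega> f u x) - 0) < e" by blast
qed

subsection \<open>The limits of the multipliers\<close>

text \<open>By completing the square, \<open>r / 2 * (x + 1 / (2 * r))\<^sup>2\<close> equals
  \<open>x + r / 2 * (x - 1 / (2 * r))\<^sup>2\<close>, so the regularised maximum lies above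
  \<open>x\<close> as well as above 0.\<close>

lemma smooth_max_props:
  assumes r: "r > 0"
  shows "0 \<le> smooth_max r x" "x \<le> smooth_max r x" "x \<le> - (1 / (2 * r)) \<Longrightarrow> smooth_max r x = 0"
proof -
  have "x \<le> r / 2 * (x + 1 / (2 * r))\<^sup>2"
  proof -
    have "r / 2 * (x + 1 / (2 * r))\<^sup>2 = r / 2 * (x - 1 / (2 * r))\<^sup>2 + x"
      using r by (simp add: power2_eq_square field_simps)
    then show ?thesis using r by simp
  qed
  then show "0 \<le> smooth_max r x" "x \<le> smooth_max r x" using r by (auto simp: smooth_max_def)
  show "smooth_max r x = 0" if "x \<le> - (1 / (2 * r))"
  proof -
    have "1 / (2 * r) > 0" using r by simp
    then have "\<bar>x\<bar> \<ge> 1 / (2 * r)" "x \<le> 0" using that by linarith+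
    then show ?thesis by (simp add: smooth_max_def)
  qed
qed

lemma nrm_tendsto_ip:
  assumes U: "\<And>n. U n \<in> sqint M" "u \<in> sqint M" "(\<lambda>n. nrm M (\<lambda>x. U n x - u x)) \<longlonglongrightarrow> 0" and v: "v \<in> sqint M"
  shows "(\<lambda>n. ip M (U n) v) \<longlonglongrightarrow> ip M u v"
proof -
  have "(\<lambda>n. ip M (U n) v - ip M u v) \<longlonglongrightarrow> 0"
  proof (rule Lim_null_comparison)
    show "\<forall>\<^sub>F n in sequentially. norm (ip M (U n) v - ip M u v) \<le> nrm M (\<lambda>x. U n x - u x) * nrm M v"
      using ip_le_nrm[OF sqint_diff[OF U(1,2)] v] ip_diff[OF U(1,2) v] by simp
    show "(\<lambda>n. nrm M (\<lambda>x. U n x - u x) * nrm M v) \<longlonglongrightarrow> 0" using tendsto_mult_right[OF U(3), of "nrm M v"] by simp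
  qed
  then show ?thesis by (simp add: LIM_zero_iff)
qed

lemma nrm_tendsto_ip_both:
  assumes U: "\<And>n. U n \<in> sqint M" "u \<in> sqint M" "(\<lambda>n. nrm M (\<lambda>x. U n x - u x)) \<longlonglongrightarrow> 0"
    and V: "\<And>n. V n \<in> sqint M" "v \<in> sqint M" "(\<lambda>n. nrm M (\<lambda>x. V n x - v x)) \<longlonglongrightarrow> 0"
  shows "(\<lambda>n. ip M (U n) (V n)) \<longlonglongrightarrow> ip M u v"
proof -
  have eq: "ip M (U n) (V n) = ip M (U n) v + (ip M u (V n) - ip M u v) + ip M (\<lambda>x. U n x - u x) (\<lambda>x. V n x - v x)" for n
  proof -
    have "ip M (\<lambda>x. U n x - u x) (\<lambda>x. V n x - v x) = ip M (U n) (\<lambda>x. V n x - v x) - ip M u (\<lambda>x. V n x - v x)"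
      by (rule ip_diff[OF U(1,2) sqint_diff[OF V(1,2)]])
    then show ?thesis
      using ip_diff[OF V(1,2) U(1), of n n] ip_diff[OF V(1,2) U(2), of n] by (simp add: ip_comm[of M "\<lambda>x. V n x - v x"] ip_comm[of M "V n"] ip_comm[of M v])
  qed
  have z: "(\<lambda>n. ip M (\<lambda>x. U n x - u x) (\<lambda>x. V n x - v x)) \<longlonglongrightarrow> 0"
  proof (rule Lim_null_comparison)
    show "\<forall>\<^sub>F n in sequentially. norm (ip M (\<lambda>x. U n x - u x) (\<lambda>x. V n x - v x)) \<le> nrm M (\<lambda>x. U n x - u x) * nrm M (\<lambda>x. V n x - v x)"
      using ip_le_nrm[OF sqint_diff[OF U(1,2)] sqint_diff[OF V(1,2)]] by simp
    show "(\<lambda>n. nrm M (\<lambda>x. U n x - u x) * nrm M (\<lambda>x. V n x - v x)) \<longlonglongrightarrow> 0" using tendsto_mult[OF U(3) V(3)] by simp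
  qed
  have "(\<lambda>n. ip M (V n) u) \<longlonglongrightarrow> ip M v u" by (rule nrm_tendsto_ip[OF V U(2)])
  then have y: "(\<lambda>n. ip M u (V n)) \<longlonglongrightarrow> ip M u v" by (simp add: ip_comm[of M u])
  have "(\<lambda>n. ip M (U n) v + (ip M u (V n) - ip M u v) + ip M (\<lambda>x. U n x - u x) (\<lambda>x. V n x - v x))
      \<longlonglongrightarrow> ip M u v + (ip M u v - ip M u v) + 0"
    by (intro tendsto_add tendsto_diff tendsto_const nrm_tendsto_ip[OF U V(2)] y z)
  then show ?thesis unfolding eq by simp
qed

context finite_measure
begin

text \<open>Stated for a lower obstacle; the upper one is the case of \<open>- U\<close> and
  \<open>c = - ub\<close>. The multiplier \<open>A n\<close> vanishes as soon as \<open>U n\<close>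
  exceeds \<open>c\<close> by \<open>1 / (2 * (R n)\<^sup>2)\<close>. This yields the last
  conclusion, a substitute for the limit of a weakly times a strongly convergent sequence, and it
  yields complementarity by localisation.\<close>

lemma obstacle_limit:
  fixes U :: "nat \<Rightarrow> 'a \<Rightarrow> real" and R :: "nat \<Rightarrow> real" and c :: real
  defines "A n x \<equiv> smooth_max (R n) (R n * (c - U n x))"
  assumes U: "\<And>n. U n \<in> sqint M" "u \<in> sqint M" "(\<lambda>n. nrm M (\<lambda>x. U n x - u x)) \<longlonglongrightarrow> 0"
    and R: "\<And>n. R n > 0" "filterlim R at_top sequentially"
    and A: "\<And>n. A n \<in> sqint M" "la \<in> sqint M" "\<And>v. v \<in> sqint M \<Longrightarrow> (\<lambda>n. ip M (A n) v) \<longlonglongrightarrow> ip M la v"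
  shows "AE x in M. c \<le> u x" "AE x in M. 0 \<le> la x" "ip M la (\<lambda>x. c - u x) = 0"
    and "\<And>n. ip M (A n) (U n) \<le> (c + 1 / (2 * (R n)\<^sup>2)) * ip M (A n) (\<lambda>_. 1)"
proof -
  have A0: "0 \<le> A n x" for n x unfolding A_def by (rule smooth_max_props(1)[OF R(1)])
  have Aoff: "A n x = 0" if "c + 1 / (2 * (R n)\<^sup>2) \<le> U n x" for n x
    unfolding A_def
  proof (rule smooth_max_props(3)[OF R(1)])
    have "R n * (c - U n x) \<le> R n * (- (1 / (2 * (R n)\<^sup>2)))" using that R(1)[of n] by (intro mult_left_mono) auto
    also have "\<dots> = - (1 / (2 * R n))" using R(1)[of n] by (simp add: power2_eq_square)
    finally show "R n * (c - U n x) \<le> - (1 / (2 * R n))" .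
  qed
  have one: "(\<lambda>_. 1) \<in> sqint M" by (rule sqint_const)
  show "ip M (A n) (U n) \<le> (c + 1 / (2 * (R n)\<^sup>2)) * ip M (A n) (\<lambda>_. 1)" for n
  proof -
    have "A n x * U n x \<le> (c + 1 / (2 * (R n)\<^sup>2)) * (A n x * 1)" for x
    proof (cases "c + 1 / (2 * (R n)\<^sup>2) \<le> U n x")
      case False
      then have "A n x * U n x \<le> A n x * (c + 1 / (2 * (R n)\<^sup>2))" using A0 by (intro mult_left_mono) auto
      then show ?thesis by (simp add: mult.commute)
    qed (simp add: Aoff)
    then have "(\<integral>x. A n x * U n x \<partial>M) \<le> (\<integral>x. (c + 1 / (2 * (R n)\<^sup>2)) * (A n x * 1) \<partial>M)"
      by (intro integral_mono sqint_mult_integrable[OF A(1) U(1)] integrable_mult_right sqint_mult_integrable[OF A(1) one])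
    then show ?thesis by (simp add: ip_def)
  qed
  have um[measurable]: "u \<in> borel_measurable M" "la \<in> borel_measurable M" "U n \<in> borel_measurable M" for n
    using U(1,2) A(2) by (auto intro: sqint_measurable)
  show la0: "AE x in M. 0 \<le> la x"
  proof -
    \<comment> \<open>The weak limit is tested on the set where it is negative.\<close>
    define v :: "'a \<Rightarrow> real" where "v x = indicator {x \<in> space M. la x < 0} x" for x
    have v: "v \<in> sqint M" unfolding v_def by (rule sqint_boundedI[of _ 1]) (auto simp: indicator_def)
    have "0 \<le> ip M (A n) v" for n unfolding ip_def using A0 by (intro Bochner_Integration.integral_nonneg) (simp add: v_def)
    then have "0 \<le> ip M la v" by (intro LIMSEQ_le_const[OF A(3)[OF v]]) auto
    moreover have nn: "0 \<le> - (la x * v x)" for x by (auto simp: v_def indicator_def)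
    then have "0 \<le> (\<integral>x. - (la x * v x) \<partial>M)" by (rule Bochner_Integration.integral_nonneg)
    ultimately have "(\<integral>x. - (la x * v x) \<partial>M) = 0" by (simp add: ip_def)
    then have "AE x in M. - (la x * v x) = 0"
      using nn sqint_mult_integrable[OF A(2) v] by (subst (asm) integral_nonneg_eq_0_iff_AE) auto
    then show ?thesis using AE_space by eventually_elim (auto simp: v_def indicator_def split: if_splits)
  qed
  have L1: "(\<lambda>n. \<integral>x. \<bar>U n x - u x\<bar> \<partial>M) \<longlonglongrightarrow> 0"
  proof (rule Lim_null_comparison)
    show "\<forall>\<^sub>F n in sequentially. norm (\<integral>x. \<bar>U n x - u x\<bar> \<partial>M) \<le> sqrt (measure M (space M)) * nrm M (\<lambda>x. U n x - u x)"
      using integral_abs_le_nrm[OF sqint_diff[OF U(1,2)]] by simp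
    show "(\<lambda>n. sqrt (measure M (space M)) * nrm M (\<lambda>x. U n x - u x)) \<longlonglongrightarrow> 0"
      using tendsto_mult_left[OF U(3)] by simp
  qed
  have Ri: "(\<lambda>n. inverse (R n)) \<longlonglongrightarrow> 0" by (rule tendsto_inverse_0_at_top[OF R(2)])
  show uc: "AE x in M. c \<le> u x"
  proof -
    have iu: "integrable M (\<lambda>x. max 0 (c - u x))" "integrable M (\<lambda>x. max 0 (c - U n x))" "integrable M (\<lambda>x. \<bar>U n x - u x\<bar>)" for n
      using sqint_integrable[OF U(1)] sqint_integrable[OF U(2)] by auto
    \<comment> \<open>The violation of the obstacle is at most \<open>A n / R n\<close> plus the
      distance to the limit. The integrals of \<open>A n\<close> converge, so division by
      \<open>R n\<close> sends the first part to 0.\<close>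
    have "(\<integral>x. max 0 (c - u x) \<partial>M) \<le> inverse (R n) * ip M (A n) (\<lambda>_. 1) + (\<integral>x. \<bar>U n x - u x\<bar> \<partial>M)" for n
    proof -
      have "(\<integral>x. max 0 (c - u x) \<partial>M) \<le> (\<integral>x. inverse (R n) * (A n x * 1) + \<bar>U n x - u x\<bar> \<partial>M)"
      proof (rule integral_mono)
        show "integrable M (\<lambda>x. inverse (R n) * (A n x * 1) + \<bar>U n x - u x\<bar>)"
          by (intro Bochner_Integration.integrable_add integrable_mult_right sqint_mult_integrable[OF A(1) one] iu)
        fix x
        have "R n * (c - U n x) \<le> A n x" unfolding A_def by (rule smooth_max_props(2)[OF R(1)])
        then have "c - U n x \<le> inverse (R n) * A n x" using R(1)[of n] by (simp add: field_simps)
        moreover have "0 \<le> inverse (R n) * A n x" using A0[of n x] R(1)[of n] by simp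
        ultimately show "max 0 (c - u x) \<le> inverse (R n) * (A n x * 1) + \<bar>U n x - u x\<bar>" by auto
      qed (rule iu)
      also have "\<dots> = inverse (R n) * ip M (A n) (\<lambda>_. 1) + (\<integral>x. \<bar>U n x - u x\<bar> \<partial>M)"
        using sqint_mult_integrable[OF A(1)[of n] one] iu(3)[of n] by (simp add: ip_def)
      finally show ?thesis .
    qed
    moreover have "(\<lambda>n. inverse (R n) * ip M (A n) (\<lambda>_. 1) + (\<integral>x. \<bar>U n x - u x\<bar> \<partial>M)) \<longlonglongrightarrow> 0 * ip M la (\<lambda>_. 1) + 0"
      by (intro tendsto_add tendsto_mult Ri A(3)[OF one] L1)
    ultimately have "(\<integral>x. max 0 (c - u x) \<partial>M) \<le> 0 * ip M la (\<lambda>_. 1) + 0" by (intro LIMSEQ_le_const) auto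
    moreover have "0 \<le> (\<integral>x. max 0 (c - u x) \<partial>M)" by simp
    ultimately have "(\<integral>x. max 0 (c - u x) \<partial>M) = 0" by linarith
    then have "AE x in M. max 0 (c - u x) = 0" by (subst (asm) integral_nonneg_eq_0_iff_AE[OF iu(1)]) auto
    then show ?thesis by eventually_elim auto
  qed
  show "ip M la (\<lambda>x. c - u x) = 0"
  proof -
    have "(\<lambda>n. \<integral>x. norm (U n x - u x) \<partial>M) \<longlonglongrightarrow> 0" using L1 by simp
    then obtain s where s: "strict_mono s" "AE x in M. (\<lambda>n. U (s n) x - u x) \<longlonglongrightarrow> 0"
      using tendsto_L1_AE_subseq[of M "\<lambda>n x. U n x - u x"] sqint_integrable[OF sqint_diff[OF U(1,2)]] by blast
    \<comment> \<open>Points where the obstacle is cleared from index \<open>J\<close> of the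
      subsequence on. There all later multipliers vanish, hence so does their weak limit, and these
      sets cover almost every point with \<open>u x > c\<close>.\<close>
    define D where "D J = {x \<in> space M. \<forall>k\<ge>J. c + 1 / (2 * (R (s k))\<^sup>2) \<le> U (s k) x}" for J
    have Dm[measurable]: "D J \<in> sets M" for J unfolding D_def by measurable
    have Dz: "AE x in M. x \<in> D J \<longrightarrow> la x = 0" for J
    proof -
      have v: "indicat_real (D J) \<in> sqint M" by (rule sqint_boundedI[of _ 1]) (auto simp: indicator_def intro!: borel_measurable_indicator)
      have "ip M (A (s k)) (indicat_real (D J)) = 0" if "k \<ge> J" for k
      proof -
        have "A (s k) x * indicat_real (D J) x = 0" for x
          using Aoff[of "s k" x] that by (auto simp: D_def indicator_def)
        then have "(\<lambda>x. A (s k) x * indicat_real (D J) x) = (\<lambda>_. 0)" by blast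
        then show ?thesis unfolding ip_def by (simp only: integral_zero)
      qed
      then have "(\<lambda>k. ip M (A (s k)) (indicat_real (D J))) \<longlonglongrightarrow> 0"
        by (intro tendsto_eventually) (auto simp: eventually_sequentially)
      moreover have "(\<lambda>k. ip M (A (s k)) (indicat_real (D J))) \<longlonglongrightarrow> ip M la (indicat_real (D J))"
        using LIMSEQ_subseq_LIMSEQ[OF A(3)[OF v] s(1)] by (simp add: o_def)
      ultimately have z: "(\<integral>x. la x * indicat_real (D J) x \<partial>M) = 0" using LIMSEQ_unique unfolding ip_def by blast
      have "AE x in M. 0 \<le> la x * indicat_real (D J) x" using la0 by eventually_elim (simp add: indicator_def)
      with z have "AE x in M. la x * indicat_real (D J) x = 0"
        by (subst (asm) integral_nonneg_eq_0_iff_AE[OF sqint_mult_integrable[OF A(2) v]])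
      then show ?thesis by eventually_elim (auto simp: indicator_def)
    qed
    have "AE x in M. \<forall>J. x \<in> D J \<longrightarrow> la x = 0" unfolding AE_all_countable using Dz by blast
    then have "AE x in M. la x * (c - u x) = 0"
      using s(2) uc AE_space
    proof eventually_elim
      case (elim x)
      show ?case
      proof (cases "u x = c")
        case False
        then have gt: "0 < u x - c" using elim(3) by simp
        have r0: "(\<lambda>k. inverse (R (s k))) \<longlonglongrightarrow> 0" using LIMSEQ_subseq_LIMSEQ[OF Ri s(1)] by (simp add: o_def)
        have "(\<lambda>k. (U (s k) x - u x) - 1 / 2 * (inverse (R (s k)) * inverse (R (s k))) + (u x - c)) \<longlonglongrightarrow> 0 - 1 / 2 * (0 * 0) + (u x - c)"
          by (intro tendsto_intros elim(2) r0)
        then have "\<forall>\<^sub>F k in sequentially. 0 < (U (s k) x - u x) - 1 / 2 * (inverse (R (s k)) * inverse (R (s k))) + (u x - c)"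
          using gt by (intro order_tendstoD(1)) auto
        then obtain J where J: "\<And>k. k \<ge> J \<Longrightarrow> 0 < (U (s k) x - u x) - 1 / 2 * (inverse (R (s k)) * inverse (R (s k))) + (u x - c)"
          unfolding eventually_sequentially by blast
        have "x \<in> D J" unfolding D_def
        proof (intro CollectI conjI allI impI elim(4))
          fix k assume "k \<ge> J"
          from J[OF this] show "c + 1 / (2 * (R (s k))\<^sup>2) \<le> U (s k) x" by (simp add: power2_eq_square inverse_eq_divide)
        qed
        with elim(1) have "la x = 0" by blast
        then show ?thesis by simp
      qed simp
    qed
    then have "(\<integral>x. la x * (c - u x) \<partial>M) = (\<integral>x. 0 \<partial>M)" by (intro integral_cong_AE) auto
    then show ?thesis by (simp add: ip_def)
  qed
qed

end

subsection \<open>The regularised equation\<close>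

lemma psi_deriv_eq:
  assumes e: "e > 0"
  shows "psi_deriv e (s :: real^'n) t = (s \<bullet> t) / sqrt (e + (norm s)\<^sup>2) + 2 * e * (s \<bullet> t)"
proof -
  have d: "((\<lambda>s :: real^'n. s \<bullet> s) has_derivative (\<lambda>t. s \<bullet> t + t \<bullet> s)) (at s)" by (rule has_derivative_inner) (rule has_derivative_ident)+
  have p: "0 < e + s \<bullet> s" using e by (simp add: add_pos_nonneg)
  have "((\<lambda>s :: real^'n. e + s \<bullet> s) has_derivative (\<lambda>t. s \<bullet> t + t \<bullet> s)) (at s)"
    using has_derivative_add[OF has_derivative_const d] by simp
  from has_derivative_compose[OF this DERIV_real_sqrt[OF p, unfolded has_field_derivative_def]]
  have q: "((\<lambda>s :: real^'n. sqrt (e + s \<bullet> s)) has_derivative (\<lambda>t. inverse (sqrt (e + s \<bullet> s)) / 2 * (s \<bullet> t + t \<bullet> s))) (at s)" .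
  have "((\<lambda>s. sqrt (e + s \<bullet> s) + e * (s \<bullet> s)) has_derivative
      (\<lambda>t. inverse (sqrt (e + s \<bullet> s)) / 2 * (s \<bullet> t + t \<bullet> s) + e * (s \<bullet> t + t \<bullet> s))) (at s)"
    by (intro has_derivative_add q has_derivative_mult_right d)
  then have "(psi e has_derivative (\<lambda>t. inverse (sqrt (e + s \<bullet> s)) / 2 * (s \<bullet> t + t \<bullet> s) + e * (s \<bullet> t + t \<bullet> s))) (at s)"
    unfolding psi_def[abs_def] power2_norm_eq_inner .
  from frechet_derivative_at[OF this] have "psi_deriv e s = (\<lambda>t. inverse (sqrt (e + s \<bullet> s)) / 2 * (s \<bullet> t + t \<bullet> s) + e * (s \<bullet> t + t \<bullet> s))"
    by (simp add: psi_deriv_def)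
  then show ?thesis by (simp add: inner_commute[of t s] power2_norm_eq_inner inverse_eq_divide)
qed

text \<open>The first part of the derivative pairs \<open>t\<close> with a vector of length at most
  1, whatever \<open>e\<close> is; the second is kept with its factor \<open>e\<close>, to be
  absorbed by the energy.\<close>

lemma psi_deriv_le:
  assumes e: "e > 0"
  shows "psi_deriv e (s :: real^'n) t \<le> norm t + 2 * e * (norm s * norm t)"
    and "\<bar>psi_deriv e s t\<bar> \<le> norm t + 2 * e * (norm s * norm t)"
proof -
  have p: "0 < sqrt (e + (norm s)\<^sup>2)" using e by (simp add: add_pos_nonneg)
  have "norm s \<le> sqrt (e + (norm s)\<^sup>2)" using e by (intro real_le_rsqrt) simp
  then have "norm s * norm t \<le> sqrt (e + (norm s)\<^sup>2) * norm t" by (intro mult_right_mono) auto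
  then have 1: "\<bar>s \<bullet> t\<bar> / sqrt (e + (norm s)\<^sup>2) \<le> norm t"
    using Cauchy_Schwarz_ineq2[of s t] p by (simp add: pos_divide_le_eq mult.commute)
  have "\<bar>psi_deriv e s t\<bar> \<le> \<bar>s \<bullet> t / sqrt (e + (norm s)\<^sup>2)\<bar> + \<bar>2 * e * (s \<bullet> t)\<bar>"
    unfolding psi_deriv_eq[OF e] by (rule abs_triangle_ineq)
  also have "\<dots> = \<bar>s \<bullet> t\<bar> / sqrt (e + (norm s)\<^sup>2) + 2 * e * \<bar>s \<bullet> t\<bar>"
    using e p by (simp add: abs_mult abs_divide)
  also have "\<dots> \<le> norm t + 2 * e * (norm s * norm t)"
    using 1 Cauchy_Schwarz_ineq2[of s t] e by (intro add_mono mult_left_mono) auto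
  finally show "\<bar>psi_deriv e s t\<bar> \<le> norm t + 2 * e * (norm s * norm t)" .
  then show "psi_deriv e s t \<le> norm t + 2 * e * (norm s * norm t)" by linarith
qed

text \<open>With \<open>a = norm s\<close>, multiply by the root and use
  \<open>sqrt (e + a\<^sup>2) \<le> sqrt e + a\<close>: the product
  \<open>(a - sqrt e) * (a + sqrt e)\<close> is below \<open>a\<^sup>2\<close>. The quadratic term
  is kept, since it controls \<open>e\<close> times the squared L2 norm of the gradient.\<close>

lemma psi_deriv_self_ge:
  assumes e: "e > 0"
  shows "norm s - sqrt e + 2 * e * (norm s * norm s) \<le> psi_deriv e (s :: real^'n) s"
proof -
  let ?q = "sqrt (e + (norm s)\<^sup>2)"
  have p: "0 < ?q" using e by (simp add: add_pos_nonneg)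
  have "(norm s - sqrt e) * ?q \<le> (norm s)\<^sup>2"
  proof (cases "norm s \<le> sqrt e")
    case True
    then have "(norm s - sqrt e) * ?q \<le> 0" using p by (intro mult_nonpos_nonneg) auto
    then show ?thesis by (rule order_trans) simp
  next
    case False
    have "?q \<le> sqrt e + norm s" using sqrt_add_le_add_sqrt[of e "(norm s)\<^sup>2"] e by simp
    then have "(norm s - sqrt e) * ?q \<le> (norm s - sqrt e) * (sqrt e + norm s)" using False by (intro mult_left_mono) auto
    also have "\<dots> = (norm s)\<^sup>2 - e" using e by (simp add: algebra_simps power2_eq_square)
    finally show ?thesis using e by simp
  qed
  then have "norm s - sqrt e \<le> (s \<bullet> s) / ?q" using p by (simp add: pos_le_divide_eq power2_norm_eq_inner)
  then show ?thesis unfolding psi_deriv_eq[OF e] by (simp add: power2_norm_eq_inner[symmetric] power2_eq_square)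
qed

lemma (in finite_measure) psi_deriv_integrable:
  fixes s t :: "'a \<Rightarrow> real^'n"
  assumes e: "e > 0" and s: "\<And>i. (\<lambda>x. s x $ i) \<in> sqint M" and t: "\<And>i. (\<lambda>x. t x $ i) \<in> sqint M"
  shows "integrable M (\<lambda>x. psi_deriv e (s x) (t x))"
proof (rule Bochner_Integration.integrable_bound)
  have [measurable]: "s \<in> borel_measurable M" "t \<in> borel_measurable M"
    using s t by (auto intro!: borel_measurable_vec sqint_measurable)
  show "(\<lambda>x. psi_deriv e (s x) (t x)) \<in> borel_measurable M" unfolding psi_deriv_eq[OF e] by measurable
  show "integrable M (\<lambda>x. norm (t x) + 2 * e * (norm (s x) * norm (t x)))"
    by (intro Bochner_Integration.integrable_add integrable_mult_right sqint_norm_field(2)[OF t]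
        sqint_mult_integrable[OF sqint_norm_field(1)[OF s] sqint_norm_field(1)[OF t]])
  show "AE x in M. norm (psi_deriv e (s x) (t x)) \<le> norm (norm (t x) + 2 * e * (norm (s x) * norm (t x)))"
    by (intro AE_I2) (simp, rule order_trans[OF psi_deriv_le(2)[OF e] abs_ge_self])
qed

text \<open>For a fixed test field the pairing is continuous in L2 and bounded by the integral of
  the gradient length; the supremum over fields is taken only after the limit.\<close>

lemma total_variation_limit:
  fixes us :: "real^'n \<Rightarrow> real"
  assumes \<Omega>: "open \<Omega>" "bounded \<Omega>" and U: "L2_tendsto \<Omega> U us" and s: "\<And>n. has_weak_gradient \<Omega> (U n) (s n)"
    and c: "\<And>n. (\<integral>x. norm (s n x) \<partial>lebesgue_on \<Omega>) \<le> c n" "c \<longlonglongrightarrow> C"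
  shows "us \<in> BV_L2 \<Omega>" "BV_seminorm \<Omega> us \<le> C"
proof -
  let ?M = "lebesgue_on \<Omega>"
  interpret finite_measure ?M using \<Omega> by (intro finite_measure_lebesgue_on_bounded) auto
  have U2: "U n \<in> sqint ?M" "us \<in> sqint ?M" and lim: "(\<lambda>n. nrm ?M (\<lambda>x. U n x - us x)) \<longlonglongrightarrow> 0" for n
    using U by (auto simp: L2_tendsto_def L2_eq)
  have sq: "(\<lambda>x. s n x $ i) \<in> sqint ?M" for n i using s by (simp add: has_weak_gradient_def L2_eq)
  have le: "p \<le> C" if p: "p \<in> BV_pairings \<Omega> us" for p
  proof -
    obtain \<phi> where \<phi>: "\<phi> \<in> test_fields \<Omega>" "\<forall>x\<in>\<Omega>. norm (\<phi> x) \<le> 1" "p = ip ?M us (divg \<phi>)"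
      using p unfolding BV_pairings_def ip_def by blast
    note t = test_fieldsD[OF \<phi>(1)]
    have "ip ?M (U n) (divg \<phi>) \<le> c n" for n
    proof -
      have i1: "integrable ?M (\<lambda>x. U n x * pd i (\<lambda>y. \<phi> y $ i) x)" for i
        by (rule sqint_mult_integrable[OF U2(1) test_funs_sqint[OF \<Omega> test_funs_pd[OF t]]])
      have i2: "integrable ?M (\<lambda>x. s n x $ i * \<phi> x $ i)" for i
        by (rule sqint_mult_integrable[OF sq test_funs_sqint[OF \<Omega> t]])
      have "ip ?M (U n) (divg \<phi>) = (\<Sum>i\<in>UNIV. (\<integral>x. U n x * pd i (\<lambda>y. \<phi> y $ i) x \<partial>?M))"
        unfolding ip_def divg_def sum_distrib_left by (rule Bochner_Integration.integral_sum) (rule i1)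
      also have "\<dots> = (\<Sum>i\<in>UNIV. - (\<integral>x. s n x $ i * \<phi> x $ i \<partial>?M))"
        using s[of n] t unfolding has_weak_gradient_def L2_inner_def by (intro sum.cong) auto
      also have "\<dots> = (\<integral>x. - (s n x \<bullet> \<phi> x) \<partial>?M)"
        unfolding inner_vec_def using i2 by (simp add: Bochner_Integration.integral_sum sum_negf)
      also have "\<dots> \<le> (\<integral>x. norm (s n x) \<partial>?M)"
      proof (rule integral_mono)
        show "integrable ?M (\<lambda>x. - (s n x \<bullet> \<phi> x))" unfolding inner_vec_def using i2 by simp
        show "integrable ?M (\<lambda>x. norm (s n x))" by (rule sqint_norm_field(2)[OF sq])
        fix x assume "x \<in> space ?M"
        then have "norm (\<phi> x) \<le> 1" using \<phi>(2) by (simp add: space_restrict_space)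
        then have "norm (s n x) * norm (\<phi> x) \<le> norm (s n x)" by (simp add: mult_left_le)
        then show "- (s n x \<bullet> \<phi> x) \<le> norm (s n x)" using Cauchy_Schwarz_ineq2[of "s n x" "\<phi> x"] by linarith
      qed
      finally show ?thesis using c(1)[of n] by linarith
    qed
    moreover have "(\<lambda>n. ip ?M (U n) (divg \<phi>)) \<longlonglongrightarrow> p"
      unfolding \<phi>(3) by (rule nrm_tendsto_ip[OF U2 lim test_funs_sqint[OF \<Omega> divg_test_funs[OF \<phi>(1)]]])
    ultimately show ?thesis by (intro LIMSEQ_le[OF _ c(2)]) auto
  qed
  have "bdd_above (BV_pairings \<Omega> us)" by (rule bdd_aboveI) (rule le)
  then show "us \<in> BV_L2 \<Omega>" using U2(2) sqint_integrable[OF U2(2)] by (simp add: BV_L2_def BV_def L2_eq)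
  show "BV_seminorm \<Omega> us \<le> C" unfolding BV_seminorm_def
  proof (rule cSup_least[OF _ le])
    have "(\<lambda>_. 0) \<in> test_fields \<Omega>" by (simp add: test_fields_def test_funs_0)
    then show "BV_pairings \<Omega> us \<noteq> {}" unfolding BV_pairings_def by (auto intro!: exI[of _ "\<lambda>_. 0"])
  qed
qed

theorem theorem3p16:
  fixes \<Omega> :: "(real^'n) set"
    and ua ub :: real
    and f :: "(real^'n \<Rightarrow> real) \<Rightarrow> real"
    and \<epsilon> \<rho> :: "nat \<Rightarrow> real"
    and u :: "nat \<Rightarrow> real^'n \<Rightarrow> real"
    and r :: "nat \<Rightarrow> nat"
    and us la lb :: "real^'n \<Rightarrow> real"
  assumes "open \<Omega>" and "bounded \<Omega>" and "lipschitz_boundary \<Omega>"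
    and "ua < ub"
    and "functional_on_L2 \<Omega> f"
    and "\<exists>c. \<forall>v\<in>L2 \<Omega>. c \<le> f v"
    and "weakly_lsc \<Omega> f"
    and "continuously_frechet_L2 \<Omega> f"
    and "\<And>w. (\<And>k. w k \<in> U_ad \<Omega> ua ub) \<Longrightarrow> filterlim (\<lambda>k::nat. L2_norm \<Omega> (w k)) at_top sequentially
           \<Longrightarrow> filterlim (\<lambda>k. f (w k)) at_top sequentially"
    and "\<And>k. \<epsilon> k > 0" and "decseq \<epsilon>" and "\<epsilon> \<longlonglongrightarrow> 0"
    and "\<And>k. \<rho> k > 0" and "filterlim \<rho> at_top sequentially"
    and "\<And>k. u k \<in> H1 \<Omega>"
    and "\<And>k v. v \<in> H1 \<Omega> \<Longrightarrow>
           (\<integral>x. L2_gradient \<Omega> f (u k) x * v x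
                + psi_deriv (\<epsilon> k) (weak_gradient \<Omega> (u k) x) (weak_gradient \<Omega> v x)
                - lam_a ua (\<rho> k) (u k) x * v x + lam_b ub (\<rho> k) (u k) x * v x \<partial>lebesgue_on \<Omega>) = 0"
    and "strict_mono r"
    and "L2_tendsto \<Omega> (\<lambda>n. u (r n)) us"
    and "L2_weakly_tendsto \<Omega> (\<lambda>n. lam_a ua (\<rho> (r n)) (u (r n))) la"
    and "L2_weakly_tendsto \<Omega> (\<lambda>n. lam_b ub (\<rho> (r n)) (u (r n))) lb"
  shows "us \<in> U_ad \<Omega> ua ub
    \<and> (AE x in lebesgue_on \<Omega>. la x \<ge> 0)
    \<and> (AE x in lebesgue_on \<Omega>. lb x \<ge> 0)
    \<and> L2_inner \<Omega> la (\<lambda>x. ua - us x) = 0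
    \<and> L2_inner \<Omega> lb (\<lambda>x. us x - ub) = 0
    \<and> (\<exists>\<mu>\<in>Linf_fields \<Omega>. \<exists>d\<in>L2 \<Omega>. has_distributional_div \<Omega> \<mu> d
          \<and> (AE x in lebesgue_on \<Omega>. - d x - la x + lb x = - L2_gradient \<Omega> f us x)
          \<and> L2_inner \<Omega> (\<lambda>x. - d x) \<in> BV_subdifferential \<Omega> us)
    \<and> (\<exists>l\<in>measure_norm_subdifferential \<Omega> (BV_gradient \<Omega> us). \<exists>d\<in>L2 \<Omega>. has_dual_div \<Omega> l d
          \<and> (AE x in lebesgue_on \<Omega>. - d x - la x + lb x = - L2_gradient \<Omega> f us x))"
proof -
  let ?M = "lebesgue_on \<Omega>"
  note \<Omega> = assms(1,2)
  interpret finite_measure ?M using \<Omega> by (intro finite_measure_lebesgue_on_bounded) auto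
  define U where "U n = u (r n)" for n
  define e where "e n = \<epsilon> (r n)" for n
  define R where "R n = \<rho> (r n)" for n
  define s where "s n = weak_gradient \<Omega> (U n)" for n
  define A where "A n x = smooth_max (R n) (R n * (ua - U n x))" for n x
  \<comment> \<open>The upper multiplier in the form of a lower one, for \<open>- U n\<close> and
    the obstacle \<open>- ub\<close>.\<close>
  define B where "B n x = smooth_max (R n) (R n * (- ub - (- U n x)))" for n x
  define F where "F n = L2_gradient \<Omega> f (U n)" for n
  define Fs where "Fs = L2_gradient \<Omega> f us"
  define g where "g x = la x - lb x - Fs x" for x
  have e0: "e n > 0" for n by (simp add: e_def assms(10))
  have elim: "e \<longlonglongrightarrow> 0" using LIMSEQ_subseq_LIMSEQ[OF assms(12,17)] by (simp add: e_def[abs_def] o_def)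
  have R0: "R n > 0" for n by (simp add: R_def assms(13))
  have Rlim: "filterlim R at_top sequentially"
    unfolding R_def[abs_def] by (rule filterlim_compose[OF assms(14) filterlim_subseq[OF assms(17)]])
  have UL: "L2_tendsto \<Omega> U us" using assms(18) by (simp add: U_def[abs_def])
  then have U: "U n \<in> sqint ?M" "us \<in> sqint ?M" "(\<lambda>n. nrm ?M (\<lambda>x. U n x - us x)) \<longlonglongrightarrow> 0" for n
    by (auto simp: L2_tendsto_def L2_eq)
  have Aeq: "lam_a ua (\<rho> (r n)) (u (r n)) = A n" for n by (simp add: fun_eq_iff lam_a_def A_def U_def R_def)
  have Beq: "lam_b ub (\<rho> (r n)) (u (r n)) = B n" for n by (simp add: fun_eq_iff lam_b_def B_def U_def R_def algebra_simps)
  have A: "A n \<in> sqint ?M" "la \<in> sqint ?M" "v \<in> sqint ?M \<Longrightarrow> (\<lambda>n. ip ?M (A n) v) \<longlonglongrightarrow> ip ?M la v" for n v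
    using assms(19) unfolding L2_weakly_tendsto_def Aeq L2_eq by blast+
  have B: "B n \<in> sqint ?M" "lb \<in> sqint ?M" "v \<in> sqint ?M \<Longrightarrow> (\<lambda>n. ip ?M (B n) v) \<longlonglongrightarrow> ip ?M lb v" for n v
    using assms(20) unfolding L2_weakly_tendsto_def Beq L2_eq by blast+
  have F: "F n \<in> sqint ?M" "Fs \<in> sqint ?M" for n
    using L2_gradient(1)[OF \<Omega> assms(8)] U by (auto simp: F_def Fs_def L2_eq)
  have Flim: "(\<lambda>n. nrm ?M (\<lambda>x. F n x - Fs x)) \<longlonglongrightarrow> 0"
    using L2_gradient_continuous[OF \<Omega> assms(8) UL] by (simp add: F_def Fs_def L2_eq)
  have one: "(\<lambda>_. 1) \<in> sqint ?M" by (rule sqint_const)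
  have Af: "(\<lambda>x. smooth_max (R n) (R n * (ua - U n x))) = A n"
    and Bf: "(\<lambda>x. smooth_max (R n) (R n * (- ub - (- U n x)))) = B n" for n by (auto simp: A_def B_def)

  \<comment> \<open>Feasibility, signs and complementarity\<close>
  note oa = obstacle_limit[where U = U and u = us and R = R and la = la and c = ua, unfolded Af, OF U R0 Rlim A]
  have nU: "(\<lambda>x. - U n x) \<in> sqint ?M" "(\<lambda>x. - us x) \<in> sqint ?M" for n
    using sqint_cmult[OF U(1), of "-1"] sqint_cmult[OF U(2), of "-1"] by auto
  have "(\<lambda>n. nrm ?M (\<lambda>x. - U n x - - us x)) \<longlonglongrightarrow> 0"
    using U(3) nrm_minus_comm[of ?M us] by simp
  note ob = obstacle_limit[where U = "\<lambda>n x. - U n x" and u = "\<lambda>x. - us x" and R = R and la = lb and c = "- ub", unfolded Bf, OF nU this R0 Rlim B]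
  have Uad: "us \<in> U_ad \<Omega> ua ub"
    unfolding U_ad_def using U(2) oa(1) ob(1) by (auto simp: L2_eq elim: eventually_elim2)
  have lbz: "ip ?M lb (\<lambda>x. us x - ub) = 0" using ob(3) by (simp add: algebra_simps)
  have laus: "ip ?M la us = ua * ip ?M la (\<lambda>_. 1)"
    using oa(3) ip_lin_right[OF one U(2) A(2), of ua "-1"] by simp
  have lbus: "ip ?M lb us = ub * ip ?M lb (\<lambda>_. 1)"
    using lbz ip_lin_right[OF one U(2) B(2), of "- ub" 1] by simp
  have g2: "g \<in> sqint ?M" unfolding g_def by (intro sqint_diff A B F)
  have gL: "g \<in> L2 \<Omega>" using g2 by (simp add: L2_eq)
  have ipg: "ip ?M g v = ip ?M la v - ip ?M lb v - ip ?M Fs v" if "v \<in> sqint ?M" for v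
    unfolding g_def using ip_diff[OF sqint_diff[OF A(2) B(2)] F(2) that] ip_diff[OF A(2) B(2) that] by simp

  \<comment> \<open>The equation along the subsequence and the energy estimate\<close>
  have ex: "has_weak_gradient \<Omega> v (weak_gradient \<Omega> v)" if "v \<in> H1 \<Omega>" for v
    using that someI_ex[of "has_weak_gradient \<Omega> v"] by (auto simp: H1_def weak_gradient_def)
  have UH: "U n \<in> H1 \<Omega>" for n by (simp add: U_def assms(15))
  have sg: "has_weak_gradient \<Omega> (U n) (s n)" for n unfolding s_def by (rule ex[OF UH])
  then have ss: "(\<lambda>x. s n x $ i) \<in> sqint ?M" for n i by (simp add: has_weak_gradient_def L2_eq)
  define S where "S n = nrm ?M (\<lambda>x. norm (s n x))" for n
  have S0: "0 \<le> S n" for n by (simp add: S_def)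
  have nss: "(\<lambda>x. norm (s n x)) \<in> sqint ?M" "integrable ?M (\<lambda>x. norm (s n x))" for n using sqint_norm_field[OF ss] by auto
  have eqn: "ip ?M (A n) v - ip ?M (B n) v - ip ?M (F n) v = (\<integral>x. psi_deriv (e n) (s n x) (weak_gradient \<Omega> v x) \<partial>?M)"
    if v: "v \<in> H1 \<Omega>" for n v
  proof -
    have v2: "v \<in> sqint ?M" using v by (simp add: H1_def L2_eq)
    have ts: "(\<lambda>x. weak_gradient \<Omega> v x $ i) \<in> sqint ?M" for i using ex[OF v] by (simp add: has_weak_gradient_def L2_eq)
    note i = sqint_mult_integrable[OF F(1)[of n] v2] psi_deriv_integrable[OF e0[of n] ss[of n] ts]
      sqint_mult_integrable[OF A(1)[of n] v2] sqint_mult_integrable[OF B(1)[of n] v2]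
    have "(\<integral>x. F n x * v x + psi_deriv (e n) (s n x) (weak_gradient \<Omega> v x) - A n x * v x + B n x * v x \<partial>?M) = 0"
      using assms(16)[OF v, of "r n"] unfolding Aeq Beq F_def s_def U_def e_def .
    then show ?thesis using i by (simp add: ip_def)
  qed
  \<comment> \<open>The equation tested with \<open>U n\<close> itself; the lower bound on
    \<open>psi_deriv\<close> retains the quadratic term, needed for \<open>eS\<close>.\<close>
  have energy: "(\<integral>x. norm (s n x) \<partial>?M) - sqrt (e n) * measure ?M (space ?M) + 2 * e n * (S n)\<^sup>2
      \<le> ip ?M (A n) (U n) - ip ?M (B n) (U n) - ip ?M (F n) (U n)" for n
  proof -
    have i: "integrable ?M (\<lambda>x. norm (s n x) * norm (s n x))" by (rule sqint_mult_integrable[OF nss(1) nss(1)])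
    have "(\<integral>x. norm (s n x) - sqrt (e n) + 2 * e n * (norm (s n x) * norm (s n x)) \<partial>?M)
        \<le> (\<integral>x. psi_deriv (e n) (s n x) (s n x) \<partial>?M)"
      using nss(2)[of n] i by (intro integral_mono psi_deriv_integrable[OF e0 ss ss] psi_deriv_self_ge[OF e0]) auto
    then have "(\<integral>x. norm (s n x) - sqrt (e n) + 2 * e n * (norm (s n x) * norm (s n x)) \<partial>?M)
        \<le> ip ?M (A n) (U n) - ip ?M (B n) (U n) - ip ?M (F n) (U n)"
      unfolding eqn[OF UH] s_def[symmetric] .
    then show ?thesis using nss(2)[of n] i by (simp add: S_def nrm_sq ip_def mult.commute)
  qed
  \<comment> \<open>Pairings of multipliers with solutions are replaced by pairings with constants,
    whose limits weak convergence provides. By complementarity the limit is again a pairing with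
    \<open>us\<close>.\<close>
  define c where "c n = (ua + 1 / (2 * (R n)\<^sup>2)) * ip ?M (A n) (\<lambda>_. 1) + (- ub + 1 / (2 * (R n)\<^sup>2)) * ip ?M (B n) (\<lambda>_. 1) - ip ?M (F n) (U n)" for n
  have up: "ip ?M (A n) (U n) - ip ?M (B n) (U n) - ip ?M (F n) (U n) \<le> c n" for n
  proof -
    have "ip ?M (B n) (\<lambda>x. - U n x) = - ip ?M (B n) (U n)" by (simp add: ip_def)
    then show ?thesis using oa(4)[of n] ob(4)[of n] unfolding c_def by linarith
  qed
  have clim: "c \<longlonglongrightarrow> ip ?M g us"
  proof -
    have Ri: "(\<lambda>n. inverse (R n)) \<longlonglongrightarrow> 0" by (rule tendsto_inverse_0_at_top[OF Rlim])
    have "(\<lambda>n. 1 / 2 * (inverse (R n) * inverse (R n))) \<longlonglongrightarrow> 1 / 2 * (0 * 0)" by (intro tendsto_intros Ri)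
    then have R2: "(\<lambda>n. 1 / (2 * (R n)\<^sup>2)) \<longlonglongrightarrow> 0" by (simp add: power2_eq_square inverse_eq_divide)
    have "c \<longlonglongrightarrow> (ua + 0) * ip ?M la (\<lambda>_. 1) + (- ub + 0) * ip ?M lb (\<lambda>_. 1) - ip ?M Fs us"
      unfolding c_def[abs_def]
      by (intro tendsto_diff tendsto_add tendsto_mult tendsto_const R2 A(3)[OF one] B(3)[OF one] nrm_tendsto_ip_both[OF F Flim U])
    then show ?thesis by (simp add: ipg[OF U(2)] laus lbus)
  qed
  have se: "(\<lambda>n. sqrt (e n)) \<longlonglongrightarrow> 0" using tendsto_real_sqrt[OF elim] by simp
  have bound: "(\<integral>x. norm (s n x) \<partial>?M) \<le> c n + sqrt (e n) * measure ?M (space ?M)" for n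
    using energy[of n] up[of n] mult_nonneg_nonneg[OF less_imp_le[OF e0[of n]] zero_le_power2[of "S n"]] by linarith
  have "(\<lambda>n. c n + sqrt (e n) * measure ?M (space ?M)) \<longlonglongrightarrow> ip ?M g us + 0 * measure ?M (space ?M)"
    by (intro tendsto_intros clim se)
  then have cl2: "(\<lambda>n. c n + sqrt (e n) * measure ?M (space ?M)) \<longlonglongrightarrow> L2_inner \<Omega> g us" by (simp add: L2_eq)
  have us: "us \<in> BV_L2 \<Omega>" "BV_seminorm \<Omega> us \<le> L2_inner \<Omega> g us"
    using total_variation_limit[OF \<Omega> UL sg bound cl2] by auto
  \<comment> \<open>Squaring leaves a factor \<open>e n\<close> beside the quadratic energy, which
    has a convergent upper bound, so the term vanishes although \<open>S n\<close> may be
    unbounded.\<close>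
  have eS: "(\<lambda>n. 2 * e n * S n) \<longlonglongrightarrow> 0"
  proof -
    have le: "(2 * e n * S n)\<^sup>2 \<le> 2 * e n * (c n + sqrt (e n) * measure ?M (space ?M))" for n
    proof -
      have "2 * e n * (S n)\<^sup>2 \<le> c n + sqrt (e n) * measure ?M (space ?M)"
        using energy[of n] up[of n] Bochner_Integration.integral_nonneg[of ?M "\<lambda>x. norm (s n x)", OF norm_ge_zero] by argo
      then have "2 * e n * (2 * e n * (S n)\<^sup>2) \<le> 2 * e n * (c n + sqrt (e n) * measure ?M (space ?M))"
        using e0[of n] by (intro mult_left_mono) auto
      then show ?thesis by (simp add: power2_eq_square mult_ac)
    qed
    have "(\<lambda>n. 2 * e n * (c n + sqrt (e n) * measure ?M (space ?M))) \<longlonglongrightarrow> 2 * 0 * L2_inner \<Omega> g us"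
      by (intro tendsto_mult tendsto_const elim cl2)
    then have "(\<lambda>n. (2 * e n * S n)\<^sup>2) \<longlonglongrightarrow> 0"
      by (intro Lim_null_comparison[where f = "\<lambda>n. (2 * e n * S n)\<^sup>2" and g = "\<lambda>n. 2 * e n * (c n + sqrt (e n) * measure ?M (space ?M))"])
         (use le in auto)
    from tendsto_real_sqrt[OF this] show ?thesis by (simp add: tendsto_rabs_zero_iff)
  qed

  \<comment> \<open>The limit inequality for H1 functions\<close>
  have primal: "L2_inner \<Omega> g v \<le> (\<integral>x. norm (G x) \<partial>?M)" if v: "v \<in> L2 \<Omega>" and G: "has_weak_gradient \<Omega> v G" for v G
  proof -
    have vH: "v \<in> H1 \<Omega>" using v G by (auto simp: H1_def)
    have v2: "v \<in> sqint ?M" using v by (simp add: L2_eq)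
    define t where "t = weak_gradient \<Omega> v"
    have tg: "has_weak_gradient \<Omega> v t" unfolding t_def by (rule ex[OF vH])
    have ts: "(\<lambda>x. t x $ i) \<in> sqint ?M" for i using tg by (simp add: has_weak_gradient_def L2_eq)
    note nt = sqint_norm_field[OF ts]
    have Gs: "(\<lambda>x. G x $ i) \<in> sqint ?M" for i using G by (simp add: has_weak_gradient_def L2_eq)
    \<comment> \<open>The equation is written with the chosen weak gradient, the claim with an
      arbitrary one.\<close>
    have "(\<integral>x. norm (t x) \<partial>?M) = (\<integral>x. norm (G x) \<partial>?M)"
    proof (rule integral_cong_AE)
      show "AE x in ?M. norm (t x) = norm (G x)" using has_weak_gradient_unique[OF \<Omega> tg G] by eventually_elim simp
    qed (use nt(2) sqint_norm_field(2)[OF Gs] in auto)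
    moreover have "ip ?M (A n) v - ip ?M (B n) v - ip ?M (F n) v \<le> (\<integral>x. norm (t x) \<partial>?M) + (2 * e n * S n) * nrm ?M (\<lambda>x. norm (t x))" for n
    proof -
      have i: "integrable ?M (\<lambda>x. norm (s n x) * norm (t x))" by (rule sqint_mult_integrable[OF nss(1) nt(1)])
      have "(\<integral>x. psi_deriv (e n) (s n x) (t x) \<partial>?M) \<le> (\<integral>x. norm (t x) + 2 * e n * (norm (s n x) * norm (t x)) \<partial>?M)"
        using nt(2) i by (intro integral_mono psi_deriv_integrable[OF e0 ss ts] psi_deriv_le(1)[OF e0]) auto
      also have "\<dots> = (\<integral>x. norm (t x) \<partial>?M) + 2 * e n * ip ?M (\<lambda>x. norm (s n x)) (\<lambda>x. norm (t x))"
        using nt(2) i by (simp add: ip_def)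
      also have "\<dots> \<le> (\<integral>x. norm (t x) \<partial>?M) + 2 * e n * (S n * nrm ?M (\<lambda>x. norm (t x)))"
        unfolding S_def using ip_le_nrm[OF nss(1)[of n] nt(1)] e0[of n] by (intro add_left_mono mult_left_mono) auto
      finally show ?thesis unfolding eqn[OF vH] t_def[symmetric] by (simp add: mult.assoc)
    qed
    moreover have "(\<lambda>n. ip ?M (A n) v - ip ?M (B n) v - ip ?M (F n) v) \<longlonglongrightarrow> ip ?M la v - ip ?M lb v - ip ?M Fs v"
      by (intro tendsto_diff A(3)[OF v2] B(3)[OF v2] nrm_tendsto_ip[OF F Flim v2])
    moreover have "(\<lambda>n. (\<integral>x. norm (t x) \<partial>?M) + (2 * e n * S n) * nrm ?M (\<lambda>x. norm (t x))) \<longlonglongrightarrow> (\<integral>x. norm (t x) \<partial>?M) + 0 * nrm ?M (\<lambda>x. norm (t x))"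
      by (intro tendsto_add tendsto_mult tendsto_const eS)
    ultimately have "ip ?M la v - ip ?M lb v - ip ?M Fs v \<le> (\<integral>x. norm (G x) \<partial>?M) + 0 * nrm ?M (\<lambda>x. norm (t x))"
      by (intro LIMSEQ_le[where X = "\<lambda>n. ip ?M (A n) v - ip ?M (B n) v - ip ?M (F n) v"]) auto
    then show ?thesis by (simp add: L2_eq ipg[OF v2])
  qed

  \<comment> \<open>The dual field and the two subgradients\<close>
  obtain \<mu> where \<mu>: "\<And>i. (\<lambda>x. \<mu> x $ i) \<in> L2 \<Omega>" "AE x in ?M. norm (\<mu> x) \<le> 1"
    "\<And>w G. w \<in> L2 \<Omega> \<Longrightarrow> has_weak_gradient \<Omega> w G \<Longrightarrow> (\<integral>x. \<mu> x \<bullet> G x \<partial>?M) = L2_inner \<Omega> g w"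
    by (rule dual_field_exists[OF \<Omega> gL primal], assumption+, rule that; assumption)
  have gle: "L2_inner \<Omega> g v \<le> BV_seminorm \<Omega> v" if v: "v \<in> BV_L2 \<Omega>" for v
  \<comment> \<open>The estimate through the dual field covers the closure of a nonempty domain; for
    the empty one the left side is 0.\<close>
  proof (cases "\<Omega> = {}")
    case True
    have "L2_inner \<Omega> g v = (\<integral>x. 0 \<partial>?M)" unfolding L2_inner_def by (rule Bochner_Integration.integral_cong) (auto simp: True)
    moreover have "0 \<le> BV_seminorm \<Omega> v" using v by (intro BV_seminorm_nonneg) (simp add: BV_L2_def BV_def)
    ultimately show ?thesis by simp
  next
    case False
    show ?thesis by (rule dual_field_pairing_le[OF \<Omega> assms(3) False gL \<mu> v])
  qed
  obtain l where l: "l \<in> measure_norm_subdifferential \<Omega> (BV_gradient \<Omega> us)" "has_dual_div \<Omega> l (\<lambda>x. - g x)"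
    by (rule measure_subgradient_exists[OF \<Omega> gL gle us])
  have mL: "\<mu> \<in> Linf_fields \<Omega>"
    unfolding Linf_fields_def using \<mu>(1,2) by (auto simp: L2_eq intro!: borel_measurable_vec sqint_measurable)
  have dL: "(\<lambda>x. - g x) \<in> L2 \<Omega>" using sqint_cmult[OF g2, of "-1"] by (simp add: L2_eq)
  have div: "has_distributional_div \<Omega> \<mu> (\<lambda>x. - g x)"
    unfolding has_distributional_div_def
  proof
    fix w assume w: "w \<in> test_funs \<Omega>"
    have "(\<integral>x. \<mu> x \<bullet> (\<chi> i. pd i w x) \<partial>?M) = L2_inner \<Omega> g w"
      using test_funs_sqint[OF \<Omega> w] by (intro \<mu>(3) test_funs_has_weak_gradient[OF \<Omega> w]) (simp add: L2_eq)
    then show "(\<integral>x. (\<Sum>i\<in>UNIV. \<mu> x $ i * pd i w x) \<partial>?M) = - L2_inner \<Omega> (\<lambda>x. - g x) w"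
      by (simp add: inner_vec_def L2_inner_def)
  qed
  have eq: "AE x in ?M. - (- g x) - la x + lb x = - L2_gradient \<Omega> f us x" by (simp add: g_def Fs_def)
  have sub: "L2_inner \<Omega> (\<lambda>x. - (- g x)) \<in> BV_subdifferential \<Omega> us"
    using L2_inner_in_BV_subdifferential[OF gL gle us] by simp
  show ?thesis
    unfolding L2_eq
    using Uad oa(2,3) ob(2) lbz mL dL div eq sub l unfolding L2_eq by blast
qed

end
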